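(* There is an absolute constant $C>0$ such that the following holds for all integers $d,n\ge1$, $1\le r\le d$ and all $B>0$. Apply the generic pre-processing and then the row symmetric joint measurement (both defined in the context) to an input state $U^{\otimes n}|e\rangle$, obtaining the output $(\lambda,\psi_1,\dots,\psi_k)$, where $k$ is the number of parts of $\lambda$. Then there is a $\mathbb C^{d\times d}$-valued function $\hat P$ of this output (not depending on $U,e$ or $O$) such that for every $U\in U(d)$ and every $e\in[d]^n$ with at most $r$ different symbols, $$\mathbb E[\hat P]=P:=\frac1n\sum_{i=1}^nU|e_i\rangle\langle e_i|U^\dagger,$$ and for every Hermitian $O\in\mathbb C^{d\times d}$ with $\|O\|_\infty=1$ and $\operatorname{Tr}(O^2)\le B$, $$\operatorname{Var}[\operatorname{Tr}(O\hat P)]\le C\left(1+\frac{rB}{n^2}\right).$$ Expectation and variance are over the randomness of the pre-processing and the measurement.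
   Context: Notation. $(\mathbb C^d)^{\otimes n}$ has standard basis $|e\rangle=|e_1,\dots,e_n\rangle$, $e\in[d]^n$. For $\pi\in S_n$, $P_\pi=\sum_{i_1,\dots,i_n\in[d]}|i_{\pi^{-1}(1)},\dots,i_{\pi^{-1}(n)}\rangle\langle i_1,\dots,i_n|$. $\lambda\vdash_d n$ means $\lambda=(\lambda_1\ge\dots\ge\lambda_k>0)$ is a partition of $n$ with $k\le d$ parts. Fill the Young diagram of $\lambda$ with $1,\dots,n$ row by row (left to right, then top to bottom); $A_\lambda$ (resp. $B_\lambda$) is the subgroup of $S_n$ preserving each row (resp. column) as a set. The Young symmetrizer is $Y_\lambda=\sum_{a\in A_\lambda}P_a\sum_{b\in B_\lambda}\operatorname{sgn}(b)P_b$ and $\mathcal Q_\lambda:=Y_\lambda(\mathbb C^d)^{\otimes n}$, an irreducible representation of $U(d)$ under $U\mapsto U^{\otimes n}$. A weight vector is $w\in\{0,\dots,n\}^d$ with $\sum_iw_i=n$; $V(w)$ is the span of the $|e\rangle$ in which each symbol $i\in[d]$ occurs exactly $w_i$ times. The basis. For each $\lambda\vdash_d n$: go through the weight vectors $w$ in reverse lexicographic order (largest first) and, whenever $Y_\lambda V(w)\ne0$, append an arbitrary orthonormal basis of $Y_\lambda V(w)$ to a list; the list, in order, is denoted $|(\lambda,0,0)\rangle,|(\lambda,1,0)\rangle,\dots,|(\lambda,\dim\mathcal Q_\lambda-1,0)\rangle$. Then choose an orthonormal basis $\{|(\lambda,0,j)\rangle\}_{j}$ of $\operatorname{span}\{P_\pi|(\lambda,0,0)\rangle:\pi\in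 S_n\}$ whose $j=0$ element is $|(\lambda,0,0)\rangle$, write $|(\lambda,0,j)\rangle=\sum_{\pi}\alpha_\pi^{(\lambda,j)}P_\pi|(\lambda,0,0)\rangle$, and set $|(\lambda,i,j)\rangle:=\sum_\pi\alpha^{(\lambda,j)}_\pi P_\pi|(\lambda,i,0)\rangle$ for all $i$. The resulting vectors form an orthonormal basis of $(\mathbb C^d)^{\otimes n}$. Generic pre-processing. On input $U^{\otimes n}|e\rangle$, perform the projective measurement $\{\Pi_{\lambda,j}\}_{\lambda,j}$, where $\Pi_{\lambda,j}$ is the orthogonal projector onto $\operatorname{span}\{|(\lambda,i,j)\rangle:\forall i\}$; upon outcome $(\lambda,j)$ apply the unitary $H_{\lambda,j}$ that swaps $|(\lambda,i,0)\rangle$ and $|(\lambda,i,j)\rangle$ for every $i$ and fixes all other basis vectors; return $\lambda$ and the resulting (normalized) state. Row symmetric joint measurement. For $\lambda\vdash_dn$ with exactly $k$ parts it is the POVM on $(\mathbb C^d)^{\otimes n}$ with elements $\bigotimes_{i=1}^k\kappa_{\lambda_i}\psi_i^{\otimes\lambda_i}$ with respect to the $k$-fold product of the Haar (unitarily invariant) probability measure on rank-one projectors $\psi_1,\dots,\psi_k\in\mathbb C^{d\times d}$, where $\kappa_s=\binom{s+d-1}{d-1}$, together with the "fail" element $I-\frac1{|A_\lambda|}\sum_{\pi\in A_\lambda}P_\pi$. It is applied to the state returned by the pre-processing, with the returned $\lambda$. *)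

theory Defs
  imports
    "HOL-Probability.Probability"
    "HOL-Combinatorics.Permutations"
    "HOL-Library.Function_Algebras"
    "HOL-Library.List_Lexorder"
    "Jordan_Normal_Form.Schur_Decomposition"
    "Jordan_Normal_Form.DL_Rank"
begin

section \<open>Matrices\<close>

definition unitary_mat :: "nat \<Rightarrow> complex mat \<Rightarrow> bool" where
  "unitary_mat d U \<longleftrightarrow> U \<in> carrier_mat d d \<and> mat_adjoint U * U = 1\<^sub>m d"

definition hermitian_mat :: "nat \<Rightarrow> complex mat \<Rightarrow> bool" where
  "hermitian_mat d A \<longleftrightarrow> A \<in> carrier_mat d d \<and> mat_adjoint A = A"

definition mat_trace :: "complex mat \<Rightarrow> complex" where
  "mat_trace A = (\<Sum>i<dim_row A. A $$ (i, i))"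

definition euclid_norm :: "complex vec \<Rightarrow> real" where
  "euclid_norm v = L2_set (\<lambda>i. cmod (v $ i)) {..<dim_vec v}"

text \<open>The Schatten norm of index infinity, i.e. the operator norm.\<close>

definition op_norm :: "nat \<Rightarrow> complex mat \<Rightarrow> real" where
  "op_norm d A = (SUP v\<in>{v \<in> carrier_vec d. euclid_norm v = 1}. euclid_norm (A *\<^sub>v v))"


section \<open>Haar measure on rank-one projectors\<close>

definition rank_one_projectors :: "nat \<Rightarrow> complex mat set" where
  "rank_one_projectors d =
     {\<psi>. hermitian_mat d \<psi> \<and> \<psi> * \<psi> = \<psi> \<and> vec_space.rank d \<psi> = 1}"

text \<open>The Borel sets of the rank-one projectors are those generated by the matrix entries.\<close>

definition projector_borel :: "nat \<Rightarrow> complex mat measure" where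
  "projector_borel d =
     vimage_algebra (rank_one_projectors d) (\<lambda>\<psi>. \<lambda>ij\<in>{..<d} \<times> {..<d}. \<psi> $$ ij)
       (Pi\<^sub>M ({..<d} \<times> {..<d}) (\<lambda>_. borel))"

definition haar_projectors :: "nat \<Rightarrow> complex mat measure \<Rightarrow> bool" where
  "haar_projectors d \<mu> \<longleftrightarrow>
     prob_space \<mu> \<and> sets \<mu> = sets (projector_borel d) \<and>
     (\<forall>U. unitary_mat d U \<longrightarrow>
        distr \<mu> (projector_borel d) (\<lambda>\<psi>. U * \<psi> * mat_adjoint U) = \<mu>)"


section \<open>The tensor power of \<open>\<complex>\<^sup>d\<close>\<close>

text \<open>Symbols are \<open>0, \<dots>, d - 1\<close> and tensor factors are \<open>0, \<dots>, n - 1\<close>. A basis label is an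
  element of \<open>strings d n\<close>. A vector of the \<open>n\<close>-fold tensor power is its coordinate function,
  which vanishes off \<open>strings d n\<close>.\<close>

type_synonym tens = "(nat \<Rightarrow> nat) \<Rightarrow> complex"

definition strings :: "nat \<Rightarrow> nat \<Rightarrow> (nat \<Rightarrow> nat) set" where
  "strings d n = {..<n} \<rightarrow>\<^sub>E {..<d}"

definition tscale :: "complex \<Rightarrow> tens \<Rightarrow> tens" where
  "tscale c v = (\<lambda>e. c * v e)"

global_interpretation tens: vector_space tscale
  by unfold_locales (auto simp: tscale_def fun_eq_iff algebra_simps)

definition ket :: "(nat \<Rightarrow> nat) \<Rightarrow> tens" where
  "ket e = (\<lambda>f. if f = e then 1 else 0)"

definition tinner :: "nat \<Rightarrow> nat \<Rightarrow> tens \<Rightarrow> tens \<Rightarrow> complex" where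
  "tinner d n u v = (\<Sum>e\<in>strings d n. cnj (u e) * v e)"

definition tnorm :: "nat \<Rightarrow> nat \<Rightarrow> tens \<Rightarrow> real" where
  "tnorm d n v = L2_set (\<lambda>e. cmod (v e)) (strings d n)"

definition orthonormal_basis :: "nat \<Rightarrow> nat \<Rightarrow> tens set \<Rightarrow> tens list \<Rightarrow> bool" where
  "orthonormal_basis d n W vs \<longleftrightarrow>
     (\<forall>i<length vs. \<forall>j<length vs. tinner d n (vs ! i) (vs ! j) = (if i = j then 1 else 0)) \<and>
     tens.span (set vs) = W"

definition orth_proj :: "nat \<Rightarrow> nat \<Rightarrow> tens set \<Rightarrow> tens \<Rightarrow> tens" where
  "orth_proj d n W v = (THE p. p \<in> W \<and> (\<forall>u\<in>W. tinner d n u (v - p) = 0))"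

text \<open>The operator \<open>M 0 \<otimes> \<dots> \<otimes> M (n - 1)\<close>.\<close>

definition tensor_op :: "nat \<Rightarrow> nat \<Rightarrow> (nat \<Rightarrow> complex mat) \<Rightarrow> tens \<Rightarrow> tens" where
  "tensor_op d n M v =
     (\<lambda>e. if e \<in> strings d n
           then \<Sum>f\<in>strings d n. (\<Prod>x<n. M x $$ (e x, f x)) * v f else 0)"

text \<open>The operator \<open>P\<^sub>\<pi>\<close>; the lemma below is its defining action on basis vectors.\<close>

definition perm_op :: "(nat \<Rightarrow> nat) \<Rightarrow> tens \<Rightarrow> tens" where
  "perm_op \<pi> v = (\<lambda>e. v (e \<circ> \<pi>))"

lemma perm_op_ket:
  assumes "\<pi> permutes {..<n}"
  shows "perm_op \<pi> (ket i) = ket (i \<circ> inv_into UNIV \<pi>)"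
proof -
  have "e \<circ> \<pi> = i \<longleftrightarrow> e = i \<circ> inv_into UNIV \<pi>" for e
    using permutes_inv_o[OF assms] by (metis comp_assoc comp_id)
  then show ?thesis
    by (simp add: perm_op_def ket_def fun_eq_iff[of "\<lambda>e. _ e"])
qed


section \<open>Partitions and Young symmetrizers\<close>

definition partition_of :: "nat \<Rightarrow> nat \<Rightarrow> nat list \<Rightarrow> bool" where
  "partition_of d n lam \<longleftrightarrow>
     sorted_wrt (\<ge>) lam \<and> 0 \<notin> set lam \<and> sum_list lam = n \<and> length lam \<le> d"

text \<open>The positions in row \<open>i\<close> and in column \<open>c\<close> of the diagram filled row by row.\<close>

definition row_set :: "nat list \<Rightarrow> nat \<Rightarrow> nat set" where
  "row_set lam i = {sum_list (take i lam) ..< sum_list (take (Suc i) lam)}"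

definition column_set :: "nat list \<Rightarrow> nat \<Rightarrow> nat set" where
  "column_set lam c = {sum_list (take i lam) + c | i. i < length lam \<and> c < lam ! i}"

definition row_of :: "nat list \<Rightarrow> nat \<Rightarrow> nat" where
  "row_of lam x = (THE i. i < length lam \<and> x \<in> row_set lam i)"

definition row_group :: "nat list \<Rightarrow> (nat \<Rightarrow> nat) set" where
  "row_group lam =
     {\<pi>. \<pi> permutes {..<sum_list lam} \<and> (\<forall>i<length lam. \<pi> ` row_set lam i = row_set lam i)}"

definition column_group :: "nat list \<Rightarrow> (nat \<Rightarrow> nat) set" where
  "column_group lam =
     {\<pi>. \<pi> permutes {..<sum_list lam} \<and> (\<forall>c. \<pi> ` column_set lam c = column_set lam c)}"

definition young :: "nat list \<Rightarrow> tens \<Rightarrow> tens" where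
  "young lam v =
     (\<Sum>a\<in>row_group lam. perm_op a
        (\<Sum>b\<in>column_group lam. tscale (of_int (sign b)) (perm_op b v)))"

definition tensor_space :: "nat \<Rightarrow> nat \<Rightarrow> tens set" where
  "tensor_space d n = tens.span (ket ` strings d n)"

definition Q_space :: "nat \<Rightarrow> nat \<Rightarrow> nat list \<Rightarrow> tens set" where
  "Q_space d n lam = young lam ` tensor_space d n"

definition weights :: "nat \<Rightarrow> nat \<Rightarrow> nat list set" where
  "weights d n = {w. length w = d \<and> sum_list w = n}"

definition weight_space :: "nat \<Rightarrow> nat \<Rightarrow> nat list \<Rightarrow> tens set" where
  "weight_space d n w =
     tens.span (ket ` {e \<in> strings d n. \<forall>i<d. card {x \<in> {..<n}. e x = i} = w ! i})"


section \<open>The basis\<close>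

definition perm_span :: "nat \<Rightarrow> tens \<Rightarrow> tens set" where
  "perm_span n v = tens.span ((\<lambda>\<pi>. perm_op \<pi> v) ` {\<pi>. \<pi> permutes {..<n}})"

type_synonym basis = "nat list \<Rightarrow> nat \<Rightarrow> nat \<Rightarrow> tens"

definition mult_dim :: "nat \<Rightarrow> basis \<Rightarrow> nat list \<Rightarrow> nat" where
  "mult_dim n b lam = tens.dim (perm_span n (b lam 0 0))"

text \<open>\<open>b lam i j\<close> is the vector \<open>|(\<lambda>, i, j)\<rangle>\<close>. The list order on \<open>nat list\<close> is the lexicographic
  one, so \<open>rev (sorted_list_of_set \<dots>)\<close> lists the weights with the largest first; weights with
  \<open>Y\<^sub>\<lambda> V(w) = 0\<close> contribute the empty list. In the last clause, \<open>i = 0\<close> says that the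
  \<open>\<alpha> j \<pi>\<close> are the coefficients expanding \<open>|(\<lambda>, 0, j)\<rangle>\<close>.\<close>

definition young_basis :: "nat \<Rightarrow> nat \<Rightarrow> basis \<Rightarrow> bool" where
  "young_basis d n b \<longleftrightarrow>
     (\<forall>lam. partition_of d n lam \<longrightarrow>
        (\<exists>L. (\<forall>w\<in>weights d n. orthonormal_basis d n (young lam ` weight_space d n w) (L w)) \<and>
           map (\<lambda>i. b lam i 0) [0..<tens.dim (Q_space d n lam)] =
             concat (map L (rev (sorted_list_of_set (weights d n))))) \<and>
        orthonormal_basis d n (perm_span n (b lam 0 0))
          (map (\<lambda>j. b lam 0 j) [0..<mult_dim n b lam]) \<and>
        (\<exists>\<alpha>. \<forall>j<mult_dim n b lam. \<forall>i<tens.dim (Q_space d n lam).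
           b lam i j = (\<Sum>\<pi> | \<pi> permutes {..<n}. tscale (\<alpha> j \<pi>) (perm_op \<pi> (b lam i 0)))))"


section \<open>Generic pre-processing\<close>

definition branches :: "nat \<Rightarrow> nat \<Rightarrow> basis \<Rightarrow> (nat list \<times> nat) set" where
  "branches d n b = {(lam, j). partition_of d n lam \<and> j < mult_dim n b lam}"

definition branch_proj :: "nat \<Rightarrow> nat \<Rightarrow> basis \<Rightarrow> nat list \<times> nat \<Rightarrow> tens \<Rightarrow> tens" where
  "branch_proj d n b = (\<lambda>(lam, j) v.
     orth_proj d n (tens.span ((\<lambda>i. b lam i j) ` {..<tens.dim (Q_space d n lam)})) v)"

text \<open>The unitary \<open>H\<^sub>\<lambda>\<^sub>,\<^sub>j\<close>, written through the expansion of a vector in the orthonormal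
  basis \<open>b\<close>.\<close>

definition branch_swap :: "nat \<Rightarrow> nat \<Rightarrow> basis \<Rightarrow> nat list \<times> nat \<Rightarrow> tens \<Rightarrow> tens" where
  "branch_swap d n b = (\<lambda>(lam, j) v.
     \<Sum>(lam', j')\<in>branches d n b. \<Sum>i<tens.dim (Q_space d n lam').
       tscale (tinner d n (b lam' i j') v)
         (b lam' i (if lam' = lam then Transposition.transpose 0 j j' else j')))"

definition branch_law :: "nat \<Rightarrow> nat \<Rightarrow> basis \<Rightarrow> tens \<Rightarrow> (nat list \<times> nat) measure" where
  "branch_law d n b v =
     density (count_space (branches d n b)) (\<lambda>br. ennreal ((tnorm d n (branch_proj d n b br v))\<^sup>2))"

definition post_state :: "nat \<Rightarrow> nat \<Rightarrow> basis \<Rightarrow> tens \<Rightarrow> nat list \<times> nat \<Rightarrow> tens" where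
  "post_state d n b v br =
     (let u = branch_swap d n b br (branch_proj d n b br v)
      in tscale (of_real (1 / tnorm d n u)) u)"


section \<open>Row symmetric joint measurement\<close>

definition sym_dim :: "nat \<Rightarrow> nat \<Rightarrow> nat" where
  "sym_dim d s = (s + d - 1) choose (d - 1)"

definition row_povm :: "nat \<Rightarrow> nat \<Rightarrow> nat list \<Rightarrow> (nat \<Rightarrow> complex mat) \<Rightarrow> tens \<Rightarrow> tens" where
  "row_povm d n lam \<psi> v =
     tscale (\<Prod>i<length lam. of_nat (sym_dim d (lam ! i)))
       (tensor_op d n (\<lambda>x. \<psi> (row_of lam x)) v)"

definition row_fail :: "nat list \<Rightarrow> tens \<Rightarrow> tens" where
  "row_fail lam v =
     v - tscale (1 / of_nat (card (row_group lam))) (\<Sum>\<pi>\<in>row_group lam. perm_op \<pi> v)"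

abbreviation haar_tuples ::
    "complex mat measure \<Rightarrow> nat list \<Rightarrow> (nat \<Rightarrow> complex mat) measure" where
  "haar_tuples \<mu> lam \<equiv> Pi\<^sub>M {..<length lam} (\<lambda>_. \<mu>)"

text \<open>Outcomes are \<open>Some \<psi>\<close> with \<open>\<psi> = (\<psi>\<^sub>1, \<dots>, \<psi>\<^sub>k)\<close> indexed from \<open>0\<close>, and \<open>None\<close> for ``fail''.\<close>

definition row_law ::
    "nat \<Rightarrow> nat \<Rightarrow> complex mat measure \<Rightarrow> nat list \<Rightarrow> tens \<Rightarrow> (nat \<Rightarrow> complex mat) option measure"
  where
  "row_law d n \<mu> lam v =
     measure_of (insert None (Some ` space (haar_tuples \<mu> lam)))
       {S. S \<subseteq> insert None (Some ` space (haar_tuples \<mu> lam)) \<and> Some -` S \<in> sets (haar_tuples \<mu> lam)}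
       (\<lambda>S. (\<integral>\<^sup>+\<psi>. ennreal (Re (tinner d n v (row_povm d n lam \<psi> v))) * indicator (Some -` S) \<psi>
                \<partial>haar_tuples \<mu> lam)
            + ennreal (Re (tinner d n v (row_fail lam v))) * indicator S None)"


section \<open>The output of the whole procedure\<close>

type_synonym outcome = "nat list \<times> (nat \<Rightarrow> complex mat) option"

definition outcome_space :: "nat \<Rightarrow> nat \<Rightarrow> complex mat measure \<Rightarrow> outcome measure" where
  "outcome_space d n \<mu> =
     (let \<Omega> = (SIGMA lam:{lam. partition_of d n lam}. insert None (Some ` space (haar_tuples \<mu> lam)))
      in sigma \<Omega> {S. S \<subseteq> \<Omega> \<and> (\<forall>lam. partition_of d n lam \<longrightarrow>
                          {\<psi>. (lam, Some \<psi>) \<in> S} \<in> sets (haar_tuples \<mu> lam))})"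

text \<open>The Giry-monad bind runs the pre-processing, then the measurement for the returned \<open>lam\<close>;
  the branch index \<open>j\<close> is forgotten.\<close>

definition output_law ::
    "nat \<Rightarrow> nat \<Rightarrow> basis \<Rightarrow> complex mat measure \<Rightarrow> tens \<Rightarrow> outcome measure" where
  "output_law d n b \<mu> v =
     Giry_Monad.bind (branch_law d n b v)
       (\<lambda>(lam, j). distr (row_law d n \<mu> lam (post_state d n b v (lam, j)))
                     (outcome_space d n \<mu>) (Pair lam))"

definition input_state :: "nat \<Rightarrow> nat \<Rightarrow> complex mat \<Rightarrow> (nat \<Rightarrow> nat) \<Rightarrow> tens" where
  "input_state d n U e = tensor_op d n (\<lambda>_. U) (ket e)"

text \<open>\<open>P = 1/n \<Sum>\<^sub>x U |e\<^sub>x\<rangle>\<langle>e\<^sub>x| U\<^sup>\<dagger>\<close>; the vector \<open>U |e\<^sub>x\<rangle>\<close> is a column of \<open>U\<close>.\<close>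

definition mean_state :: "nat \<Rightarrow> nat \<Rightarrow> complex mat \<Rightarrow> (nat \<Rightarrow> nat) \<Rightarrow> complex mat" where
  "mean_state d n U e =
     mat d d (\<lambda>(a, c). (1 / of_nat n) * (\<Sum>x<n. col U (e x) $ a * cnj (col U (e x) $ c)))"


section \<open>Moments of matrix- and complex-valued random variables\<close>

definition mat_expectation :: "nat \<Rightarrow> 'a measure \<Rightarrow> ('a \<Rightarrow> complex mat) \<Rightarrow> complex mat" where
  "mat_expectation d M X = mat d d (\<lambda>ij. \<integral>\<omega>. X \<omega> $$ ij \<partial>M)"

definition complex_variance :: "'a measure \<Rightarrow> ('a \<Rightarrow> complex) \<Rightarrow> real" where
  "complex_variance M X = (\<integral>\<omega>. (cmod (X \<omega> - (\<integral>\<omega>'. X \<omega>' \<partial>M)))\<^sup>2 \<partial>M)"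

end

theory Submission
  imports Defs
begin

text \<open>The estimator is \<open>1/n \<Sum>\<^sub>i ((\<lambda>\<^sub>i + d) \<psi>\<^sub>i - I)\<close>. Invariance under the unitaries \<open>I + (w - 1) z z\<^sup>*\<close>, in
  infinitesimal form, gives a recursion for the moments of a random projector. On a state that is
  symmetric along the rows of \<open>\<lambda>\<close>, inserting one factor \<open>\<psi>\<^sub>i\<close> therefore reproduces \<open>\<Sum>\<^sub>x A\<^sub>x\<close> over the
  positions \<open>x\<close> of row \<open>i\<close>, and inserting two factors adds, for equal rows only, a correction of at most
  \<open>tr A\<^sup>2\<close> plus the mean of \<open>\<Sum>\<^sub>x (A\<^sup>2)\<^sub>x\<close>. Operators that commute with the permutations are not affected by the
  pre-processing, because the vectors of the basis form an orthonormal basis of the tensor power;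
  completeness follows as the sum of all transpositions takes the value of the content of \<open>\<lambda>\<close> on a
  suitable vector of any invariant subspace, and the content bounds are attained together only at a tableau.
  Hence the mean is unbiased. On \<open>U\<^sup>\<otimes>\<^sup>n |e\<rangle>\<close> the second moment of \<open>\<Sum>\<^sub>x A\<^sub>x\<close> exceeds the squared mean by at most
  \<open>n\<close>, and only partitions with at most \<open>r\<close> rows occur, so \<open>n\<^sup>2\<close> times the variance is at most \<open>2 n + r B\<close>.\<close>

subsection \<open>Moments of a random projector\<close>

text \<open>Tracing an added copy of a projector of row \<open>i\<close> against an observable costs
  the factor \<open>lam ! i + d\<close>, which explains the weight in the estimator. A second copy
  from the same row costs \<open>lam ! i + d + 1\<close>. Counting these corrections is what brings
  in the number of rows, and through it \<open>r\<close>.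

  The spaces \<open>Q_space\<close> enter through three facts: on one of them the inner product of
  \<open>x\<close> with a permuted \<open>y\<close> is a fixed multiple of that of \<open>x\<close>
  with \<open>y\<close>; permuted copies for different partitions are orthogonal; and the permuted
  copies for all partitions exhaust the tensor power. In all three the content plays the part
  usually given to the dominance order: it is a comparison of integers whose equality case recovers
  a diagram.

  Branches are kept unnormalized throughout, since the probability of a branch cancels the
  normalization of the state that it returns.\<close>

lemma mat_adjoint_index:
  fixes A :: "complex mat"
  assumes "A \<in> carrier_mat n m" "i < m" "j < n"
  shows "mat_adjoint A $$ (i, j) = cnj (A $$ (j, i))"
  using assms by (simp add: mat_adjoint_def mat_of_rows_def)

lemma mat_adjoint_carrier:
  fixes A :: "complex mat"
  assumes "A \<in> carrier_mat n m"
  shows "mat_adjoint A \<in> carrier_mat m n"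
  using assms by (auto simp: mat_adjoint_def)

lemma mult_mat_index:
  fixes A :: "complex mat"
  assumes "A \<in> carrier_mat n m" "B \<in> carrier_mat m l" "i < n" "j < l"
  shows "(A * B) $$ (i, j) = (\<Sum>k<m. A $$ (i, k) * B $$ (k, j))"
  using assms by (simp add: scalar_prod_def atLeast0LessThan)

text \<open>By the rank, a maximal independent set of columns has a single element, and adding any
  other column makes it dependent. So every column is a multiple of one of them.\<close>

lemma rank_one_column:
  fixes A :: "complex mat"
  assumes A: "A \<in> carrier_mat n m" and r: "vec_space.rank n A = 1"
  obtains v :: "complex Matrix.vec" where "v \<in> carrier_vec n" "\<forall>c<m. \<exists>t. \<forall>i<n. A $$ (i, c) = t * v $ i"
    "\<exists>i<n. v $ i \<noteq> (0::complex)" "\<exists>c<m. v = col A c"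
proof -
  interpret vec_space "TYPE(complex)" n .
  let ?P = "\<lambda>T. T \<subseteq> set (cols A) \<and> lin_indpt T"
  have "lin_indpt {}" by (auto simp: lin_dep_def)
  then obtain S where S: "maximal S ?P"
    using maximal_exists_superset[of "set (cols A)" ?P "{}"] by auto
  have "card S = 1" using rank_card_indpt[OF A S] r by simp
  then obtain v where Sv: "S = {v}" by (auto simp: card_1_singleton_iff)
  have vc: "v \<in> set (cols A)" and li: "lin_indpt {v}" using S Sv by (auto simp: maximal_def)
  have cc: "set (cols A) \<subseteq> carrier_vec n" using A cols_dim by blast
  have v: "v \<in> carrier_vec n" using vc cc by auto
  have v0: "\<exists>i<n. v $ i \<noteq> (0::complex)"
  proof (rule ccontr)
    assume "\<not> ?thesis"
    then have "v = 0\<^sub>v n" using v by (intro eq_vecI) auto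
    then show False using li zero_nin_lin_indpt[of "{v}"] v by auto
  qed
  have "\<exists>t. \<forall>i<n. A $$ (i, c) = t * v $ i" if c: "c < m" for c
  proof -
    define w where "w = col A c"
    have w: "w \<in> set (cols A)" "w \<in> carrier_vec n" using c A by (auto simp: w_def cols_def)
    have "\<exists>t. \<forall>i<n. w $ i = t * v $ i"
    proof (cases "w = v")
      case True then show ?thesis by (intro exI[of _ 1]) auto
    next
      case False
      have "\<not> lin_indpt ({v} \<union> {w})"
      proof
        assume "lin_indpt ({v} \<union> {w})"
        then have "?P ({v} \<union> {w})" using vc w by auto
        then have "{v} \<union> {w} = {v}" using S unfolding Sv maximal_def by (metis Un_upper1)
        then show False using False by auto
      qed
      then have "w \<in> span {v}"
        by (intro iffD2[OF lin_dep_iff_in_span[OF _ li w(2)]]) (use v False in auto)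
      then obtain a T where a: "w = lincomb a T" "T \<subseteq> {v}" "finite T" unfolding span_def by (elim CollectE exE conjE) (rule that)
      show ?thesis
      proof (cases "T = {}")
        case True
        then show ?thesis using a by (intro exI[of _ 0]) (auto simp: lincomb_def)
      next
        case False
        then have "T = {v}" using a by auto
        then show ?thesis using a v lincomb_index[of _ "{v}" a] by (intro exI[of _ "a v"]) auto
      qed
    qed
    then show ?thesis using A c by (simp add: w_def)
  qed
  moreover have "\<exists>c<m. v = col A c" using vc A by (auto simp: cols_def)
  ultimately show ?thesis using that v v0 by blast
qed

context
  fixes d and \<psi> :: "complex mat"
  assumes \<psi>: "\<psi> \<in> rank_one_projectors d"
begin

lemma projector_carrier: "\<psi> \<in> carrier_mat d d"
  using \<psi> by (auto simp: rank_one_projectors_def hermitian_mat_def)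

lemma projector_cnj: "i < d \<Longrightarrow> j < d \<Longrightarrow> cnj (\<psi> $$ (i, j)) = \<psi> $$ (j, i)"
  using \<psi> mat_adjoint_index[OF projector_carrier, of j i]
  by (auto simp: rank_one_projectors_def hermitian_mat_def)

lemma projector_idem: "i < d \<Longrightarrow> j < d \<Longrightarrow> (\<Sum>k<d. \<psi> $$ (i, k) * \<psi> $$ (k, j)) = \<psi> $$ (i, j)"
  using \<psi> mult_mat_index[OF projector_carrier projector_carrier, of i j]
  by (auto simp: rank_one_projectors_def)

lemma projector_factor:
  obtains v t where "\<And>i j. i < d \<Longrightarrow> j < d \<Longrightarrow> \<psi> $$ (i, j) = t j * v i" "\<exists>i<d. \<exists>j<d. \<psi> $$ (i, j) \<noteq> 0"
proof -
  have r: "vec_space.rank d \<psi> = 1" using \<psi> by (simp add: rank_one_projectors_def)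
  obtain v :: "complex Matrix.vec" where v: "v \<in> carrier_vec d" "\<forall>c<d. \<exists>t. \<forall>i<d. \<psi> $$ (i, c) = t * v $ i"
    "\<exists>i<d. v $ i \<noteq> (0::complex)" "\<exists>c<d. v = col \<psi> c"
    by (rule rank_one_column[OF projector_carrier r])
  then obtain t where t: "\<forall>c<d. \<forall>i<d. \<psi> $$ (i, c) = t c * v $ i" by metis
  have "\<exists>i<d. \<exists>j<d. \<psi> $$ (i, j) \<noteq> 0" using v(3,4) projector_carrier by (auto; blast)
  then show ?thesis using that[of t "\<lambda>i. v $ i"] t by auto
qed

text \<open>The 2 by 2 minors of a matrix \<open>t j * v i\<close> vanish. In this form the rank
  condition enters the recursion for the moments.\<close>

lemma projector_minor:
  "i < d \<Longrightarrow> j < d \<Longrightarrow> k < d \<Longrightarrow> l < d \<Longrightarrow> \<psi> $$ (i, j) * \<psi> $$ (k, l) = \<psi> $$ (i, l) * \<psi> $$ (k, j)"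
  by (rule projector_factor) (simp add: mult_ac)

text \<open>For a nonzero entry \<open>\<psi> $$ (i, j)\<close>, the minors turn the trace times
  this entry into the same entry of the square of \<psi>, which is the entry itself.\<close>

lemma projector_trace: "(\<Sum>k<d. \<psi> $$ (k, k)) = 1"
proof -
  obtain v t where f: "\<And>i j. i < d \<Longrightarrow> j < d \<Longrightarrow> \<psi> $$ (i, j) = t j * v i" "\<exists>i<d. \<exists>j<d. \<psi> $$ (i, j) \<noteq> 0"
    using projector_factor by metis
  then obtain i j where ij: "i < d" "j < d" "\<psi> $$ (i, j) \<noteq> 0" by auto
  have "\<psi> $$ (k, k) * \<psi> $$ (i, j) = \<psi> $$ (i, k) * \<psi> $$ (k, j)" if "k < d" for k
    using projector_minor[OF that that ij(1,2)] by (simp add: mult.commute)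
  then have "\<psi> $$ (i, j) = (\<Sum>k<d. \<psi> $$ (k, k) * \<psi> $$ (i, j))"
    using projector_idem[OF ij(1,2)] by simp
  then show ?thesis using ij(3) by (simp flip: sum_distrib_right)
qed

text \<open>Since \<psi> is Hermitian and idempotent, the squared moduli of all entries sum to the
  trace, which is 1. The bound supplies integrability and dominated convergence for monomials in the
  entries.\<close>

lemma projector_norm_le_1:
  assumes "i < d" "j < d" shows "cmod (\<psi> $$ (i, j)) \<le> 1"
proof -
  have rd: "\<psi> $$ (k, k) = of_real (\<Sum>l<d. (cmod (\<psi> $$ (k, l)))\<^sup>2)" if k: "k < d" for k
  proof -
    have "\<psi> $$ (k, k) = (\<Sum>l<d. \<psi> $$ (k, l) * cnj (\<psi> $$ (k, l)))"
      unfolding projector_idem[OF k k, symmetric] by (rule sum.cong) (auto simp: projector_cnj k)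
    then show ?thesis by (simp only: of_real_sum complex_norm_square)
  qed
  have "(\<Sum>k<d. \<Sum>l<d. (cmod (\<psi> $$ (k, l)))\<^sup>2) = 1"
  proof -
    have "complex_of_real (\<Sum>k<d. \<Sum>l<d. (cmod (\<psi> $$ (k, l)))\<^sup>2) = 1"
      unfolding of_real_sum projector_trace[symmetric] by (rule sum.cong) (auto simp: rd)
    then show ?thesis using of_real_eq_1_iff by blast
  qed
  moreover have "(cmod (\<psi> $$ (i, j)))\<^sup>2 \<le> (\<Sum>l<d. (cmod (\<psi> $$ (i, l)))\<^sup>2)"
    using member_le_sum[of j "{..<d}" "\<lambda>l. (cmod (\<psi> $$ (i, l)))\<^sup>2"] assms by auto
  moreover have "\<dots> \<le> (\<Sum>k<d. \<Sum>l<d. (cmod (\<psi> $$ (k, l)))\<^sup>2)"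
    using member_le_sum[of i "{..<d}" "\<lambda>k. \<Sum>l<d. (cmod (\<psi> $$ (k, l)))\<^sup>2"] assms
    by (auto simp: sum_nonneg)
  ultimately have "(cmod (\<psi> $$ (i, j)))\<^sup>2 \<le> 1\<^sup>2" by simp
  then show ?thesis using power2_le_imp_le zero_le_one by blast
qed

end


section \<open>Phase unitaries and conjugated projectors\<close>

lemma sum_delta_less: "i < d \<Longrightarrow> (\<Sum>k<d::nat. (if k = i then f k else 0)) = (f i :: complex)"
  "i < d \<Longrightarrow> (\<Sum>k<d. (if i = k then f k else 0)) = f i"
  by (simp_all add: sum.delta sum.delta')

text \<open>For a rank-one projection \<open>A = z z\<^sup>*\<close> and \<open>\<bar>w\<bar> = 1\<close> the matrix \<open>I + (w - 1) A\<close> is unitary. These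
  unitaries are all that is used of the invariance of the measure.\<close>

definition phase_mat :: "nat \<Rightarrow> (nat \<Rightarrow> complex) \<Rightarrow> complex \<Rightarrow> complex mat" where
  "phase_mat d z p = mat d d (\<lambda>(i, j). (if i = j then 1 else 0) + p * (z i * cnj (z j)))"

lemma phase_mat_unitary:
  assumes z: "(\<Sum>i<d. z i * cnj (z i)) = 1" and p: "cmod (1 + p) = 1"
  shows "unitary_mat d (phase_mat d z p)"
proof -
  have c: "phase_mat d z p \<in> carrier_mat d d" by (simp add: phase_mat_def)
  \<comment> \<open>The left side is the coefficient of the projection onto \<open>z\<close> in the
    product of the adjoint with the matrix; it vanishes because \<open>1 + p\<close> has modulus
    1.\<close>
  have pp: "p + cnj p + cnj p * p = 0"
  proof -
    have "(1 + p) * cnj (1 + p) = 1" using p by (metis complex_norm_square mult_1_right of_real_1 power_one)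
    then show ?thesis by (simp add: algebra_simps)
  qed
  have "mat_adjoint (phase_mat d z p) * phase_mat d z p = 1\<^sub>m d"
  proof (rule eq_matI)
    fix i j assume "i < dim_row (1\<^sub>m d)" "j < dim_col (1\<^sub>m d)"
    then have ij: "i < d" "j < d" by auto
    have "(mat_adjoint (phase_mat d z p) * phase_mat d z p) $$ (i, j)
      = (\<Sum>k<d. ((if i = k then 1 else 0) + cnj p * (z i * cnj (z k))) * ((if k = j then 1 else 0) + p * (z k * cnj (z j))))"
      using ij by (simp add: mult_mat_index[OF mat_adjoint_carrier[OF c] c] mat_adjoint_index[OF c])
        (auto simp: phase_mat_def intro!: sum.cong)
    also have "\<dots> = (\<Sum>k<d. (if i = k then (if k = j then 1 else 0) else 0) + (if i = k then p * (z k * cnj (z j)) else 0)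
       + (if k = j then cnj p * (z i * cnj (z k)) else 0) + cnj p * p * z i * cnj (z j) * (z k * cnj (z k)))"
      by (rule sum.cong) (auto simp: algebra_simps)
    also have "\<dots> = (if i = j then 1 else 0) + p * (z i * cnj (z j)) + cnj p * (z i * cnj (z j)) + cnj p * p * z i * cnj (z j) * 1"
      unfolding sum.distrib sum_distrib_left[symmetric] z sum_delta_less[OF ij(1)] sum_delta_less[OF ij(2)] by simp
    also have "\<dots> = (if i = j then 1 else 0) + (p + cnj p + cnj p * p) * (z i * cnj (z j))"
      by (simp add: algebra_simps)
    finally show "(mat_adjoint (phase_mat d z p) * phase_mat d z p) $$ (i, j) = 1\<^sub>m d $$ (i, j)"
      using ij pp by simp
  qed (use c mat_adjoint_carrier[OF c] in auto)
  then show ?thesis using c by (simp add: unitary_mat_def)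
qed

text \<open>The expansion keeps \<open>p\<close> and \<open>cnj p\<close> apart. For
  \<open>1 + p\<close> on the unit circle the latter is a rational function of \<open>p\<close>, so
  that the invariance can later be differentiated in the complex variable \<open>p\<close>.\<close>

lemma phase_mat_conj_index:
  assumes "\<psi> \<in> carrier_mat d d" "i < d" "j < d"
  shows "(phase_mat d z p * \<psi> * mat_adjoint (phase_mat d z p)) $$ (i, j) =
    \<psi> $$ (i, j) + p * (\<Sum>k<d. z i * cnj (z k) * \<psi> $$ (k, j)) + cnj p * (\<Sum>k<d. \<psi> $$ (i, k) * (z k * cnj (z j)))
      + p * cnj p * (\<Sum>k<d. \<Sum>l<d. z i * cnj (z k) * \<psi> $$ (k, l) * (z l * cnj (z j)))"
proof -
  have c: "phase_mat d z p \<in> carrier_mat d d" by (simp add: phase_mat_def)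
  have 1: "(phase_mat d z p * \<psi>) $$ (i, l) = \<psi> $$ (i, l) + p * (\<Sum>k<d. z i * cnj (z k) * \<psi> $$ (k, l))" if "l < d" for l
  proof -
    have "(phase_mat d z p * \<psi>) $$ (i, l) = (\<Sum>k<d. (if i = k then \<psi> $$ (k, l) else 0) + p * (z i * cnj (z k) * \<psi> $$ (k, l)))"
      unfolding mult_mat_index[OF c assms(1) assms(2) that]
      by (rule sum.cong) (use assms(2) in \<open>auto simp: phase_mat_def algebra_simps\<close>)
    then show ?thesis by (simp only: sum.distrib sum_distrib_left[symmetric] sum_delta_less[OF assms(2)])
  qed
  have 2: "mat_adjoint (phase_mat d z p) $$ (l, j) = (if l = j then 1 else 0) + cnj p * (z l * cnj (z j))" if "l < d" for l
    using that assms(3) by (simp add: mat_adjoint_index[OF c]) (auto simp: phase_mat_def)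
  have "(phase_mat d z p * \<psi> * mat_adjoint (phase_mat d z p)) $$ (i, j)
    = (\<Sum>l<d. (\<psi> $$ (i, l) + p * (\<Sum>k<d. z i * cnj (z k) * \<psi> $$ (k, l))) * ((if l = j then 1 else 0) + cnj p * (z l * cnj (z j))))"
    using mult_mat_index[OF mult_carrier_mat[OF c assms(1)] mat_adjoint_carrier[OF c] assms(2,3)] 1 2 by simp
  also have "\<dots> = (\<Sum>l<d. (if l = j then \<psi> $$ (i, l) + p * (\<Sum>k<d. z i * cnj (z k) * \<psi> $$ (k, l)) else 0)
      + cnj p * (\<psi> $$ (i, l) * (z l * cnj (z j)))
      + p * cnj p * (\<Sum>k<d. z i * cnj (z k) * \<psi> $$ (k, l) * (z l * cnj (z j))))"
    by (rule sum.cong) (auto simp: algebra_simps sum_distrib_left sum_distrib_right)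
  also have "\<dots> = \<psi> $$ (i, j) + p * (\<Sum>k<d. z i * cnj (z k) * \<psi> $$ (k, j)) + cnj p * (\<Sum>k<d. \<psi> $$ (i, k) * (z k * cnj (z j)))
      + p * cnj p * (\<Sum>l<d. \<Sum>k<d. z i * cnj (z k) * \<psi> $$ (k, l) * (z l * cnj (z j)))"
    by (simp only: sum.distrib sum_distrib_left[symmetric] sum_delta_less[OF assms(3)])
  finally show ?thesis by (simp add: sum.swap[of "\<lambda>k l. z i * cnj (z k) * \<psi> $$ (k, l) * (z l * cnj (z j))"])
qed

lemma mat_adjoint_mult:
  fixes A B :: "complex mat"
  assumes "A \<in> carrier_mat n m" "B \<in> carrier_mat m l"
  shows "mat_adjoint (A * B) = mat_adjoint B * mat_adjoint A"
proof (rule eq_matI)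
  have c: "A * B \<in> carrier_mat n l" using assms by auto
  note A = mat_adjoint_carrier[OF assms(1)] and B = mat_adjoint_carrier[OF assms(2)]
  fix i j assume "i < dim_row (mat_adjoint B * mat_adjoint A)" "j < dim_col (mat_adjoint B * mat_adjoint A)"
  then have ij: "i < l" "j < n" using A B by auto
  show "mat_adjoint (A * B) $$ (i, j) = (mat_adjoint B * mat_adjoint A) $$ (i, j)"
    unfolding mat_adjoint_index[OF c ij] mult_mat_index[OF B A ij] mult_mat_index[OF assms ij(2,1)]
    using ij by (auto simp: mat_adjoint_index[OF assms(1)] mat_adjoint_index[OF assms(2)] mult.commute intro!: sum.cong)
qed (use mat_adjoint_carrier[OF assms(1)] mat_adjoint_carrier[OF assms(2)] mat_adjoint_carrier[OF mult_carrier_mat[OF assms]] in auto)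

lemma mat_adjoint_adjoint:
  fixes A :: "complex mat"
  assumes "A \<in> carrier_mat n m" shows "mat_adjoint (mat_adjoint A) = A"
  using assms mat_adjoint_carrier[OF assms] mat_adjoint_carrier[OF mat_adjoint_carrier[OF assms]]
  by (intro eq_matI) (auto simp: mat_adjoint_index[OF mat_adjoint_carrier[OF assms]] mat_adjoint_index[OF assms])

lemma rank_one_iff:
  fixes A :: "complex mat"
  assumes A: "A \<in> carrier_mat n m" and f: "\<And>i j. i < n \<Longrightarrow> j < m \<Longrightarrow> A $$ (i, j) = f i * g j" and "A \<noteq> 0\<^sub>m n m"
  shows "vec_space.rank n A = 1"
proof -
  interpret vec_space "TYPE(complex)" n .
  have "\<exists>i j. i < n \<and> j < m \<and> A $$ (i, j) \<noteq> 0"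
  proof (rule ccontr)
    assume "\<not> ?thesis"
    then have "A = 0\<^sub>m n m" using A by (intro eq_matI) auto
    then show False using assms(3) by simp
  qed
  then obtain i j where ij: "i < n" "j < m" "A $$ (i, j) \<noteq> 0" by blast
  let ?v = "col A j"
  have v: "?v \<in> carrier_vec n" "?v $ i \<noteq> (0::complex)" using A ij by auto
  have "lin_indpt {?v}"
  proof
    assume "lin_dep {?v}"
    then obtain a T w where a: "finite T" "T \<subseteq> {?v}" "lincomb a T = 0\<^sub>v n" "w \<in> T" "a w \<noteq> 0"
      unfolding lin_dep_def by auto
    then have "T = {?v}" "w = ?v" by auto
    then have "a ?v * ?v $ i = (0::complex)" using a(3) lincomb_index[OF ij(1), of "{?v}" a] v ij(1) by simp
    then show False using v a \<open>w = ?v\<close> by simp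
  qed
  then have "1 \<le> rank A" using rank_ge_card_indpt[OF A, of "{?v}"] A ij by (auto simp: cols_def)
  moreover have "rank A \<le> 1" using rank_le_1_product_entries[OF A, of f g] f A by auto
  ultimately show ?thesis by simp
qed

lemma conj_projector:
  assumes U: "unitary_mat d U" and \<psi>: "\<psi> \<in> rank_one_projectors d"
  shows "U * \<psi> * mat_adjoint U \<in> rank_one_projectors d"
proof -
  have c: "U \<in> carrier_mat d d" and UU: "mat_adjoint U * U = 1\<^sub>m d" using U by (auto simp: unitary_mat_def)
  note c' = mat_adjoint_carrier[OF c]
  note p = projector_carrier[OF \<psi>]
  have up: "U * \<psi> \<in> carrier_mat d d" using c p by auto
  have cc: "U * \<psi> * mat_adjoint U \<in> carrier_mat d d" using up c' by auto
  have h: "mat_adjoint \<psi> = \<psi>" "\<psi> * \<psi> = \<psi>" using \<psi> by (auto simp: rank_one_projectors_def hermitian_mat_def)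
  have herm: "mat_adjoint (U * \<psi> * mat_adjoint U) = U * \<psi> * mat_adjoint U"
    using mat_adjoint_mult[OF up c'] mat_adjoint_mult[OF c p] mat_adjoint_adjoint[OF c] h assoc_mult_mat[OF c p c'] by simp
  have "U * \<psi> * mat_adjoint U * (U * \<psi> * mat_adjoint U) = U * \<psi> * (mat_adjoint U * (U * (\<psi> * mat_adjoint U)))"
    using assoc_mult_mat[OF up c' cc] assoc_mult_mat[OF c p c'] by simp
  also have "mat_adjoint U * (U * (\<psi> * mat_adjoint U)) = \<psi> * mat_adjoint U"
    unfolding assoc_mult_mat[OF c' c mult_carrier_mat[OF p c'], symmetric] UU by (rule left_mult_one_mat[OF mult_carrier_mat[OF p c']])
  also have "U * \<psi> * (\<psi> * mat_adjoint U) = U * \<psi> * mat_adjoint U"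
    using assoc_mult_mat[OF up p c'] assoc_mult_mat[OF c p p] h by simp
  finally have idem: "U * \<psi> * mat_adjoint U * (U * \<psi> * mat_adjoint U) = U * \<psi> * mat_adjoint U" .
  obtain v t where f: "\<And>i j. i < d \<Longrightarrow> j < d \<Longrightarrow> \<psi> $$ (i, j) = t j * v i" "\<exists>i<d. \<exists>j<d. \<psi> $$ (i, j) \<noteq> 0"
    using projector_factor[OF \<psi>] by metis
  have "U * \<psi> * mat_adjoint U \<noteq> 0\<^sub>m d d"
  proof
    assume z: "U * \<psi> * mat_adjoint U = 0\<^sub>m d d"
    have "mat_adjoint U * (U * \<psi> * mat_adjoint U) * U = mat_adjoint U * (U * \<psi>) * (mat_adjoint U * U)"
      using assoc_mult_mat[OF c' up c'] assoc_mult_mat[OF mult_carrier_mat[OF c' up] c' c] by simp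
    also have "\<dots> = \<psi>" using assoc_mult_mat[OF c' c p] UU p by simp
    finally have "\<psi> = 0\<^sub>m d d" using z c c' by simp
    then show False using f(2) by auto
  qed
  moreover have "(U * \<psi> * mat_adjoint U) $$ (i, j) = (\<Sum>k<d. U $$ (i, k) * v k) * (\<Sum>l<d. t l * mat_adjoint U $$ (l, j))"
    if ij: "i < d" "j < d" for i j
  proof -
    have "(U * \<psi>) $$ (i, l) = (\<Sum>k<d. U $$ (i, k) * v k) * t l" if "l < d" for l
      unfolding mult_mat_index[OF c p ij(1) that] sum_distrib_right
      by (rule sum.cong) (use that in \<open>auto simp: f(1)\<close>)
    then show ?thesis unfolding mult_mat_index[OF up c' ij] sum_distrib_left
      by (intro sum.cong) (auto simp: mult_ac)
  qed
  ultimately have "vec_space.rank d (U * \<psi> * mat_adjoint U) = 1"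
    by (intro rank_one_iff[OF cc]) auto
  then show ?thesis using herm idem cc by (simp add: rank_one_projectors_def hermitian_mat_def)
qed

locale haar =
  fixes d :: nat and \<mu> :: "complex mat measure"
  assumes haar: "haar_projectors d \<mu>"
begin

sublocale prob_space \<mu>
  using haar by (simp add: haar_projectors_def)

lemma sets_haar: "sets \<mu> = sets (projector_borel d)"
  using haar by (simp add: haar_projectors_def)

lemma space_haar: "space \<mu> = rank_one_projectors d"
  using sets_eq_imp_space_eq[OF sets_haar] by (simp add: projector_borel_def space_vimage_algebra)

lemma entry_measurable_projector_borel:
  assumes "i < d" "j < d" shows "(\<lambda>\<psi>. \<psi> $$ (i, j)) \<in> borel_measurable (projector_borel d)"
proof -
  have "(\<lambda>\<psi>. \<lambda>ij\<in>{..<d} \<times> {..<d}. \<psi> $$ ij) \<in> measurable (projector_borel d) (Pi\<^sub>M ({..<d} \<times> {..<d}) (\<lambda>_. borel :: complex measure))"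
    unfolding projector_borel_def by (rule measurable_vimage_algebra1) (auto simp: space_PiM)
  then have "(\<lambda>\<psi>. (\<lambda>ij\<in>{..<d} \<times> {..<d}. \<psi> $$ ij) (i, j)) \<in> borel_measurable (projector_borel d)"
    by (rule measurable_compose[OF _ measurable_component_singleton]) (use assms in auto)
  then show ?thesis using assms by simp
qed

lemma entry_measurable [measurable]:
  "i < d \<Longrightarrow> j < d \<Longrightarrow> (\<lambda>\<psi>. \<psi> $$ (i, j)) \<in> borel_measurable \<mu>"
  using entry_measurable_projector_borel by (simp add: measurable_cong_sets[OF sets_haar refl])

text \<open>Monomials are indexed by positions and not by exponents: the positions will be the
  tensor factors of one row together with the added copies of its projector.\<close>

definition entries :: "nat set \<Rightarrow> (nat \<Rightarrow> nat) \<Rightarrow> (nat \<Rightarrow> nat) \<Rightarrow> complex mat \<Rightarrow> complex" where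
  "entries S a c \<psi> = (\<Prod>x\<in>S. \<psi> $$ (a x, c x))"

definition moment :: "nat set \<Rightarrow> (nat \<Rightarrow> nat) \<Rightarrow> (nat \<Rightarrow> nat) \<Rightarrow> complex" where
  "moment S a c = (\<integral>\<psi>. entries S a c \<psi> \<partial>\<mu>)"

lemma entries_measurable [measurable]:
  "(\<And>x. x \<in> S \<Longrightarrow> a x < d) \<Longrightarrow> (\<And>x. x \<in> S \<Longrightarrow> c x < d) \<Longrightarrow> entries S a c \<in> borel_measurable \<mu>"
  unfolding entries_def[abs_def] by measurable

lemma entries_norm_le_1:
  assumes "\<psi> \<in> rank_one_projectors d" "\<And>x. x \<in> S \<Longrightarrow> a x < d" "\<And>x. x \<in> S \<Longrightarrow> c x < d"
  shows "cmod (entries S a c \<psi>) \<le> 1"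
  unfolding entries_def prod_norm[symmetric] using projector_norm_le_1[OF assms(1)] assms(2,3)
  by (intro prod_le_1) auto

lemma entries_integrable:
  assumes "\<And>x. x \<in> S \<Longrightarrow> a x < d" "\<And>x. x \<in> S \<Longrightarrow> c x < d"
  shows "integrable \<mu> (entries S a c)"
  by (rule integrable_const_bound[of _ 1]) (use assms entries_norm_le_1 in \<open>auto simp: space_haar[symmetric]\<close>)


text \<open>The infinitesimal form of the invariance: the matrix unit \<open>E\<^sub>j\<^sub>l\<close> acts as a derivation on the monomials
  in the entries of \<open>\<psi>\<close>, through \<open>E\<^sub>j\<^sub>l \<psi> - \<psi> E\<^sub>j\<^sub>l\<close>, and the mean of the result vanishes.\<close>

definition commutator :: "nat \<Rightarrow> nat \<Rightarrow> nat set \<Rightarrow> (nat \<Rightarrow> nat) \<Rightarrow> (nat \<Rightarrow> nat) \<Rightarrow> complex mat \<Rightarrow> complex" where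
  "commutator j l S a c \<psi> = (\<Sum>x\<in>S. ((if a x = j then \<psi> $$ (l, c x) else 0) - (if l = c x then \<psi> $$ (a x, j) else 0))
     * entries (S - {x}) a c \<psi>)"

lemma commutator_integrable:
  assumes S: "finite S" "\<And>x. x \<in> S \<Longrightarrow> a x < d" "\<And>x. x \<in> S \<Longrightarrow> c x < d" and jl: "j < d" "l < d"
  shows "integrable \<mu> (commutator j l S a c)"
  unfolding commutator_def[abs_def]
proof (intro Bochner_Integration.integrable_sum integrable_const_bound)
  fix x assume x: "x \<in> S"
  show "(\<lambda>\<psi>. ((if a x = j then \<psi> $$ (l, c x) else 0) - (if l = c x then \<psi> $$ (a x, j) else 0)) * entries (S - {x}) a c \<psi>)
    \<in> borel_measurable \<mu>"
    using x S jl by (intro borel_measurable_times entries_measurable borel_measurable_diff) auto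
  show "AE \<psi> in \<mu>. cmod (((if a x = j then \<psi> $$ (l, c x) else 0) - (if l = c x then \<psi> $$ (a x, j) else 0)) * entries (S - {x}) a c \<psi>) \<le> 2 * 1"
  proof (rule AE_I2)
    fix \<psi> assume "\<psi> \<in> space \<mu>"
    then have p: "\<psi> \<in> rank_one_projectors d" by (simp add: space_haar)
    have "cmod ((if a x = j then \<psi> $$ (l, c x) else 0) - (if l = c x then \<psi> $$ (a x, j) else 0)) \<le> 1 + 1"
      using x S jl projector_norm_le_1[OF p] by (intro order_trans[OF norm_triangle_ineq4] add_mono) auto
    moreover have "cmod (entries (S - {x}) a c \<psi>) \<le> 1"
      using S by (intro entries_norm_le_1 p) auto
    ultimately show "cmod (((if a x = j then \<psi> $$ (l, c x) else 0) - (if l = c x then \<psi> $$ (a x, j) else 0)) * entries (S - {x}) a c \<psi>) \<le> 2 * 1"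
      unfolding norm_mult by (intro mult_mono) auto
  qed
qed

lemma conj_measurable:
  assumes U: "unitary_mat d U"
  shows "(\<lambda>\<psi>. U * \<psi> * mat_adjoint U) \<in> measurable \<mu> (projector_borel d)"
  unfolding projector_borel_def
proof (rule measurable_vimage_algebra2)
  show "(\<lambda>\<psi>. U * \<psi> * mat_adjoint U) \<in> space \<mu> \<rightarrow> rank_one_projectors d"
    using conj_projector[OF U] by (simp add: space_haar)
  have c: "U \<in> carrier_mat d d" using U by (simp add: unitary_mat_def)
  have e: "(U * \<psi> * mat_adjoint U) $$ (i, j) = (\<Sum>l<d. (\<Sum>k<d. U $$ (i, k) * \<psi> $$ (k, l)) * mat_adjoint U $$ (l, j))"
    if "\<psi> \<in> space \<mu>" "i < d" "j < d" for \<psi> i j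
  proof -
    have \<psi>: "\<psi> \<in> carrier_mat d d" using that projector_carrier by (simp add: space_haar)
    show ?thesis
      using mult_mat_index[OF mult_carrier_mat[OF c \<psi>] mat_adjoint_carrier[OF c] that(2,3)] mult_mat_index[OF c \<psi> that(2)]
      by simp
  qed
  show "(\<lambda>\<psi>. \<lambda>ij\<in>{..<d} \<times> {..<d}. (U * \<psi> * mat_adjoint U) $$ ij) \<in> measurable \<mu> (Pi\<^sub>M ({..<d} \<times> {..<d}) (\<lambda>_. borel))"
  proof (rule measurable_restrict)
    fix ij assume "ij \<in> {..<d} \<times> {..<d}"
    then obtain i j where ij: "ij = (i, j)" "i < d" "j < d" by auto
    have "(\<lambda>\<psi>. \<Sum>l<d. (\<Sum>k<d. U $$ (i, k) * \<psi> $$ (k, l)) * mat_adjoint U $$ (l, j)) \<in> borel_measurable \<mu>"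
      by (intro borel_measurable_sum borel_measurable_times borel_measurable_const entry_measurable) auto
    then show "(\<lambda>\<psi>. (U * \<psi> * mat_adjoint U) $$ ij) \<in> borel_measurable \<mu>"
      unfolding ij(1) by (subst measurable_cong[OF e]) (use ij in auto)
  qed
qed

lemma entries_conj_measurable:
  assumes U: "unitary_mat d U" and S: "\<And>x. x \<in> S \<Longrightarrow> a x < d" "\<And>x. x \<in> S \<Longrightarrow> c x < d"
  shows "(\<lambda>\<psi>. entries S a c (U * \<psi> * mat_adjoint U)) \<in> borel_measurable \<mu>"
  using measurable_compose[OF conj_measurable[OF U], of "entries S a c" borel] entries_measurable[of S a c] S
  by (simp add: measurable_cong_sets[OF sets_haar refl])

lemma moment_invariant:
  assumes U: "unitary_mat d U" and S: "\<And>x. x \<in> S \<Longrightarrow> a x < d" "\<And>x. x \<in> S \<Longrightarrow> c x < d"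
  shows "(\<integral>\<psi>. entries S a c (U * \<psi> * mat_adjoint U) \<partial>\<mu>) = moment S a c"
proof -
  let ?g = "\<lambda>\<psi>. U * \<psi> * mat_adjoint U"
  have inv: "distr \<mu> (projector_borel d) ?g = \<mu>" using haar U by (simp add: haar_projectors_def)
  have "moment S a c = (\<integral>\<psi>. entries S a c \<psi> \<partial>distr \<mu> (projector_borel d) ?g)"
    by (simp add: inv moment_def)
  also have "\<dots> = (\<integral>\<psi>. entries S a c (?g \<psi>) \<partial>\<mu>)"
    using entries_measurable[of S a c] S
    by (intro integral_distr conj_measurable[OF U]) (simp add: measurable_cong_sets[OF sets_haar refl])
  finally show ?thesis by simp
qed

text \<open>For \<open>1 + p\<close> of modulus 1, \<open>cnj p\<close> equals
  \<open>- p / (1 + p)\<close>. After this substitution a conjugated entry is a rational function of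
  \<open>p\<close>, and its derivative at 0 is an entry of the commutator of the projection onto
  \<open>z\<close> with \<psi>.\<close>

lemma conj_phase_entry:
  assumes \<psi>: "\<psi> \<in> carrier_mat d d" and ij: "i < d" "j < d"
  shows "((\<lambda>p. \<psi> $$ (i, j) + p * (\<Sum>k<d. z i * cnj (z k) * \<psi> $$ (k, j)) + (- p / (1 + p)) * (\<Sum>k<d. \<psi> $$ (i, k) * (z k * cnj (z j)))
      + p * (- p / (1 + p)) * (\<Sum>k<d. \<Sum>l<d. z i * cnj (z k) * \<psi> $$ (k, l) * (z l * cnj (z j))))
     has_field_derivative (\<Sum>k<d. z i * cnj (z k) * \<psi> $$ (k, j)) - (\<Sum>k<d. \<psi> $$ (i, k) * (z k * cnj (z j)))) (at (0::complex))"
  by (auto intro!: derivative_eq_intros)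

text \<open>By invariance, the difference quotients of a monomial along phases tending to 1 have
  mean 0. They converge to the derivative of the product, which the Leibniz rule writes as a
  combination of the functions \<open>commutator j l S a c\<close>.\<close>

lemma commutator_phase_mean:
  assumes z: "(\<Sum>i<d. z i * cnj (z i)) = 1"
    and S: "finite S" "\<And>x. x \<in> S \<Longrightarrow> a x < d" "\<And>x. x \<in> S \<Longrightarrow> c x < d"
  shows "(\<Sum>j<d. \<Sum>l<d. z j * cnj (z l) * (\<integral>\<psi>. commutator j l S a c \<psi> \<partial>\<mu>)) = 0"
proof -
  define D where "D \<psi> = (\<Sum>j<d. \<Sum>l<d. z j * cnj (z l) * commutator j l S a c \<psi>)" for \<psi>
  \<comment> \<open>A phase on the unit circle minus 1. The angle lies strictly between 0 and pi, so
    the imaginary part is positive and division by \<open>p n\<close> is allowed.\<close>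
  define p where "p n = cis (1 / real (Suc n)) - 1" for n
  have p1: "cmod (1 + p n) = 1" for n by (simp add: p_def)
  have p0: "p n \<noteq> 0" for n
  proof -
    have "0 < 1 / real (Suc n)" by simp
    moreover have "1 / real (Suc n) \<le> 1" by simp
    then have "1 / real (Suc n) < pi" using pi_gt3 by linarith
    ultimately have "Im (p n) > 0" unfolding p_def by (simp add: sin_gt_zero)
    then show ?thesis by auto
  qed
  have lim: "p \<longlonglongrightarrow> 0"
  proof -
    have "(\<lambda>n. cis (1 / real (Suc n))) \<longlonglongrightarrow> cis 0"
      by (intro tendsto_intros LIMSEQ_inverse_real_of_nat[unfolded inverse_eq_divide])
    from tendsto_diff[OF this tendsto_const[of 1]] show ?thesis by (simp add: p_def[abs_def])
  qed
  have cp: "cnj (p n) = - p n / (1 + p n)" for n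
  proof -
    have "(1 + p n) * cnj (1 + p n) = 1" using p1 by (metis complex_norm_square mult_1_right of_real_1 power_one)
    moreover have "1 + p n \<noteq> 0" using p1[of n] by auto
    ultimately show ?thesis by (simp add: divide_simps) (simp add: algebra_simps add_eq_0_iff)
  qed
  let ?U = "\<lambda>n. phase_mat d z (p n)"
  define f where "f n \<psi> = (entries S a c (?U n * \<psi> * mat_adjoint (?U n)) - entries S a c \<psi>) / p n" for n \<psi>
  have U: "unitary_mat d (?U n)" for n by (rule phase_mat_unitary[OF z p1])
  have ci: "integrable \<mu> (commutator j l S a c)" if "j < d" "l < d" for j l
    by (rule commutator_integrable[OF S]) (use that in auto)
  have mU: "integrable \<mu> (\<lambda>\<psi>. entries S a c (?U n * \<psi> * mat_adjoint (?U n)))" for n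
    by (rule integrable_const_bound[of _ 1])
      (use entries_norm_le_1[OF conj_projector[OF U], of _ S a c] entries_conj_measurable[OF U, of S a c] S in \<open>auto simp: space_haar\<close>)
  define Z where "Z = (\<Sum>k<d. cmod (z k))"
  have Z: "cmod (z k) \<le> Z" if "k < d" for k
    unfolding Z_def using that by (intro member_le_sum) auto
  have Z0: "0 \<le> Z" unfolding Z_def by (intro sum_nonneg) auto
  \<comment> \<open>The dominating constant: conjugation changes a factor of the monomial by at most
    \<open>cmod (p n)\<close> times \<open>2 * Z\<^sup>2\<close> from the two linear terms plus, as
    \<open>cmod (p n)\<close> is at most 2, \<open>2 * (Z\<^sup>2 * Z\<^sup>2)\<close> from the
    quadratic term. All factors have modulus at most 1, so the changes of the \<open>card S\<close>
    factors add up.\<close>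
  have "(\<lambda>n. \<integral>\<psi>. f n \<psi> \<partial>\<mu>) \<longlonglongrightarrow> (\<integral>\<psi>. D \<psi> \<partial>\<mu>)"
  proof (rule integral_dominated_convergence[where w = "\<lambda>_. real (card S) * (2 * Z\<^sup>2 + 2 * (Z\<^sup>2 * Z\<^sup>2))"])
    show "D \<in> borel_measurable \<mu>" unfolding D_def[abs_def]
      using ci by (intro borel_measurable_sum borel_measurable_times) auto
    show "f n \<in> borel_measurable \<mu>" for n unfolding f_def[abs_def]
      using mU entries_integrable[of S a c] S by (intro borel_measurable_divide borel_measurable_diff) auto
    show "AE \<psi> in \<mu>. (\<lambda>n. f n \<psi>) \<longlonglongrightarrow> D \<psi>"
    proof (rule AE_I2)
      fix \<psi> assume "\<psi> \<in> space \<mu>"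
      then have \<psi>: "\<psi> \<in> carrier_mat d d" by (simp add: space_haar projector_carrier)
      define g where "g x p = \<psi> $$ (a x, c x) + p * (\<Sum>k<d. z (a x) * cnj (z k) * \<psi> $$ (k, c x)) + (- p / (1 + p)) * (\<Sum>k<d. \<psi> $$ (a x, k) * (z k * cnj (z (c x))))
      + p * (- p / (1 + p)) * (\<Sum>k<d. \<Sum>l<d. z (a x) * cnj (z k) * \<psi> $$ (k, l) * (z l * cnj (z (c x))))" for x p
      define g' where "g' x = (\<Sum>k<d. z (a x) * cnj (z k) * \<psi> $$ (k, c x)) - (\<Sum>k<d. \<psi> $$ (a x, k) * (z k * cnj (z (c x))))" for x
      have "((\<lambda>p. \<Prod>x\<in>S. g x p) has_field_derivative (\<Sum>x\<in>S. g' x * (\<Prod>y\<in>S - {x}. g y 0))) (at 0)"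
        unfolding g_def g'_def using S by (intro has_field_derivative_prod conj_phase_entry[OF \<psi>]) auto
      then have "((\<lambda>h. ((\<Prod>x\<in>S. g x (0 + h)) - (\<Prod>x\<in>S. g x 0)) / h) \<longlongrightarrow> (\<Sum>x\<in>S. g' x * (\<Prod>y\<in>S - {x}. g y 0))) (at 0)"
        by (simp only: DERIV_def)
      moreover have "filterlim p (at 0) sequentially"
        using lim p0 by (intro filterlim_atI) auto
      ultimately have "(\<lambda>n. ((\<Prod>x\<in>S. g x (0 + p n)) - (\<Prod>x\<in>S. g x 0)) / p n) \<longlonglongrightarrow> (\<Sum>x\<in>S. g' x * (\<Prod>y\<in>S - {x}. g y 0))"
        by (rule filterlim_compose)
      moreover have "(\<Prod>x\<in>S. g x (0 + p n)) = entries S a c (?U n * \<psi> * mat_adjoint (?U n))" for n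
        unfolding entries_def using S by (intro prod.cong) (auto simp: phase_mat_conj_index[OF \<psi>] g_def cp)
      moreover have g0: "g x 0 = \<psi> $$ (a x, c x)" for x by (simp add: g_def)
      moreover have "(\<Sum>x\<in>S. g' x * (\<Prod>y\<in>S - {x}. g y 0)) = D \<psi>"
      proof -
        have "g' x = (\<Sum>j<d. \<Sum>l<d. z j * cnj (z l) * ((if a x = j then \<psi> $$ (l, c x) else 0) - (if l = c x then \<psi> $$ (a x, j) else 0)))"
          if "x \<in> S" for x
        proof -
          have "(\<Sum>j<d. \<Sum>l<d. z j * cnj (z l) * ((if a x = j then \<psi> $$ (l, c x) else 0) - (if l = c x then \<psi> $$ (a x, j) else 0)))
            = (\<Sum>j<d. if a x = j then (\<Sum>l<d. z j * cnj (z l) * \<psi> $$ (l, c x)) else 0)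
              - (\<Sum>j<d. \<Sum>l<d. if l = c x then z j * cnj (z l) * \<psi> $$ (a x, j) else 0)"
            unfolding sum_subtractf[symmetric]
            by (rule sum.cong[OF refl]) (simp add: right_diff_distrib sum_subtractf if_distrib[of "\<lambda>t. _ * t"] cong: if_cong)
          then show ?thesis using that S by (simp add: g'_def sum_delta_less algebra_simps)
        qed
        then have "(\<Sum>x\<in>S. g' x * (\<Prod>y\<in>S - {x}. g y 0)) = (\<Sum>x\<in>S. \<Sum>j<d. \<Sum>l<d. z j * cnj (z l) *
          (((if a x = j then \<psi> $$ (l, c x) else 0) - (if l = c x then \<psi> $$ (a x, j) else 0)) * entries (S - {x}) a c \<psi>))"
          by (intro sum.cong refl) (simp add: g0 entries_def sum_distrib_right mult.assoc)
        also have "\<dots> = D \<psi>"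
          unfolding D_def commutator_def sum_distrib_left by (rule trans[OF sum.swap], rule sum.cong[OF refl], rule sum.swap)
        finally show ?thesis .
      qed
      ultimately show "(\<lambda>n. f n \<psi>) \<longlonglongrightarrow> D \<psi>" by (simp add: f_def entries_def)
    qed
    show "AE \<psi> in \<mu>. cmod (f n \<psi>) \<le> real (card S) * (2 * Z\<^sup>2 + 2 * (Z\<^sup>2 * Z\<^sup>2))" for n
    proof (rule AE_I2)
      fix \<psi> assume "\<psi> \<in> space \<mu>"
      then have p: "\<psi> \<in> rank_one_projectors d" by (simp add: space_haar)
      note \<psi> = projector_carrier[OF p]
      let ?\<phi> = "?U n * \<psi> * mat_adjoint (?U n)"
      have e: "cmod (?\<phi> $$ (i, j) - \<psi> $$ (i, j)) \<le> cmod (p n) * (2 * Z\<^sup>2 + 2 * (Z\<^sup>2 * Z\<^sup>2))" if ij: "i < d" "j < d" for i j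
      proof -
        have 1: "cmod (\<Sum>k<d. z i * cnj (z k) * \<psi> $$ (k, j)) \<le> Z\<^sup>2"
        proof -
          have "cmod (\<Sum>k<d. z i * cnj (z k) * \<psi> $$ (k, j)) \<le> (\<Sum>k<d. Z * cmod (z k) * 1)"
            by (intro order_trans[OF norm_sum] sum_mono)
              (unfold norm_mult complex_mod_cnj, intro mult_mono mult_nonneg_nonneg, use Z Z0 ij projector_norm_le_1[OF p] in auto)
          then show ?thesis by (simp add: sum_distrib_left[symmetric] Z_def[symmetric] power2_eq_square)
        qed
        have 2: "cmod (\<Sum>k<d. \<psi> $$ (i, k) * (z k * cnj (z j))) \<le> Z\<^sup>2"
        proof -
          have "cmod (\<Sum>k<d. \<psi> $$ (i, k) * (z k * cnj (z j))) \<le> (\<Sum>k<d. 1 * (cmod (z k) * Z))"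
            by (intro order_trans[OF norm_sum] sum_mono)
              (unfold norm_mult complex_mod_cnj, intro mult_mono mult_nonneg_nonneg, use Z Z0 ij projector_norm_le_1[OF p] in auto)
          then show ?thesis by (simp add: sum_distrib_right[symmetric] Z_def[symmetric] power2_eq_square)
        qed
        have 3: "cmod (\<Sum>k<d. \<Sum>l<d. z i * cnj (z k) * \<psi> $$ (k, l) * (z l * cnj (z j))) \<le> Z\<^sup>2 * Z\<^sup>2"
        proof -
          have "cmod (\<Sum>k<d. \<Sum>l<d. z i * cnj (z k) * \<psi> $$ (k, l) * (z l * cnj (z j))) \<le> (\<Sum>k<d. \<Sum>l<d. Z * cmod (z k) * 1 * (cmod (z l) * Z))"
            by (intro order_trans[OF norm_sum] sum_mono)
              (unfold norm_mult complex_mod_cnj, intro mult_mono mult_nonneg_nonneg, use Z Z0 ij projector_norm_le_1[OF p] in auto)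
          also have "\<dots> = Z\<^sup>2 * Z\<^sup>2"
            by (simp add: sum_distrib_left[symmetric] sum_distrib_right[symmetric] Z_def[symmetric] power2_eq_square)
          finally show ?thesis .
        qed
        have p2: "cmod (p n) \<le> 2" using norm_triangle_ineq4[of "cis (1 / real (Suc n))" 1] by (simp add: p_def)
        have "cmod (?\<phi> $$ (i, j) - \<psi> $$ (i, j)) \<le> cmod (p n) * Z\<^sup>2 + cmod (p n) * Z\<^sup>2 + cmod (p n) * 2 * (Z\<^sup>2 * Z\<^sup>2)"
          unfolding phase_mat_conj_index[OF \<psi> ij] add.assoc add_diff_cancel_left'
          unfolding add.assoc[symmetric]
          by (intro order_trans[OF norm_triangle_ineq] add_mono)
            (use 1 2 3 p2 in \<open>auto simp: norm_mult intro!: mult_mono\<close>)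
        then show ?thesis by (simp add: algebra_simps)
      qed
      have "cmod (entries S a c ?\<phi> - entries S a c \<psi>) \<le> (\<Sum>x\<in>S. cmod (?\<phi> $$ (a x, c x) - \<psi> $$ (a x, c x)))"
        unfolding entries_def using S projector_norm_le_1[OF p] projector_norm_le_1[OF conj_projector[OF U p]]
        by (intro norm_prod_diff) auto
      also have "\<dots> \<le> (\<Sum>x\<in>S. cmod (p n) * (2 * Z\<^sup>2 + 2 * (Z\<^sup>2 * Z\<^sup>2)))"
        using S by (intro sum_mono e) auto
      finally show "cmod (f n \<psi>) \<le> real (card S) * (2 * Z\<^sup>2 + 2 * (Z\<^sup>2 * Z\<^sup>2))"
        using p0[of n] by (simp add: f_def norm_divide divide_le_eq mult_ac)
    qed
  qed auto
  moreover have "(\<integral>\<psi>. f n \<psi> \<partial>\<mu>) = 0" for n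
    using moment_invariant[OF U, of S a c] mU entries_integrable[of S a c] S
    by (simp add: f_def moment_def)
  moreover have "(\<integral>\<psi>. D \<psi> \<partial>\<mu>) = (\<Sum>j<d. \<Sum>l<d. z j * cnj (z l) * (\<integral>\<psi>. commutator j l S a c \<psi> \<partial>\<mu>))"
    unfolding D_def using ci
    by (subst Bochner_Integration.integral_sum, force)+ (auto intro!: sum.cong)
  ultimately show ?thesis using LIMSEQ_unique[OF _ tendsto_const] by fastforce
qed


text \<open>Polarization: the form in \<open>z\<close> of \<open>commutator_phase_mean\<close>
  vanishes on unit vectors. Basis vectors give the diagonal coefficients; the vectors with entries
  \<open>1 / sqrt 2\<close> at \<open>j\<close> and \<open>w / sqrt 2\<close> at \<open>l\<close>,
  for \<open>w\<close> equal to 1 and to \<i>, give the others.\<close>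

lemma commutator_mean:
  assumes S: "finite S" "\<And>x. x \<in> S \<Longrightarrow> a x < d" "\<And>x. x \<in> S \<Longrightarrow> c x < d" and jl: "j < d" "l < d"
  shows "(\<integral>\<psi>. commutator j l S a c \<psi> \<partial>\<mu>) = 0"
proof -
  define L where "L j l = (\<integral>\<psi>. commutator j l S a c \<psi> \<partial>\<mu>)" for j l
  have diag: "L k k = 0" if k: "k < d" for k
  proof -
    let ?z = "\<lambda>i. if i = k then 1 else (0::complex)"
    have "(\<Sum>i<d. ?z i * cnj (?z i)) = (\<Sum>i<d. if i = k then 1 else 0)" by (rule sum.cong) auto
    then have "(\<Sum>i<d. ?z i * cnj (?z i)) = 1" using k by simp
    from commutator_phase_mean[OF this S]
    have "(\<Sum>i<d. \<Sum>m<d. ?z i * cnj (?z m) * L i m) = 0" by (simp add: L_def)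
    also have "(\<Sum>i<d. \<Sum>m<d. ?z i * cnj (?z m) * L i m) = (\<Sum>i<d. \<Sum>m<d. if m = k then (if i = k then L i m else 0) else 0)"
      by (intro sum.cong[OF refl]) simp
    finally show ?thesis using k by simp
  qed
  show ?thesis
  proof (cases "j = l")
    case True then show ?thesis using diag jl by (simp add: L_def)
  next
    case False
    have off: "cnj w * L j l + w * L l j = 0" if w: "cmod w = 1" for w
    proof -
      define r where "r = complex_of_real (1 / sqrt 2)"
      have r: "r * r = 1/2" "cnj r = r" by (simp_all add: r_def flip: of_real_mult)
      let ?z = "\<lambda>i. if i = j then r else if i = l then r * w else (0::complex)"
      have ww: "w * cnj w = 1" using w by (metis complex_norm_square of_real_1 power_one)
      have sp: "(\<Sum>i<d. ?z i * f i) = r * f j + r * w * f l" for f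
      proof -
        have "(\<Sum>i<d. ?z i * f i) = (\<Sum>i<d. (if i = j then r * f i else 0) + (if i = l then r * w * f i else 0))"
          by (rule sum.cong) (use False in auto)
        then show ?thesis using jl by (simp add: sum.distrib)
      qed
      have sp': "(\<Sum>i<d. cnj (?z i) * f i) = r * f j + r * cnj w * f l" for f
      proof -
        have "(\<Sum>i<d. cnj (?z i) * f i) = (\<Sum>i<d. (if i = j then r * f i else 0) + (if i = l then r * cnj w * f i else 0))"
          by (rule sum.cong) (use False r in auto)
        then show ?thesis using jl by (simp add: sum.distrib)
      qed
      have "r * cnj r + r * w * (cnj r * cnj w) = r * r + r * r * (w * cnj w)"
        unfolding r(2) by (simp only: mult_ac)
      then have "r * cnj r + r * w * (cnj r * cnj w) = 1" unfolding ww r(1) by simp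
      then have "(\<Sum>i<d. ?z i * cnj (?z i)) = 1" unfolding sp using False by simp
      from commutator_phase_mean[OF this, of S a c] S
      have "(\<Sum>i<d. \<Sum>m<d. ?z i * cnj (?z m) * L i m) = 0" unfolding L_def by blast
      then have "(\<Sum>i<d. ?z i * (\<Sum>m<d. cnj (?z m) * L i m)) = 0" by (simp only: sum_distrib_left mult.assoc)
      then have "r * (r * L j j + r * cnj w * L j l) + r * w * (r * L l j + r * cnj w * L l l) = 0"
        unfolding sp sp' .
      then have "r * r * (cnj w * L j l + w * L l j) = 0" using diag jl by (simp add: algebra_simps)
      then show ?thesis using r(1) by simp
    qed
    have "L j l + L l j = 0" using off[of 1] by simp
    moreover have "L j l - L l j = 0"
    proof -
      have "- \<i> * (L j l - L l j) = 0" using off[of \<i>] by (simp add: algebra_simps)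
      then show ?thesis by simp
    qed
    ultimately have "2 * L j l = 0" by (simp add: algebra_simps)
    then show ?thesis by (simp add: L_def)
  qed
qed

text \<open>Summing the derivation identities for the monomials \<open>\<psi>\<^sub>k\<^sub>q \<Prod>\<^sub>x \<psi>(a x, c x)\<close> and \<open>E\<^sub>k\<^sub>p\<close> over \<open>k\<close> and
  contracting with \<open>\<psi>\<^sup>2 = \<psi>\<close>, \<open>tr \<psi> = 1\<close> gives a recursion that determines all moments.\<close>

lemma moment_insert:
  assumes S: "finite S" "\<And>x. x \<in> S \<Longrightarrow> a x < d" "\<And>x. x \<in> S \<Longrightarrow> c x < d" and y: "y \<notin> S" "a y < d" "c y < d"
  shows "(of_nat (card S) + of_nat d) * moment (insert y S) a c
    = (if a y = c y then moment S a c else 0) + (\<Sum>x\<in>S. if a y = c x then moment S a (c(x := c y)) else 0)"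
proof -
  let ?S = "insert y S" and ?p = "a y" and ?q = "c y"
  have upd: "\<And>k. k < d \<Longrightarrow> x \<in> ?S \<Longrightarrow> (a(y := k)) x < d" "\<And>x. x \<in> ?S \<Longrightarrow> c x < d" for x using S y by auto
  have ci: "integrable \<mu> (commutator k ?p ?S (a(y := k)) c)" if "k < d" for k
    using that S y by (intro commutator_integrable) auto
  have "0 = (\<Sum>k<d. \<integral>\<psi>. commutator k ?p ?S (a(y := k)) c \<psi> \<partial>\<mu>)"
    by (rule sum.neutral[symmetric], intro ballI commutator_mean) (use S y in auto)
  also have "\<dots> = (\<integral>\<psi>. (\<Sum>k<d. commutator k ?p ?S (a(y := k)) c \<psi>) \<partial>\<mu>)"
    using ci by (simp add: Bochner_Integration.integral_sum)
  also have "\<dots> = (\<integral>\<psi>. (of_nat (card S) + of_nat d) * entries ?S a c \<psi> - (if ?p = ?q then entries S a c \<psi> else 0)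
      - (\<Sum>x\<in>S. if ?p = c x then entries S a (c(x := ?q)) \<psi> else 0) \<partial>\<mu>)"
  proof (rule Bochner_Integration.integral_cong[OF refl])
    fix \<psi> assume "\<psi> \<in> space \<mu>"
    then have p: "\<psi> \<in> rank_one_projectors d" by (simp add: space_haar)
    define E where "E = entries S a c \<psi>"
    define E' where "E' x = entries (S - {x}) a c \<psi>" for x
    have EE: "E = \<psi> $$ (a x, c x) * E' x" if "x \<in> S" for x
      unfolding E_def E'_def entries_def by (rule prod.remove) (use S that in auto)
    have Ey: "entries ?S a c \<psi> = \<psi> $$ (?p, ?q) * E" using S y by (simp add: entries_def E_def)
    have c0: "entries (?S - {y}) (a(y := k)) c \<psi> = E" for k
      unfolding entries_def E_def using y by (intro prod.cong) auto
    have cx: "entries (?S - {x}) (a(y := k)) c \<psi> = \<psi> $$ (k, ?q) * E' x" if "x \<in> S" for x k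
    proof -
      have "?S - {x} = insert y (S - {x})" using that y by auto
      then have "entries (?S - {x}) (a(y := k)) c \<psi> = \<psi> $$ (k, ?q) * (\<Prod>u\<in>S - {x}. \<psi> $$ ((a(y := k)) u, c u))"
        using S y by (simp add: entries_def)
      also have "(\<Prod>u\<in>S - {x}. \<psi> $$ ((a(y := k)) u, c u)) = E' x"
        unfolding E'_def entries_def using y by (intro prod.cong) auto
      finally show ?thesis .
    qed
    have up: "entries S a (c(x := ?q)) \<psi> = \<psi> $$ (a x, ?q) * E' x" if "x \<in> S" for x
    proof -
      have "entries S a (c(x := ?q)) \<psi> = \<psi> $$ (a x, ?q) * (\<Prod>u\<in>S - {x}. \<psi> $$ (a u, (c(x := ?q)) u))"
        unfolding entries_def using S that by (subst prod.remove[of _ x]) auto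
      also have "(\<Prod>u\<in>S - {x}. \<psi> $$ (a u, (c(x := ?q)) u)) = E' x"
        unfolding E'_def entries_def by (intro prod.cong) auto
      finally show ?thesis .
    qed
    have comm: "commutator k ?p ?S (a(y := k)) c \<psi> = (\<psi> $$ (?p, ?q) - (if ?p = ?q then \<psi> $$ (k, k) else 0)) * E
      + (\<Sum>x\<in>S. ((if a x = k then \<psi> $$ (?p, c x) else 0) - (if ?p = c x then \<psi> $$ (a x, k) else 0)) * (\<psi> $$ (k, ?q) * E' x))" for k
    proof -
      have "commutator k ?p ?S (a(y := k)) c \<psi> = (\<psi> $$ (?p, ?q) - (if ?p = ?q then \<psi> $$ (k, k) else 0)) * entries (?S - {y}) (a(y := k)) c \<psi>
        + (\<Sum>x\<in>S. ((if (a(y := k)) x = k then \<psi> $$ (?p, c x) else 0) - (if ?p = c x then \<psi> $$ ((a(y := k)) x, k) else 0)) * entries (?S - {x}) (a(y := k)) c \<psi>)"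
        unfolding commutator_def using S y by (subst sum.insert) auto
      also have "(\<Sum>x\<in>S. ((if (a(y := k)) x = k then \<psi> $$ (?p, c x) else 0) - (if ?p = c x then \<psi> $$ ((a(y := k)) x, k) else 0)) * entries (?S - {x}) (a(y := k)) c \<psi>)
        = (\<Sum>x\<in>S. ((if a x = k then \<psi> $$ (?p, c x) else 0) - (if ?p = c x then \<psi> $$ (a x, k) else 0)) * (\<psi> $$ (k, ?q) * E' x))"
        using y by (intro sum.cong refl) (auto simp: cx)
      finally show ?thesis by (simp only: c0)
    qed
    \<comment> \<open>Each \<open>x\<close> in \<open>S\<close> contributes one more copy of the
      full monomial, by the minor identity, and by idempotence one monomial in which
      \<open>x\<close> has taken over the column index of \<open>y\<close>. This is where
      \<open>card S\<close> in the factor of the recursion comes from; the summand \<open>d\<close>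
      counts the values of \<open>k\<close> at the position \<open>y\<close> itself.\<close>
    have inner: "(\<Sum>k<d. ((if a x = k then \<psi> $$ (?p, c x) else 0) - (if ?p = c x then \<psi> $$ (a x, k) else 0)) * (\<psi> $$ (k, ?q) * E' x))
      = \<psi> $$ (?p, ?q) * E - (if ?p = c x then entries S a (c(x := ?q)) \<psi> else 0)" if x: "x \<in> S" for x
    proof -
      have "(\<Sum>k<d. ((if a x = k then \<psi> $$ (?p, c x) else 0) - (if ?p = c x then \<psi> $$ (a x, k) else 0)) * (\<psi> $$ (k, ?q) * E' x))
        = (\<Sum>k<d. (if a x = k then \<psi> $$ (?p, c x) * \<psi> $$ (k, ?q) * E' x else 0) - (if ?p = c x then 1 else 0) * (\<psi> $$ (a x, k) * \<psi> $$ (k, ?q)) * E' x)"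
        by (rule sum.cong) (auto simp: algebra_simps)
      also have "\<dots> = \<psi> $$ (?p, c x) * \<psi> $$ (a x, ?q) * E' x - (if ?p = c x then 1 else 0) * \<psi> $$ (a x, ?q) * E' x"
        unfolding sum_subtractf sum_distrib_right[symmetric] sum_distrib_left[symmetric]
          projector_idem[OF p S(2)[OF x] y(3)] using S(2)[OF x] by (simp add: sum_delta_less)
      also have "\<psi> $$ (?p, c x) * \<psi> $$ (a x, ?q) = \<psi> $$ (?p, ?q) * \<psi> $$ (a x, c x)"
        using projector_minor[OF p y(2) S(3)[OF x] S(2)[OF x] y(3)] .
      finally show ?thesis using x by (simp add: EE[OF x] up mult_ac)
    qed
    have "(\<Sum>k<d. commutator k ?p ?S (a(y := k)) c \<psi>) = (of_nat d * \<psi> $$ (?p, ?q) - (if ?p = ?q then (\<Sum>k<d. \<psi> $$ (k, k)) else 0)) * E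
      + (\<Sum>x\<in>S. \<psi> $$ (?p, ?q) * E - (if ?p = c x then entries S a (c(x := ?q)) \<psi> else 0))"
    proof -
      have "(\<Sum>k<d. \<Sum>x\<in>S. ((if a x = k then \<psi> $$ (?p, c x) else 0) - (if ?p = c x then \<psi> $$ (a x, k) else 0)) * (\<psi> $$ (k, ?q) * E' x))
        = (\<Sum>x\<in>S. \<psi> $$ (?p, ?q) * E - (if ?p = c x then entries S a (c(x := ?q)) \<psi> else 0))"
        by (subst sum.swap) (auto simp: inner intro!: sum.cong)
      then show ?thesis unfolding comm sum.distrib sum_distrib_right[symmetric] sum_subtractf by (cases "?p = ?q") auto
    qed
    then show "(\<Sum>k<d. commutator k ?p ?S (a(y := k)) c \<psi>) = (of_nat (card S) + of_nat d) * entries ?S a c \<psi> - (if ?p = ?q then entries S a c \<psi> else 0)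
      - (\<Sum>x\<in>S. if ?p = c x then entries S a (c(x := ?q)) \<psi> else 0)"
      unfolding Ey projector_trace[OF p] E_def[symmetric] by (cases "?p = ?q") (simp_all add: sum_subtractf algebra_simps)
  qed
  also have "\<dots> = (of_nat (card S) + of_nat d) * moment ?S a c - (if ?p = ?q then moment S a c else 0)
      - (\<Sum>x\<in>S. if ?p = c x then moment S a (c(x := ?q)) else 0)"
  proof -
    have i1: "integrable \<mu> (entries ?S a c)" using S y by (intro entries_integrable) auto
    have i2: "integrable \<mu> (\<lambda>\<psi>. if ?p = ?q then entries S a c \<psi> else 0)" using entries_integrable[of S a c] S by (cases "?p = ?q") auto
    have i3: "integrable \<mu> (\<lambda>\<psi>. if ?p = c x then entries S a (c(x := ?q)) \<psi> else 0)" if "x \<in> S" for x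
      using entries_integrable[of S a "c(x := ?q)"] S y by (cases "?p = c x") auto
    have i4: "integrable \<mu> (\<lambda>\<psi>. \<Sum>x\<in>S. if ?p = c x then entries S a (c(x := ?q)) \<psi> else 0)"
      by (intro Bochner_Integration.integrable_sum i3)
    have s: "(\<integral>\<psi>. (if b then f \<psi> else 0) \<partial>\<mu>) = (if b then \<integral>\<psi>. f \<psi> \<partial>\<mu> else 0)" for b and f :: "complex mat \<Rightarrow> complex"
      by simp
    show ?thesis
      by (subst Bochner_Integration.integral_diff[OF Bochner_Integration.integrable_diff i4],
          rule integrable_mult_right[OF i1], rule i2,
          subst Bochner_Integration.integral_diff[OF _ i2], rule integrable_mult_right[OF i1],
          subst Bochner_Integration.integral_sum[OF i3], assumption)
        (simp only: s moment_def integral_mult_right_zero)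
  qed
  finally show ?thesis by (simp add: algebra_simps)
qed

end

section \<open>Linear operators on tensors and the action of permutations\<close>

abbreviation swap :: "nat \<Rightarrow> nat \<Rightarrow> nat \<Rightarrow> nat" where
  "swap \<equiv> Transposition.transpose"

abbreviation pinv :: "(nat \<Rightarrow> nat) \<Rightarrow> nat \<Rightarrow> nat" where
  "pinv \<equiv> inv_into UNIV"

abbreviation tlinear :: "(tens \<Rightarrow> tens) \<Rightarrow> bool" where
  "tlinear \<equiv> Modules.module_hom tscale tscale"

lemma sum_apply: "(\<Sum>x\<in>A. f x) e = (\<Sum>x\<in>A. f x e)" for f :: "'a \<Rightarrow> 'b \<Rightarrow> 'c :: comm_monoid_add"
  by (induction A rule: infinite_finite_induct) (auto simp: plus_fun_def zero_fun_def)

lemma tlinearI: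
  assumes "\<And>u v. K (u + v) = K u + K v" "\<And>c v. K (tscale c v) = tscale c (K v)"
  shows "tlinear K"
  using assms by unfold_locales auto

lemmas tlinear_add = Modules.module_hom.add
  and tlinear_scale = Modules.module_hom.scale
  and tlinear_sum = Modules.module_hom.sum
  and tlinear_zero = Modules.module_hom.zero

lemma tlinear_sum_fun:
  assumes K: "\<And>x. x \<in> A \<Longrightarrow> tlinear (K x)" shows "tlinear (\<lambda>v. \<Sum>x\<in>A. K x v)"
proof (rule tlinearI)
  show "(\<Sum>x\<in>A. K x (u + v)) = (\<Sum>x\<in>A. K x u) + (\<Sum>x\<in>A. K x v)" for u v
    unfolding sum.distrib[symmetric] by (rule sum.cong[OF refl]) (rule tlinear_add[OF K])
  show "(\<Sum>x\<in>A. K x (tscale c v)) = tscale c (\<Sum>x\<in>A. K x v)" for c v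
    unfolding tens.scale_sum_right by (rule sum.cong[OF refl]) (rule tlinear_scale[OF K])
qed

lemma tlinear_scale_fun: "tlinear K \<Longrightarrow> tlinear (\<lambda>v. tscale c (K v))"
  by (intro tlinearI) (simp_all add: tlinear_add tlinear_scale tens.scale_right_distrib mult.commute)

lemma tlinear_comp: "tlinear K \<Longrightarrow> tlinear L \<Longrightarrow> tlinear (\<lambda>v. K (L v))"
  by (intro tlinearI) (simp_all add: tlinear_add tlinear_scale)

lemma tlinear_perm_op: "tlinear (perm_op \<pi>)"
  by (intro tlinearI) (auto simp: perm_op_def tscale_def plus_fun_def)

lemma perm_op_comp: "perm_op \<pi> (perm_op \<sigma> v) = perm_op (\<pi> \<circ> \<sigma>) v"
  by (simp add: perm_op_def comp_assoc)

lemma perm_op_id [simp]: "perm_op id v = v"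
  by (simp add: perm_op_def)

subsection \<open>The inner product\<close>

lemma finite_strings [simp]: "finite (strings d n)"
  by (simp add: strings_def finite_PiE)

lemma tinner_add_right: "tinner d n u (v + w) = tinner d n u v + tinner d n u w"
  by (simp add: tinner_def plus_fun_def algebra_simps sum.distrib)

lemma tinner_add_left: "tinner d n (v + w) u = tinner d n v u + tinner d n w u"
  by (simp add: tinner_def plus_fun_def algebra_simps sum.distrib)

lemma tinner_scale_right: "tinner d n u (tscale c v) = c * tinner d n u v"
  by (simp add: tinner_def tscale_def sum_distrib_left mult_ac)

lemma tinner_scale_left: "tinner d n (tscale c u) v = cnj c * tinner d n u v"
  by (simp add: tinner_def tscale_def sum_distrib_left mult_ac)

lemma tinner_zero [simp]: "tinner d n u 0 = 0" "tinner d n 0 u = 0"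
  by (simp_all add: tinner_def zero_fun_def)

lemma tinner_sum_right: "tinner d n u (\<Sum>x\<in>A. f x) = (\<Sum>x\<in>A. tinner d n u (f x))"
  by (induction A rule: infinite_finite_induct) (simp_all only: sum.infinite sum.empty sum.insert tinner_zero tinner_add_right not_False_eq_True)

lemma tinner_sum_left: "tinner d n (\<Sum>x\<in>A. f x) u = (\<Sum>x\<in>A. tinner d n (f x) u)"
  by (induction A rule: infinite_finite_induct) (simp_all only: sum.infinite sum.empty sum.insert tinner_zero tinner_add_left not_False_eq_True)

lemma tinner_diff_right: "tinner d n u (v - w) = tinner d n u v - tinner d n u w"
  by (simp add: tinner_def algebra_simps sum_subtractf)

lemma tinner_commute: "tinner d n u v = cnj (tinner d n v u)"
  by (simp add: tinner_def mult.commute)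

lemma tinner_self: "tinner d n v v = of_real ((tnorm d n v)\<^sup>2)"
proof -
  have "(tnorm d n v)\<^sup>2 = (\<Sum>e\<in>strings d n. (cmod (v e))\<^sup>2)"
    by (simp add: tnorm_def L2_set_def sum_nonneg)
  then show ?thesis
    by (simp only: tinner_def of_real_sum complex_norm_square) (simp add: mult.commute)
qed

lemma tensor_space_iff: "v \<in> tensor_space d n \<longleftrightarrow> (\<forall>e. e \<notin> strings d n \<longrightarrow> v e = 0)"
proof
  assume "v \<in> tensor_space d n"
  then show "\<forall>e. e \<notin> strings d n \<longrightarrow> v e = 0" unfolding tensor_space_def
    by (induction rule: tens.span_induct_alt) (auto simp: ket_def tscale_def split: if_splits)
next
  assume v: "\<forall>e. e \<notin> strings d n \<longrightarrow> v e = 0"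
  have "v = (\<Sum>e\<in>strings d n. tscale (v e) (ket e))"
  proof
    fix f
    have "(\<Sum>e\<in>strings d n. tscale (v e) (ket e)) f = (\<Sum>e\<in>strings d n. if f = e then v e else 0)"
      unfolding sum_apply by (rule sum.cong) (auto simp: tscale_def ket_def)
    then show "v f = (\<Sum>e\<in>strings d n. tscale (v e) (ket e)) f" using v by simp
  qed
  also have "\<dots> \<in> tensor_space d n"
    unfolding tensor_space_def by (intro tens.span_sum tens.span_scale tens.span_base) auto
  finally show "v \<in> tensor_space d n" .
qed

lemma subspace_tensor_space: "tens.subspace (tensor_space d n)"
  by (simp add: tensor_space_def)

lemma tinner_self_eq_0:
  assumes "v \<in> tensor_space d n" "tinner d n v v = 0" shows "v = 0"
proof
  fix e
  have "tnorm d n v = 0" using assms(2) by (simp add: tinner_self)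
  then have "v e = 0" if "e \<in> strings d n" using that by (simp add: tnorm_def L2_set_eq_0_iff)
  then show "v e = 0 e" using assms(1) unfolding tensor_space_iff by (cases "e \<in> strings d n") auto
qed

lemma strings_comp_permutes:
  assumes "\<pi> permutes {..<n}" shows "e \<circ> \<pi> \<in> strings d n \<longleftrightarrow> e \<in> strings d n"
proof -
  have *: "e \<circ> \<pi> \<in> strings d n" if "e \<in> strings d n" "\<pi> permutes {..<n}" for e \<pi>
    using that permutes_in_image[OF that(2)] permutes_not_in[OF that(2)]
    by (auto simp: strings_def PiE_iff extensional_def)
  show ?thesis using *[of e \<pi>] *[of "e \<circ> \<pi>" "pinv \<pi>"] assms permutes_inv[OF assms]
    by (auto simp: comp_assoc permutes_inv_o[OF assms])
qed

lemma perm_op_tensor_space: "\<pi> permutes {..<n} \<Longrightarrow> v \<in> tensor_space d n \<Longrightarrow> perm_op \<pi> v \<in> tensor_space d n"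
  using strings_comp_permutes by (auto simp: tensor_space_iff perm_op_def)

lemma tinner_perm_op:
  assumes p: "\<pi> permutes {..<n}"
  shows "tinner d n (perm_op \<pi> u) (perm_op \<pi> v) = tinner d n u v"
  unfolding tinner_def perm_op_def
  by (rule sum.reindex_bij_witness[where i = "\<lambda>e. e \<circ> pinv \<pi>" and j = "\<lambda>e. e \<circ> \<pi>"])
    (auto simp: comp_assoc permutes_inv_o[OF p] strings_comp_permutes[OF p] strings_comp_permutes[OF permutes_inv[OF p]])

lemma tinner_perm_op_left:
  assumes p: "\<pi> permutes {..<n}"
  shows "tinner d n (perm_op \<pi> u) v = tinner d n u (perm_op (pinv \<pi>) v)"
  using tinner_perm_op[OF p, of d u "perm_op (pinv \<pi>) v"] by (simp add: perm_op_comp permutes_inv_o[OF p])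

subsection \<open>Symmetrization along a colouring\<close>

text \<open>A tableau enters only through its row map or its column map, that is, through a colouring
  \<open>f\<close> of the positions. The flag \<open>b\<close> selects antisymmetrization.\<close>

definition color_group :: "nat \<Rightarrow> (nat \<Rightarrow> nat) \<Rightarrow> (nat \<Rightarrow> nat) set" where
  "color_group n f = {\<pi>. \<pi> permutes {..<n} \<and> (\<forall>x<n. f (\<pi> x) = f x)}"

definition chi :: "bool \<Rightarrow> (nat \<Rightarrow> nat) \<Rightarrow> complex" where
  "chi b \<pi> = (if b then of_int (sign \<pi>) else 1)"

definition color_sum :: "nat \<Rightarrow> bool \<Rightarrow> (nat \<Rightarrow> nat) \<Rightarrow> tens \<Rightarrow> tens" where
  "color_sum n b f v = (\<Sum>\<pi>\<in>color_group n f. tscale (chi b \<pi>) (perm_op \<pi> v))"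

definition color_sym :: "nat \<Rightarrow> bool \<Rightarrow> (nat \<Rightarrow> nat) \<Rightarrow> tens \<Rightarrow> bool" where
  "color_sym n b f v \<longleftrightarrow> (\<forall>\<pi>\<in>color_group n f. perm_op \<pi> v = tscale (chi b \<pi>) v)"

lemma color_group_permutes: "\<pi> \<in> color_group n f \<Longrightarrow> \<pi> permutes {..<n}"
  by (simp add: color_group_def)

lemma color_group_color: "\<pi> \<in> color_group n f \<Longrightarrow> x < n \<Longrightarrow> f (\<pi> x) = f x"
  by (simp add: color_group_def)

lemma finite_color_group [simp]: "finite (color_group n f)"
  unfolding color_group_def by (rule finite_subset[OF _ finite_permutations[of "{..<n}"]]) auto

lemma color_group_id [simp]: "id \<in> color_group n f"
  by (simp add: color_group_def permutes_id)

lemma card_color_group: "card (color_group n f) > 0"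
  using color_group_id[of n f] by (auto simp: card_gt_0_iff simp del: color_group_id)

lemma color_group_comp:
  assumes "\<pi> \<in> color_group n f" "\<sigma> \<in> color_group n f" shows "\<pi> \<circ> \<sigma> \<in> color_group n f"
proof -
  have "f (\<pi> (\<sigma> x)) = f x" if "x < n" for x
    using color_group_color[OF assms(1), of "\<sigma> x"] color_group_color[OF assms(2) that]
      permutes_in_image[OF color_group_permutes[OF assms(2)], of x] that by simp
  then show ?thesis
    using permutes_compose[OF color_group_permutes[OF assms(2)] color_group_permutes[OF assms(1)]]
    by (simp add: color_group_def)
qed

lemma color_group_inv:
  assumes "\<pi> \<in> color_group n f" shows "pinv \<pi> \<in> color_group n f"
proof -
  have p: "\<pi> permutes {..<n}" using assms by (rule color_group_permutes)
  note i = permutes_inv[OF p]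
  have "f (pinv \<pi> x) = f x" if "x < n" for x
    using color_group_color[OF assms, of "pinv \<pi> x"] permutes_in_image[OF i, of x] that permutes_inverses(1)[OF p] by simp
  then show ?thesis using i by (simp add: color_group_def)
qed

lemma permutation_of_permutes: "\<pi> permutes {..<n::nat} \<Longrightarrow> permutation \<pi>"
  using permutation_permutes by blast

lemma chi_comp: "\<pi> permutes {..<n} \<Longrightarrow> \<sigma> permutes {..<n} \<Longrightarrow> chi b (\<pi> \<circ> \<sigma>) = chi b \<pi> * chi b \<sigma>"
  by (simp add: chi_def sign_compose permutation_of_permutes)

lemma chi_inv: "\<pi> permutes {..<n} \<Longrightarrow> chi b (pinv \<pi>) = chi b \<pi>"
  by (simp add: chi_def sign_inverse permutation_of_permutes)

lemma chi_square: "chi b \<pi> * chi b \<pi> = 1"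
  by (simp add: chi_def sign_def)

lemma chi_cnj: "cnj (chi b \<pi>) = chi b \<pi>"
  by (simp add: chi_def)

lemma chi_id [simp]: "chi b id = 1"
  by (simp add: chi_def)

text \<open>The common value of \<open>chi b\<close> at all transpositions of two different
  positions.\<close>

definition csign :: "bool \<Rightarrow> complex" where
  "csign b = (if b then -1 else 1)"

lemma csign_square: "csign b * csign b = 1"
  by (simp add: csign_def)

lemma chi_swap: "x \<noteq> y \<Longrightarrow> chi b (swap x y) = csign b"
  by (simp add: chi_def csign_def sign_swap_id)

lemma swap_conj: "inj g \<Longrightarrow> g \<circ> swap x y = swap (g x) (g y) \<circ> g"
  by (auto simp: fun_eq_iff Transposition.transpose_def inj_eq)

lemma swap_color_group: "x < n \<Longrightarrow> y < n \<Longrightarrow> f x = f y \<Longrightarrow> swap x y \<in> color_group n f"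
  by (simp add: color_group_def permutes_swap_id Transposition.transpose_def)

lemma tlinear_color_sum: "tlinear (color_sum n b f)"
  unfolding color_sum_def[abs_def] by (intro tlinear_sum_fun tlinear_scale_fun tlinear_perm_op)

lemma color_sum_perm:
  assumes "\<pi> \<in> color_group n f"
  shows "color_sum n b f (perm_op \<pi> v) = tscale (chi b \<pi>) (color_sum n b f v)"
    and "perm_op \<pi> (color_sum n b f v) = tscale (chi b \<pi>) (color_sum n b f v)"
proof -
  note p = color_group_permutes[OF assms]
  note i = permutes_inv[OF p]
  have "color_sum n b f (perm_op \<pi> v) = (\<Sum>\<sigma>\<in>color_group n f. tscale (chi b \<pi> * chi b \<sigma>) (perm_op \<sigma> v))"
    unfolding color_sum_def perm_op_comp
  proof (rule sum.reindex_bij_witness[where i = "\<lambda>\<sigma>. \<sigma> \<circ> pinv \<pi>" and j = "\<lambda>\<sigma>. \<sigma> \<circ> \<pi>"])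
    fix \<sigma> assume s: "\<sigma> \<in> color_group n f"
    show "tscale (chi b \<pi> * chi b (\<sigma> \<circ> \<pi>)) (perm_op (\<sigma> \<circ> \<pi>) v) = tscale (chi b \<sigma>) (perm_op (\<sigma> \<circ> \<pi>) v)"
      unfolding chi_comp[OF color_group_permutes[OF s] p] using chi_square[of b \<pi>]
      by (metis (no_types, lifting) mult.assoc mult.commute mult_1_right)
  qed (use assms color_group_comp color_group_inv in \<open>auto simp: comp_assoc permutes_inv_o[OF p]\<close>)
  then show "color_sum n b f (perm_op \<pi> v) = tscale (chi b \<pi>) (color_sum n b f v)"
    by (simp add: color_sum_def tens.scale_sum_right)
  have "perm_op \<pi> (color_sum n b f v) = (\<Sum>\<sigma>\<in>color_group n f. tscale (chi b \<sigma>) (perm_op (\<pi> \<circ> \<sigma>) v))"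
    by (simp add: color_sum_def tlinear_sum[OF tlinear_perm_op] tlinear_scale[OF tlinear_perm_op] perm_op_comp)
  also have "\<dots> = (\<Sum>\<sigma>\<in>color_group n f. tscale (chi b \<pi> * chi b \<sigma>) (perm_op \<sigma> v))"
  proof (rule sum.reindex_bij_witness[where i = "\<lambda>\<sigma>. pinv \<pi> \<circ> \<sigma>" and j = "\<lambda>\<sigma>. \<pi> \<circ> \<sigma>"])
    fix \<sigma> assume s: "\<sigma> \<in> color_group n f"
    show "tscale (chi b \<pi> * chi b (\<pi> \<circ> \<sigma>)) (perm_op (\<pi> \<circ> \<sigma>) v) = tscale (chi b \<sigma>) (perm_op (\<pi> \<circ> \<sigma>) v)"
      unfolding chi_comp[OF p color_group_permutes[OF s]] using chi_square[of b \<pi>]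
      by (metis (no_types, lifting) mult.assoc mult_1)
  qed (use assms color_group_comp color_group_inv in \<open>auto simp: comp_assoc[symmetric] permutes_inv_o[OF p]\<close>)
  finally show "perm_op \<pi> (color_sum n b f v) = tscale (chi b \<pi>) (color_sum n b f v)"
    by (simp add: color_sum_def tens.scale_sum_right)
qed

lemma color_sym_color_sum: "color_sym n b f (color_sum n b f v)"
  by (simp add: color_sym_def color_sum_perm)

lemma color_sum_sym:
  assumes "color_sym n b f v" shows "color_sum n b f v = tscale (of_nat (card (color_group n f))) v"
proof -
  have "color_sum n b f v = (\<Sum>\<pi>\<in>color_group n f. v)"
    unfolding color_sum_def using assms by (intro sum.cong) (auto simp: color_sym_def chi_square)
  then show ?thesis by (simp only: tens.sum_constant_scale)
qed

lemma color_sum_adjoint: "tinner d n (color_sum n b f u) v = tinner d n u (color_sum n b f v)"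
proof -
  have "tinner d n (color_sum n b f u) v = (\<Sum>\<pi>\<in>color_group n f. chi b \<pi> * tinner d n u (perm_op (pinv \<pi>) v))"
    unfolding color_sum_def tinner_sum_left tinner_scale_left chi_cnj
    by (intro sum.cong) (auto simp: tinner_perm_op_left color_group_permutes)
  also have "\<dots> = (\<Sum>\<pi>\<in>color_group n f. chi b \<pi> * tinner d n u (perm_op \<pi> v))"
    by (rule sum.reindex_bij_witness[where i = pinv and j = pinv])
      (auto simp: color_group_inv permutes_inv_inv[OF color_group_permutes] chi_inv[OF color_group_permutes])
  finally show ?thesis by (simp add: color_sum_def tinner_sum_right tinner_scale_right)
qed

text \<open>Conjugation by \<open>g\<close> maps the group of \<open>f \<circ> g\<close> onto the
  group of \<open>f\<close> and keeps signs. Hence a tableau can be moved by a permutation of the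
  vector instead of a renaming of its entries.\<close>

lemma color_sum_conj:
  assumes g: "g permutes {..<n}"
  shows "perm_op g (color_sum n b (f \<circ> g) v) = color_sum n b f (perm_op g v)"
proof -
  note i = permutes_inv[OF g]
  have "perm_op g (color_sum n b (f \<circ> g) v) = (\<Sum>\<pi>\<in>color_group n (f \<circ> g). tscale (chi b \<pi>) (perm_op (g \<circ> \<pi>) v))"
    by (simp add: color_sum_def tlinear_sum[OF tlinear_perm_op] tlinear_scale[OF tlinear_perm_op] perm_op_comp)
  also have "\<dots> = (\<Sum>\<pi>\<in>color_group n f. tscale (chi b \<pi>) (perm_op (\<pi> \<circ> g) v))"
  proof (rule sum.reindex_bij_witness[where i = "\<lambda>\<pi>. pinv g \<circ> \<pi> \<circ> g" and j = "\<lambda>\<pi>. g \<circ> \<pi> \<circ> pinv g"])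
    fix \<pi> assume p: "\<pi> \<in> color_group n (f \<circ> g)"
    note pp = color_group_permutes[OF p]
    show "g \<circ> \<pi> \<circ> pinv g \<in> color_group n f"
      unfolding color_group_def
    proof (intro CollectI conjI allI impI)
      show "g \<circ> \<pi> \<circ> pinv g permutes {..<n}" using g i pp by (intro permutes_compose)
      fix x assume "x < n"
      then have "pinv g x < n" using permutes_in_image[OF i] by auto
      then show "f ((g \<circ> \<pi> \<circ> pinv g) x) = f x"
        using color_group_color[OF p] permutes_inverses(1)[OF g] by simp
    qed
    show "tscale (chi b (g \<circ> \<pi> \<circ> pinv g)) (perm_op (g \<circ> \<pi> \<circ> pinv g \<circ> g) v) = tscale (chi b \<pi>) (perm_op (g \<circ> \<pi>) v)"
      using chi_square[of b g]
      by (simp add: comp_assoc permutes_inv_o[OF g] chi_comp[OF g permutes_compose[OF i pp]] chi_comp[OF pp i] chi_inv[OF g])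
    show "pinv g \<circ> (g \<circ> \<pi> \<circ> pinv g) \<circ> g = \<pi>"
      by (auto simp: fun_eq_iff permutes_inverses[OF g])
  next
    fix \<pi> assume p: "\<pi> \<in> color_group n f"
    note pp = color_group_permutes[OF p]
    show "pinv g \<circ> \<pi> \<circ> g \<in> color_group n (f \<circ> g)"
      unfolding color_group_def
    proof (intro CollectI conjI allI impI)
      show "pinv g \<circ> \<pi> \<circ> g permutes {..<n}" using g i pp by (intro permutes_compose)
      fix x assume "x < n"
      then have "g x < n" using permutes_in_image[OF g] by auto
      then show "(f \<circ> g) ((pinv g \<circ> \<pi> \<circ> g) x) = (f \<circ> g) x"
        using color_group_color[OF p] permutes_inverses(1)[OF g] by simp
    qed
    show "g \<circ> (pinv g \<circ> \<pi> \<circ> g) \<circ> pinv g = \<pi>"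
      by (auto simp: fun_eq_iff permutes_inverses[OF g])
  qed
  finally show ?thesis by (simp add: color_sum_def perm_op_comp)
qed

text \<open>Induction on the number of moved positions: composing with the transposition of
  \<open>x\<close> and its image fixes \<open>x\<close>, stays in the group and moves no new
  position.\<close>

lemma color_sym_transpositions:
  assumes "\<And>x y. x < n \<Longrightarrow> y < n \<Longrightarrow> x \<noteq> y \<Longrightarrow> f x = f y \<Longrightarrow> perm_op (swap x y) v = tscale (csign b) v"
  shows "color_sym n b f v"
  unfolding color_sym_def
proof
  fix \<pi> assume "\<pi> \<in> color_group n f"
  then show "perm_op \<pi> v = tscale (chi b \<pi>) v"
  proof (induction "card {x. \<pi> x \<noteq> x}" arbitrary: \<pi> rule: less_induct)
    case less
    note p = color_group_permutes[OF less.prems]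
    show ?case
    proof (cases "\<pi> = id")
      case False
      then obtain x where x: "\<pi> x \<noteq> x" by (auto simp: fun_eq_iff)
      define y where "y = \<pi> x"
      have xn: "x < n" using x permutes_not_in[OF p] by auto
      have yn: "y < n" using permutes_in_image[OF p, of x] xn by (simp add: y_def)
      have fy: "f x = f y" using color_group_color[OF less.prems xn] by (simp add: y_def)
      define \<rho> where "\<rho> = swap x y \<circ> \<pi>"
      have \<rho>: "\<rho> \<in> color_group n f" unfolding \<rho>_def
        by (intro color_group_comp swap_color_group xn yn fy less.prems)
      have \<pi>: "\<pi> = swap x y \<circ> \<rho>" by (simp add: \<rho>_def fun_eq_iff)
      have sub: "{z. \<rho> z \<noteq> z} \<subseteq> {z. \<pi> z \<noteq> z} - {x}"
      proof
        fix z assume "z \<in> {z. \<rho> z \<noteq> z}"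
        then have z: "\<rho> z \<noteq> z" by simp
        have "\<rho> x = x" by (simp add: \<rho>_def y_def)
        then have "z \<noteq> x" using z by auto
        moreover have "\<pi> z \<noteq> z"
        proof
          assume e: "\<pi> z = z"
          then have "z \<noteq> y" using permutes_inj[OF p] \<open>z \<noteq> x\<close> by (auto simp: y_def inj_def)
          then show False using z e \<open>z \<noteq> x\<close> by (simp add: \<rho>_def Transposition.transpose_def)
        qed
        ultimately show "z \<in> {z. \<pi> z \<noteq> z} - {x}" by simp
      qed
      have fin: "finite {z. \<pi> z \<noteq> z}"
        by (rule finite_subset[of _ "{..<n}"]) (use permutes_not_in[OF p] in auto)
      have "card {z. \<rho> z \<noteq> z} < card {z. \<pi> z \<noteq> z}"
        by (rule psubset_card_mono[OF fin]) (use sub x in blast)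
      from less.hyps[OF this \<rho>] have "perm_op \<rho> v = tscale (chi b \<rho>) v" .
      then have "perm_op \<pi> v = tscale (chi b \<rho> * csign b) v"
        unfolding \<pi> perm_op_comp[symmetric] using assms[OF xn yn _ fy] x
        by (simp add: tlinear_scale[OF tlinear_perm_op] y_def)
      moreover have "chi b \<pi> = chi b (swap x y) * chi b \<rho>"
        unfolding \<pi> by (rule chi_comp) (auto intro!: color_group_permutes \<rho> swap_color_group xn yn fy)
      ultimately show ?thesis using chi_swap[of x y b] x by (simp add: y_def mult.commute)
    qed simp
  qed
qed

text \<open>The transposition of two positions that share both colours negates \<open>v\<close> by
  antisymmetry and is absorbed by the symmetrizer, so the result is its own negative.\<close>

lemma color_sum_collision:
  assumes xy: "x < n" "y < n" "x \<noteq> y" "f x = f y" "h x = h y" and v: "color_sym n True h v"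
  shows "color_sum n False f v = 0"
proof -
  have "perm_op (swap x y) v = tscale (-1) v"
    using v swap_color_group[of x n y h] xy by (simp add: color_sym_def chi_swap csign_def)
  then have "color_sum n False f v = tscale (-1) (color_sum n False f v)"
    using color_sum_perm(1)[OF swap_color_group[of x n y f], of False v] xy
    by (simp only: chi_def tlinear_scale[OF tlinear_color_sum] tens.scale_one if_False)
  then have "color_sum n False f v e = - color_sum n False f v e" for e
    by (metis mult_minus1 tscale_def)
  then show ?thesis by (simp add: fun_eq_iff)
qed


subsection \<open>The content of a colouring\<close>

text \<open>Twice the content of a partition is the value of this function at the row map of its tableau, and
  minus its value at the column map. The sum of all transpositions acts through it.\<close>

definition color_content :: "nat \<Rightarrow> (nat \<Rightarrow> nat) \<Rightarrow> int" where
  "color_content n f = int (card {(x, y). x < n \<and> y < n \<and> x \<noteq> y \<and> f x = f y}) - 2 * (\<Sum>x<n. int (f x))"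

text \<open>By injectivity, \<open>h\<close> separates the positions of one class of
  \<open>f\<close>; every pair is therefore counted once with the smaller value of \<open>h\<close>
  first and once with it second.\<close>

lemma card_pairs:
  fixes f h :: "nat \<Rightarrow> nat"
  assumes inj: "inj_on (\<lambda>x. (f x, h x)) {..<n}"
  shows "card {(x, y). x < n \<and> y < n \<and> x \<noteq> y \<and> f x = f y} = 2 * (\<Sum>x<n. card {y. y < n \<and> f y = f x \<and> h y < h x})"
proof -
  let ?P = "{(x, y). x < n \<and> y < n \<and> f x = f y \<and> h y < h x}" and ?Q = "{(x, y). x < n \<and> y < n \<and> f x = f y \<and> h x < h y}"
  have e: "{(x, y). x < n \<and> y < n \<and> x \<noteq> y \<and> f x = f y} = ?P \<union> ?Q"
  proof -
    have "h x \<noteq> h y" if "x < n" "y < n" "x \<noteq> y" "f x = f y" for x y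
      using inj_onD[OF inj, of x y] that by auto
    then show ?thesis by auto (metis linorder_neqE_nat)
  qed
  have f1: "finite ?P" by (rule finite_subset[of _ "{..<n} \<times> {..<n}"]) auto
  have f2: "finite ?Q" by (rule finite_subset[of _ "{..<n} \<times> {..<n}"]) auto
  have "card ?Q = card ?P"
    by (rule bij_betw_same_card[of prod.swap]) (auto simp: bij_betw_def inj_on_def image_def)
  moreover have "card (?P \<union> ?Q) = card ?P + card ?Q" by (rule card_Un_disjoint[OF f1 f2]) auto
  moreover have "card ?P = (\<Sum>x<n. card {y. y < n \<and> f y = f x \<and> h y < h x})"
  proof -
    have "?P = (SIGMA x:{..<n}. {y. y < n \<and> f y = f x \<and> h y < h x})" by auto
    then show ?thesis by (simp add: card_SigmaI)
  qed
  ultimately show ?thesis by (simp add: e)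
qed

text \<open>Within a class of \<open>f\<close> the values of \<open>h\<close> are distinct, so at
  most \<open>h x\<close> of them lie below \<open>h x\<close>. In the case of equality the position
  \<open>x\<close> itself makes the class strictly larger than \<open>h x\<close>.\<close>

lemma card_below:
  fixes f h :: "nat \<Rightarrow> nat"
  assumes inj: "inj_on (\<lambda>x. (f x, h x)) {..<n}"
  shows "card {y. y < n \<and> f y = f x \<and> h y < h x} \<le> h x"
    and "x < n \<Longrightarrow> card {y. y < n \<and> f y = f x \<and> h y < h x} = h x \<Longrightarrow> h x < card {y. y < n \<and> f y = f x}"
proof -
  let ?A = "{y. y < n \<and> f y = f x \<and> h y < h x}"
  have i: "inj_on h ?A"
  proof (rule inj_onI)
    fix y z assume "y \<in> ?A" "z \<in> ?A" "h y = h z"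
    then show "y = z" using inj_onD[OF inj, of y z] by simp
  qed
  have "card (h ` ?A) \<le> card {..<h x}" by (rule card_mono) auto
  then show "card ?A \<le> h x" by (simp add: card_image[OF i])
  assume x: "x < n" "card ?A = h x"
  have "card ?A < card {y. y < n \<and> f y = f x}"
    by (rule psubset_card_mono) (use x(1) in auto)
  then show "h x < card {y. y < n \<and> f y = f x}" using x by simp
qed

text \<open>With \<open>(f x, h x)\<close> as the cell of \<open>x\<close>, half of the sum of the
  contents is a sum over \<open>x\<close> of two terms: the number of cells to the left of
  \<open>x\<close> in its row minus \<open>h x\<close>, and the number of cells above
  \<open>x\<close> in its column minus \<open>f x\<close>. Both are at most 0. In the case of
  equality all of them vanish, so rows and columns have no gaps and the cells form a
  diagram.\<close>

lemma content_add_le: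
  assumes inj: "inj_on (\<lambda>x. (f x, h x)) {..<n}"
  shows "color_content n f + color_content n h \<le> 0"
    and "color_content n f + color_content n h = 0 \<Longrightarrow> x < n \<Longrightarrow>
      h x < card {y. y < n \<and> f y = f x} \<and> f x < card {y. y < n \<and> h y = h x}"
proof -
  have inj': "inj_on (\<lambda>x. (h x, f x)) {..<n}" using inj by (auto simp: inj_on_def)
  define A where "A = (\<lambda>x. card {y. y < n \<and> f y = f x \<and> h y < h x})"
  define B where "B = (\<lambda>x. card {y. y < n \<and> h y = h x \<and> f y < f x})"
  have AB: "A x \<le> h x" "B x \<le> f x" for x
    unfolding A_def B_def using card_below(1)[OF inj] card_below(1)[OF inj'] by auto
  define D where "D x = (int (A x) - int (h x)) + (int (B x) - int (f x))" for x
  have c: "color_content n f + color_content n h = 2 * (\<Sum>x<n. D x)"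
    unfolding color_content_def card_pairs[OF inj] card_pairs[OF inj'] A_def[symmetric] B_def[symmetric] D_def
    by (simp add: sum.distrib sum_subtractf)
  have le: "D x \<le> 0" for x using AB[of x] by (simp add: D_def)
  have "(\<Sum>x<n. D x) \<le> 0" by (rule sum_nonpos) (rule le)
  then show "color_content n f + color_content n h \<le> 0" unfolding c by linarith
  assume "color_content n f + color_content n h = 0" and x: "x < n"
  then have "(\<Sum>x<n. - D x) = 0" unfolding c sum_negf by simp
  then have "\<forall>x\<in>{..<n}. - D x = 0"
    by (subst (asm) sum_nonneg_eq_0_iff) (use le in auto)
  then have "D x = 0" using x by simp
  then have "A x = h x \<and> B x = f x" using AB[of x] by (simp add: D_def)
  then show "h x < card {y. y < n \<and> f y = f x} \<and> f x < card {y. y < n \<and> h y = h x}"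
    using card_below(2)[OF inj x] card_below(2)[OF inj' x] by (simp add: A_def B_def)
qed

text \<open>Ordered pairs count every transposition twice; this matches
  \<open>color_content\<close>, which is twice a content.\<close>

definition trans_sum :: "nat \<Rightarrow> tens \<Rightarrow> tens" where
  "trans_sum n v = (\<Sum>(x, y)\<in>{(x, y). x < n \<and> y < n \<and> x \<noteq> y}. perm_op (swap x y) v)"

lemma tlinear_trans_sum: "tlinear (trans_sum n)"
  unfolding trans_sum_def[abs_def] by (intro tlinear_sum_fun) (auto intro: tlinear_perm_op)

text \<open>Conjugation by \<open>g\<close> permutes the transpositions, so their sum is
  central.\<close>

lemma trans_sum_perm:
  assumes g: "g permutes {..<n}"
  shows "trans_sum n (perm_op g v) = perm_op g (trans_sum n v)"
proof -
  have "perm_op g (trans_sum n v) = (\<Sum>(x, y)\<in>{(x, y). x < n \<and> y < n \<and> x \<noteq> y}. perm_op (g \<circ> swap x y) v)"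
    unfolding trans_sum_def tlinear_sum[OF tlinear_perm_op] by (intro sum.cong refl) (auto simp: perm_op_comp)
  also have "\<dots> = (\<Sum>(x, y)\<in>{(x, y). x < n \<and> y < n \<and> x \<noteq> y}. perm_op (swap x y \<circ> g) v)"
  proof (rule sum.reindex_bij_witness[where i = "map_prod (pinv g) (pinv g)" and j = "map_prod g g"])
    fix p assume "p \<in> {(x, y). x < n \<and> y < n \<and> x \<noteq> y}"
    then obtain x y where p: "p = (x, y)" "x < n" "y < n" "x \<noteq> y" by auto
    show "map_prod (pinv g) (pinv g) (map_prod g g p) = p" by (simp add: p permutes_inverses[OF g])
    show "map_prod g g p \<in> {(x, y). x < n \<and> y < n \<and> x \<noteq> y}"
      using permutes_in_image[OF g] p permutes_inj[OF g] by (auto simp: inj_eq)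
    show "(case map_prod g g p of (x, y) \<Rightarrow> perm_op (swap x y \<circ> g) v) = (case p of (x, y) \<Rightarrow> perm_op (g \<circ> swap x y) v)"
      by (simp add: p swap_conj[OF permutes_inj[OF g]])
  next
    note i = permutes_inv[OF g]
    fix p assume "p \<in> {(x, y). x < n \<and> y < n \<and> x \<noteq> y}"
    then obtain x y where p: "p = (x, y)" "x < n" "y < n" "x \<noteq> y" by auto
    show "map_prod g g (map_prod (pinv g) (pinv g) p) = p" by (simp add: p permutes_inverses[OF g])
    show "map_prod (pinv g) (pinv g) p \<in> {(x, y). x < n \<and> y < n \<and> x \<noteq> y}"
      using permutes_in_image[OF i] p permutes_inj[OF i] by (auto simp: inj_eq)
  qed
  finally show ?thesis by (simp add: trans_sum_def perm_op_comp)
qed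

text \<open>Among the colourings for which an invariant subspace contains an (anti)symmetric vector, one of
  maximal content has sizes of colour classes that do not increase with the colour, and moving one
  position to a smaller colour raises the content, so that the corresponding Garnir element kills the
  vector. This evaluates the sum of all transpositions.\<close>

lemma exists_content_vector:
  assumes W: "tens.subspace W" and inv: "\<And>g w. g permutes {..<n} \<Longrightarrow> w \<in> W \<Longrightarrow> perm_op g w \<in> W"
    and w0: "w0 \<in> W" "w0 \<noteq> 0"
  obtains f w where "w \<in> W" "w \<noteq> 0" "color_sym n b f w"
    "trans_sum n w = tscale (csign b * of_int (color_content n f)) w"
proof -
  let ?s = "csign b"
  define P where "P f \<longleftrightarrow> f \<in> {..<n} \<rightarrow>\<^sub>E {..<n} \<and> (\<exists>w\<in>W. w \<noteq> 0 \<and> color_sym n b f w)" for f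
  \<comment> \<open>The colouring with all colours different has a trivial group, so every vector
    qualifies and the maximum is taken over a nonempty set.\<close>
  have "P (restrict id {..<n})"
  proof -
    have "color_group n (restrict id {..<n}) \<subseteq> {id}"
    proof
      fix \<pi> assume p: "\<pi> \<in> color_group n (restrict id {..<n})"
      have "\<pi> x = x" for x
        using color_group_color[OF p, of x] permutes_not_in[OF color_group_permutes[OF p], of x]
          permutes_in_image[OF color_group_permutes[OF p], of x] by (cases "x < n") auto
      then show "\<pi> \<in> {id}" by auto
    qed
    then have "color_sym n b (restrict id {..<n}) w0" by (auto simp: color_sym_def)
    then show ?thesis unfolding P_def using w0 by auto
  qed
  moreover have "finite {f. P f}"
    by (rule finite_subset[of _ "{..<n} \<rightarrow>\<^sub>E {..<n}"]) (auto simp: P_def intro: finite_PiE)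
  ultimately have fin: "finite (color_content n ` {f. P f})" "color_content n ` {f. P f} \<noteq> {}" by auto
  obtain f where f: "P f" "color_content n f = Max (color_content n ` {f. P f})" using Max_in[OF fin] by auto
  have mx: "color_content n f' \<le> color_content n f" if "P f'" for f'
    unfolding f(2) by (rule Max_ge[OF fin(1)]) (use that in auto)
  obtain w where w: "w \<in> W" "w \<noteq> 0" "color_sym n b f w" and fP: "f \<in> {..<n} \<rightarrow>\<^sub>E {..<n}" using f(1) by (auto simp: P_def)
  have fn: "f x < n" if "x < n" for x using fP that by auto
  define s where "s c = card {x. x < n \<and> f x = c}" for c
  have sw: "perm_op (swap x y) w = tscale ?s w" if "x < n" "y < n" "x \<noteq> y" "f x = f y" for x y
    using w(3) swap_color_group[of x n y f] that chi_swap[of x y b] by (simp add: color_sym_def)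
  \<comment> \<open>Exchanging the names of two colours changes neither the group nor the number of
    pairs. If the larger colour had the larger class, the exchange would lower the sum of the
    colours and so raise the content.\<close>
  have anti: "s c' \<le> s c" if c: "c < c'" "c' < n" for c c'
  proof (rule ccontr)
    assume less: "\<not> s c' \<le> s c"
    define f' where "f' = restrict (swap c c' \<circ> f) {..<n}"
    have same: "f' x = f' y \<longleftrightarrow> f x = f y" if "x < n" "y < n" for x y
      using that by (simp add: f'_def) (metis transpose_involutory)
    have "f' (\<pi> x) = f' x \<longleftrightarrow> f (\<pi> x) = f x" if "\<pi> permutes {..<n}" "x < n" for \<pi> x
      using same[of "\<pi> x" x] permutes_in_image[OF that(1), of x] that(2) by simp
    then have "color_group n f' = color_group n f"
      by (auto simp: color_group_def)
    moreover have "f' \<in> {..<n} \<rightarrow>\<^sub>E {..<n}"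
      using fn c by (auto simp: f'_def Transposition.transpose_def)
    ultimately have "P f'" using w by (auto simp: P_def color_sym_def)
    have "(\<Sum>x<n. int (f' x)) = (\<Sum>x<n. int (f x) + (if f x = c then int c' - int c else 0) + (if f x = c' then int c - int c' else 0))"
      by (rule sum.cong) (use c in \<open>auto simp: f'_def Transposition.transpose_def\<close>)
    also have "\<dots> = (\<Sum>x<n. int (f x)) + int (s c) * (int c' - int c) + int (s c') * (int c - int c')"
    proof -
      have "(\<Sum>x<n. if f x = k then z else 0) = int (s k) * z" for k and z :: int
      proof -
        have "(\<Sum>x<n. if f x = k then z else 0) = (\<Sum>x\<in>{x \<in> {..<n}. f x = k}. z)"
          by (rule sum.inter_filter[symmetric]) simp
        moreover have "{x \<in> {..<n}. f x = k} = {x. x < n \<and> f x = k}" by auto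
        ultimately show ?thesis by (simp add: s_def)
      qed
      then show ?thesis by (simp only: sum.distrib)
    qed
    also have "\<dots> = (\<Sum>x<n. int (f x)) + (int (s c) - int (s c')) * (int c' - int c)" by (simp add: algebra_simps)
    also have "\<dots> < (\<Sum>x<n. int (f x))" using less c by (simp add: mult_neg_pos)
    finally have "(\<Sum>x<n. int (f' x)) < (\<Sum>x<n. int (f x))" .
    moreover have "{(x, y). x < n \<and> y < n \<and> x \<noteq> y \<and> f' x = f' y} = {(x, y). x < n \<and> y < n \<and> x \<noteq> y \<and> f x = f y}"
      using same by auto
    ultimately have "color_content n f < color_content n f'" by (simp add: color_content_def)
    then show False using mx[OF \<open>P f'\<close>] by simp
  qed
  \<comment> \<open>The vector \<open>z\<close> is \<open>w\<close> (anti)symmetrized further over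
    the class of \<open>c\<close> enlarged by \<open>y\<close>. It belongs to the colouring
    \<open>f'\<close> in which \<open>y\<close> has colour \<open>c\<close>; as \<open>f'\<close>
    has larger content, maximality forces \<open>z = 0\<close>.\<close>
  have garnir: "(\<Sum>x | x < n \<and> f x = c. perm_op (swap x y) w) = tscale (- ?s) w" if y: "y < n" "c < f y" for y c
  proof -
    let ?K = "{x. x < n \<and> f x = c}"
    have ss: "?s * ?s = 1" by (rule csign_square)
    define z where "z = w + tscale ?s (\<Sum>x\<in>?K. perm_op (swap x y) w)"
    define f' where "f' = f(y := c)"
    have zs: "perm_op t z = perm_op t w + tscale ?s (\<Sum>x\<in>?K. perm_op (t \<circ> swap x y) w)" for t
      by (simp add: z_def tlinear_add[OF tlinear_perm_op] tlinear_scale[OF tlinear_perm_op] tlinear_sum[OF tlinear_perm_op] perm_op_comp)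
    have stab: "perm_op (swap u v) z = tscale ?s z"
      if uv: "u < n" "v < n" "u \<noteq> v" "f u = f v" "u \<noteq> y" "v \<noteq> y" for u v
    proof -
      have "(\<Sum>x\<in>?K. perm_op (swap u v \<circ> swap x y) w) = (\<Sum>x\<in>?K. perm_op (swap x y) (perm_op (swap u v) w))"
        unfolding perm_op_comp
      proof (rule sum.reindex_bij_witness[where i = "swap u v" and j = "swap u v"])
        fix x assume "x \<in> ?K"
        then show "swap u v x \<in> ?K" using uv by (auto simp: Transposition.transpose_def)
        have "swap u v y = y" using uv by (simp add: Transposition.transpose_def)
        then have "swap (swap u v x) y \<circ> swap u v = swap u v \<circ> swap x y"
          using swap_conj[of "swap u v" x y] permutes_inj[OF permutes_swap_id[of u UNIV v]] by simp
        then show "perm_op (swap (swap u v x) y \<circ> swap u v) w = perm_op (swap u v \<circ> swap x y) w" by simp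
      qed (use uv in \<open>auto simp: Transposition.transpose_def\<close>)
      then show ?thesis unfolding zs sw[OF uv(1-4)]
        by (simp add: z_def tens.scale_right_distrib tlinear_scale[OF tlinear_perm_op] tens.scale_sum_right)
    qed
    \<comment> \<open>The transposition exchanges \<open>w\<close> with the summand for
      \<open>u\<close>. On the summand of another \<open>x\<close> it can be moved past
      \<open>swap x y\<close>, where it becomes \<open>swap x u\<close> and acts on \<open>w\<close>
      by the sign.\<close>
    have stab': "perm_op (swap u y) z = tscale ?s z" if u: "u \<in> ?K" for u
    proof -
      have uy: "u \<noteq> y" "u < n" "f u = c" using u y by auto
      have fK: "finite ?K" by simp
      have "(\<Sum>x\<in>?K. perm_op (swap u y \<circ> swap x y) w) = w + (\<Sum>x\<in>?K - {u}. perm_op (swap u y \<circ> swap x y) w)"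
        by (subst sum.remove[OF fK u]) (simp add: perm_op_def)
      also have "(\<Sum>x\<in>?K - {u}. perm_op (swap u y \<circ> swap x y) w) = (\<Sum>x\<in>?K - {u}. tscale ?s (perm_op (swap x y) w))"
      proof (rule sum.cong[OF refl])
        fix x assume x: "x \<in> ?K - {u}"
        have "swap u y \<circ> swap x y = swap x y \<circ> swap x u"
          using x uy y by (auto simp: fun_eq_iff Transposition.transpose_def)
        then show "perm_op (swap u y \<circ> swap x y) w = tscale ?s (perm_op (swap x y) w)"
          using sw[of x u] x uy by (simp add: perm_op_comp[symmetric] tlinear_scale[OF tlinear_perm_op])
      qed
      finally have fin: "(\<Sum>x\<in>?K. perm_op (swap u y \<circ> swap x y) w) = w + (\<Sum>x\<in>?K - {u}. tscale ?s (perm_op (swap x y) w))" .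
      have "perm_op (swap u y) z = perm_op (swap u y) w + tscale ?s (w + (\<Sum>x\<in>?K - {u}. tscale ?s (perm_op (swap x y) w)))"
        by (simp only: zs fin)
      also have "\<dots> = tscale ?s w + (perm_op (swap u y) w + (\<Sum>x\<in>?K - {u}. perm_op (swap x y) w))"
        by (simp add: tens.scale_right_distrib tens.scale_sum_right ss)
      also have "perm_op (swap u y) w + (\<Sum>x\<in>?K - {u}. perm_op (swap x y) w) = (\<Sum>x\<in>?K. perm_op (swap x y) w)"
        by (rule sum.remove[OF fK u, symmetric])
      finally have "perm_op (swap u y) z = tscale ?s w + (\<Sum>x\<in>?K. perm_op (swap x y) w)" .
      then show ?thesis by (simp only: z_def tens.scale_right_distrib tens.scale_scale ss tens.scale_one)
    qed
    have "color_sym n b f' z"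
    proof (rule color_sym_transpositions)
      fix u v assume uv: "u < n" "v < n" "u \<noteq> v" "f' u = f' v"
      show "perm_op (swap u v) z = tscale ?s z"
      proof (cases "u = y")
        case True
        then have "v \<in> ?K" using uv by (auto simp: f'_def)
        then show ?thesis using stab' True by (metis transpose_commute)
      next
        case False
        show ?thesis
        proof (cases "v = y")
          case True
          then have "u \<in> ?K" using uv by (auto simp: f'_def)
          then show ?thesis using stab' True by simp
        next
          case F: False
          then show ?thesis using stab[of u v] uv False by (simp add: f'_def)
        qed
      qed
    qed
    moreover have "z \<in> W"
      unfolding z_def using W w(1) y
      by (intro tens.subspace_add tens.subspace_scale tens.subspace_sum inv permutes_swap_id) auto
    moreover have "f' \<in> {..<n} \<rightarrow>\<^sub>E {..<n}"
    proof -
      have "c < n" using y fn[of y] by simp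
      then show ?thesis using fP y by (auto simp: f'_def PiE_iff extensional_def)
    qed
    \<comment> \<open>The number of ordered pairs changes by
      \<open>2 * s c - 2 * s (f y) + 2\<close>, which is at least 2 as class sizes do not increase
      with the colour; twice the sum of the colours drops by \<open>2 * (f y - c)\<close>.\<close>
    moreover have "color_content n f < color_content n f'"
    proof -
      let ?N = "{(u, v). u < n \<and> v < n \<and> u \<noteq> v \<and> u \<noteq> y \<and> v \<noteq> y \<and> f u = f v}"
      have pairs: "card {(u, v). u < n \<and> v < n \<and> u \<noteq> v \<and> g u = g v} = card ?N + 2 * card {x. x < n \<and> x \<noteq> y \<and> g x = g y}"
        if g: "\<And>x. x \<noteq> y \<Longrightarrow> g x = f x" for g
      proof -
        let ?L = "{x. x < n \<and> x \<noteq> y \<and> g x = g y}"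
        have "{(u, v). u < n \<and> v < n \<and> u \<noteq> v \<and> g u = g v} = ?N \<union> (Pair y ` ?L \<union> (\<lambda>x. (x, y)) ` ?L)"
          using g y by (auto simp: image_iff) (metis g)+
        moreover have "finite ?N" by (rule finite_subset[of _ "{..<n} \<times> {..<n}"]) auto
        ultimately have "card {(u, v). u < n \<and> v < n \<and> u \<noteq> v \<and> g u = g v} = card ?N + card (Pair y ` ?L \<union> (\<lambda>x. (x, y)) ` ?L)"
          by (simp only:) (rule card_Un_disjoint, auto)
        also have "card (Pair y ` ?L \<union> (\<lambda>x. (x, y)) ` ?L) = card (Pair y ` ?L) + card ((\<lambda>x. (x, y)) ` ?L)"
          by (rule card_Un_disjoint) auto
        also have "card (Pair y ` ?L) = card ?L" by (rule card_image) (auto simp: inj_on_def)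
        also have "card ((\<lambda>x. (x, y)) ` ?L) = card ?L" by (rule card_image) (auto simp: inj_on_def)
        finally show ?thesis by simp
      qed
      have "{x. x < n \<and> x \<noteq> y \<and> f' x = f' y} = ?K" using y by (auto simp: f'_def)
      then have p': "card {(u, v). u < n \<and> v < n \<and> u \<noteq> v \<and> f' u = f' v} = card ?N + 2 * s c"
        using pairs[of f'] by (simp add: f'_def s_def)
      have "{x. x < n \<and> f x = f y} = insert y {x. x < n \<and> x \<noteq> y \<and> f x = f y}" using y by auto
      then have "s (f y) = Suc (card {x. x < n \<and> x \<noteq> y \<and> f x = f y})" by (simp add: s_def)
      then have p: "card {(u, v). u < n \<and> v < n \<and> u \<noteq> v \<and> f u = f v} + 2 = card ?N + 2 * s (f y)"
        using pairs[of f] by simp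
      have "(\<Sum>x<n. int (f' x)) = int c + (\<Sum>x\<in>{..<n} - {y}. int (f x))"
        using y by (subst sum.remove[of _ y]) (auto simp: f'_def intro!: sum.cong)
      moreover have "(\<Sum>x<n. int (f x)) = int (f y) + (\<Sum>x\<in>{..<n} - {y}. int (f x))"
        using y by (subst sum.remove[of _ y]) auto
      ultimately show ?thesis
        unfolding color_content_def p' using p anti[of c "f y"] y fn[of y] by linarith
    qed
    ultimately have "z = 0" using mx[of f'] unfolding P_def by fastforce
    then have "tscale ?s z = 0" by simp
    then have "tscale ?s w + (\<Sum>x\<in>?K. perm_op (swap x y) w) = 0"
      by (simp add: z_def tens.scale_right_distrib ss)
    then show ?thesis by (simp add: tens.scale_minus_left add_eq_0_iff)
  qed
  \<comment> \<open>Pairs of equal colour contribute the sign each. For pairs of different colours,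
    the vanishing Garnir vectors give minus the sign for each \<open>y\<close> and each colour below
    \<open>f y\<close>, hence \<open>- f y\<close> signs per \<open>y\<close>, and each such pair
    occurs in both orders.\<close>
  have "trans_sum n w = tscale (?s * of_int (color_content n f)) w"
  proof -
    let ?E = "{(x, y). x < n \<and> y < n \<and> x \<noteq> y \<and> f x = f y}" and ?L = "{(x, y). x < n \<and> y < n \<and> f x < f y}"
    let ?G = "{(x, y). x < n \<and> y < n \<and> f y < f x}" and ?p = "\<lambda>(x, y). perm_op (swap x y) w"
    have fE: "finite ?E" "finite ?L" "finite ?G" by (rule finite_subset[of _ "{..<n} \<times> {..<n}"]; auto)+
    have split: "{(x, y). x < n \<and> y < n \<and> x \<noteq> y} = ?E \<union> (?L \<union> ?G)" by auto
    have "trans_sum n w = sum ?p ?E + sum ?p (?L \<union> ?G)"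
      unfolding trans_sum_def split by (rule sum.union_disjoint) (use fE in auto)
    also have "sum ?p (?L \<union> ?G) = sum ?p ?L + sum ?p ?G"
      by (rule sum.union_disjoint) (use fE in auto)
    also have "sum ?p ?G = sum ?p ?L"
      by (rule sum.reindex_bij_witness[where i = prod.swap and j = prod.swap]) (auto simp: transpose_commute)
    also have "sum ?p ?E = (\<Sum>p\<in>?E. tscale ?s w)"
      by (rule sum.cong) (auto simp: sw)
    also have "\<dots> = tscale (of_nat (card ?E)) (tscale ?s w)" by (rule tens.sum_constant_scale)
    also have "sum ?p ?L = (\<Sum>y<n. tscale (of_nat (f y)) (tscale (- ?s) w))"
    proof -
      have "sum ?p ?L = (\<Sum>(y, x)\<in>(SIGMA y:{..<n}. {x. x < n \<and> f x < f y}). perm_op (swap x y) w)"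
        by (rule sum.reindex_bij_witness[where i = prod.swap and j = prod.swap]) auto
      also have "\<dots> = (\<Sum>y<n. \<Sum>x | x < n \<and> f x < f y. perm_op (swap x y) w)"
        by (rule sum.Sigma[symmetric]) auto
      also have "\<dots> = (\<Sum>y<n. tscale (of_nat (f y)) (tscale (- ?s) w))"
      proof (rule sum.cong[OF refl])
        fix y assume y: "y \<in> {..<n}"
        have "(\<Sum>x | x < n \<and> f x < f y. perm_op (swap x y) w)
          = (\<Sum>c<f y. \<Sum>x\<in>{x \<in> {x. x < n \<and> f x < f y}. f x = c}. perm_op (swap x y) w)"
          by (rule sum.group[symmetric]) auto
        also have "\<dots> = (\<Sum>c<f y. tscale (- ?s) w)"
        proof (rule sum.cong[OF refl])
          fix c assume c: "c \<in> {..<f y}"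
          then have "{x \<in> {x. x < n \<and> f x < f y}. f x = c} = {x. x < n \<and> f x = c}" by auto
          then show "(\<Sum>x\<in>{x \<in> {x. x < n \<and> f x < f y}. f x = c}. perm_op (swap x y) w) = tscale (- ?s) w"
            using garnir[of y c] y c by simp
        qed
        also have "\<dots> = tscale (of_nat (card {..<f y})) (tscale (- ?s) w)" by (rule tens.sum_constant_scale)
        finally show "(\<Sum>x | x < n \<and> f x < f y. perm_op (swap x y) w) = tscale (of_nat (f y)) (tscale (- ?s) w)"
          by simp
      qed
      finally show ?thesis .
    qed
    also have "\<dots> = tscale (\<Sum>y<n. of_nat (f y)) (tscale (- ?s) w)" by (rule tens.scale_sum_left[symmetric])
    finally show ?thesis
      by (simp add: fun_eq_iff tscale_def color_content_def algebra_simps)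
  qed
  then show ?thesis using that[OF w] by simp
qed


subsection \<open>Tableaux\<close>

definition col_of :: "nat list \<Rightarrow> nat \<Rightarrow> nat" where
  "col_of lam x = x - sum_list (take (row_of lam x) lam)"

lemma sum_list_take_mono: "i \<le> j \<Longrightarrow> sum_list (take i lam) \<le> sum_list (take j (lam :: nat list))"
  by (metis le_add1 min.absorb2 sum_list_append take_add le_Suc_ex)

lemma sum_list_take_Suc: "i < length lam \<Longrightarrow> sum_list (take (Suc i) lam) = sum_list (take i lam) + (lam ! i :: nat)"
  by (simp add: take_Suc_conv_app_nth)

lemma row_set_unique:
  assumes "x \<in> row_set lam i" "x \<in> row_set lam j" shows "i = j"
  using assms sum_list_take_mono[of "Suc i" j lam] sum_list_take_mono[of "Suc j" i lam]
  by (cases i j rule: linorder_cases) (auto simp: row_set_def)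

lemma row_of_eq: "i < length lam \<Longrightarrow> x \<in> row_set lam i \<Longrightarrow> row_of lam x = i"
  unfolding row_of_def using row_set_unique by (intro the_equality) auto

lemma row_exists:
  assumes "x < sum_list lam" shows "\<exists>i<length lam. x \<in> row_set lam i"
proof -
  define i where "i = (LEAST i. x < sum_list (take i lam))"
  have ex: "x < sum_list (take (length lam) lam)" using assms by simp
  have i: "x < sum_list (take i lam)" unfolding i_def by (rule LeastI[of _ "length lam"]) (rule ex)
  have il: "i \<le> length lam" unfolding i_def by (rule Least_le) (rule ex)
  have "i \<noteq> 0" using i by (cases i) auto
  then obtain j where j: "i = Suc j" using not0_implies_Suc by auto
  have "\<not> x < sum_list (take j lam)" using not_less_Least[of j "\<lambda>i. x < sum_list (take i lam)"] j unfolding i_def by simp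
  then have "x \<in> row_set lam j" using i j by (simp add: row_set_def)
  then show ?thesis using il j by (intro exI[of _ j]) simp
qed

lemma tableau_coords:
  assumes "x < sum_list lam"
  shows "row_of lam x < length lam" "x \<in> row_set lam (row_of lam x)" "col_of lam x < lam ! row_of lam x"
    "x = sum_list (take (row_of lam x) lam) + col_of lam x"
proof -
  obtain i where i: "i < length lam" "x \<in> row_set lam i" using row_exists[OF assms] by auto
  have r: "row_of lam x = i" using row_of_eq[OF i] .
  show "row_of lam x < length lam" "x \<in> row_set lam (row_of lam x)" using i r by auto
  show "col_of lam x < lam ! row_of lam x" "x = sum_list (take (row_of lam x) lam) + col_of lam x"
    using i unfolding col_of_def r row_set_def by (auto simp: sum_list_take_Suc)
qed

lemma tableau_position:
  assumes "i < length lam" "c < lam ! i"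
  shows "sum_list (take i lam) + c < sum_list lam" "row_of lam (sum_list (take i lam) + c) = i"
    "col_of lam (sum_list (take i lam) + c) = c"
proof -
  have "sum_list (take i lam) + c \<in> row_set lam i" using assms by (simp add: row_set_def sum_list_take_Suc)
  then show r: "row_of lam (sum_list (take i lam) + c) = i" using row_of_eq assms by blast
  then show "col_of lam (sum_list (take i lam) + c) = c" by (simp add: col_of_def)
  have "sum_list (take i lam) + c < sum_list (take (Suc i) lam)" using assms by (simp add: sum_list_take_Suc)
  also have "\<dots> \<le> sum_list (take (length lam) lam)" using assms by (intro sum_list_take_mono) simp
  finally show "sum_list (take i lam) + c < sum_list lam" by simp
qed

lemma tableau_inj: "inj_on (\<lambda>x. (row_of lam x, col_of lam x)) {..<sum_list lam}"
  by (rule inj_onI) (metis Pair_inject lessThan_iff tableau_coords(4))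

lemma row_set_iff: "i < length lam \<Longrightarrow> x < sum_list lam \<Longrightarrow> x \<in> row_set lam i \<longleftrightarrow> row_of lam x = i"
  using row_of_eq tableau_coords(2) by blast

lemma row_set_subset: "i < length lam \<Longrightarrow> row_set lam i \<subseteq> {..<sum_list lam}"
  using sum_list_take_mono[of "Suc i" "length lam" lam] by (auto simp: row_set_def)

lemma column_set_iff: "x \<in> column_set lam c \<longleftrightarrow> x < sum_list lam \<and> col_of lam x = c"
proof
  assume "x \<in> column_set lam c"
  then obtain i where "x = sum_list (take i lam) + c" "i < length lam" "c < lam ! i" by (auto simp: column_set_def)
  then show "x < sum_list lam \<and> col_of lam x = c" using tableau_position by auto
next
  assume x: "x < sum_list lam \<and> col_of lam x = c"
  then show "x \<in> column_set lam c"
    using tableau_coords[of x lam] unfolding column_set_def by blast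
qed

lemma row_group_eq: "row_group lam = color_group (sum_list lam) (row_of lam)"
proof (rule Set.set_eqI)
  fix \<pi>
  show "\<pi> \<in> row_group lam \<longleftrightarrow> \<pi> \<in> color_group (sum_list lam) (row_of lam)"
  proof (cases "\<pi> permutes {..<sum_list lam}")
    case p: True
    have "(\<forall>i<length lam. \<pi> ` row_set lam i = row_set lam i) \<longleftrightarrow> (\<forall>x<sum_list lam. row_of lam (\<pi> x) = row_of lam x)"
    proof
      assume a: "\<forall>i<length lam. \<pi> ` row_set lam i = row_set lam i"
      show "\<forall>x<sum_list lam. row_of lam (\<pi> x) = row_of lam x"
        using a tableau_coords(1,2) row_of_eq by blast
    next
      assume a: "\<forall>x<sum_list lam. row_of lam (\<pi> x) = row_of lam x"
      show "\<forall>i<length lam. \<pi> ` row_set lam i = row_set lam i"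
      proof (intro allI impI)
        fix i assume i: "i < length lam"
        have "\<pi> ` row_set lam i \<subseteq> row_set lam i"
        proof
          fix y assume "y \<in> \<pi> ` row_set lam i"
          then obtain x where x: "x \<in> row_set lam i" "y = \<pi> x" by auto
          then have xn: "x < sum_list lam" using row_set_subset[OF i] by auto
          then have "\<pi> x < sum_list lam" using permutes_in_image[OF p, of x] by simp
          then show "y \<in> row_set lam i" using a xn x row_set_iff[OF i] by auto
        qed
        moreover have "finite (row_set lam i)" by (simp add: row_set_def)
        moreover have "inj_on \<pi> (row_set lam i)" using permutes_inj[OF p] by (rule inj_on_subset) simp
        ultimately show "\<pi> ` row_set lam i = row_set lam i" by (intro endo_inj_surj)
      qed
    qed
    then show ?thesis using p by (simp add: row_group_def color_group_def)
  qed (simp add: row_group_def color_group_def)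
qed

lemma column_group_eq: "column_group lam = color_group (sum_list lam) (col_of lam)"
proof (rule Set.set_eqI)
  fix \<pi>
  show "\<pi> \<in> column_group lam \<longleftrightarrow> \<pi> \<in> color_group (sum_list lam) (col_of lam)"
  proof (cases "\<pi> permutes {..<sum_list lam}")
    case p: True
    have "(\<forall>c. \<pi> ` column_set lam c = column_set lam c) \<longleftrightarrow> (\<forall>x<sum_list lam. col_of lam (\<pi> x) = col_of lam x)"
    proof
      assume a: "\<forall>c. \<pi> ` column_set lam c = column_set lam c"
      show "\<forall>x<sum_list lam. col_of lam (\<pi> x) = col_of lam x"
        using a column_set_iff by blast
    next
      assume a: "\<forall>x<sum_list lam. col_of lam (\<pi> x) = col_of lam x"
      show "\<forall>c. \<pi> ` column_set lam c = column_set lam c"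
      proof
        fix c
        have "\<pi> ` column_set lam c \<subseteq> column_set lam c"
          using a permutes_in_image[OF p] by (auto simp: column_set_iff)
        moreover have "finite (column_set lam c)"
          by (rule finite_subset[of _ "{..<sum_list lam}"]) (auto simp: column_set_iff)
        moreover have "inj_on \<pi> (column_set lam c)" using permutes_inj[OF p] by (rule inj_on_subset) simp
        ultimately show "\<pi> ` column_set lam c = column_set lam c" by (intro endo_inj_surj)
      qed
    qed
    then show ?thesis using p by (simp add: column_group_def color_group_def)
  qed (simp add: column_group_def color_group_def)
qed

lemma young_eq: "young lam v = color_sum (sum_list lam) False (row_of lam) (color_sum (sum_list lam) True (col_of lam) v)"
  by (simp add: young_def color_sum_def row_group_eq column_group_eq chi_def)

lemma partition_nth_mono:
  assumes "partition_of d n lam" "i \<le> j" "j < length lam" shows "lam ! j \<le> lam ! i"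
  using assms sorted_wrt_nth_less[of "(\<ge>)" lam i j] by (cases "i = j") (auto simp: partition_of_def)

lemma partition_nth_pos: "partition_of d n lam \<Longrightarrow> i < length lam \<Longrightarrow> 0 < lam ! i"
  by (metis gr0I nth_mem partition_of_def)

lemma partition_sum: "partition_of d n lam \<Longrightarrow> sum_list lam = n"
  by (simp add: partition_of_def)

text \<open>In a tableau the cells to the left of \<open>x\<close> number exactly its column index.
  Rows do not get longer downwards, so all rows above \<open>x\<close> reach its column and the
  cells above number exactly its row index. Both bounds behind \<open>content_add_le\<close> are
  thus attained.\<close>

lemma content_tableau:
  assumes lam: "partition_of d n lam"
  shows "color_content n (row_of lam) + color_content n (col_of lam) = 0"
proof -
  have n: "sum_list lam = n" using lam by (rule partition_sum)
  let ?r = "row_of lam" and ?c = "col_of lam"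
  have inj: "inj_on (\<lambda>x. (?r x, ?c x)) {..<n}" "inj_on (\<lambda>x. (?c x, ?r x)) {..<n}"
    using tableau_inj[of lam] n by (auto simp: inj_on_def)
  have 1: "card {y. y < n \<and> ?r y = ?r x \<and> ?c y < ?c x} = ?c x" if x: "x < n" for x
  proof -
    note tx = tableau_coords[of x lam, unfolded n, OF x]
    let ?g = "\<lambda>c. sum_list (take (?r x) lam) + c"
    have "{y. y < n \<and> ?r y = ?r x \<and> ?c y < ?c x} = ?g ` {..<?c x}"
    proof (intro equalityI subsetI)
      fix y assume "y \<in> {y. y < n \<and> ?r y = ?r x \<and> ?c y < ?c x}"
      then show "y \<in> ?g ` {..<?c x}" using tableau_coords(4)[of y lam] n by (intro image_eqI[of _ _ "?c y"]) auto
    next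
      fix y assume "y \<in> ?g ` {..<?c x}"
      then obtain c where c: "y = ?g c" "c < ?c x" by auto
      then have "c < lam ! ?r x" using tx by linarith
      from tableau_position[OF tx(1) this] show "y \<in> {y. y < n \<and> ?r y = ?r x \<and> ?c y < ?c x}"
        using c n by auto
    qed
    then show ?thesis by (simp add: card_image inj_on_def)
  qed
  have 2: "card {y. y < n \<and> ?c y = ?c x \<and> ?r y < ?r x} = ?r x" if x: "x < n" for x
  proof -
    note tx = tableau_coords[of x lam, unfolded n, OF x]
    let ?g = "\<lambda>i. sum_list (take i lam) + ?c x"
    have pos: "?g i < n" "?r (?g i) = i" "?c (?g i) = ?c x" if "i < ?r x" for i
    proof -
      have "?c x < lam ! i" using partition_nth_mono[OF lam _ tx(1), of i] that tx(3) by linarith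
      moreover have "i < length lam" using that tx(1) by linarith
      ultimately show "?g i < n" "?r (?g i) = i" "?c (?g i) = ?c x" using tableau_position n by auto
    qed
    have "{y. y < n \<and> ?c y = ?c x \<and> ?r y < ?r x} = ?g ` {..<?r x}"
    proof (intro equalityI subsetI)
      fix y assume "y \<in> {y. y < n \<and> ?c y = ?c x \<and> ?r y < ?r x}"
      then show "y \<in> ?g ` {..<?r x}" using tableau_coords(4)[of y lam] n by (intro image_eqI[of _ _ "?r y"]) auto
    next
      fix y assume "y \<in> ?g ` {..<?r x}"
      then show "y \<in> {y. y < n \<and> ?c y = ?c x \<and> ?r y < ?r x}" using pos by auto
    qed
    moreover have "inj_on ?g {..<?r x}" by (rule inj_on_inverseI[of _ ?r]) (use pos in auto)
    ultimately show ?thesis by (simp add: card_image)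
  qed
  show ?thesis
    unfolding color_content_def card_pairs[OF inj(1)] card_pairs[OF inj(2)]
    using 1 2 by simp
qed

lemma content_comp:
  assumes g: "g permutes {..<n}"
  shows "color_content n (f \<circ> g) = color_content n f"
proof -
  note i = permutes_inv[OF g]
  have gi: "g x = g y \<longleftrightarrow> x = y" "g x < n \<longleftrightarrow> x < n" for x y
    using inj_eq[OF permutes_inj[OF g]] permutes_in_image[OF g, of x] by auto
  have ii: "pinv g x = pinv g y \<longleftrightarrow> x = y" "pinv g x < n \<longleftrightarrow> x < n" "g (pinv g x) = x" for x y
    using inj_eq[OF permutes_inj[OF i]] permutes_in_image[OF i, of x] permutes_inverses[OF g] by auto
  have "card {(x, y). x < n \<and> y < n \<and> x \<noteq> y \<and> (f \<circ> g) x = (f \<circ> g) y} = card {(x, y). x < n \<and> y < n \<and> x \<noteq> y \<and> f x = f y}"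
  proof (rule bij_betw_same_card[of "map_prod g g"], rule bij_betw_byWitness[where f' = "map_prod (pinv g) (pinv g)"])
    show "map_prod g g ` {(x, y). x < n \<and> y < n \<and> x \<noteq> y \<and> (f \<circ> g) x = (f \<circ> g) y} \<subseteq> {(x, y). x < n \<and> y < n \<and> x \<noteq> y \<and> f x = f y}"
      using gi by auto
    show "map_prod (pinv g) (pinv g) ` {(x, y). x < n \<and> y < n \<and> x \<noteq> y \<and> f x = f y} \<subseteq> {(x, y). x < n \<and> y < n \<and> x \<noteq> y \<and> (f \<circ> g) x = (f \<circ> g) y}"
      using ii by auto
  qed (auto simp: permutes_inverses[OF g])
  moreover have "(\<Sum>x<n. int ((f \<circ> g) x)) = (\<Sum>x<n. int (f x))"
    using sum.permute[OF g, of "\<lambda>x. int (f x)"] by (simp add: comp_def)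
  ultimately show ?thesis by (simp add: color_content_def)
qed

declare plus_fun_apply [simp del] zero_fun_apply [simp del]

lemma card_color_group_nonzero: "complex_of_nat (card (color_group n f)) \<noteq> 0"
  by (metis card_color_group less_numeral_extra(3) of_nat_eq_0_iff)

text \<open>Equality in the content bound makes \<open>h\<close> smaller than the row length, so
  \<open>(row_of lam x, h x)\<close> is a cell of the diagram; \<open>p\<close> sends
  \<open>x\<close> to the position in this cell.\<close>

lemma exists_row_permutation:
  assumes lam: "partition_of d n lam" and inj: "inj_on (\<lambda>x. (row_of lam x, h x)) {..<n}"
    and c: "color_content n h = color_content n (col_of lam)"
  obtains p where "p \<in> color_group n (row_of lam)" "\<And>x. x < n \<Longrightarrow> col_of lam (p x) = h x"
proof -
  note n = partition_sum[OF lam]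
  define p where "p x = (if x < n then sum_list (take (row_of lam x) lam) + h x else x)" for x
  have "h x < lam ! row_of lam x" if x: "x < n" for x
  proof -
    have "h x < card {y. y < n \<and> row_of lam y = row_of lam x}"
      using content_add_le(2)[OF inj _ x] content_tableau[OF lam] c by simp
    also have "{y. y < n \<and> row_of lam y = row_of lam x} = row_set lam (row_of lam x)"
      using row_set_iff[of "row_of lam x" lam] tableau_coords(1)[of x lam] row_set_subset[of "row_of lam x" lam] x n
      by auto
    also have "card \<dots> = lam ! row_of lam x"
      using tableau_coords(1)[of x lam] x n by (simp add: row_set_def sum_list_take_Suc)
    finally show ?thesis .
  qed
  note pos = tableau_position[OF tableau_coords(1)[of _ lam, unfolded n] this, unfolded n]
  have p: "p x < n" "row_of lam (p x) = row_of lam x" "col_of lam (p x) = h x" if "x < n" for x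
    using pos[OF that that] that by (auto simp: p_def)
  have "inj_on p {..<n}"
    by (rule inj_onI) (use p inj in \<open>metis (mono_tags, lifting) inj_onD lessThan_iff\<close>)
  then have "p permutes {..<n}"
    using p(1) by (intro bij_imp_permutes bij_betw_imageI endo_inj_surj) (auto simp: p_def)
  then show ?thesis using that[of p] p by (auto simp: color_group_def)
qed

lemma color_sym_conj:
  assumes g: "g permutes {..<n}" and v: "color_sym n b h v"
  shows "color_sym n b (h \<circ> pinv g) (perm_op g v)"
proof -
  define k where "k = complex_of_nat (card (color_group n h))"
  have k: "k \<noteq> 0" unfolding k_def by (rule card_color_group_nonzero)
  have e: "(h \<circ> pinv g) \<circ> g = h" by (simp add: comp_assoc permutes_inv_o[OF g])
  have "color_sum n b (h \<circ> pinv g) (perm_op g v) = perm_op g (tscale k v)"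
    using color_sum_conj[OF g, of b "h \<circ> pinv g" v] color_sum_sym[OF v] unfolding e k_def by simp
  then have "perm_op g v = tscale (1 / k) (color_sum n b (h \<circ> pinv g) (perm_op g v))"
    using k by (simp add: tlinear_scale[OF tlinear_perm_op])
  also have "\<dots> = color_sum n b (h \<circ> pinv g) (tscale (1 / k) (perm_op g v))"
    by (simp add: tlinear_scale[OF tlinear_color_sum])
  finally show ?thesis using color_sym_color_sum by metis
qed

text \<open>The lemma of von Neumann behind the theory of Young symmetrizers.\<close>

lemma young_no_collision:
  assumes g: "g permutes {..<n}"
    and nz: "color_sum n False f (perm_op g (color_sum n True h v)) \<noteq> 0"
  shows "inj_on (\<lambda>x. (f x, (h \<circ> pinv g) x)) {..<n}"
proof (rule inj_onI, rule ccontr)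
  fix x y assume "x \<in> {..<n}" "y \<in> {..<n}" "(f x, (h \<circ> pinv g) x) = (f y, (h \<circ> pinv g) y)" "x \<noteq> y"
  then show False
    using color_sum_collision[of x n y f "h \<circ> pinv g", OF _ _ _ _ _ color_sym_conj[OF g color_sym_color_sum]] nz by auto
qed

text \<open>If the product does not vanish identically, there is no collision and the contents are
  opposite, so some row permutation \<open>p\<close> makes \<open>q = p \<circ> g\<close> a column
  permutation. Thus \<open>g\<close> is the inverse of \<open>p\<close> after \<open>q\<close>: the
  symmetrizer absorbs the first, the antisymmetrizer turns the second into its sign.\<close>

lemma young_scalar:
  assumes lam: "partition_of d n lam" and g: "g permutes {..<n}"
  shows "\<exists>c. \<forall>v. color_sum n False (row_of lam) (perm_op g (color_sum n True (col_of lam) v)) = tscale c (young lam v)"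
proof (cases "\<forall>v. color_sum n False (row_of lam) (perm_op g (color_sum n True (col_of lam) v)) = 0")
  case True then show ?thesis by (intro exI[of _ 0]) simp
next
  case False
  let ?r = "row_of lam" and ?c = "col_of lam"
  note n = partition_sum[OF lam]
  have "inj_on (\<lambda>x. (?r x, (?c \<circ> pinv g) x)) {..<n}" using False young_no_collision[OF g] by blast
  then obtain p where p: "p \<in> color_group n ?r" "\<And>x. x < n \<Longrightarrow> ?c (p x) = (?c \<circ> pinv g) x"
    using exists_row_permutation[OF lam _ content_comp[OF permutes_inv[OF g]]] by blast
  note pp = color_group_permutes[OF p(1)]
  define q where "q = p \<circ> g"
  have q: "q \<in> color_group n ?c"
    unfolding color_group_def
  proof (intro CollectI conjI allI impI)
    show "q permutes {..<n}" unfolding q_def by (rule permutes_compose[OF g pp])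
    fix x assume "x < n"
    then have "g x < n" using permutes_in_image[OF g, of x] by simp
    then show "?c (q x) = ?c x" using p(2) by (simp add: q_def permutes_inverses[OF g])
  qed
  have "pinv p \<circ> q = g" by (simp add: q_def comp_assoc[symmetric] permutes_inv_o[OF pp])
  then have "perm_op g (color_sum n True ?c v) = perm_op (pinv p) (tscale (chi True q) (color_sum n True ?c v))" for v
    using color_sum_perm(2)[OF q] by (metis perm_op_comp)
  then have "color_sum n False ?r (perm_op g (color_sum n True ?c v)) = tscale (chi True q) (young lam v)" for v
    using color_sum_perm(1)[OF color_group_inv[OF p(1)], of False]
    by (simp add: young_eq n tlinear_scale[OF tlinear_color_sum] chi_def)
  then show ?thesis by blast
qed

section \<open>Comparison of two partitions and inner products on the spaces
  \<open>Q_space\<close>\<close>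

definition diagram :: "nat list \<Rightarrow> (nat \<times> nat) set" where
  "diagram lam = {(i, c). i < length lam \<and> c < lam ! i}"

lemma diagram_eq: "diagram lam = (\<lambda>x. (row_of lam x, col_of lam x)) ` {..<sum_list lam}"
proof (intro equalityI subsetI)
  fix p assume "p \<in> diagram lam"
  then obtain i c where p: "p = (i, c)" "i < length lam" "c < lam ! i" by (auto simp: diagram_def)
  show "p \<in> (\<lambda>x. (row_of lam x, col_of lam x)) ` {..<sum_list lam}"
    using tableau_position[OF p(2,3)] p(1) by (intro image_eqI[of _ _ "sum_list (take i lam) + c"]) auto
qed (auto simp: diagram_def tableau_coords)

lemma card_diagram: "card (diagram lam) = sum_list lam" and finite_diagram: "finite (diagram lam)"
  unfolding diagram_eq by (simp_all add: card_image[OF tableau_inj])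

lemma diagram_inj:
  assumes lam: "partition_of d n lam" "partition_of d' n' mu" and e: "diagram lam = diagram mu"
  shows "lam = mu"
proof -
  have iff: "(i < length lam \<and> c < lam ! i) \<longleftrightarrow> (i < length mu \<and> c < mu ! i)" for i c
    using e by (auto simp: diagram_def set_eq_iff)
  have len: "i < length lam \<longleftrightarrow> i < length mu" for i
    using iff[of i 0] partition_nth_pos[OF lam(1)] partition_nth_pos[OF lam(2)] by blast
  then have "length lam = length mu" by (metis linorder_neqE_nat less_irrefl)
  then show ?thesis
  proof (rule nth_equalityI)
    fix i assume "i < length lam"
    then have "c < lam ! i \<longleftrightarrow> c < mu ! i" for c using iff[of i c] len by auto
    then show "lam ! i = mu ! i" by (metis linorder_neqE_nat less_irrefl)
  qed
qed

text \<open>If the cell were missing, only rows above \<open>i\<close> would reach column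
  \<open>c\<close>, because lengths do not increase; the entries of a column lie in different rows,
  so there would be at most \<open>i\<close> of them.\<close>

lemma column_height:
  assumes mu: "partition_of d n mu" and i: "i < card {y. y < n \<and> col_of mu y = c}"
  shows "(i, c) \<in> diagram mu"
proof (rule ccontr)
  assume not: "(i, c) \<notin> diagram mu"
  note n = partition_sum[OF mu]
  let ?S = "{y. y < n \<and> col_of mu y = c}"
  have "row_of mu ` ?S \<subseteq> {..<i}"
  proof
    fix r assume "r \<in> row_of mu ` ?S"
    then obtain y where y: "y < n" "col_of mu y = c" "r = row_of mu y" by auto
    have "r < length mu" "c < mu ! r" using tableau_coords[of y mu] y n by auto
    then have "r < i" using not partition_nth_mono[OF mu, of i r] unfolding diagram_def
      by (cases "r < i") auto
    then show "r \<in> {..<i}" by simp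
  qed
  moreover have "inj_on (row_of mu) ?S"
    using tableau_inj[of mu] n by (auto simp: inj_on_def)
  ultimately have "card ?S \<le> i"
    using card_mono[of "{..<i}" "row_of mu ` ?S"] by (simp add: card_image)
  then show False using i by simp
qed

text \<open>Two nonvanishing products give two collision-free pairs of colourings, and the content
  bound then compares the contents of \<open>lam\<close> and \<open>mu\<close> in both directions.
  They agree, the bound is attained, and one set of \<open>n\<close> cells is the diagram of both
  partitions.\<close>

lemma young_cross:
  assumes lam: "partition_of d n lam" and mu: "partition_of d' n mu" and ne: "lam \<noteq> mu"
  shows "(\<forall>g v. g permutes {..<n} \<longrightarrow> color_sum n False (row_of lam) (perm_op g (color_sum n True (col_of mu) v)) = 0) \<or>
    (\<forall>g v. g permutes {..<n} \<longrightarrow> color_sum n False (row_of mu) (perm_op g (color_sum n True (col_of lam) v)) = 0)"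
proof (rule ccontr)
  assume "\<not> ?thesis"
  then obtain g v g' v' where g: "g permutes {..<n}" "color_sum n False (row_of lam) (perm_op g (color_sum n True (col_of mu) v)) \<noteq> 0"
    and g': "g' permutes {..<n}" "color_sum n False (row_of mu) (perm_op g' (color_sum n True (col_of lam) v')) \<noteq> 0"
    by blast
  note n = partition_sum[OF lam] partition_sum[OF mu]
  let ?h = "col_of mu \<circ> pinv g"
  have inj: "inj_on (\<lambda>x. (row_of lam x, ?h x)) {..<n}" by (rule young_no_collision[OF g])
  have inj': "inj_on (\<lambda>x. (row_of mu x, (col_of lam \<circ> pinv g') x)) {..<n}" by (rule young_no_collision[OF g'])
  have zero: "color_content n (row_of lam) + color_content n ?h = 0"
    using content_add_le(1)[OF inj] content_add_le(1)[OF inj']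
    unfolding content_comp[OF permutes_inv[OF g(1)]] content_comp[OF permutes_inv[OF g'(1)]]
    using content_tableau[OF lam] content_tableau[OF mu] by linarith
  have gn: "g y < n \<longleftrightarrow> y < n" "pinv g y < n \<longleftrightarrow> y < n" for y
    using permutes_in_image[OF g(1), of y] permutes_in_image[OF permutes_inv[OF g(1)], of y] by auto
  have *: "(row_of lam x, ?h x) \<in> diagram lam" "(row_of lam x, ?h x) \<in> diagram mu" if x: "x < n" for x
  proof -
    note le = content_add_le(2)[OF inj zero x]
    have "{y. y < n \<and> row_of lam y = row_of lam x} = row_set lam (row_of lam x)"
      using row_set_iff[of "row_of lam x" lam] tableau_coords(1)[of x lam] row_set_subset[of "row_of lam x" lam] x n(1)
      by auto
    then have "?h x < lam ! row_of lam x"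
      using le tableau_coords(1)[of x lam] x n(1) by (simp add: row_set_def sum_list_take_Suc)
    then show "(row_of lam x, ?h x) \<in> diagram lam" using tableau_coords(1)[of x lam] x n(1) by (simp add: diagram_def)
    have "card {y. y < n \<and> ?h y = ?h x} = card {y. y < n \<and> col_of mu y = ?h x}"
    proof (rule bij_betw_same_card[of "pinv g"], rule bij_betw_byWitness[where f' = g])
      show "pinv g ` {y. y < n \<and> ?h y = ?h x} \<subseteq> {y. y < n \<and> col_of mu y = ?h x}"
        using gn by auto
      show "g ` {y. y < n \<and> col_of mu y = ?h x} \<subseteq> {y. y < n \<and> ?h y = ?h x}"
        by (intro subsetI, elim imageE) (simp add: gn permutes_inverses[OF g(1)])
    qed (intro ballI, rule permutes_inverses[OF g(1)])+
    then have "row_of lam x < card {y. y < n \<and> col_of mu y = ?h x}" using conjunct2[OF le] by (simp only:)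
    then show "(row_of lam x, ?h x) \<in> diagram mu" by (rule column_height[OF mu])
  qed
  let ?I = "(\<lambda>x. (row_of lam x, ?h x)) ` {..<n}"
  have cI: "card ?I = n" by (simp only: card_image[OF inj] card_lessThan)
  have "?I = diagram lam"
    by (rule card_subset_eq[OF finite_diagram]) (use * cI card_diagram[of lam] n in auto)
  moreover have "?I = diagram mu"
    by (rule card_subset_eq[OF finite_diagram]) (use * cI card_diagram[of mu] n in auto)
  ultimately show False using diagram_inj[OF lam mu] ne by simp
qed

lemma Q_space_row_sym:
  assumes "partition_of d n lam" "x \<in> Q_space d n lam"
  shows "color_sym n False (row_of lam) x"
  using assms by (auto simp: Q_space_def young_eq partition_sum color_sym_color_sum)

text \<open>Since \<open>x\<close> is a multiple of its own row symmetrization and the symmetrizer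
  is self-adjoint, it can be applied to the other argument. This brings inner products into the
  shape treated by \<open>young_scalar\<close> and \<open>young_cross\<close>.\<close>

lemma Q_inner_symmetrize:
  assumes lam: "partition_of d n lam" and x: "x \<in> Q_space d n lam"
  shows "tinner d n x (perm_op g (color_sum n False f v)) =
    (\<Sum>p\<in>color_group n f. tinner d n x (color_sum n False (row_of lam) (perm_op (g \<circ> p) v))) / of_nat (card (color_group n (row_of lam)))"
proof -
  let ?r = "row_of lam"
  define k where "k = complex_of_nat (card (color_group n ?r))"
  have k: "k \<noteq> 0" unfolding k_def by (rule card_color_group_nonzero)
  have "k * tinner d n x z = tinner d n x (color_sum n False ?r z)" for z
    using color_sum_sym[OF Q_space_row_sym[OF lam x]] color_sum_adjoint[of d n False ?r x z]
    by (simp add: k_def tinner_scale_left)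
  then have e: "tinner d n x z = tinner d n x (color_sum n False ?r z) / k" for z
    using k by (simp add: field_simps)
  have "perm_op g (color_sum n False f v) = (\<Sum>p\<in>color_group n f. perm_op (g \<circ> p) v)"
    by (simp add: color_sum_def tlinear_sum[OF tlinear_perm_op] chi_def perm_op_comp)
  then show ?thesis
    by (subst e) (simp add: tlinear_sum[OF tlinear_color_sum] tinner_sum_right k_def)
qed

text \<open>The substitute for Schur's lemma: every term of the symmetrized inner product reduces by
  \<open>young_scalar\<close> to a multiple of \<open>young lam v\<close>, with a factor that
  depends on the permutation only.\<close>

lemma Q_inner_scalar:
  assumes lam: "partition_of d n lam" and g: "g permutes {..<n}"
  shows "\<exists>c. \<forall>x\<in>Q_space d n lam. \<forall>y\<in>Q_space d n lam. tinner d n x (perm_op g y) = c * tinner d n x y"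
proof -
  let ?r = "row_of lam" and ?c = "col_of lam"
  note n = partition_sum[OF lam]
  have "\<exists>c. \<forall>p\<in>color_group n ?r. \<forall>v. color_sum n False ?r (perm_op (g \<circ> p) (color_sum n True ?c v)) = tscale (c p) (young lam v)"
    by (rule bchoice) (rule ballI, rule young_scalar[OF lam permutes_compose[OF color_group_permutes g]])
  then obtain c where c: "\<And>p v. p \<in> color_group n ?r \<Longrightarrow> color_sum n False ?r (perm_op (g \<circ> p) (color_sum n True ?c v)) = tscale (c p) (young lam v)"
    by blast
  show ?thesis
  proof (intro exI ballI)
    fix x y assume x: "x \<in> Q_space d n lam" and y: "y \<in> Q_space d n lam"
    obtain u where u: "y = young lam u" using y by (auto simp: Q_space_def)
    have "tinner d n x (perm_op g y) = (\<Sum>p\<in>color_group n ?r. c p * tinner d n x y) / of_nat (card (color_group n ?r))"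
      unfolding u by (subst young_eq) (simp add: n Q_inner_symmetrize[OF lam x] c tinner_scale_right)
    then show "tinner d n x (perm_op g y) = ((\<Sum>p\<in>color_group n ?r. c p) / of_nat (card (color_group n ?r))) * tinner d n x y"
      by (simp add: sum_distrib_right)
  qed
qed

lemma Q_inner_orthogonal:
  assumes lam: "partition_of d n lam" and mu: "partition_of d n mu" and ne: "lam \<noteq> mu" and g: "g permutes {..<n}"
    and x: "x \<in> Q_space d n lam" and y: "y \<in> Q_space d n mu"
  shows "tinner d n x (perm_op g y) = 0"
proof -
  have *: "tinner d n x (perm_op g y) = 0"
    if z: "\<forall>g v. g permutes {..<n} \<longrightarrow> color_sum n False (row_of lam) (perm_op g (color_sum n True (col_of mu) v)) = 0"
      and lam: "partition_of d n lam" and mu: "partition_of d n mu"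
      and x: "x \<in> Q_space d n lam" and y: "y \<in> Q_space d n mu" and g: "g permutes {..<n}" for lam mu x y g
  proof -
    obtain u where u: "y = young mu u" using y by (auto simp: Q_space_def)
    have "color_sum n False (row_of lam) (perm_op (g \<circ> p) (color_sum n True (col_of mu) u)) = 0"
      if p: "p \<in> color_group n (row_of mu)" for p
      using z permutes_compose[OF color_group_permutes[OF p] g] by blast
    then show ?thesis
      unfolding u young_eq partition_sum[OF mu] Q_inner_symmetrize[OF lam x] by simp
  qed
  from young_cross[OF lam mu ne] show ?thesis
  proof
    assume "\<forall>g v. g permutes {..<n} \<longrightarrow> color_sum n False (row_of lam) (perm_op g (color_sum n True (col_of mu) v)) = 0"
    from *[OF this lam mu x y g] show ?thesis .
  next
    assume "\<forall>g v. g permutes {..<n} \<longrightarrow> color_sum n False (row_of mu) (perm_op g (color_sum n True (col_of lam) v)) = 0"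
    \<comment> \<open>Here the product with the roles of the partitions exchanged vanishes, so the
      arguments are exchanged by conjugation and the permutation changes sides as its
      inverse.\<close>
    from *[OF this mu lam y x permutes_inv[OF g]] have "tinner d n (perm_op g y) x = 0"
      by (simp add: tinner_perm_op_left[OF g])
    then show ?thesis using tinner_commute[of d n x "perm_op g y"] by simp
  qed
qed


subsection \<open>Completeness\<close>

lemma subspace_perm_span: "tens.subspace (perm_span n w)"
  by (simp add: perm_span_def)

lemma perm_span_base: "g permutes {..<n} \<Longrightarrow> perm_op g w \<in> perm_span n w"
  by (auto simp: perm_span_def intro: tens.span_base)

lemma perm_span_induct [consumes 1, case_names zero step]:
  assumes "v \<in> perm_span n w" "P 0"
    "\<And>c g v. g permutes {..<n} \<Longrightarrow> P v \<Longrightarrow> P (tscale c (perm_op g w) + v)"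
  shows "P v"
  using assms(1) unfolding perm_span_def by (induction rule: tens.span_induct_alt) (use assms(2,3) in auto)

lemma perm_span_perm_op:
  assumes "v \<in> perm_span n w" "g permutes {..<n}" shows "perm_op g v \<in> perm_span n w"
  using assms(1)
proof (induction rule: perm_span_induct)
  case zero
  show ?case using tens.subspace_0[OF subspace_perm_span] by (simp add: tlinear_zero[OF tlinear_perm_op])
next
  case (step c h v)
  then show ?case
    unfolding tlinear_add[OF tlinear_perm_op] tlinear_scale[OF tlinear_perm_op] perm_op_comp
    by (intro tens.subspace_add tens.subspace_scale subspace_perm_span perm_span_base permutes_compose assms(2))
qed

lemma color_sum_mem:
  assumes "tens.subspace W" "\<And>g w. g permutes {..<n} \<Longrightarrow> w \<in> W \<Longrightarrow> perm_op g w \<in> W" "w \<in> W"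
  shows "color_sum n b f w \<in> W"
  unfolding color_sum_def using assms color_group_permutes
  by (intro tens.subspace_sum tens.subspace_scale) auto

lemma color_sum_cong:
  assumes "\<And>x. x < n \<Longrightarrow> f x = f' x" shows "color_sum n b f = color_sum n b f'"
proof -
  have "f (\<pi> x) = f' (\<pi> x)" if "\<pi> permutes {..<n}" "x < n" for \<pi> x
    using assms permutes_in_image[OF that(1), of x] that(2) by simp
  then have "color_group n f = color_group n f'" using assms by (auto simp: color_group_def)
  then show ?thesis by (simp add: color_sum_def fun_eq_iff)
qed

text \<open>The first column is longer than the number of symbols, so two of its positions carry the
  same symbol. Their transposition fixes the basis vector but has sign -1 under the
  antisymmetrizer.\<close>

lemma color_sum_column_ket:
  assumes lam: "partition_of d n lam" and few: "card (e ` {..<n}) < length lam"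
  shows "color_sum n True (col_of lam) (ket e) = 0"
proof -
  note n = partition_sum[OF lam]
  let ?off = "\<lambda>i. sum_list (take i lam) + 0"
  have pos: "?off i < n" "row_of lam (?off i) = i" "col_of lam (?off i) = 0" if "i < length lam" for i
    using tableau_position[OF that partition_nth_pos[OF lam that]] n by auto
  have "(\<lambda>i. e (?off i)) ` {..<length lam} \<subseteq> e ` {..<n}" using pos(1) by auto
  then have "card ((\<lambda>i. e (?off i)) ` {..<length lam}) < card {..<length lam}"
    using few card_mono[of "e ` {..<n}" "(\<lambda>i. e (?off i)) ` {..<length lam}"] by simp
  then have "\<not> inj_on (\<lambda>i. e (?off i)) {..<length lam}" by (rule pigeonhole)
  then obtain i j where ij: "i < length lam" "j < length lam" "i \<noteq> j" "e (?off i) = e (?off j)"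
    by (auto simp: inj_on_def)
  define x y where "x = ?off i" and "y = ?off j"
  have xy: "x < n" "y < n" "x \<noteq> y" "e x = e y" "col_of lam x = col_of lam y"
    using pos[OF ij(1)] pos[OF ij(2)] ij unfolding x_def y_def by auto
  have "ket e (f \<circ> swap x y) = ket e f" for f
  proof -
    have e': "e \<circ> swap x y = e" using xy(4) by (auto simp: fun_eq_iff Transposition.transpose_def)
    have "f \<circ> swap x y = e \<longleftrightarrow> f = e"
    proof
      assume a: "f \<circ> swap x y = e"
      have "f = (f \<circ> swap x y) \<circ> swap x y" by (simp add: comp_assoc)
      then show "f = e" using e' a by simp
    qed (use e' in simp)
    then show ?thesis by (simp add: ket_def)
  qed
  then have "perm_op (swap x y) (ket e) = ket e" by (simp add: perm_op_def fun_eq_iff)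
  then have "color_sum n True (col_of lam) (ket e) = tscale (csign True) (color_sum n True (col_of lam) (ket e))"
    using color_sum_perm(1)[OF swap_color_group[OF xy(1,2,5)], of True "ket e"] chi_swap[OF xy(3)] by simp
  then have "color_sum n True (col_of lam) (ket e) f = - color_sum n True (col_of lam) (ket e) f" for f
    by (metis csign_def mult_minus1 tscale_def)
  then show ?thesis by (simp add: fun_eq_iff zero_fun_apply)
qed

lemma young_length_le:
  assumes lam: "partition_of d' n lam" and v: "v \<in> tensor_space d n" and nz: "young lam v \<noteq> 0"
  shows "length lam \<le> d"
proof (rule ccontr)
  assume "\<not> length lam \<le> d"
  have "color_sum n True (col_of lam) v = 0"
    using v unfolding tensor_space_def
  proof (induction rule: tens.span_induct_alt)
    case base show ?case by (rule tlinear_zero[OF tlinear_color_sum])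
  next
    case (step c x y)
    then obtain e where e: "x = ket e" "e \<in> strings d n" by auto
    have "e ` {..<n} \<subseteq> {..<d}" using e by (auto simp: strings_def)
    then have "card (e ` {..<n}) \<le> card {..<d}" by (intro card_mono) auto
    then have "color_sum n True (col_of lam) x = 0"
      unfolding e(1) using \<open>\<not> length lam \<le> d\<close> by (intro color_sum_column_ket[OF lam]) simp
    then show ?case using step by (simp add: tlinear_add[OF tlinear_color_sum] tlinear_scale[OF tlinear_color_sum])
  qed
  then have "young lam v = 0"
    by (simp add: young_eq partition_sum[OF lam] tlinear_zero[OF tlinear_color_sum])
  then show False using nz by simp
qed

text \<open>In the equality case every row and every column is an initial segment, so the row sizes
  \<open>s\<close> and the column sizes \<open>k\<close> are conjugate to each other. Monotonicity
  of \<open>s\<close> follows from this conjugacy, and \<open>k 0\<close> counts the nonempty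
  rows.\<close>

lemma exists_partition:
  assumes inj: "inj_on (\<lambda>x. (f x, h x)) {..<n}" and c: "color_content n f + color_content n h = 0"
  obtains lam p where "partition_of n n lam" "p permutes {..<n}"
    "\<And>x. x < n \<Longrightarrow> row_of lam (p x) = f x" "\<And>x. x < n \<Longrightarrow> col_of lam (p x) = h x"
proof -
  define s where "s i = card {y. y < n \<and> f y = i}" for i
  define k where "k c = card {y. y < n \<and> h y = c}" for c
  have le: "h x < s (f x)" "f x < k (h x)" if "x < n" for x
    using content_add_le(2)[OF inj c that] by (auto simp: s_def k_def)
  have imf: "h ` {y. y < n \<and> f y = i} = {..<s i}" for i
  proof (rule card_subset_eq)
    show "h ` {y. y < n \<and> f y = i} \<subseteq> {..<s i}" using le by auto
    have "inj_on h {y. y < n \<and> f y = i}" using inj by (auto simp: inj_on_def)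
    then show "card (h ` {y. y < n \<and> f y = i}) = card {..<s i}" by (simp add: card_image s_def)
  qed simp
  have imh: "f ` {y. y < n \<and> h y = c} = {..<k c}" for c
  proof (rule card_subset_eq)
    show "f ` {y. y < n \<and> h y = c} \<subseteq> {..<k c}" using le by auto
    have "inj_on f {y. y < n \<and> h y = c}" using inj by (auto simp: inj_on_def)
    then show "card (f ` {y. y < n \<and> h y = c}) = card {..<k c}" by (simp add: card_image k_def)
  qed simp
  have iff: "c < s i \<longleftrightarrow> i < k c" for i c
  proof -
    have "c < s i \<longleftrightarrow> c \<in> h ` {y. y < n \<and> f y = i}" unfolding imf by simp
    also have "\<dots> \<longleftrightarrow> (\<exists>y<n. f y = i \<and> h y = c)" by auto
    finally have "c < s i \<longleftrightarrow> (\<exists>y<n. f y = i \<and> h y = c)" .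
    moreover have "i < k c \<longleftrightarrow> i \<in> f ` {y. y < n \<and> h y = c}" unfolding imh by simp
    moreover have "\<dots> \<longleftrightarrow> (\<exists>y<n. f y = i \<and> h y = c)" by auto
    ultimately show ?thesis by simp
  qed
  have anti: "s j \<le> s i" if "i \<le> j" for i j
    using iff that by (metis le_less_trans linorder_not_le less_irrefl)
  define lam where "lam = map s [0..<k 0]"
  have len: "length lam = k 0" and nth: "\<And>i. i < k 0 \<Longrightarrow> lam ! i = s i" by (simp_all add: lam_def)
  have fk: "f x < k 0" if "x < n" for x using le(1)[OF that] iff[of 0 "f x"] by simp
  have sum: "sum_list lam = n"
  proof -
    have "sum_list lam = (\<Sum>i<k 0. s i)" by (simp add: lam_def interv_sum_list_conv_sum_set_nat atLeast0LessThan)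
    also have "\<dots> = (\<Sum>i<k 0. \<Sum>x\<in>{x \<in> {..<n}. f x = i}. 1)" by (simp add: s_def)
    also have "\<dots> = (\<Sum>x<n. 1)" by (rule sum.group) (use fk in auto)
    finally show ?thesis by simp
  qed
  \<comment> \<open>The bound \<open>n\<close> on the number of rows is provisional;
    \<open>young_length_le\<close> replaces it by \<open>d\<close> once the symmetrizer is known to
    have a nonzero value.\<close>
  have "k 0 \<le> n" unfolding k_def using card_mono[of "{..<n}" "{y. y < n \<and> h y = 0}"] by auto
  moreover have "sorted_wrt (\<ge>) lam" by (auto simp: sorted_wrt_iff_nth_less len nth intro: anti)
  moreover have "0 \<notin> set lam"
  proof -
    have "s i \<noteq> 0" if "i < k 0" for i using iff[of 0 i] that by simp
    then show ?thesis by (fastforce simp: lam_def)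
  qed
  ultimately have part: "partition_of n n lam" using sum by (simp add: partition_of_def len)
  define p where "p x = (if x < n then sum_list (take (f x) lam) + h x else x)" for x
  have p: "p x < n" "row_of lam (p x) = f x" "col_of lam (p x) = h x" if x: "x < n" for x
    using tableau_position[of "f x" lam "h x"] fk[OF x] le(1)[OF x] x by (auto simp: p_def len nth sum)
  have "inj_on p {..<n}"
    by (rule inj_onI) (use p inj in \<open>metis (mono_tags, lifting) inj_onD lessThan_iff\<close>)
  then have "p permutes {..<n}"
    using p(1) by (intro bij_imp_permutes bij_betw_imageI endo_inj_surj) (auto simp: p_def)
  then show ?thesis using that part p by blast
qed

text \<open>An antisymmetric content vector \<open>w\<close> is taken in \<open>W\<close>, then a
  symmetric one \<open>v\<close> in the span of the permuted copies of \<open>w\<close>. The central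
  sum of transpositions has one eigenvalue on this span, so the two contents are opposite. A
  permuted \<open>w\<close> that survives the symmetrizer gives a collision-free pair of colourings
  in the equality case, that is, a tableau up to a permutation.\<close>

lemma exists_young_nonzero:
  assumes W: "tens.subspace W" and inv: "\<And>g w. g permutes {..<n} \<Longrightarrow> w \<in> W \<Longrightarrow> perm_op g w \<in> W"
    and WT: "W \<subseteq> tensor_space d n" and w0: "w0 \<in> W" "w0 \<noteq> 0"
  obtains lam w where "partition_of d n lam" "w \<in> W" "young lam w \<noteq> 0"
proof -
  obtain h w where w: "w \<in> W" "w \<noteq> 0" "color_sym n True h w"
    "trans_sum n w = tscale (csign True * of_int (color_content n h)) w"
    using exists_content_vector[OF W inv w0] by metis
  let ?c = "csign True * of_int (color_content n h)"
  have T: "trans_sum n v = tscale ?c v" if "v \<in> perm_span n w" for v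
    using that
  proof (induction rule: perm_span_induct)
    case zero show ?case by (simp add: tlinear_zero[OF tlinear_trans_sum])
  next
    case (step a g v)
    then show ?case
      by (simp add: tlinear_add[OF tlinear_trans_sum] tlinear_scale[OF tlinear_trans_sum] trans_sum_perm w(4)
          tlinear_scale[OF tlinear_perm_op] tens.scale_right_distrib mult.commute)
  qed
  have ww: "w \<in> perm_span n w" using perm_span_base[OF permutes_id, where n = n and w = w] by simp
  obtain f v where v: "v \<in> perm_span n w" "v \<noteq> 0" "color_sym n False f v"
    "trans_sum n v = tscale (csign False * of_int (color_content n f)) v"
    by (rule exists_content_vector[OF subspace_perm_span[of n w] perm_span_perm_op ww w(2), where b = False])
  have "csign False * of_int (color_content n f) = ?c"
    using T[OF v(1)] v(2,4) by (metis tens.scale_right_imp_eq)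
  then have cont: "color_content n f + color_content n h = 0"
    unfolding csign_def by simp (metis add.commute eq_neg_iff_add_eq_0 of_int_eq_iff of_int_minus)
  \<comment> \<open>Otherwise the symmetrizer would kill the whole span, hence also
    \<open>v\<close>, which it multiplies by the order of the group.\<close>
  have "\<exists>g. g permutes {..<n} \<and> color_sum n False f (perm_op g w) \<noteq> 0"
  proof (rule ccontr)
    assume no: "\<not> ?thesis"
    have "color_sum n False f v = 0" using v(1)
    proof (induction rule: perm_span_induct)
      case zero show ?case by (rule tlinear_zero[OF tlinear_color_sum])
    next
      case (step a g v)
      then show ?case using no by (simp add: tlinear_add[OF tlinear_color_sum] tlinear_scale[OF tlinear_color_sum])
    qed
    then show False using color_sum_sym[OF v(3)] v(2) card_color_group_nonzero[of n f] by simp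
  qed
  then obtain g where g: "g permutes {..<n}" "color_sum n False f (perm_op g w) \<noteq> 0" by blast
  define h' where "h' = h \<circ> pinv g"
  have hs: "color_sym n True h' (perm_op g w)" unfolding h'_def by (rule color_sym_conj[OF g(1) w(3)])
  have inj: "inj_on (\<lambda>x. (f x, h' x)) {..<n}"
  proof (rule inj_onI, rule ccontr)
    fix x y assume "x \<in> {..<n}" "y \<in> {..<n}" "(f x, h' x) = (f y, h' y)" "x \<noteq> y"
    then show False using color_sum_collision[OF _ _ _ _ _ hs, of x y f] g(2) by auto
  qed
  have "color_content n f + color_content n h' = 0"
    unfolding h'_def content_comp[OF permutes_inv[OF g(1)]] by (rule cont)
  then obtain lam p where lam: "partition_of n n lam" and p: "p permutes {..<n}"
    "\<And>x. x < n \<Longrightarrow> row_of lam (p x) = f x" "\<And>x. x < n \<Longrightarrow> col_of lam (p x) = h' x"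
    using exists_partition[OF inj] by metis
  let ?u = "perm_op g w"
  have u: "?u \<in> W" using inv g w by blast
  have fr: "color_sum n b (row_of lam \<circ> p) = color_sum n b f" "color_sum n b (col_of lam \<circ> p) = color_sum n b h'" for b
    by (rule color_sum_cong; simp add: p)+
  have "color_sum n False (row_of lam) (perm_op p ?u) = perm_op p (color_sum n False f ?u)"
    using color_sum_conj[OF p(1), of False "row_of lam" ?u] unfolding fr by simp
  moreover have "perm_op p z \<noteq> 0" if "z \<noteq> 0" for z
  proof
    assume "perm_op p z = 0"
    then have "perm_op (pinv p) (perm_op p z) = 0" by (simp add: tlinear_zero[OF tlinear_perm_op])
    then show False using that by (simp add: perm_op_comp permutes_inv_o[OF p(1)])
  qed
  ultimately have r: "color_sum n False (row_of lam) (perm_op p ?u) \<noteq> 0" using g(2) by metis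
  have "color_sum n True (col_of lam) (perm_op p ?u) = perm_op p (color_sum n True h' ?u)"
    using color_sum_conj[OF p(1), of True "col_of lam" ?u] unfolding fr by simp
  also have "\<dots> = tscale (of_nat (card (color_group n h'))) (perm_op p ?u)"
    using color_sum_sym[OF hs] by (simp add: tlinear_scale[OF tlinear_perm_op])
  finally have nz: "young lam (perm_op p ?u) \<noteq> 0"
    using r card_color_group_nonzero[of n h']
    by (simp add: young_eq partition_sum[OF lam] tlinear_scale[OF tlinear_color_sum])
  have pu: "perm_op p ?u \<in> W" using inv p(1) u by blast
  have "length lam \<le> d" using young_length_le[OF lam _ nz] pu WT by blast
  then have "partition_of d n lam" using lam by (simp add: partition_of_def)
  then show ?thesis using that pu nz by blast
qed

text \<open>The orthogonal complement \<open>W\<close> of all permuted copies is invariant. If it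
  were nonzero, a Young symmetrizer would have a nonzero value on it; this value lies in
  \<open>W\<close> and in a space \<open>Q_space\<close>, so it would be orthogonal to
  itself.\<close>

lemma Q_spaces_complete:
  assumes v: "v \<in> tensor_space d n"
    and orth: "\<And>lam g y. partition_of d n lam \<Longrightarrow> g permutes {..<n} \<Longrightarrow> y \<in> Q_space d n lam \<Longrightarrow> tinner d n (perm_op g y) v = 0"
  shows "v = 0"
proof (rule ccontr)
  assume v0: "v \<noteq> 0"
  define W where "W = {v \<in> tensor_space d n. \<forall>lam g y. partition_of d n lam \<longrightarrow> g permutes {..<n} \<longrightarrow> y \<in> Q_space d n lam \<longrightarrow>
    tinner d n (perm_op g y) v = 0}"
  have W: "tens.subspace W"
    unfolding tens.subspace_def W_def
    using tens.subspace_0[OF subspace_tensor_space, of d n] tens.subspace_add[OF subspace_tensor_space, of _ d n]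
      tens.subspace_scale[OF subspace_tensor_space, of _ d n]
    by (simp add: tinner_add_right tinner_scale_right)
  have inv: "perm_op s w \<in> W" if s: "s permutes {..<n}" and w: "w \<in> W" for s w
  proof -
    have "tinner d n (perm_op g y) (perm_op s w) = 0"
      if "partition_of d n lam" "g permutes {..<n}" "y \<in> Q_space d n lam" for lam g y
    proof -
      have "tinner d n (perm_op g y) (perm_op s w) = cnj (tinner d n w (perm_op (pinv s \<circ> g) y))"
        using tinner_commute[of d n "perm_op g y" "perm_op s w"] tinner_perm_op_left[OF s, of d w "perm_op g y"]
        by (simp add: perm_op_comp)
      also have "\<dots> = tinner d n (perm_op (pinv s \<circ> g) y) w" by (rule tinner_commute[symmetric])
      also have "\<dots> = 0" using w that permutes_compose[OF that(2) permutes_inv[OF s]] unfolding W_def by blast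
      finally show ?thesis .
    qed
    then show ?thesis using w perm_op_tensor_space[OF s] by (auto simp: W_def)
  qed
  have vW: "v \<in> W" using v orth by (auto simp: W_def)
  obtain lam w where lam: "partition_of d n lam" and w: "w \<in> W" "young lam w \<noteq> 0"
    by (rule exists_young_nonzero[OF W inv _ vW v0, where d = d]) (auto simp: W_def)
  have y: "young lam w \<in> W"
    unfolding young_eq partition_sum[OF lam] using W inv w by (intro color_sum_mem)
  have "young lam w \<in> Q_space d n lam" using w by (auto simp: Q_space_def W_def)
  then have "tinner d n (perm_op id (young lam w)) (young lam w) = 0"
    using y lam permutes_id[of "{..<n}"] unfolding W_def by blast
  then show False using tinner_self_eq_0[of "young lam w" d n] y w(2) by (simp add: W_def)
qed

declare minus_apply [simp del]

section \<open>Orthonormal families and their projections\<close>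

definition orthonormal_on :: "nat \<Rightarrow> nat \<Rightarrow> 'a set \<Rightarrow> ('a \<Rightarrow> tens) \<Rightarrow> bool" where
  "orthonormal_on d n I f \<longleftrightarrow> (\<forall>i\<in>I. \<forall>j\<in>I. tinner d n (f i) (f j) = (if i = j then 1 else 0))"

lemma orthonormal_on_sum:
  assumes o: "orthonormal_on d n I f" and I: "finite I" "i \<in> I"
  shows "tinner d n (f i) (\<Sum>j\<in>I. tscale (c j) (f j)) = c i"
proof -
  have "tinner d n (f i) (\<Sum>j\<in>I. tscale (c j) (f j)) = (\<Sum>j\<in>I. if i = j then c j else 0)"
    unfolding tinner_sum_right tinner_scale_right
    by (rule sum.cong) (use o I in \<open>auto simp: orthonormal_on_def\<close>)
  then show ?thesis using I by simp
qed

lemma orthonormal_on_sum_inner: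
  assumes o: "orthonormal_on d n I f" and I: "finite I"
  shows "tinner d n (\<Sum>j\<in>I. tscale (a j) (f j)) (\<Sum>j\<in>I. tscale (c j) (f j)) = (\<Sum>j\<in>I. cnj (a j) * c j)"
  unfolding tinner_sum_left tinner_scale_left
  by (rule sum.cong[OF refl]) (simp add: orthonormal_on_sum[OF o I])

lemma orthonormal_expansion:
  assumes o: "orthonormal_on d n I f" and I: "finite I" and v: "v \<in> tens.span (f ` I)"
  shows "v = (\<Sum>i\<in>I. tscale (tinner d n (f i) v) (f i))"
  using v
proof (induction rule: tens.span_induct_alt)
  case base show ?case by simp
next
  case (step c x y)
  then obtain k where k: "k \<in> I" "x = f k" by auto
  have "(\<Sum>i\<in>I. tscale (tinner d n (f i) (f k)) (f i)) = (\<Sum>i\<in>I. if i = k then f i else 0)"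
    by (rule sum.cong) (use o k in \<open>auto simp: orthonormal_on_def\<close>)
  also have "\<dots> = f k" using I k by simp
  finally have "(\<Sum>i\<in>I. tscale (tinner d n (f i) x) (f i)) = x" by (simp add: k)
  then have e: "(\<Sum>i\<in>I. tscale (c * tinner d n (f i) x) (f i)) = tscale c x"
    by (metis (no_types, lifting) sum.cong tens.scale_scale tens.scale_sum_right)
  have "(\<Sum>i\<in>I. tscale (tinner d n (f i) (tscale c x + y)) (f i))
    = (\<Sum>i\<in>I. tscale (c * tinner d n (f i) x) (f i)) + (\<Sum>i\<in>I. tscale (tinner d n (f i) y) (f i))"
    by (simp only: tinner_add_right tinner_scale_right tens.scale_left_distrib sum.distrib)
  then show ?case unfolding e step(2)[symmetric] ..
qed

text \<open>For the uniqueness in the definite description: two candidates differ by a vector of the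
  span that is orthogonal to itself, and the span lies in the tensor space, where the inner product
  is definite.\<close>

lemma orth_proj_orthonormal:
  assumes o: "orthonormal_on d n I f" and I: "finite I" and T: "\<And>i. i \<in> I \<Longrightarrow> f i \<in> tensor_space d n"
  shows "orth_proj d n (tens.span (f ` I)) v = (\<Sum>i\<in>I. tscale (tinner d n (f i) v) (f i))"
  unfolding orth_proj_def
proof (rule the_equality)
  let ?p = "\<Sum>i\<in>I. tscale (tinner d n (f i) v) (f i)"
  have sp: "?p \<in> tens.span (f ` I)" by (intro tens.span_sum tens.span_scale tens.span_base) auto
  have z: "tinner d n u (v - ?p) = 0" if "u \<in> tens.span (f ` I)" for u
    using that
  proof (induction rule: tens.span_induct_alt)
    case (step c x y)
    then show ?case
      using orthonormal_on_sum[OF o I]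
      by (auto simp: tinner_add_left tinner_scale_left tinner_diff_right)
  qed simp
  then show "?p \<in> tens.span (f ` I) \<and> (\<forall>u\<in>tens.span (f ` I). tinner d n u (v - ?p) = 0)"
    using sp by blast
  fix p assume p: "p \<in> tens.span (f ` I) \<and> (\<forall>u\<in>tens.span (f ` I). tinner d n u (v - p) = 0)"
  then have s: "p - ?p \<in> tens.span (f ` I)" using sp by (intro tens.span_diff) auto
  have "tinner d n (p - ?p) (p - ?p) = tinner d n (p - ?p) (v - ?p) - tinner d n (p - ?p) (v - p)"
    by (simp add: tinner_diff_right)
  also have "\<dots> = 0" using z[OF s] p s by simp
  finally have 0: "tinner d n (p - ?p) (p - ?p) = 0" .
  have "tens.span (f ` I) \<subseteq> tensor_space d n"
    using T by (intro tens.span_minimal subspace_tensor_space) auto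
  then show "p = ?p" using tinner_self_eq_0[OF _ 0] s by auto
qed

subsection \<open>Weights\<close>

text \<open>A condition on the support, which passes through permutations and signed sums; vectors
  of different weights have disjoint supports and are thereby orthogonal.\<close>

definition has_weight :: "nat \<Rightarrow> nat \<Rightarrow> nat list \<Rightarrow> tens \<Rightarrow> bool" where
  "has_weight d n w v \<longleftrightarrow> (\<forall>e. v e \<noteq> 0 \<longrightarrow> e \<in> strings d n \<and> (\<forall>i<d. card {x \<in> {..<n}. e x = i} = w ! i))"

lemma weight_space_has_weight: "v \<in> weight_space d n w \<Longrightarrow> has_weight d n w v"
  unfolding weight_space_def
proof (induction rule: tens.span_induct_alt)
  case base show ?case by (simp add: has_weight_def zero_fun_apply)
next
  case (step c x y)
  then obtain e where e: "x = ket e" "e \<in> strings d n" "\<forall>i<d. card {x \<in> {..<n}. e x = i} = w ! i" by auto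
  show ?case unfolding has_weight_def
  proof (intro allI impI)
    fix f assume "(tscale c x + y) f \<noteq> 0"
    then have "f = e \<or> y f \<noteq> 0" using e(1) by (auto simp: plus_fun_apply tscale_def ket_def split: if_splits)
    then show "f \<in> strings d n \<and> (\<forall>i<d. card {x \<in> {..<n}. f x = i} = w ! i)"
      using e step by (auto simp: has_weight_def)
  qed
qed

lemma has_weight_perm_op:
  assumes p: "\<pi> permutes {..<n}" and v: "has_weight d n w v" shows "has_weight d n w (perm_op \<pi> v)"
  unfolding has_weight_def
proof (intro allI impI)
  fix e assume "perm_op \<pi> v e \<noteq> 0"
  then have e: "e \<circ> \<pi> \<in> strings d n" "\<forall>i<d. card {x \<in> {..<n}. (e \<circ> \<pi>) x = i} = w ! i"
    using v by (auto simp: perm_op_def has_weight_def)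
  have "card {x \<in> {..<n}. (e \<circ> \<pi>) x = i} = card {x \<in> {..<n}. e x = i}" for i
  proof -
    have "{x \<in> {..<n}. e x = i} = \<pi> ` {x \<in> {..<n}. (e \<circ> \<pi>) x = i}"
    proof (intro equalityI subsetI)
      fix x assume "x \<in> {x \<in> {..<n}. e x = i}"
      then show "x \<in> \<pi> ` {x \<in> {..<n}. (e \<circ> \<pi>) x = i}"
        using permutes_in_image[OF permutes_inv[OF p], of x]
        by (intro image_eqI[of _ _ "pinv \<pi> x"]) (auto simp: permutes_inverses[OF p])
    next
      fix x assume "x \<in> \<pi> ` {x \<in> {..<n}. (e \<circ> \<pi>) x = i}"
      then show "x \<in> {x \<in> {..<n}. e x = i}" using permutes_in_image[OF p] by auto
    qed
    then show ?thesis by (simp add: card_image inj_on_subset[OF permutes_inj[OF p]])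
  qed
  then show "e \<in> strings d n \<and> (\<forall>i<d. card {x \<in> {..<n}. e x = i} = w ! i)"
    using e strings_comp_permutes[OF p] by auto
qed

lemma has_weight_color_sum:
  assumes "has_weight d n w v" shows "has_weight d n w (color_sum n b f v)"
  unfolding has_weight_def
proof (intro allI impI)
  fix e assume "color_sum n b f v e \<noteq> 0"
  then obtain \<pi> where "\<pi> \<in> color_group n f" "perm_op \<pi> v e \<noteq> 0"
    unfolding color_sum_def sum_apply tscale_def by (metis (no_types, lifting) mult_zero_right sum.not_neutral_contains_not_neutral)
  then show "e \<in> strings d n \<and> (\<forall>i<d. card {x \<in> {..<n}. e x = i} = w ! i)"
    using has_weight_perm_op[OF color_group_permutes _] assms unfolding has_weight_def by blast
qed

lemma has_weight_orthogonal:
  assumes "has_weight d n w u" "has_weight d n w' v" "length w = d" "length w' = d" "w \<noteq> w'"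
  shows "tinner d n u v = 0"
  unfolding tinner_def
proof (rule sum.neutral, intro ballI, rule ccontr)
  fix e assume "cnj (u e) * v e \<noteq> 0"
  then have "\<forall>i<d. w ! i = w' ! i" using assms(1,2) unfolding has_weight_def by auto
  then show False using assms(3-5) by (simp add: list_eq_iff_nth_eq)
qed

lemma finite_weights: "finite (weights d n)"
proof (rule finite_subset)
  show "weights d n \<subseteq> {xs. set xs \<subseteq> {..n} \<and> length xs = d}"
    by (auto simp: weights_def intro: member_le_sum_list)
qed (simp add: finite_lists_length_eq)

lemma tlinear_young: "tlinear (young lam)"
  unfolding young_eq[abs_def] by (rule tlinear_comp[OF tlinear_color_sum tlinear_color_sum])

lemma subspace_Q_space: "tens.subspace (Q_space d n lam)"
  unfolding Q_space_def by (rule Modules.module_hom.subspace_image[OF tlinear_young subspace_tensor_space])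

lemma young_tensor_space:
  assumes "sum_list lam = n" "v \<in> tensor_space d n" shows "young lam v \<in> tensor_space d n"
  unfolding young_eq assms(1)
  by (intro color_sum_mem subspace_tensor_space perm_op_tensor_space assms(2))

lemma Q_space_tensor_space: "partition_of d n lam \<Longrightarrow> x \<in> Q_space d n lam \<Longrightarrow> x \<in> tensor_space d n"
  using young_tensor_space partition_sum by (auto simp: Q_space_def)

lemma ket_weight_space:
  assumes "e \<in> strings d n"
  obtains w where "w \<in> weights d n" "ket e \<in> weight_space d n w"
proof
  let ?w = "map (\<lambda>i. card {x \<in> {..<n}. e x = i}) [0..<d]"
  have "sum_list ?w = (\<Sum>i<d. \<Sum>x\<in>{x \<in> {..<n}. e x = i}. 1)"
    by (simp add: interv_sum_list_conv_sum_set_nat atLeast0LessThan)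
  also have "\<dots> = (\<Sum>x<n. 1)" by (rule sum.group) (use assms in \<open>auto simp: strings_def\<close>)
  finally show "?w \<in> weights d n" by (simp add: weights_def)
  show "ket e \<in> weight_space d n ?w"
    unfolding weight_space_def using assms by (intro tens.span_base) auto
qed

lemma weight_space_subset: "weight_space d n w \<subseteq> tensor_space d n"
  unfolding weight_space_def tensor_space_def by (rule tens.span_mono) auto

text \<open>Orthonormality in a form that splits over an append, so that the bases for the
  individual weights can be concatenated by induction.\<close>

definition ortho_list :: "nat \<Rightarrow> nat \<Rightarrow> tens list \<Rightarrow> bool" where
  "ortho_list d n xs \<longleftrightarrow> sorted_wrt (\<lambda>u v. tinner d n u v = 0) xs \<and> (\<forall>u\<in>set xs. tinner d n u u = 1)"

lemma ortho_list_iff: "ortho_list d n xs \<longleftrightarrow> orthonormal_on d n {..<length xs} (nth xs)"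
proof
  assume o: "ortho_list d n xs"
  have "tinner d n (xs ! i) (xs ! j) = 0" if "i < j" "j < length xs" for i j
    using o that sorted_wrt_nth_less by (fastforce simp: ortho_list_def)
  moreover have "tinner d n (xs ! j) (xs ! i) = 0" if "i < j" "j < length xs" for i j
    using calculation[OF that] tinner_commute[of d n "xs ! j" "xs ! i"] by simp
  ultimately show "orthonormal_on d n {..<length xs} (nth xs)"
    using o unfolding orthonormal_on_def ortho_list_def by (metis lessThan_iff linorder_neqE_nat nth_mem)
next
  assume "orthonormal_on d n {..<length xs} (nth xs)"
  then show "ortho_list d n xs"
    by (auto simp: ortho_list_def orthonormal_on_def sorted_wrt_iff_nth_less in_set_conv_nth)
qed

lemma ortho_list_concat:
  assumes "distinct ws" "\<And>w. w \<in> set ws \<Longrightarrow> length w = d" "\<And>w. w \<in> set ws \<Longrightarrow> ortho_list d n (L w)"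
    "\<And>w u. w \<in> set ws \<Longrightarrow> u \<in> set (L w) \<Longrightarrow> has_weight d n w u"
  shows "ortho_list d n (concat (map L ws))"
  using assms
proof (induction ws)
  case Nil show ?case by (simp add: ortho_list_def)
next
  case (Cons w ws)
  have IH: "ortho_list d n (concat (map L ws))" using Cons by (intro Cons.IH) auto
  have "tinner d n u v = 0" if "u \<in> set (L w)" "w' \<in> set ws" "v \<in> set (L w')" for u v w'
    using that Cons.prems by (intro has_weight_orthogonal[of d n w u w' v]) auto
  then show ?case using IH Cons.prems(3)[of w] by (auto simp: ortho_list_def sorted_wrt_append)
qed

section \<open>Orthonormality and completeness of the basis\<close>

locale schur_basis =
  fixes d n :: nat and b :: basis
  assumes basis: "young_basis d n b"
begin

abbreviation Qdim :: "nat list \<Rightarrow> nat" where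
  "Qdim lam \<equiv> tens.dim (Q_space d n lam)"

abbreviation mdim :: "nat list \<Rightarrow> nat" where
  "mdim lam \<equiv> mult_dim n b lam"

context
  fixes lam assumes lam: "partition_of d n lam"
begin

text \<open>Young symmetrizers preserve weights, so the bases for different weights are orthogonal
  to each other. They span because every basis vector of the tensor power lies in some weight
  space.\<close>

lemma Q_basis: "orthonormal_on d n {..<Qdim lam} (\<lambda>i. b lam i 0)"
  "tens.span ((\<lambda>i. b lam i 0) ` {..<Qdim lam}) = Q_space d n lam"
proof -
  obtain L where L: "\<forall>w\<in>weights d n. orthonormal_basis d n (young lam ` weight_space d n w) (L w)"
    "map (\<lambda>i. b lam i 0) [0..<Qdim lam] = concat (map L (rev (sorted_list_of_set (weights d n))))"
    using basis lam unfolding young_basis_def by blast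
  let ?ws = "rev (sorted_list_of_set (weights d n))" and ?xs = "map (\<lambda>i. b lam i 0) [0..<Qdim lam]"
  have ws: "set ?ws = weights d n" "distinct ?ws" using finite_weights by auto
  have n: "sum_list lam = n" using lam by (rule partition_sum)
  have sub: "set (L w) \<subseteq> young lam ` weight_space d n w" if "w \<in> weights d n" for w
    using L(1) that tens.span_superset[of "set (L w)"] by (auto simp: orthonormal_basis_def)
  have "has_weight d n w u" if w: "w \<in> weights d n" and u: "u \<in> set (L w)" for w u
  proof -
    obtain v where v: "u = young lam v" "v \<in> weight_space d n w" using sub[OF w] u by blast
    show ?thesis unfolding v(1) young_eq by (simp add: n has_weight_color_sum weight_space_has_weight[OF v(2)])
  qed
  then have "ortho_list d n (concat (map L ?ws))"
    using L(1) ws unfolding ortho_list_iff orthonormal_basis_def orthonormal_on_def[symmetric]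
    by (intro ortho_list_concat[unfolded ortho_list_iff]) (auto simp: weights_def orthonormal_on_def)
  then have "orthonormal_on d n {..<Qdim lam} (nth ?xs)"
    unfolding L(2)[symmetric] ortho_list_iff by simp
  then show "orthonormal_on d n {..<Qdim lam} (\<lambda>i. b lam i 0)" by (simp add: orthonormal_on_def)
  have img: "(\<lambda>i. b lam i 0) ` {..<Qdim lam} = set (concat (map L ?ws))"
    unfolding L(2)[symmetric] by (auto simp: image_iff)
  show "tens.span ((\<lambda>i. b lam i 0) ` {..<Qdim lam}) = Q_space d n lam"
  proof (rule subset_antisym)
    show "tens.span ((\<lambda>i. b lam i 0) ` {..<Qdim lam}) \<subseteq> Q_space d n lam"
      unfolding img using sub weight_space_subset[of d n] ws
      by (intro tens.span_minimal subspace_Q_space) (fastforce simp: Q_space_def)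
    have "young lam v \<in> tens.span (set (concat (map L ?ws)))" if "v \<in> tensor_space d n" for v
      using that unfolding tensor_space_def
    proof (induction rule: tens.span_induct_alt)
      case base show ?case by (simp add: tlinear_zero[OF tlinear_young] tens.span_zero)
    next
      case (step c x y)
      then obtain e where e: "x = ket e" "e \<in> strings d n" by auto
      obtain w where w: "w \<in> weights d n" "ket e \<in> weight_space d n w" using ket_weight_space[OF e(2)] .
      have "young lam x \<in> tens.span (set (L w))"
        using L(1) w e by (auto simp: orthonormal_basis_def)
      moreover have "set (L w) \<subseteq> set (concat (map L ?ws))" using w ws by auto
      ultimately have "young lam x \<in> tens.span (set (concat (map L ?ws)))" using tens.span_mono by blast
      then show ?case using step
        by (simp add: tlinear_add[OF tlinear_young] tlinear_scale[OF tlinear_young] tens.span_add tens.span_scale)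
    qed
    then show "Q_space d n lam \<subseteq> tens.span ((\<lambda>i. b lam i 0) ` {..<Qdim lam})"
      unfolding img by (auto simp only: Q_space_def)
  qed
qed

lemma Q_basis_mem: "i < Qdim lam \<Longrightarrow> b lam i 0 \<in> Q_space d n lam"
  using tens.span_base[of "b lam i 0" "(\<lambda>i. b lam i 0) ` {..<Qdim lam}"] unfolding Q_basis(2) by simp

lemma mult_basis: "orthonormal_on d n {..<mdim lam} (\<lambda>j. b lam 0 j)"
  "tens.span ((\<lambda>j. b lam 0 j) ` {..<mdim lam}) = perm_span n (b lam 0 0)"
proof -
  have o: "orthonormal_basis d n (perm_span n (b lam 0 0)) (map (\<lambda>j. b lam 0 j) [0..<mdim lam])"
    using basis lam unfolding young_basis_def by blast
  then show "orthonormal_on d n {..<mdim lam} (\<lambda>j. b lam 0 j)" by (auto simp: orthonormal_basis_def orthonormal_on_def)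
  have "(\<lambda>j. b lam 0 j) ` {..<mdim lam} = set (map (\<lambda>j. b lam 0 j) [0..<mdim lam])" by (auto simp: image_iff)
  then show "tens.span ((\<lambda>j. b lam 0 j) ` {..<mdim lam}) = perm_span n (b lam 0 0)" using o by (simp add: orthonormal_basis_def)
qed

end

text \<open>The element of the group algebra with coefficients \<alpha>, acting on tensors.\<close>

definition galg :: "((nat \<Rightarrow> nat) \<Rightarrow> complex) \<Rightarrow> tens \<Rightarrow> tens" where
  "galg \<alpha> v = (\<Sum>\<pi> | \<pi> permutes {..<n}. tscale (\<alpha> \<pi>) (perm_op \<pi> v))"

lemma tlinear_galg: "tlinear (galg \<alpha>)"
  unfolding galg_def[abs_def] by (intro tlinear_sum_fun tlinear_scale_fun tlinear_perm_op)

lemma galg_tensor_space: "v \<in> tensor_space d n \<Longrightarrow> galg \<alpha> v \<in> tensor_space d n"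
  unfolding galg_def
  by (intro tens.subspace_sum[OF subspace_tensor_space] tens.subspace_scale[OF subspace_tensor_space] perm_op_tensor_space) simp_all

text \<open>One fixed choice of the coefficients whose existence is part of
  \<open>young_basis\<close>; the same choice serves all \<open>i\<close>.\<close>

definition coef :: "nat list \<Rightarrow> nat \<Rightarrow> (nat \<Rightarrow> nat) \<Rightarrow> complex" where
  "coef lam = (SOME \<alpha>. \<forall>j<mdim lam. \<forall>i<Qdim lam. b lam i j = galg (\<alpha> j) (b lam i 0))"

lemma basis_eq:
  assumes "partition_of d n lam" "j < mdim lam" "i < Qdim lam"
  shows "b lam i j = galg (coef lam j) (b lam i 0)"
proof -
  have "\<exists>\<alpha>. \<forall>j<mdim lam. \<forall>i<Qdim lam. b lam i j = galg (\<alpha> j) (b lam i 0)"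
    using basis assms(1) unfolding young_basis_def galg_def by blast
  from someI_ex[OF this, folded coef_def] show ?thesis using assms by blast
qed

lemma galg_inner_scalar:
  assumes lam: "partition_of d n lam"
  shows "\<exists>c. \<forall>x\<in>Q_space d n lam. \<forall>y\<in>Q_space d n lam. tinner d n (galg \<alpha> x) (galg \<beta> y) = c * tinner d n x y"
proof -
  have "\<exists>\<phi>. \<forall>g\<in>{g. g permutes {..<n}}. \<forall>x\<in>Q_space d n lam. \<forall>y\<in>Q_space d n lam. tinner d n x (perm_op g y) = \<phi> g * tinner d n x y"
    by (rule bchoice) (use Q_inner_scalar[OF lam] in blast)
  then obtain \<phi> where \<phi>: "\<And>g x y. g permutes {..<n} \<Longrightarrow> x \<in> Q_space d n lam \<Longrightarrow> y \<in> Q_space d n lam \<Longrightarrow>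
    tinner d n x (perm_op g y) = \<phi> g * tinner d n x y" by blast
  let ?S = "{\<pi>. \<pi> permutes {..<n}}"
  show ?thesis
  proof (intro exI ballI)
    fix x y assume x: "x \<in> Q_space d n lam" and y: "y \<in> Q_space d n lam"
    have "tinner d n (perm_op \<pi> x) (perm_op \<sigma> y) = \<phi> (pinv \<pi> \<circ> \<sigma>) * tinner d n x y" if "\<pi> \<in> ?S" "\<sigma> \<in> ?S" for \<pi> \<sigma>
      using that \<phi>[OF permutes_compose[OF _ permutes_inv] x y, of \<sigma> \<pi>] by (simp add: tinner_perm_op_left perm_op_comp)
    then have "tinner d n (galg \<alpha> x) (galg \<beta> y) = (\<Sum>\<sigma>\<in>?S. \<Sum>\<pi>\<in>?S. \<beta> \<sigma> * (cnj (\<alpha> \<pi>) * (\<phi> (pinv \<pi> \<circ> \<sigma>) * tinner d n x y)))"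
      unfolding galg_def tinner_sum_left tinner_sum_right tinner_scale_left tinner_scale_right
      by (intro sum.cong refl) (simp add: sum_distrib_left)
    then show "tinner d n (galg \<alpha> x) (galg \<beta> y) = (\<Sum>\<sigma>\<in>?S. \<Sum>\<pi>\<in>?S. \<beta> \<sigma> * (cnj (\<alpha> \<pi>) * \<phi> (pinv \<pi> \<circ> \<sigma>))) * tinner d n x y"
      by (simp add: sum_distrib_right mult.assoc)
  qed
qed

lemma galg_inner_orthogonal:
  assumes "partition_of d n lam" "partition_of d n mu" "lam \<noteq> mu" "x \<in> Q_space d n lam" "y \<in> Q_space d n mu"
  shows "tinner d n (galg \<alpha> x) (galg \<beta> y) = 0"
proof -
  have "tinner d n (perm_op \<pi> x) (perm_op \<sigma> y) = 0" if "\<pi> permutes {..<n}" "\<sigma> permutes {..<n}" for \<pi> \<sigma>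
    using Q_inner_orthogonal[OF assms(1-3) permutes_compose[OF that(2) permutes_inv[OF that(1)]] assms(4,5)]
    by (simp add: tinner_perm_op_left that perm_op_comp)
  then show ?thesis
    unfolding galg_def tinner_sum_left tinner_sum_right tinner_scale_left tinner_scale_right
    by (auto intro!: sum.neutral)
qed

text \<open>By \<open>galg_inner_scalar\<close> the inner product is a constant times that of
  \<open>x\<close> and \<open>y\<close>. The constant is read off at \<open>b lam 0 0\<close>, whose
  images are the orthonormal vectors \<open>b lam 0 j\<close>.\<close>

lemma galg_inner:
  assumes lam: "partition_of d n lam" and j: "j < mdim lam" "k < mdim lam"
    and x: "x \<in> Q_space d n lam" and y: "y \<in> Q_space d n lam"
  shows "tinner d n (galg (coef lam j) x) (galg (coef lam k) y) = (if j = k then tinner d n x y else 0)"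
proof (cases "Qdim lam = 0")
  case True
  then have "x = 0" using x Q_basis(2)[OF lam, symmetric] by simp
  then show ?thesis by (simp add: tlinear_zero[OF tlinear_galg])
next
  case False
  then have N: "0 < Qdim lam" by simp
  obtain c where c: "\<And>x y. x \<in> Q_space d n lam \<Longrightarrow> y \<in> Q_space d n lam \<Longrightarrow>
    tinner d n (galg (coef lam j) x) (galg (coef lam k) y) = c * tinner d n x y"
    using galg_inner_scalar[OF lam] by blast
  have "tinner d n (b lam 0 j) (b lam 0 k) = c * tinner d n (b lam 0 0) (b lam 0 0)"
    using basis_eq[OF lam j(1) N] basis_eq[OF lam j(2) N] c[OF Q_basis_mem[OF lam N] Q_basis_mem[OF lam N]] by simp
  moreover have "tinner d n (b lam 0 0) (b lam 0 0) = 1" using Q_basis(1)[OF lam] N by (auto simp: orthonormal_on_def)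
  moreover have "tinner d n (b lam 0 j) (b lam 0 k) = (if j = k then 1 else 0)"
    using mult_basis(1)[OF lam] j by (auto simp: orthonormal_on_def)
  ultimately have "c = (if j = k then 1 else 0)" by simp
  then show ?thesis using c[OF x y] by simp
qed

lemma basis_tensor_space:
  assumes "partition_of d n lam" "j < mdim lam" "i < Qdim lam" shows "b lam i j \<in> tensor_space d n"
  unfolding basis_eq[OF assms]
  by (intro galg_tensor_space Q_space_tensor_space[OF assms(1)] Q_basis_mem[OF assms(1,3)])

lemma basis_orthonormal:
  assumes "partition_of d n lam" "j < mdim lam" "i < Qdim lam" "partition_of d n mu" "k < mdim mu" "l < Qdim mu"
  shows "tinner d n (b lam i j) (b mu l k) = (if lam = mu \<and> i = l \<and> j = k then 1 else 0)"
proof (cases "lam = mu")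
  case True
  then show ?thesis
    using assms Q_basis(1)[OF assms(1)] unfolding basis_eq[OF assms(1-3)] basis_eq[OF assms(4-6)]
    by (auto simp: galg_inner Q_basis_mem orthonormal_on_def)
next
  case False
  then show ?thesis
    unfolding basis_eq[OF assms(1-3)] basis_eq[OF assms(4-6)]
    by (simp add: galg_inner_orthogonal[OF assms(1,4) False] Q_basis_mem assms)
qed

text \<open>The expansion of a permuted \<open>b lam 0 0\<close> in the vectors
  \<open>b lam 0 j\<close> is a relation in the group algebra: the element \<gamma> kills
  \<open>b lam 0 0\<close>. On \<open>Q_space\<close> the squared norm of
  \<open>galg \<gamma> x\<close> is a constant times that of \<open>x\<close>, so the constant is 0
  and \<gamma> kills every \<open>b lam i 0\<close>; the same expansion holds there.\<close>

lemma perm_op_basis_span: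
  assumes lam: "partition_of d n lam" and i: "i < Qdim lam" and g: "g permutes {..<n}"
  shows "perm_op g (b lam i 0) \<in> tens.span ((\<lambda>j. b lam i j) ` {..<mdim lam})"
proof -
  have N: "0 < Qdim lam" using i by simp
  define c where "c j = tinner d n (b lam 0 j) (perm_op g (b lam 0 0))" for j
  define \<gamma> where "\<gamma> \<pi> = (if \<pi> = g then 1 else 0) - (\<Sum>j<mdim lam. c j * coef lam j \<pi>)" for \<pi>
  have gm: "galg \<gamma> x = perm_op g x - (\<Sum>j<mdim lam. tscale (c j) (galg (coef lam j) x))" for x
  proof -
    let ?S = "{\<pi>. \<pi> permutes {..<n}}"
    have S: "finite ?S" by (rule finite_permutations) simp
    have "galg \<gamma> x = (\<Sum>\<pi>\<in>?S. (if \<pi> = g then perm_op g x else 0) - (\<Sum>j<mdim lam. tscale (c j) (tscale (coef lam j \<pi>) (perm_op \<pi> x))))"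
      unfolding galg_def by (rule sum.cong) (auto simp: \<gamma>_def tens.scale_left_diff_distrib tens.scale_sum_left)
    also have "\<dots> = (\<Sum>\<pi>\<in>?S. if \<pi> = g then perm_op g x else 0) - (\<Sum>j<mdim lam. \<Sum>\<pi>\<in>?S. tscale (c j) (tscale (coef lam j \<pi>) (perm_op \<pi> x)))"
      unfolding sum_subtractf by (subst (2) sum.swap) (rule refl)
    also have "(\<Sum>\<pi>\<in>?S. if \<pi> = g then perm_op g x else 0) = perm_op g x" using S g by simp
    finally show ?thesis by (simp only: galg_def tens.scale_sum_right)
  qed
  have "perm_op g (b lam 0 0) \<in> tens.span ((\<lambda>j. b lam 0 j) ` {..<mdim lam})"
    unfolding mult_basis(2)[OF lam] by (rule perm_span_base[OF g])
  from orthonormal_expansion[OF mult_basis(1)[OF lam] _ this]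
  have "perm_op g (b lam 0 0) = (\<Sum>j<mdim lam. tscale (c j) (b lam 0 j))"
    unfolding c_def by blast
  then have z: "galg \<gamma> (b lam 0 0) = 0" using basis_eq[OF lam _ N, symmetric] by (simp add: gm)
  obtain k where k: "\<And>x y. x \<in> Q_space d n lam \<Longrightarrow> y \<in> Q_space d n lam \<Longrightarrow>
    tinner d n (galg \<gamma> x) (galg \<gamma> y) = k * tinner d n x y"
    using galg_inner_scalar[OF lam] by blast
  have "k = 0"
    using k[OF Q_basis_mem[OF lam N] Q_basis_mem[OF lam N]] z Q_basis(1)[OF lam] N by (auto simp: orthonormal_on_def)
  then have "tinner d n (galg \<gamma> (b lam i 0)) (galg \<gamma> (b lam i 0)) = 0"
    using k[OF Q_basis_mem[OF lam i] Q_basis_mem[OF lam i]] by simp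
  then have "galg \<gamma> (b lam i 0) = 0"
    by (rule tinner_self_eq_0[rotated]) (intro galg_tensor_space Q_space_tensor_space[OF lam] Q_basis_mem[OF lam i])
  then have "perm_op g (b lam i 0) = (\<Sum>j<mdim lam. tscale (c j) (b lam i j))"
    using basis_eq[OF lam _ i, symmetric] by (simp add: gm)
  also have "\<dots> \<in> tens.span ((\<lambda>j. b lam i j) ` {..<mdim lam})"
    by (intro tens.span_sum tens.span_scale tens.span_base) auto
  finally show ?thesis .
qed

section \<open>Branches of the pre-processing\<close>

lemma finite_partitions: "finite {lam. partition_of d n lam}"
proof (rule finite_subset)
  show "{lam. partition_of d n lam} \<subseteq> {xs. set xs \<subseteq> {..n} \<and> length xs \<le> d}"
    by (auto simp: partition_of_def intro: member_le_sum_list)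
qed (simp add: finite_lists_length_le)

lemma finite_branches: "finite (branches d n b)"
proof -
  have "branches d n b = (SIGMA lam:{lam. partition_of d n lam}. {..<mdim lam})" by (auto simp: branches_def)
  then show ?thesis using finite_partitions by simp
qed

text \<open>The component of \<open>v\<close> in the branch, carried back to multiplicity index 0:
  the unnormalized state that the pre-processing returns.\<close>

definition branch_vec :: "tens \<Rightarrow> nat list \<times> nat \<Rightarrow> tens" where
  "branch_vec v = (\<lambda>(lam, j). \<Sum>i<Qdim lam. tscale (tinner d n (b lam i j) v) (b lam i 0))"

lemma branch_vec_Q: "(lam, j) \<in> branches d n b \<Longrightarrow> branch_vec v (lam, j) \<in> Q_space d n lam"
  unfolding branch_vec_def branches_def
  by (auto intro!: tens.subspace_sum tens.subspace_scale subspace_Q_space Q_basis_mem)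

lemma galg_branch_vec:
  assumes "(lam, j) \<in> branches d n b"
  shows "galg (coef lam j) (branch_vec v (lam, j)) = (\<Sum>i<Qdim lam. tscale (tinner d n (b lam i j) v) (b lam i j))"
  using assms basis_eq[of lam j, symmetric]
  by (simp add: branch_vec_def branches_def tlinear_sum[OF tlinear_galg] tlinear_scale[OF tlinear_galg])

text \<open>The difference of both sides is orthogonal to all basis vectors, hence by
  \<open>perm_op_basis_span\<close> to all permuted copies of the spaces \<open>Q_space\<close>, and
  completeness makes it 0.\<close>

lemma expansion:
  assumes v: "v \<in> tensor_space d n"
  shows "v = (\<Sum>(lam, j)\<in>branches d n b. galg (coef lam j) (branch_vec v (lam, j)))"
proof -
  let ?v = "\<Sum>(lam, j)\<in>branches d n b. galg (coef lam j) (branch_vec v (lam, j))"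
  have vT: "v - ?v \<in> tensor_space d n"
    using branch_vec_Q Q_space_tensor_space
    by (intro tens.subspace_diff subspace_tensor_space v tens.subspace_sum)
       (auto intro!: galg_tensor_space simp: branches_def)
  have o: "tinner d n (b mu l k) (v - ?v) = 0" if mu: "partition_of d n mu" "k < mdim mu" "l < Qdim mu" for mu k l
  proof -
    have "tinner d n (b mu l k) ?v = (\<Sum>p\<in>branches d n b. if p = (mu, k) then tinner d n (b mu l k) v else 0)"
      unfolding tinner_sum_right
    proof (rule sum.cong[OF refl])
      fix p assume p: "p \<in> branches d n b"
      obtain lam j where lj: "p = (lam, j)" by (cases p)
      have pl: "partition_of d n lam" "j < mdim lam" using p lj by (auto simp: branches_def)
      have "tinner d n (b mu l k) (galg (coef lam j) (branch_vec v (lam, j)))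
        = (\<Sum>i<Qdim lam. tinner d n (b lam i j) v * (if mu = lam \<and> l = i \<and> k = j then 1 else 0))"
        unfolding galg_branch_vec[OF p[unfolded lj]] tinner_sum_right tinner_scale_right
        by (rule sum.cong) (use basis_orthonormal[OF mu pl] in auto)
      also have "\<dots> = (if p = (mu, k) then tinner d n (b mu l k) v else 0)"
        using mu(3) by (cases "p = (mu, k)") (auto simp: lj if_distrib cong: if_cong)
      finally show "tinner d n (b mu l k) (case p of (lam, j) \<Rightarrow> galg (coef lam j) (branch_vec v (lam, j)))
        = (if p = (mu, k) then tinner d n (b mu l k) v else 0)" by (simp add: lj)
    qed
    also have "\<dots> = tinner d n (b mu l k) v" using finite_branches mu by (simp add: branches_def)
    finally show ?thesis by (simp add: tinner_diff_right)
  qed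
  have o2: "tinner d n (perm_op g (b mu l 0)) (v - ?v) = 0" if mu: "partition_of d n mu" "l < Qdim mu" and g: "g permutes {..<n}" for mu l g
    using perm_op_basis_span[OF mu g]
  proof (induction rule: tens.span_induct_alt)
    case (step c x y)
    then show ?case using o mu by (auto simp: tinner_add_left tinner_scale_left)
  qed simp
  have "v - ?v = 0"
  proof (rule Q_spaces_complete[OF vT])
    fix mu g y assume mu: "partition_of d n mu" and g: "g permutes {..<n}" and y: "y \<in> Q_space d n mu"
    have "y \<in> tens.span ((\<lambda>i. b mu i 0) ` {..<Qdim mu})" using y Q_basis(2)[OF mu] by simp
    then show "tinner d n (perm_op g y) (v - ?v) = 0"
    proof (induction rule: tens.span_induct_alt)
      case base show ?case by (simp add: tlinear_zero[OF tlinear_perm_op])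
    next
      case (step c x y)
      then show ?case using o2[OF mu _ g]
        by (auto simp: tlinear_add[OF tlinear_perm_op] tlinear_scale[OF tlinear_perm_op] tinner_add_left tinner_scale_left)
    qed
  qed
  then show ?thesis by simp
qed

text \<open>An operator that commutes with the permutations of the tensor factors has the same mean before
  and after the pre-processing.\<close>

lemma inner_commuting:
  assumes v: "v \<in> tensor_space d n" and K: "tlinear K" "\<And>x. x \<in> tensor_space d n \<Longrightarrow> K x \<in> tensor_space d n"
    and comm: "\<And>g x. g permutes {..<n} \<Longrightarrow> K (perm_op g x) = perm_op g (K x)"
  shows "tinner d n v (K v) = (\<Sum>br\<in>branches d n b. tinner d n (branch_vec v br) (K (branch_vec v br)))"
proof -
  have Kg: "K (galg \<alpha> x) = galg \<alpha> (K x)" for \<alpha> x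
    unfolding galg_def tlinear_sum[OF K(1)] tlinear_scale[OF K(1)] by (rule sum.cong) (simp_all add: comm)
  have Kc: "K (color_sum n s f x) = color_sum n s f (K x)" for s f x
    unfolding color_sum_def tlinear_sum[OF K(1)] tlinear_scale[OF K(1)] by (rule sum.cong) (simp_all add: comm color_group_permutes)
  have KQ: "K x \<in> Q_space d n lam" if lam: "partition_of d n lam" and x: "x \<in> Q_space d n lam" for lam x
  proof -
    obtain u where u: "u \<in> tensor_space d n" "x = young lam u" using x by (auto simp: Q_space_def)
    have "K x = young lam (K u)" by (simp add: u(2) young_eq partition_sum[OF lam] Kc)
    then show ?thesis using K(2)[OF u(1)] by (auto simp: Q_space_def)
  qed
  let ?u = "branch_vec v" and ?A = "\<lambda>(lam, j). galg (coef lam j)"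
  have "tinner d n v (K v) = tinner d n (\<Sum>p\<in>branches d n b. ?A p (?u p)) (K (\<Sum>p\<in>branches d n b. ?A p (?u p)))"
    using expansion[OF v] by (simp add: case_prod_beta')
  also have "\<dots> = (\<Sum>q\<in>branches d n b. \<Sum>p\<in>branches d n b. tinner d n (?A p (?u p)) (?A q (K (?u q))))"
    unfolding tlinear_sum[OF K(1)] tinner_sum_left tinner_sum_right
    by (intro sum.cong refl) (auto simp: Kg split: prod.split)
  also have "\<dots> = (\<Sum>q\<in>branches d n b. \<Sum>p\<in>branches d n b. if p = q then tinner d n (?u q) (K (?u q)) else 0)"
  proof (intro sum.cong refl)
    fix p q assume pq: "p \<in> branches d n b" "q \<in> branches d n b"
    obtain lam j mu k where e: "p = (lam, j)" "q = (mu, k)" by (cases p, cases q)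
    have P: "partition_of d n lam" "j < mdim lam" "partition_of d n mu" "k < mdim mu" using pq e by (auto simp: branches_def)
    note Q = branch_vec_Q[OF pq(1)[unfolded e], of v] KQ[OF P(3) branch_vec_Q[OF pq(2)[unfolded e], of v]]
    show "tinner d n (?A p (?u p)) (?A q (K (?u q))) = (if p = q then tinner d n (?u q) (K (?u q)) else 0)"
    proof (cases "lam = mu")
      case True
      then show ?thesis using galg_inner[OF P(1,2), of k "?u p" "K (?u q)"] P Q e by auto
    next
      case False
      then show ?thesis using galg_inner_orthogonal[OF P(1,3) False Q] e by simp
    qed
  qed
  also have "\<dots> = (\<Sum>p\<in>branches d n b. tinner d n (?u p) (K (?u p)))" using finite_branches by simp
  finally show ?thesis .
qed

lemma branch_orthonormal:
  assumes "(lam, j) \<in> branches d n b" shows "orthonormal_on d n {..<Qdim lam} (\<lambda>i. b lam i j)"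
  using assms basis_orthonormal[of lam j _ lam j] by (auto simp: orthonormal_on_def branches_def)

lemma branch_proj_eq:
  assumes "(lam, j) \<in> branches d n b"
  shows "branch_proj d n b (lam, j) v = (\<Sum>i<Qdim lam. tscale (tinner d n (b lam i j) v) (b lam i j))"
  using orth_proj_orthonormal[OF branch_orthonormal[OF assms], of v] basis_tensor_space assms
  by (auto simp: branch_proj_def branches_def)

lemma branch_norm_eq:
  assumes br: "br \<in> branches d n b"
  shows "tnorm d n (branch_proj d n b br v) = tnorm d n (branch_vec v br)"
proof -
  obtain lam j where e: "br = (lam, j)" by (cases br)
  have l: "(lam, j) \<in> branches d n b" using br e by simp
  have p: "partition_of d n lam" using l by (simp add: branches_def)
  have "tinner d n (branch_proj d n b br v) (branch_proj d n b br v) = tinner d n (branch_vec v br) (branch_vec v br)"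
    unfolding e branch_proj_eq[OF l] branch_vec_def prod.case
      orthonormal_on_sum_inner[OF branch_orthonormal[OF l] finite_lessThan]
      orthonormal_on_sum_inner[OF Q_basis(1)[OF p] finite_lessThan] ..
  then have "(tnorm d n (branch_proj d n b br v))\<^sup>2 = (tnorm d n (branch_vec v br))\<^sup>2"
    unfolding tinner_self of_real_eq_iff .
  then show ?thesis by (simp add: tnorm_def L2_set_nonneg)
qed

text \<open>The projection overlaps only the basis vectors of its own branch, and the transposition
  sends their index \<open>j\<close> to 0.\<close>

lemma branch_swap_proj:
  assumes br: "br \<in> branches d n b"
  shows "branch_swap d n b br (branch_proj d n b br v) = branch_vec v br"
proof -
  obtain lam j where e: "br = (lam, j)" by (cases br)
  have l: "(lam, j) \<in> branches d n b" using br e by simp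
  have p: "partition_of d n lam" "j < mdim lam" using l by (auto simp: branches_def)
  let ?c = "\<lambda>i. tinner d n (b lam i j) v"
  have c: "tinner d n (b mu l k) (branch_proj d n b br v) = (if (mu, k) = br then ?c l else 0)"
    if mu: "partition_of d n mu" "k < mdim mu" "l < Qdim mu" for mu k l
  proof -
    have "tinner d n (b mu l k) (branch_proj d n b br v)
      = (\<Sum>i<Qdim lam. ?c i * (if mu = lam \<and> l = i \<and> k = j then 1 else 0))"
      unfolding e branch_proj_eq[OF l] tinner_sum_right tinner_scale_right
      by (rule sum.cong) (use basis_orthonormal[OF mu p] in auto)
    also have "\<dots> = (if (mu, k) = br then ?c l else 0)"
      using mu(3) by (cases "(mu, k) = br") (auto simp: e if_distrib cong: if_cong)
    finally show ?thesis .
  qed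
  have "branch_swap d n b br (branch_proj d n b br v)
    = (\<Sum>q\<in>branches d n b. if q = br then branch_vec v br else 0)"
    unfolding branch_swap_def e prod.case
  proof (rule sum.cong[OF refl])
    fix q assume q: "q \<in> branches d n b"
    obtain mu k where q': "q = (mu, k)" by (cases q)
    have mu: "partition_of d n mu" "k < mdim mu" using q q' by (auto simp: branches_def)
    have "(\<Sum>i<Qdim mu. tscale (tinner d n (b mu i k) (branch_proj d n b br v)) (b mu i (if mu = lam then swap 0 j k else k)))
      = (\<Sum>i<Qdim mu. tscale (if (mu, k) = br then ?c i else 0) (b mu i (if mu = lam then swap 0 j k else k)))"
      by (rule sum.cong) (auto simp: c[OF mu])
    also have "\<dots> = (if q = br then branch_vec v br else 0)"
      by (auto simp: q' e branch_vec_def)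
    finally show "(case q of (lam', j') \<Rightarrow> \<Sum>i<Qdim lam'. tscale (tinner d n (b lam' i j') (branch_proj d n b (lam, j) v))
        (b lam' i (if lam' = lam then swap 0 j j' else j'))) = (if q = (lam, j) then branch_vec v (lam, j) else 0)"
      by (simp add: q' e)
  qed
  then show ?thesis using finite_branches br by simp
qed

text \<open>A nonzero coefficient of \<open>v\<close> is an inner product with a combination of
  permuted values of the Young symmetrizer. Moving permutation and symmetrizer onto \<open>v\<close>
  shows that the column antisymmetrizer does not kill every permuted \<open>v\<close>. This will
  bound the number of rows.\<close>

lemma branch_vec_nonzero:
  assumes br: "(lam, j) \<in> branches d n b" and nz: "branch_vec v (lam, j) \<noteq> 0"
  obtains g where "g permutes {..<n}" "color_sum n True (col_of lam) (perm_op g v) \<noteq> 0"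
proof -
  have p: "partition_of d n lam" "j < mdim lam" using br by (auto simp: branches_def)
  obtain i where i: "i < Qdim lam" "tinner d n (b lam i j) v \<noteq> 0"
    using nz unfolding branch_vec_def prod.case
    by (metis (no_types, lifting) lessThan_iff sum.not_neutral_contains_not_neutral tens.scale_eq_0_iff)
  obtain z where z: "b lam i 0 = young lam z" using Q_basis_mem[OF p(1) i(1)] by (auto simp: Q_space_def)
  have "tinner d n (galg (coef lam j) (b lam i 0)) v \<noteq> 0" using i(2) basis_eq[OF p i(1)] by simp
  then obtain \<pi> where \<pi>: "\<pi> permutes {..<n}" "tinner d n (perm_op \<pi> (b lam i 0)) v \<noteq> 0"
    unfolding galg_def tinner_sum_left tinner_scale_left
    by (metis (no_types, lifting) mem_Collect_eq mult_zero_right sum.not_neutral_contains_not_neutral)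
  have "color_sum n True (col_of lam) (color_sum n False (row_of lam) (perm_op (pinv \<pi>) v)) \<noteq> 0"
  proof
    assume "color_sum n True (col_of lam) (color_sum n False (row_of lam) (perm_op (pinv \<pi>) v)) = 0"
    then have "tinner d n (young lam z) (perm_op (pinv \<pi>) v) = 0"
      by (simp add: young_eq partition_sum[OF p(1)] color_sum_adjoint)
    then show False using \<pi> z by (simp add: tinner_perm_op_left)
  qed
  moreover have "color_sum n True (col_of lam) (color_sum n False (row_of lam) (perm_op (pinv \<pi>) v))
    = (\<Sum>\<sigma>\<in>color_group n (row_of lam). color_sum n True (col_of lam) (perm_op (\<sigma> \<circ> pinv \<pi>) v))"
    by (simp add: color_sum_def[of n False] chi_def tlinear_sum[OF tlinear_color_sum] perm_op_comp)
  ultimately obtain \<sigma> where "\<sigma> \<in> color_group n (row_of lam)" "color_sum n True (col_of lam) (perm_op (\<sigma> \<circ> pinv \<pi>) v) \<noteq> 0"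
    by (metis (no_types, lifting) sum.not_neutral_contains_not_neutral)
  then show ?thesis using that permutes_compose[OF permutes_inv[OF \<pi>(1)] color_group_permutes] by blast
qed

end

subsection \<open>Operators on one tensor factor\<close>

definition site_op :: "nat \<Rightarrow> nat \<Rightarrow> (nat \<Rightarrow> nat \<Rightarrow> complex) \<Rightarrow> nat \<Rightarrow> tens \<Rightarrow> tens" where
  "site_op d n A x v = (\<lambda>e. if e \<in> strings d n then \<Sum>q<d. A (e x) q * v (e(x := q)) else 0)"

definition sites_op :: "nat \<Rightarrow> nat \<Rightarrow> (nat \<Rightarrow> nat \<Rightarrow> complex) \<Rightarrow> nat set \<Rightarrow> tens \<Rightarrow> tens" where
  "sites_op d n A S v = (\<Sum>x\<in>S. site_op d n A x v)"

definition mat_mul :: "nat \<Rightarrow> (nat \<Rightarrow> nat \<Rightarrow> complex) \<Rightarrow> (nat \<Rightarrow> nat \<Rightarrow> complex) \<Rightarrow> nat \<Rightarrow> nat \<Rightarrow> complex" where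
  "mat_mul d A B = (\<lambda>p q. \<Sum>k<d. A p k * B k q)"

definition mat_tr :: "nat \<Rightarrow> (nat \<Rightarrow> nat \<Rightarrow> complex) \<Rightarrow> complex" where
  "mat_tr d A = (\<Sum>k<d. A k k)"

lemma strings_upd: "e \<in> strings d n \<Longrightarrow> x < n \<Longrightarrow> q < d \<Longrightarrow> e(x := q) \<in> strings d n"
  by (auto simp: strings_def PiE_iff extensional_def)

lemma strings_less: "e \<in> strings d n \<Longrightarrow> x < n \<Longrightarrow> e x < d"
  by (auto simp: strings_def)

lemma site_op_tensor_space: "site_op d n A x v \<in> tensor_space d n"
  by (simp add: tensor_space_iff site_op_def)

lemma tlinear_site_op: "tlinear (site_op d n A x)"
  by (intro tlinearI) (auto simp: site_op_def tscale_def plus_fun_apply fun_eq_iff algebra_simps sum.distrib sum_distrib_left)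

lemma tlinear_sites_op: "tlinear (sites_op d n A S)"
  unfolding sites_op_def[abs_def] by (intro tlinear_sum_fun tlinear_site_op)

lemma sites_op_tensor_space: "sites_op d n A S v \<in> tensor_space d n"
  unfolding sites_op_def by (rule tens.subspace_sum[OF subspace_tensor_space site_op_tensor_space])

lemma site_op_perm:
  assumes g: "g permutes {..<n}"
  shows "perm_op g (site_op d n A x v) = site_op d n A (g x) (perm_op g v)"
proof
  fix e :: "nat \<Rightarrow> nat"
  have "(e \<circ> g)(x := q) = e(g x := q) \<circ> g" for q
    using inj_eq[OF permutes_inj[OF g]] by (auto simp: fun_eq_iff)
  then show "perm_op g (site_op d n A x v) e = site_op d n A (g x) (perm_op g v) e"
    by (simp add: perm_op_def site_op_def strings_comp_permutes[OF g])
qed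

lemma sites_op_perm:
  assumes g: "g permutes {..<n}" and S: "g ` S = S"
  shows "perm_op g (sites_op d n A S v) = sites_op d n A S (perm_op g v)"
proof -
  have "perm_op g (sites_op d n A S v) = (\<Sum>x\<in>S. site_op d n A (g x) (perm_op g v))"
    by (simp add: sites_op_def tlinear_sum[OF tlinear_perm_op] site_op_perm[OF g])
  also have "\<dots> = (\<Sum>x\<in>g ` S. site_op d n A x (perm_op g v))"
    by (subst sum.reindex) (auto intro: inj_on_subset[OF permutes_inj[OF g]])
  finally show ?thesis by (simp add: S sites_op_def)
qed

lemma sites_op_color_sym:
  assumes "color_sym n False f v"
  shows "color_sym n False f (sites_op d n A {x. x < n \<and> f x = i} v)"
  unfolding color_sym_def
proof
  fix \<pi> assume p: "\<pi> \<in> color_group n f"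
  note pp = color_group_permutes[OF p]
  let ?S = "{x. x < n \<and> f x = i}"
  have "\<pi> ` ?S \<subseteq> ?S" using color_group_color[OF p] permutes_in_image[OF pp] by auto
  then have "\<pi> ` ?S = ?S" by (intro endo_inj_surj inj_on_subset[OF permutes_inj[OF pp]]) auto
  from sites_op_perm[OF pp this] show "perm_op \<pi> (sites_op d n A ?S v) = tscale (chi False \<pi>) (sites_op d n A ?S v)"
    using assms p by (simp add: color_sym_def chi_def)
qed

text \<open>Exchanging the symbol at \<open>x\<close> with the summation variable is an involution
  of the pairs. It moves an operator from the column index of a kernel onto the vector.\<close>

lemma sum_strings_swap:
  assumes x: "x < n"
  shows "(\<Sum>f\<in>strings d n. \<Sum>q<d. X f q) = (\<Sum>f\<in>strings d n. \<Sum>q<d. X (f(x := q)) (f x))"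
  unfolding sum.cartesian_product
  by (rule sum.reindex_bij_witness[where i = "\<lambda>(f, q). (f(x := q), f x)" and j = "\<lambda>(f, q). (f(x := q), f x)"])
    (use x in \<open>auto simp: strings_upd strings_less\<close>)

lemma sum_site_op:
  assumes x: "x < n"
  shows "(\<Sum>f\<in>strings d n. (\<Sum>q<d. A q (f x) * M (f(x := q))) * w f) = (\<Sum>f\<in>strings d n. M f * site_op d n A x w f)"
proof -
  have "(\<Sum>f\<in>strings d n. (\<Sum>q<d. A q (f x) * M (f(x := q))) * w f) = (\<Sum>f\<in>strings d n. \<Sum>q<d. A q (f x) * M (f(x := q)) * w f)"
    by (simp add: sum_distrib_right)
  also have "\<dots> = (\<Sum>f\<in>strings d n. \<Sum>q<d. A (f x) q * M f * w (f(x := q)))"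
    by (subst sum_strings_swap[OF x]) simp
  also have "\<dots> = (\<Sum>f\<in>strings d n. M f * site_op d n A x w f)"
    by (rule sum.cong) (auto simp: site_op_def sum_distrib_left mult_ac)
  finally show ?thesis .
qed

lemma sum_sites_op:
  assumes S: "S \<subseteq> {..<n}"
  shows "(\<Sum>f\<in>strings d n. (\<Sum>x\<in>S. \<Sum>q<d. A q (f x) * M (f(x := q))) * w f) = (\<Sum>f\<in>strings d n. M f * sites_op d n A S w f)"
proof -
  have "(\<Sum>f\<in>strings d n. (\<Sum>x\<in>S. \<Sum>q<d. A q (f x) * M (f(x := q))) * w f)
    = (\<Sum>x\<in>S. \<Sum>f\<in>strings d n. (\<Sum>q<d. A q (f x) * M (f(x := q))) * w f)"
    by (subst sum.swap) (simp add: sum_distrib_right)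
  also have "\<dots> = (\<Sum>x\<in>S. \<Sum>f\<in>strings d n. M f * site_op d n A x w f)"
    by (rule sum.cong[OF refl], rule sum_site_op) (use S in auto)
  also have "\<dots> = (\<Sum>f\<in>strings d n. M f * sites_op d n A S w f)"
    by (subst sum.swap) (simp add: sites_op_def sum_apply sum_distrib_left)
  finally show ?thesis .
qed

text \<open>The ratio of consecutive normalizations is \<open>(s + d) / (s + 1)\<close>. It cancels
  the factor \<open>s + d\<close> of the moment recursion against the \<open>s + 1\<close> equal
  terms that the recursion yields on symmetric vectors.\<close>

lemma sym_dim_Suc: "1 \<le> d \<Longrightarrow> Suc s * sym_dim d (Suc s) = (s + d) * sym_dim d s"
proof -
  assume "1 \<le> d"
  then obtain m where m: "d = Suc m" by (cases d) auto
  have "sym_dim d s = (s + m choose s)" for s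
    by (simp add: sym_dim_def m binomial_symmetric[of s "s + m"])
  then show ?thesis using Suc_times_binomial[of s "s + m"] by (simp add: m)
qed

lemma sym_dim_0 [simp]: "sym_dim d 0 = 1"
  by (simp add: sym_dim_def)

subsection \<open>Moments of independent projectors\<close>

context haar
begin

lemma moment_cong:
  assumes "\<And>x. x \<in> S \<Longrightarrow> a x = a' x" "\<And>x. x \<in> S \<Longrightarrow> c x = c' x"
  shows "moment S a c = moment S a' c'"
proof -
  have "entries S a c = entries S a' c'" unfolding entries_def[abs_def] by (intro ext prod.cong) (use assms in auto)
  then show ?thesis by (simp add: moment_def)
qed

lemma moment_empty: "moment {} a c = 1"
  by (simp add: moment_def entries_def prob_space)

text \<open>The joint moment of \<open>k\<close> independent projectors; the position
  \<open>x\<close> uses the projector with index \<open>r x\<close>, so independence makes it a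
  product over the rows.\<close>

definition row_moment :: "nat \<Rightarrow> (nat \<Rightarrow> nat) \<Rightarrow> nat set \<Rightarrow> (nat \<Rightarrow> nat) \<Rightarrow> (nat \<Rightarrow> nat) \<Rightarrow> complex" where
  "row_moment k r S a c = (\<Prod>i<k. moment {x \<in> S. r x = i} a c)"

lemma row_moment_cong:
  assumes "\<And>x. x \<in> S \<Longrightarrow> a x = a' x" "\<And>x. x \<in> S \<Longrightarrow> c x = c' x" "\<And>x. x \<in> S \<Longrightarrow> r x = r' x"
  shows "row_moment k r S a c = row_moment k r' S a' c'"
  unfolding row_moment_def
proof (rule prod.cong[OF refl])
  fix i
  have "{x \<in> S. r x = i} = {x \<in> S. r' x = i}" using assms(3) by auto
  then show "moment {x \<in> S. r x = i} a c = moment {x \<in> S. r' x = i} a' c'"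
    using assms by (auto intro!: moment_cong)
qed

lemma row_moment_insert:
  assumes S: "finite S" "\<And>x. x \<in> S \<Longrightarrow> a x < d" "\<And>x. x \<in> S \<Longrightarrow> c x < d"
    and y: "y \<notin> S" "a y < d" "c y < d" "r y < k"
  shows "(of_nat (card {x \<in> S. r x = r y}) + of_nat d) * row_moment k r (insert y S) a c
    = (if a y = c y then row_moment k r S a c else 0)
      + (\<Sum>x | x \<in> S \<and> r x = r y. if a y = c x then row_moment k r S a (c(x := c y)) else 0)"
proof -
  let ?R = "{x \<in> S. r x = r y}"
  define P where "P c = (\<Prod>i\<in>{..<k} - {r y}. moment {x \<in> S. r x = i} a c)" for c
  have split: "row_moment k r S a c = moment ?R a c * P c" for c
    unfolding row_moment_def P_def by (rule prod.remove) (use y in auto)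
  have "row_moment k r (insert y S) a c = moment {x \<in> insert y S. r x = r y} a c * (\<Prod>i\<in>{..<k} - {r y}. moment {x \<in> insert y S. r x = i} a c)"
    unfolding row_moment_def by (rule prod.remove) (use y in auto)
  also have "{x \<in> insert y S. r x = r y} = insert y ?R" by auto
  also have "(\<Prod>i\<in>{..<k} - {r y}. moment {x \<in> insert y S. r x = i} a c) = P c"
    unfolding P_def
  proof (rule prod.cong[OF refl])
    fix i assume "i \<in> {..<k} - {r y}"
    then have "{x \<in> insert y S. r x = i} = {x \<in> S. r x = i}" by auto
    then show "moment {x \<in> insert y S. r x = i} a c = moment {x \<in> S. r x = i} a c" by simp
  qed
  finally have e: "row_moment k r (insert y S) a c = moment (insert y ?R) a c * P c" .
  have Pu: "P (c(x := c y)) = P c" if "x \<in> ?R" for x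
    unfolding P_def by (intro prod.cong moment_cong refl) (use that in auto)
  have "(of_nat (card ?R) + of_nat d) * row_moment k r (insert y S) a c
    = ((if a y = c y then moment ?R a c else 0) + (\<Sum>x\<in>?R. if a y = c x then moment ?R a (c(x := c y)) else 0)) * P c"
    unfolding e mult.assoc[symmetric] by (subst moment_insert) (use S y in auto)
  also have "\<dots> = (if a y = c y then row_moment k r S a c else 0) + (\<Sum>x\<in>?R. if a y = c x then row_moment k r S a (c(x := c y)) else 0)"
    unfolding split distrib_right sum_distrib_right by (intro arg_cong2[where f = "(+)"] sum.cong refl) (auto simp: Pu)
  finally show ?thesis .
qed

lemma row_moment_integral:
  assumes S: "finite S" "\<And>x. x \<in> S \<Longrightarrow> a x < d" "\<And>x. x \<in> S \<Longrightarrow> c x < d" "\<And>x. x \<in> S \<Longrightarrow> r x < k"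
  shows "row_moment k r S a c = (\<integral>\<psi>. (\<Prod>x\<in>S. \<psi> (r x) $$ (a x, c x)) \<partial>Pi\<^sub>M {..<k} (\<lambda>_. \<mu>))"
proof -
  interpret product_sigma_finite "\<lambda>_::nat. \<mu>" by unfold_locales
  have "(\<integral>\<psi>. (\<Prod>x\<in>S. \<psi> (r x) $$ (a x, c x)) \<partial>Pi\<^sub>M {..<k} (\<lambda>_. \<mu>))
    = (\<integral>\<psi>. (\<Prod>i<k. entries {x \<in> S. r x = i} a c (\<psi> i)) \<partial>Pi\<^sub>M {..<k} (\<lambda>_. \<mu>))"
  proof (rule Bochner_Integration.integral_cong[OF refl])
    fix \<psi> :: "nat \<Rightarrow> complex mat"
    have "(\<Prod>x\<in>S. \<psi> (r x) $$ (a x, c x)) = (\<Prod>i<k. \<Prod>x\<in>{x \<in> S. r x = i}. \<psi> (r x) $$ (a x, c x))"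
      by (rule prod.group[symmetric]) (use S in auto)
    also have "\<dots> = (\<Prod>i<k. entries {x \<in> S. r x = i} a c (\<psi> i))"
      unfolding entries_def by (intro prod.cong refl) auto
    finally show "(\<Prod>x\<in>S. \<psi> (r x) $$ (a x, c x)) = (\<Prod>i<k. entries {x \<in> S. r x = i} a c (\<psi> i))" .
  qed
  also have "\<dots> = (\<Prod>i<k. \<integral>\<psi>. entries {x \<in> S. r x = i} a c \<psi> \<partial>\<mu>)"
    by (rule product_integral_prod) (use S in \<open>auto intro!: entries_integrable\<close>)
  finally show ?thesis by (simp add: row_moment_def moment_def)
qed

text \<open>Contracting the recursion with \<open>A\<close> traces out the copy at \<open>y\<close>:
  the diagonal term becomes the trace of \<open>A\<close>, and each transposed term becomes an
  action of \<open>A\<close> on a position of the same row.\<close>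

lemma row_moment_contract:
  assumes S: "finite S" "\<And>x. x \<in> S \<Longrightarrow> a x < d" "\<And>x. x \<in> S \<Longrightarrow> c x < d" and y: "y \<notin> S" "r y < k"
  shows "(of_nat (card {x \<in> S. r x = r y}) + of_nat d) * (\<Sum>p<d. \<Sum>q<d. A q p * row_moment k r (insert y S) (a(y := p)) (c(y := q)))
    = mat_tr d A * row_moment k r S a c + (\<Sum>x | x \<in> S \<and> r x = r y. \<Sum>q<d. A q (c x) * row_moment k r S a (c(x := q)))"
proof -
  let ?R = "{x. x \<in> S \<and> r x = r y}" and ?m = "row_moment k r S a"
  have e: "(of_nat (card ?R) + of_nat d) * (A q p * row_moment k r (insert y S) (a(y := p)) (c(y := q)))
    = (if q = p then A q p * ?m c else 0) + (\<Sum>x\<in>?R. if p = c x then A q p * ?m (c(x := q)) else 0)"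
    if pq: "p < d" "q < d" for p q
  proof -
    define a' where "a' = a(y := p)"
    define c' where "c' = c(y := q)"
    have ay: "a' y = p" "c' y = q" by (simp_all add: a'_def c'_def)
    have ax: "a' x = a x" "c' x = c x" if "x \<in> S" for x using that y by (auto simp: a'_def c'_def)
    have up: "row_moment k r S a' c' = ?m c"
      by (rule row_moment_cong) (use ax in auto)
    have up': "row_moment k r S a' (c'(x := q)) = ?m (c(x := q))" for x
      by (rule row_moment_cong) (use ax in auto)
    have "(of_nat (card ?R) + of_nat d) * row_moment k r (insert y S) a' c'
      = (if a' y = c' y then row_moment k r S a' c' else 0) + (\<Sum>x\<in>?R. if a' y = c' x then row_moment k r S a' (c'(x := c' y)) else 0)"
      by (rule row_moment_insert) (use S y pq in \<open>auto simp: ay ax\<close>)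
    also have "(\<Sum>x\<in>?R. if a' y = c' x then row_moment k r S a' (c'(x := c' y)) else 0) = (\<Sum>x\<in>?R. if p = c x then ?m (c(x := q)) else 0)"
      unfolding ay up' by (rule sum.cong) (auto simp: ax)
    finally have "A q p * ((of_nat (card ?R) + of_nat d) * row_moment k r (insert y S) a' c')
      = A q p * ((if p = q then ?m c else 0) + (\<Sum>x\<in>?R. if p = c x then ?m (c(x := q)) else 0))" by (simp only: ay up)
    also have "\<dots> = (if q = p then A q p * ?m c else 0) + (\<Sum>x\<in>?R. if p = c x then A q p * ?m (c(x := q)) else 0)"
      unfolding distrib_left sum_distrib_left by (intro arg_cong2[where f = "(+)"] sum.cong refl) auto
    finally show ?thesis by (simp only: a'_def c'_def mult.left_commute)
  qed
  have "(of_nat (card ?R) + of_nat d) * (\<Sum>p<d. \<Sum>q<d. A q p * row_moment k r (insert y S) (a(y := p)) (c(y := q)))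
    = (\<Sum>p<d. \<Sum>q<d. (if q = p then A q p * ?m c else 0) + (\<Sum>x\<in>?R. if p = c x then A q p * ?m (c(x := q)) else 0))"
    unfolding sum_distrib_left by (intro sum.cong refl e) auto
  also have "\<dots> = (\<Sum>p<d. \<Sum>q<d. if q = p then A q p * ?m c else 0) + (\<Sum>p<d. \<Sum>q<d. \<Sum>x\<in>?R. if p = c x then A q p * ?m (c(x := q)) else 0)"
    by (simp only: sum.distrib)
  also have "(\<Sum>p<d. \<Sum>q<d. if q = p then A q p * ?m c else 0) = mat_tr d A * ?m c"
    by (simp add: mat_tr_def sum_distrib_right)
  also have "(\<Sum>p<d. \<Sum>q<d. \<Sum>x\<in>?R. if p = c x then A q p * ?m (c(x := q)) else 0)
    = (\<Sum>p<d. \<Sum>x\<in>?R. \<Sum>q<d. if p = c x then A q p * ?m (c(x := q)) else 0)"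
    by (intro sum.cong refl sum.swap)
  also have "\<dots> = (\<Sum>x\<in>?R. \<Sum>p<d. if p = c x then (\<Sum>q<d. A q p * ?m (c(x := q))) else 0)"
    by (subst sum.swap) (intro sum.cong refl, auto)
  also have "\<dots> = (\<Sum>x\<in>?R. \<Sum>q<d. A q (c x) * ?m (c(x := q)))"
    by (rule sum.cong[OF refl], rule sum_delta_less(1)) (use S in auto)
  finally show ?thesis .
qed

text \<open>Induction on \<open>S\<close>, where the strings in the sum are free on \<open>S\<close>
  and agree with \<open>e\<close> elsewhere. By the recursion a new position \<open>y\<close> yields
  one diagonal term and one term per \<open>x\<close> of its row. The symmetry of \<open>w\<close>
  under the transposition of \<open>x\<close> and \<open>y\<close> makes all of them equal to the
  sum for \<open>S\<close>, and \<open>sym_dim_Suc\<close> absorbs their number.\<close>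

lemma row_moment_symmetric_aux:
  assumes w: "color_sym n False r w" and r: "\<And>x. x < n \<Longrightarrow> r x < k" and d: "1 \<le> d" and e: "e \<in> strings d n"
    and S: "S \<subseteq> {..<n}"
  shows "of_nat (\<Prod>i<k. sym_dim d (card {x \<in> S. r x = i})) *
    (\<Sum>f | f \<in> strings d n \<and> (\<forall>x\<in>{..<n} - S. f x = e x). row_moment k r S e f * w f) = w e"
  using finite_subset[OF S finite_lessThan] S
proof (induction rule: finite_induct)
  case empty
  have "{f \<in> strings d n. \<forall>x\<in>{..<n} - {}. f x = e x} = {e}"
    using e by (auto simp: strings_def intro: PiE_ext)
  then show ?case by (simp add: row_moment_def moment_empty)
next
  case (insert y S)
  define F where "F S = {f \<in> strings d n. \<forall>x\<in>{..<n} - S. f x = e x}" for S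
  define \<kappa> where "\<kappa> S = (\<Prod>i<k. sym_dim d (card {x \<in> S. r x = i}))" for S
  define T where "T S = (\<Sum>f\<in>F S. row_moment k r S e f * w f)" for S
  define s where "s = card {x \<in> S. r x = r y}"
  have y: "y < n" "y \<notin> S" and Sn: "S \<subseteq> {..<n}" using insert by auto
  have IH: "of_nat (\<kappa> S) * T S = w e" using insert.IH[OF Sn] by (simp add: \<kappa>_def T_def F_def)
  have finF: "finite (F S)" for S by (simp add: F_def)
  have fd: "f x < d" if "f \<in> F S" "x < n" for f S x using that strings_less by (auto simp: F_def)
  have ed: "e x < d" if "x < n" for x using e that strings_less by auto
  have "(of_nat s + of_nat d) * T (insert y S) = (\<Sum>f\<in>F (insert y S). (of_nat s + of_nat d) * row_moment k r (insert y S) e f * w f)"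
    by (simp add: T_def sum_distrib_left mult.assoc)
  also have "\<dots> = (\<Sum>f\<in>F (insert y S). ((if e y = f y then row_moment k r S e f else 0)
      + (\<Sum>x | x \<in> S \<and> r x = r y. if e y = f x then row_moment k r S e (f(x := f y)) else 0)) * w f)"
  proof (rule sum.cong[OF refl])
    fix f assume f: "f \<in> F (insert y S)"
    have "(of_nat s + of_nat d) * row_moment k r (insert y S) e f = (if e y = f y then row_moment k r S e f else 0)
      + (\<Sum>x | x \<in> S \<and> r x = r y. if e y = f x then row_moment k r S e (f(x := f y)) else 0)"
      unfolding s_def by (rule row_moment_insert) (use insert.hyps y Sn fd[OF f] ed r in auto)
    then show "(of_nat s + of_nat d) * row_moment k r (insert y S) e f * w f = ((if e y = f y then row_moment k r S e f else 0)
      + (\<Sum>x | x \<in> S \<and> r x = r y. if e y = f x then row_moment k r S e (f(x := f y)) else 0)) * w f" by simp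
  qed
  also have "\<dots> = (\<Sum>f\<in>F (insert y S). (if e y = f y then row_moment k r S e f * w f else 0))
      + (\<Sum>f\<in>F (insert y S). \<Sum>x | x \<in> S \<and> r x = r y. if e y = f x then row_moment k r S e (f(x := f y)) * w f else 0)"
    unfolding sum.distrib[symmetric] by (rule sum.cong) (auto simp: distrib_right sum_distrib_right intro!: sum.cong)
  also have "(\<Sum>f\<in>F (insert y S). (if e y = f y then row_moment k r S e f * w f else 0)) = T S"
  proof -
    have "F S = {f \<in> F (insert y S). e y = f y}" using y by (auto simp: F_def)
    then show ?thesis by (simp add: T_def sum.inter_filter[OF finF])
  qed
  also have "(\<Sum>f\<in>F (insert y S). \<Sum>x | x \<in> S \<and> r x = r y. if e y = f x then row_moment k r S e (f(x := f y)) * w f else 0)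
    = (\<Sum>x | x \<in> S \<and> r x = r y. T S)"
  proof (subst sum.swap, rule sum.cong[OF refl])
    fix x assume x: "x \<in> {x. x \<in> S \<and> r x = r y}"
    then have xn: "x < n" "x \<noteq> y" using Sn y by auto
    have sw: "w (f \<circ> swap x y) = w f" for f
    proof -
      have "perm_op (swap x y) w = w"
        using w swap_color_group[of x n y r] x xn y by (simp add: color_sym_def chi_def)
      then show ?thesis unfolding perm_op_def by (rule fun_cong)
    qed
    have p: "swap x y permutes {..<n}" using xn y by (intro permutes_swap_id) auto
    have "(\<Sum>f\<in>F (insert y S). if e y = f x then row_moment k r S e (f(x := f y)) * w f else 0)
      = (\<Sum>f\<in>{f \<in> F (insert y S). e y = f x}. row_moment k r S e (f(x := f y)) * w f)"
      by (simp add: sum.inter_filter[OF finF])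
    also have "\<dots> = (\<Sum>f\<in>F S. row_moment k r S e f * w f)"
    proof (rule sum.reindex_bij_witness[where i = "\<lambda>f. f \<circ> swap x y" and j = "\<lambda>f. f \<circ> swap x y"])
      fix f assume f: "f \<in> {f \<in> F (insert y S). e y = f x}"
      show "f \<circ> swap x y \<circ> swap x y = f" by (simp add: comp_assoc)
      show "f \<circ> swap x y \<in> F S"
        using f x xn y strings_comp_permutes[OF p] by (auto simp: F_def Transposition.transpose_def)
      have "row_moment k r S e (f \<circ> swap x y) = row_moment k r S e (f(x := f y))"
        by (rule row_moment_cong) (use y xn in \<open>auto simp: Transposition.transpose_def\<close>)
      then show "row_moment k r S e (f \<circ> swap x y) * w (f \<circ> swap x y) = row_moment k r S e (f(x := f y)) * w f"
        by (simp add: sw)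
    next
      fix f assume f: "f \<in> F S"
      show "f \<circ> swap x y \<circ> swap x y = f" by (simp add: comp_assoc)
      show "f \<circ> swap x y \<in> {f \<in> F (insert y S). e y = f x}"
        using f x xn y strings_comp_permutes[OF p] by (auto simp: F_def Transposition.transpose_def)
    qed
    finally show "(\<Sum>f\<in>F (insert y S). if e y = f x then row_moment k r S e (f(x := f y)) * w f else 0) = T S"
      by (simp add: T_def)
  qed
  finally have 1: "(of_nat s + of_nat d) * T (insert y S) = of_nat (Suc s) * T S"
    by (simp add: s_def algebra_simps)
  have 2: "Suc s * \<kappa> (insert y S) = (s + d) * \<kappa> S"
  proof -
    define P where "P = (\<Prod>i\<in>{..<k} - {r y}. sym_dim d (card {x \<in> S. r x = i}))"
    have ry: "r y \<in> {..<k}" using r y by simp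
    have "\<kappa> (insert y S) = sym_dim d (card {x \<in> insert y S. r x = r y}) * (\<Prod>i\<in>{..<k} - {r y}. sym_dim d (card {x \<in> insert y S. r x = i}))"
      unfolding \<kappa>_def by (rule prod.remove[OF _ ry]) simp
    also have "{x \<in> insert y S. r x = r y} = insert y {x \<in> S. r x = r y}" by auto
    also have "card \<dots> = Suc s" using y insert.hyps by (simp add: s_def)
    also have "(\<Prod>i\<in>{..<k} - {r y}. sym_dim d (card {x \<in> insert y S. r x = i})) = P"
      unfolding P_def
    proof (rule prod.cong[OF refl])
      fix i assume "i \<in> {..<k} - {r y}"
      then have "{x \<in> insert y S. r x = i} = {x \<in> S. r x = i}" by auto
      then show "sym_dim d (card {x \<in> insert y S. r x = i}) = sym_dim d (card {x \<in> S. r x = i})" by simp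
    qed
    finally have a: "\<kappa> (insert y S) = sym_dim d (Suc s) * P" .
    have "\<kappa> S = sym_dim d s * P" unfolding \<kappa>_def P_def s_def by (rule prod.remove[OF _ ry]) simp
    then show ?thesis using a sym_dim_Suc[OF d, of s] by (metis mult.assoc)
  qed
  have "of_nat (Suc s) * (of_nat s + of_nat d) * (of_nat (\<kappa> (insert y S)) * T (insert y S))
    = of_nat (Suc s * \<kappa> (insert y S)) * ((of_nat s + of_nat d) * T (insert y S))" by (simp only: of_nat_mult mult_ac)
  also have "\<dots> = of_nat ((s + d) * \<kappa> S) * (of_nat (Suc s) * T S)" by (simp only: 1 2)
  also have "\<dots> = of_nat (Suc s) * (of_nat s + of_nat d) * (of_nat (\<kappa> S) * T S)" by (simp only: of_nat_mult of_nat_add mult_ac)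
  finally have "of_nat (Suc s) * (of_nat s + of_nat d) * (of_nat (\<kappa> (insert y S)) * T (insert y S)) = of_nat (Suc s) * (of_nat s + of_nat d) * w e"
    by (simp only: IH)
  moreover have "of_nat (Suc s) * (of_nat s + of_nat d) \<noteq> (0 :: complex)"
    using d by (simp flip: of_nat_add of_nat_mult del: of_nat_Suc)
  ultimately have "of_nat (\<kappa> (insert y S)) * T (insert y S) = w e" by (metis mult_left_cancel)
  then show ?case by (simp add: \<kappa>_def T_def F_def)
qed

end

section \<open>The row symmetric measurement for one partition\<close>

locale row_measurement = haar d \<mu> for d \<mu> +
  fixes n :: nat and lam :: "nat list"
  assumes d_pos: "1 \<le> d" and lam: "partition_of d n lam"
begin

abbreviation k :: nat where "k \<equiv> length lam"
abbreviation r :: "nat \<Rightarrow> nat" where "r \<equiv> row_of lam"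
abbreviation R :: "nat \<Rightarrow> nat set" where "R i \<equiv> {x. x < n \<and> r x = i}"
abbreviation H :: "(nat \<Rightarrow> complex mat) measure" where "H \<equiv> haar_tuples \<mu> lam"

definition \<kappa> :: complex where
  "\<kappa> = (\<Prod>i<k. of_nat (sym_dim d (lam ! i)))"

lemma sum_lam: "sum_list lam = n"
  using lam by (rule partition_sum)

lemma r_less: "x < n \<Longrightarrow> r x < k"
  using tableau_coords(1)[of x lam] sum_lam by simp

lemma card_R: "i < k \<Longrightarrow> card (R i) = lam ! i"
proof -
  assume i: "i < k"
  have "R i = row_set lam i"
    using row_set_iff[OF i] row_set_subset[OF i] sum_lam by auto
  then show ?thesis using i by (simp add: row_set_def sum_list_take_Suc)
qed

definition M0 :: "(nat \<Rightarrow> nat) \<Rightarrow> (nat \<Rightarrow> nat) \<Rightarrow> complex" where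
  "M0 a c = row_moment k r {..<n} a c"

text \<open>The positions \<open>n\<close> and \<open>n + 1\<close> carry the additional copies of the projectors that are traced against
  an observable.\<close>

definition M1 :: "nat \<Rightarrow> (nat \<Rightarrow> nat \<Rightarrow> complex) \<Rightarrow> (nat \<Rightarrow> nat) \<Rightarrow> (nat \<Rightarrow> nat) \<Rightarrow> complex" where
  "M1 i A a c = (\<Sum>p<d. \<Sum>q<d. A q p * row_moment k (r(n := i)) (insert n {..<n}) (a(n := p)) (c(n := q)))"

definition M2 :: "nat \<Rightarrow> nat \<Rightarrow> (nat \<Rightarrow> nat \<Rightarrow> complex) \<Rightarrow> (nat \<Rightarrow> nat \<Rightarrow> complex) \<Rightarrow> (nat \<Rightarrow> nat) \<Rightarrow> (nat \<Rightarrow> nat) \<Rightarrow> complex" where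
  "M2 i j A B a c = (\<Sum>p<d. \<Sum>q<d. A q p * (\<Sum>p'<d. \<Sum>q'<d. B q' p' *
     row_moment k (r(n := i, Suc n := j)) (insert (Suc n) (insert n {..<n})) (a(n := p, Suc n := p')) (c(n := q, Suc n := q'))))"

definition mapply :: "((nat \<Rightarrow> nat) \<Rightarrow> (nat \<Rightarrow> nat) \<Rightarrow> complex) \<Rightarrow> tens \<Rightarrow> (nat \<Rightarrow> nat) \<Rightarrow> complex" where
  "mapply M w e = (\<Sum>f\<in>strings d n. M e f * w f)"

text \<open>The resolution of the identity: integrated over the projectors, the elements of the
  measurement reproduce row symmetric vectors.\<close>

lemma M0_apply:
  assumes w: "color_sym n False r w" and e: "e \<in> strings d n"
  shows "\<kappa> * mapply M0 w e = w e"
proof -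
  have c: "{x \<in> {..<n}. r x = i} = R i" for i by auto
  have "(\<Prod>i<k. sym_dim d (card {x \<in> {..<n}. r x = i})) = (\<Prod>i<k. sym_dim d (lam ! i))"
    unfolding c by (rule prod.cong) (auto simp: card_R)
  then show ?thesis
    using row_moment_symmetric_aux[OF w r_less d_pos e, of "{..<n}"] by (simp add: \<kappa>_def mapply_def M0_def)
qed

lemma M1_rec:
  assumes ac: "a \<in> strings d n" "c \<in> strings d n" and i: "i < k"
  shows "(of_nat (lam ! i) + of_nat d) * M1 i A a c = mat_tr d A * M0 a c + (\<Sum>x\<in>R i. \<Sum>q<d. A q (c x) * M0 a (c(x := q)))"
proof -
  let ?r = "r(n := i)"
  have R: "{x \<in> {..<n}. ?r x = ?r n} = R i" by auto
  have m: "row_moment k ?r {..<n} a' c' = M0 a' c'" for a' c'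
    unfolding M0_def by (rule row_moment_cong) auto
  have "(of_nat (card {x \<in> {..<n}. ?r x = ?r n}) + of_nat d) * M1 i A a c = mat_tr d A * row_moment k ?r {..<n} a c
    + (\<Sum>x | x \<in> {..<n} \<and> ?r x = ?r n. \<Sum>q<d. A q (c x) * row_moment k ?r {..<n} a (c(x := q)))"
    unfolding M1_def by (rule row_moment_contract) (use ac i in \<open>auto simp: strings_less\<close>)
  then show ?thesis unfolding R m card_R[OF i] .
qed

text \<open>For \<open>i = j\<close> the first copy, at position \<open>n\<close>, belongs to the
  row of the second one. It raises the count by 1 and adds a term in which \<open>B\<close> acts on
  the copy already traced against \<open>A\<close>, that is, the product of \<open>B\<close> and
  \<open>A\<close>.\<close>

lemma M2_rec:
  assumes ac: "a \<in> strings d n" "c \<in> strings d n" and i: "i < k" and j: "j < k"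
  shows "(of_nat (lam ! j) + (if i = j then 1 else 0) + of_nat d) * M2 i j A B a c
    = mat_tr d B * M1 i A a c + (\<Sum>x\<in>R j. \<Sum>q<d. B q (c x) * M1 i A a (c(x := q))) + (if i = j then M1 i (mat_mul d B A) a c else 0)"
proof -
  let ?r = "r(n := i, Suc n := j)" and ?S = "insert n {..<n}"
  define g where "g a c = row_moment k (r(n := i)) ?S a c" for a c
  have m: "row_moment k ?r ?S a' c' = g a' c'" for a' c'
    unfolding g_def by (rule row_moment_cong) auto
  have R: "{x \<in> ?S. ?r x = ?r (Suc n)} = (if i = j then insert n (R j) else R j)" by auto
  have nR: "n \<notin> R j" "finite (R j)" by auto
  have cR: "of_nat (card {x \<in> ?S. ?r x = ?r (Suc n)}) = (of_nat (lam ! j) + (if i = j then 1 else 0) :: complex)"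
    unfolding R using nR card_R[OF j] by simp
  have inner: "(of_nat (lam ! j) + (if i = j then 1 else 0) + of_nat d) * (\<Sum>p'<d. \<Sum>q'<d. B q' p' *
     row_moment k ?r (insert (Suc n) ?S) (a(n := p, Suc n := p')) (c(n := q, Suc n := q')))
     = mat_tr d B * g (a(n := p)) (c(n := q)) + (\<Sum>x\<in>R j. \<Sum>q'<d. B q' (c x) * g (a(n := p)) (c(x := q', n := q)))
       + (if i = j then (\<Sum>q'<d. B q' q * g (a(n := p)) (c(n := q'))) else 0)" if pq: "p < d" "q < d" for p q
  proof -
    define a' where "a' = a(n := p)"
    define c' where "c' = c(n := q)"
    have c'n: "c' n = q" "c'(n := q') = c(n := q')" for q' by (simp_all add: c'_def)
    have c'x: "c' x = c x" "c'(x := q') = c(x := q', n := q)" if "x \<in> R j" for x q'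
      using that by (auto simp: c'_def fun_upd_twist)
    have "(of_nat (card {x \<in> ?S. ?r x = ?r (Suc n)}) + of_nat d) * (\<Sum>p'<d. \<Sum>q'<d. B q' p' *
     row_moment k ?r (insert (Suc n) ?S) (a'(Suc n := p')) (c'(Suc n := q')))
     = mat_tr d B * row_moment k ?r ?S a' c' + (\<Sum>x | x \<in> ?S \<and> ?r x = ?r (Suc n). \<Sum>q'<d. B q' (c' x) * row_moment k ?r ?S a' (c'(x := q')))"
      by (rule row_moment_contract) (use ac pq j in \<open>auto simp: strings_less a'_def c'_def\<close>)
    also have "(\<Sum>x | x \<in> ?S \<and> ?r x = ?r (Suc n). \<Sum>q'<d. B q' (c' x) * row_moment k ?r ?S a' (c'(x := q')))
      = (\<Sum>x\<in>R j. \<Sum>q'<d. B q' (c' x) * g a' (c'(x := q'))) + (if i = j then (\<Sum>q'<d. B q' (c' n) * g a' (c'(n := q'))) else 0)"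
      unfolding R m using nR by (cases "i = j") (simp_all add: add.commute)
    also have "(\<Sum>x\<in>R j. \<Sum>q'<d. B q' (c' x) * g a' (c'(x := q'))) = (\<Sum>x\<in>R j. \<Sum>q'<d. B q' (c x) * g a' (c(x := q', n := q)))"
      by (intro sum.cong refl) (simp only: c'x)
    finally show ?thesis unfolding cR m c'n by (simp only: a'_def c'_def add.assoc)
  qed
  have "(of_nat (lam ! j) + (if i = j then 1 else 0) + of_nat d) * M2 i j A B a c
    = (\<Sum>p<d. \<Sum>q<d. A q p * (mat_tr d B * g (a(n := p)) (c(n := q)) + (\<Sum>x\<in>R j. \<Sum>q'<d. B q' (c x) * g (a(n := p)) (c(x := q', n := q)))
       + (if i = j then (\<Sum>q'<d. B q' q * g (a(n := p)) (c(n := q'))) else 0)))"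
    unfolding M2_def sum_distrib_left[of "of_nat (lam ! j) + (if i = j then 1 else 0) + of_nat d"]
    by (intro sum.cong refl) (simp only: inner[symmetric] lessThan_iff mult.left_commute)
  also have "\<dots> = (\<Sum>p<d. \<Sum>q<d. mat_tr d B * (A q p * g (a(n := p)) (c(n := q))))
     + (\<Sum>p<d. \<Sum>q<d. \<Sum>x\<in>R j. \<Sum>q'<d. B q' (c x) * (A q p * g (a(n := p)) (c(x := q', n := q))))
     + (if i = j then (\<Sum>p<d. \<Sum>q<d. \<Sum>q'<d. B q' q * A q p * g (a(n := p)) (c(n := q'))) else 0)"
  proof -
    have "A q p * (mat_tr d B * g (a(n := p)) (c(n := q)) + (\<Sum>x\<in>R j. \<Sum>q'<d. B q' (c x) * g (a(n := p)) (c(x := q', n := q)))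
       + (if i = j then (\<Sum>q'<d. B q' q * g (a(n := p)) (c(n := q'))) else 0))
      = mat_tr d B * (A q p * g (a(n := p)) (c(n := q))) + (\<Sum>x\<in>R j. \<Sum>q'<d. B q' (c x) * (A q p * g (a(n := p)) (c(x := q', n := q))))
       + (if i = j then (\<Sum>q'<d. B q' q * A q p * g (a(n := p)) (c(n := q'))) else 0)" for p q
      unfolding distrib_left sum_distrib_left
      by (intro arg_cong2[where f = "(+)"] sum.cong refl) (auto simp: sum_distrib_left mult_ac)
    then show ?thesis by (cases "i = j") (simp_all add: sum.distrib)
  qed
  also have "(\<Sum>p<d. \<Sum>q<d. mat_tr d B * (A q p * g (a(n := p)) (c(n := q)))) = mat_tr d B * M1 i A a c"
    by (simp only: M1_def g_def sum_distrib_left)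
  also have "(\<Sum>p<d. \<Sum>q<d. \<Sum>x\<in>R j. \<Sum>q'<d. B q' (c x) * (A q p * g (a(n := p)) (c(x := q', n := q))))
    = (\<Sum>x\<in>R j. \<Sum>q'<d. B q' (c x) * M1 i A a (c(x := q')))"
  proof -
    have "(\<Sum>p<d. \<Sum>q<d. \<Sum>x\<in>R j. \<Sum>q'<d. B q' (c x) * (A q p * g (a(n := p)) (c(x := q', n := q))))
      = (\<Sum>p<d. \<Sum>x\<in>R j. \<Sum>q<d. \<Sum>q'<d. B q' (c x) * (A q p * g (a(n := p)) (c(x := q', n := q))))"
      by (rule sum.cong[OF refl], rule sum.swap)
    also have "\<dots> = (\<Sum>x\<in>R j. \<Sum>p<d. \<Sum>q<d. \<Sum>q'<d. B q' (c x) * (A q p * g (a(n := p)) (c(x := q', n := q))))"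
      by (rule sum.swap)
    also have "\<dots> = (\<Sum>x\<in>R j. \<Sum>p<d. \<Sum>q'<d. \<Sum>q<d. B q' (c x) * (A q p * g (a(n := p)) (c(x := q', n := q))))"
      by (rule sum.cong[OF refl], rule sum.cong[OF refl], rule sum.swap)
    also have "\<dots> = (\<Sum>x\<in>R j. \<Sum>q'<d. \<Sum>p<d. \<Sum>q<d. B q' (c x) * (A q p * g (a(n := p)) (c(x := q', n := q))))"
      by (rule sum.cong[OF refl], rule sum.swap)
    also have "\<dots> = (\<Sum>x\<in>R j. \<Sum>q'<d. B q' (c x) * M1 i A a (c(x := q')))"
      by (simp only: M1_def g_def sum_distrib_left)
    finally show ?thesis .
  qed
  also have "(\<Sum>p<d. \<Sum>q<d. \<Sum>q'<d. B q' q * A q p * g (a(n := p)) (c(n := q'))) = M1 i (mat_mul d B A) a c"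
  proof -
    have "(\<Sum>p<d. \<Sum>q<d. \<Sum>q'<d. B q' q * A q p * g (a(n := p)) (c(n := q')))
      = (\<Sum>p<d. \<Sum>q'<d. \<Sum>q<d. B q' q * A q p * g (a(n := p)) (c(n := q')))"
      by (rule sum.cong[OF refl], rule sum.swap)
    then show ?thesis by (simp only: M1_def mat_mul_def g_def sum_distrib_right)
  qed
  finally show ?thesis .
qed

lemma R_subset: "R i \<subseteq> {..<n}" by auto

lemma M1_apply:
  assumes e: "e \<in> strings d n" and i: "i < k"
  shows "(of_nat (lam ! i) + of_nat d) * mapply (M1 i A) w e = mat_tr d A * mapply M0 w e + mapply M0 (sites_op d n A (R i) w) e"
proof -
  have "(of_nat (lam ! i) + of_nat d) * mapply (M1 i A) w e
    = (\<Sum>f\<in>strings d n. (mat_tr d A * M0 e f + (\<Sum>x\<in>R i. \<Sum>q<d. A q (f x) * M0 e (f(x := q)))) * w f)"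
    unfolding mapply_def sum_distrib_left mult.assoc[symmetric] by (intro sum.cong refl) (simp only: M1_rec[OF e _ i])
  also have "\<dots> = (\<Sum>f\<in>strings d n. mat_tr d A * (M0 e f * w f)) + (\<Sum>f\<in>strings d n. (\<Sum>x\<in>R i. \<Sum>q<d. A q (f x) * M0 e (f(x := q))) * w f)"
    by (simp only: distrib_right sum.distrib mult.assoc)
  also have "(\<Sum>f\<in>strings d n. (\<Sum>x\<in>R i. \<Sum>q<d. A q (f x) * M0 e (f(x := q))) * w f) = mapply M0 (sites_op d n A (R i) w) e"
    unfolding mapply_def by (rule sum_sites_op[OF R_subset])
  finally show ?thesis by (simp only: mapply_def sum_distrib_left)
qed

lemma M2_apply:
  assumes e: "e \<in> strings d n" and i: "i < k" and j: "j < k"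
  shows "(of_nat (lam ! j) + (if i = j then 1 else 0) + of_nat d) * mapply (M2 i j A B) w e
    = mat_tr d B * mapply (M1 i A) w e + mapply (M1 i A) (sites_op d n B (R j) w) e
      + (if i = j then mapply (M1 i (mat_mul d B A)) w e else 0)"
proof -
  have "(of_nat (lam ! j) + (if i = j then 1 else 0) + of_nat d) * mapply (M2 i j A B) w e
    = (\<Sum>f\<in>strings d n. (mat_tr d B * M1 i A e f + (\<Sum>x\<in>R j. \<Sum>q<d. B q (f x) * M1 i A e (f(x := q)))
        + (if i = j then M1 i (mat_mul d B A) e f else 0)) * w f)"
    unfolding mapply_def sum_distrib_left mult.assoc[symmetric] by (intro sum.cong refl) (simp only: M2_rec[OF e _ i j])
  also have "\<dots> = (\<Sum>f\<in>strings d n. mat_tr d B * (M1 i A e f * w f)) + (\<Sum>f\<in>strings d n. (\<Sum>x\<in>R j. \<Sum>q<d. B q (f x) * M1 i A e (f(x := q))) * w f)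
      + (\<Sum>f\<in>strings d n. (if i = j then M1 i (mat_mul d B A) e f else 0) * w f)"
    by (simp only: distrib_right sum.distrib mult.assoc)
  also have "(\<Sum>f\<in>strings d n. (\<Sum>x\<in>R j. \<Sum>q<d. B q (f x) * M1 i A e (f(x := q))) * w f) = mapply (M1 i A) (sites_op d n B (R j) w) e"
    unfolding mapply_def by (rule sum_sites_op[OF R_subset])
  also have "(\<Sum>f\<in>strings d n. (if i = j then M1 i (mat_mul d B A) e f else 0) * w f) = (if i = j then mapply (M1 i (mat_mul d B A)) w e else 0)"
    by (simp add: mapply_def)
  finally show ?thesis by (simp only: mapply_def sum_distrib_left)
qed

text \<open>The unnormalized means of \<open>1\<close>, of \<open>tr A \<psi>\<^sub>i\<close> and of \<open>tr A \<psi>\<^sub>i tr B \<psi>\<^sub>j\<close> in the state \<open>w\<close>.\<close>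

definition J :: "((nat \<Rightarrow> nat) \<Rightarrow> (nat \<Rightarrow> nat) \<Rightarrow> complex) \<Rightarrow> tens \<Rightarrow> complex" where
  "J M w = (\<Sum>e\<in>strings d n. cnj (w e) * (\<kappa> * mapply M w e))"

context
  fixes w assumes w: "color_sym n False r w"
begin

lemma sites_sym: "color_sym n False r (sites_op d n A (R i) w)"
  using w by (rule sites_op_color_sym)

lemma J0_eq: "J M0 w = tinner d n w w"
  unfolding J_def tinner_def by (intro sum.cong refl) (simp only: M0_apply[OF w])

text \<open>The sum of one-site operators over a whole row keeps row symmetry, so
  \<open>M0_apply\<close> is available for both terms of \<open>M1_apply\<close>.\<close>

lemma M1_apply_sym:
  assumes "color_sym n False r v" "e \<in> strings d n" "i < k"
  shows "(of_nat (lam ! i) + of_nat d) * (\<kappa> * mapply (M1 i A) v e) = mat_tr d A * v e + sites_op d n A (R i) v e"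
proof -
  have "(of_nat (lam ! i) + of_nat d) * (\<kappa> * mapply (M1 i A) v e)
    = mat_tr d A * (\<kappa> * mapply M0 v e) + \<kappa> * mapply M0 (sites_op d n A (R i) v) e"
    using M1_apply[OF assms(2,3), of A v] by (simp add: algebra_simps)
  then show ?thesis unfolding M0_apply[OF assms(1,2)] M0_apply[OF sites_op_color_sym[OF assms(1)] assms(2)] .
qed

lemma J1_eq:
  assumes "i < k"
  shows "(of_nat (lam ! i) + of_nat d) * J (M1 i A) w = mat_tr d A * tinner d n w w + tinner d n w (sites_op d n A (R i) w)"
proof -
  have "(of_nat (lam ! i) + of_nat d) * J (M1 i A) w = (\<Sum>e\<in>strings d n. cnj (w e) * (mat_tr d A * w e + sites_op d n A (R i) w e))"
    unfolding J_def sum_distrib_left by (intro sum.cong refl) (simp only: mult.left_commute[of _ "cnj _"] M1_apply_sym[OF w _ assms])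
  then show ?thesis by (simp add: tinner_def distrib_left sum.distrib sum_distrib_left mult_ac)
qed

lemma J2_eq:
  assumes i: "i < k" and j: "j < k"
  shows "(of_nat (lam ! i) + of_nat d) * ((of_nat (lam ! j) + (if i = j then 1 else 0) + of_nat d) * J (M2 i j A B) w)
    = mat_tr d B * (mat_tr d A * tinner d n w w + tinner d n w (sites_op d n A (R i) w))
      + mat_tr d A * tinner d n w (sites_op d n B (R j) w) + tinner d n w (sites_op d n A (R i) (sites_op d n B (R j) w))
      + (if i = j then mat_tr d (mat_mul d B A) * tinner d n w w + tinner d n w (sites_op d n (mat_mul d B A) (R i) w) else 0)"
proof -
  let ?b = "of_nat (lam ! j) + (if i = j then 1 else 0) + of_nat d :: complex" and ?a = "of_nat (lam ! i) + of_nat d :: complex"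
  let ?N = "sites_op d n"
  have e: "?a * (?b * (\<kappa> * mapply (M2 i j A B) w e)) = mat_tr d B * (mat_tr d A * w e + ?N A (R i) w e)
      + (mat_tr d A * ?N B (R j) w e + ?N A (R i) (?N B (R j) w) e)
      + (if i = j then mat_tr d (mat_mul d B A) * w e + ?N (mat_mul d B A) (R i) w e else 0)" if e: "e \<in> strings d n" for e
  proof -
    have "?a * (?b * (\<kappa> * mapply (M2 i j A B) w e)) = ?a * (\<kappa> * (?b * mapply (M2 i j A B) w e))" by (simp only: mult_ac)
    also have "\<dots> = ?a * (\<kappa> * (mat_tr d B * mapply (M1 i A) w e + mapply (M1 i A) (?N B (R j) w) e
      + (if i = j then mapply (M1 i (mat_mul d B A)) w e else 0)))" unfolding M2_apply[OF e i j] ..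
    also have "\<dots> = mat_tr d B * (?a * (\<kappa> * mapply (M1 i A) w e)) + ?a * (\<kappa> * mapply (M1 i A) (?N B (R j) w) e)
      + (if i = j then ?a * (\<kappa> * mapply (M1 i (mat_mul d B A)) w e) else 0)" by (simp add: algebra_simps)
    finally show ?thesis unfolding M1_apply_sym[OF w e i] M1_apply_sym[OF sites_sym e i] .
  qed
  have "?a * (?b * J (M2 i j A B) w) = (\<Sum>e\<in>strings d n. cnj (w e) * (?a * (?b * (\<kappa> * mapply (M2 i j A B) w e))))"
    unfolding J_def sum_distrib_left by (intro sum.cong refl) (simp only: mult_ac)
  also have "\<dots> = (\<Sum>e\<in>strings d n. cnj (w e) * (mat_tr d B * (mat_tr d A * w e + ?N A (R i) w e)
      + (mat_tr d A * ?N B (R j) w e + ?N A (R i) (?N B (R j) w) e)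
      + (if i = j then mat_tr d (mat_mul d B A) * w e + ?N (mat_mul d B A) (R i) w e else 0)))"
    by (intro sum.cong refl) (simp only: e)
  finally show ?thesis
    by (cases "i = j") (simp_all add: tinner_def distrib_left sum.distrib sum_distrib_left mult_ac)
qed

end

subsection \<open>Integrals over the measurement outcomes\<close>

lemma space_H: "\<psi> \<in> space H \<Longrightarrow> i < k \<Longrightarrow> \<psi> i \<in> rank_one_projectors d"
  by (auto simp: space_PiM space_haar)

lemma prob_space_H: "prob_space H"
  by (intro prob_space_PiM prob_space_axioms)

lemma entry_H_measurable: "i < k \<Longrightarrow> p < d \<Longrightarrow> q < d \<Longrightarrow> (\<lambda>\<psi>. \<psi> i $$ (p, q)) \<in> borel_measurable H"
  using measurable_compose[OF measurable_component_singleton[of i "{..<k}" "\<lambda>_. \<mu>"] entry_measurable] by simp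

lemma monomial_integral:
  assumes S: "finite S" "\<And>x. x \<in> S \<Longrightarrow> a x < d" "\<And>x. x \<in> S \<Longrightarrow> c x < d" "\<And>x. x \<in> S \<Longrightarrow> s x < k"
  shows "has_bochner_integral H (\<lambda>\<psi>. \<Prod>x\<in>S. \<psi> (s x) $$ (a x, c x)) (row_moment k s S a c)"
proof -
  interpret H: prob_space H by (rule prob_space_H)
  have "integrable H (\<lambda>\<psi>. \<Prod>x\<in>S. \<psi> (s x) $$ (a x, c x))"
  proof (rule H.integrable_const_bound[of _ 1])
    show "AE \<psi> in H. cmod (\<Prod>x\<in>S. \<psi> (s x) $$ (a x, c x)) \<le> 1"
    proof (rule AE_I2)
      fix \<psi> assume "\<psi> \<in> space H"
      then show "cmod (\<Prod>x\<in>S. \<psi> (s x) $$ (a x, c x)) \<le> 1"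
        unfolding prod_norm[symmetric] using S by (intro prod_le_1) (auto intro!: projector_norm_le_1 space_H)
    qed
    show "(\<lambda>\<psi>. \<Prod>x\<in>S. \<psi> (s x) $$ (a x, c x)) \<in> borel_measurable H"
      using S by (intro borel_measurable_prod entry_H_measurable) auto
  qed
  then show ?thesis
    using row_moment_integral[OF S] by (simp add: has_bochner_integral_iff)
qed

definition obs :: "(nat \<Rightarrow> nat \<Rightarrow> complex) \<Rightarrow> nat \<Rightarrow> (nat \<Rightarrow> complex mat) \<Rightarrow> complex" where
  "obs A i \<psi> = (\<Sum>p<d. \<Sum>q<d. A q p * \<psi> i $$ (p, q))"

definition dens :: "tens \<Rightarrow> (nat \<Rightarrow> complex mat) \<Rightarrow> complex" where
  "dens w \<psi> = tinner d n w (row_povm d n lam \<psi> w)"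

lemma dens_eq: "dens w \<psi> = (\<Sum>e\<in>strings d n. \<Sum>f\<in>strings d n. \<kappa> * cnj (w e) * w f * (\<Prod>x<n. \<psi> (r x) $$ (e x, f x)))"
  unfolding dens_def tinner_def row_povm_def tscale_def tensor_op_def \<kappa>_def[symmetric]
  by (rule sum.cong) (auto simp: sum_distrib_left mult_ac)

lemma J_integral:
  assumes "\<And>e f. e \<in> strings d n \<Longrightarrow> f \<in> strings d n \<Longrightarrow> has_bochner_integral H (\<lambda>\<psi>. (\<Prod>x<n. \<psi> (r x) $$ (e x, f x)) * g \<psi>) (M e f)"
  shows "has_bochner_integral H (\<lambda>\<psi>. dens w \<psi> * g \<psi>) (J M w)"
proof -
  have "has_bochner_integral H (\<lambda>\<psi>. \<Sum>e\<in>strings d n. \<Sum>f\<in>strings d n. \<kappa> * cnj (w e) * w f * ((\<Prod>x<n. \<psi> (r x) $$ (e x, f x)) * g \<psi>))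
    (\<Sum>e\<in>strings d n. \<Sum>f\<in>strings d n. \<kappa> * cnj (w e) * w f * M e f)"
    by (intro has_bochner_integral_sum has_bochner_integral_mult_right assms)
  moreover have "(\<Sum>e\<in>strings d n. \<Sum>f\<in>strings d n. \<kappa> * cnj (w e) * w f * M e f) = J M w"
    unfolding J_def mapply_def by (intro sum.cong refl) (simp add: sum_distrib_left mult_ac)
  moreover have "(\<Sum>e\<in>strings d n. \<Sum>f\<in>strings d n. \<kappa> * cnj (w e) * w f * ((\<Prod>x<n. \<psi> (r x) $$ (e x, f x)) * g \<psi>)) = dens w \<psi> * g \<psi>" for \<psi>
    unfolding dens_eq sum_distrib_right by (intro sum.cong refl) (simp only: mult.assoc)
  ultimately show ?thesis by simp
qed

lemma J0_integral: "has_bochner_integral H (\<lambda>\<psi>. dens w \<psi>) (J M0 w)"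
proof -
  have "has_bochner_integral H (\<lambda>\<psi>. dens w \<psi> * 1) (J M0 w)"
    by (rule J_integral) (unfold M0_def mult_1_right, rule monomial_integral, auto simp: strings_less r_less)
  then show ?thesis by simp
qed

lemma J1_integral:
  assumes i: "i < k"
  shows "has_bochner_integral H (\<lambda>\<psi>. dens w \<psi> * obs A i \<psi>) (J (M1 i A) w)"
proof (rule J_integral)
  fix e f assume ef: "e \<in> strings d n" "f \<in> strings d n"
  let ?S = "insert n {..<n}" and ?s = "r(n := i)"
  have "has_bochner_integral H (\<lambda>\<psi>. \<Sum>p<d. \<Sum>q<d. A q p * (\<Prod>x\<in>?S. \<psi> (?s x) $$ ((e(n := p)) x, (f(n := q)) x))) (M1 i A e f)"
    unfolding M1_def
    by (intro has_bochner_integral_sum has_bochner_integral_mult_right monomial_integral) (use ef i in \<open>auto simp: strings_less r_less\<close>)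
  moreover have "(\<Sum>p<d. \<Sum>q<d. A q p * (\<Prod>x\<in>?S. \<psi> (?s x) $$ ((e(n := p)) x, (f(n := q)) x)))
    = (\<Prod>x<n. \<psi> (r x) $$ (e x, f x)) * obs A i \<psi>" for \<psi> :: "nat \<Rightarrow> complex mat"
  proof -
    have "(\<Prod>x\<in>?S. \<psi> (?s x) $$ ((e(n := p)) x, (f(n := q)) x)) = \<psi> i $$ (p, q) * (\<Prod>x<n. \<psi> (r x) $$ (e x, f x))" for p q
      by (subst prod.insert) (auto intro!: prod.cong)
    then show ?thesis unfolding obs_def sum_distrib_left by (intro sum.cong refl) (simp add: mult_ac)
  qed
  ultimately show "has_bochner_integral H (\<lambda>\<psi>. (\<Prod>x<n. \<psi> (r x) $$ (e x, f x)) * obs A i \<psi>) (M1 i A e f)" by simp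
qed

lemma J2_integral:
  assumes i: "i < k" and j: "j < k"
  shows "has_bochner_integral H (\<lambda>\<psi>. dens w \<psi> * (obs A i \<psi> * obs B j \<psi>)) (J (M2 i j A B) w)"
proof (rule J_integral)
  fix e f assume ef: "e \<in> strings d n" "f \<in> strings d n"
  let ?S = "insert (Suc n) (insert n {..<n})" and ?s = "r(n := i, Suc n := j)"
  let ?P = "\<lambda>\<psi> p q p' q'. \<Prod>x\<in>?S. \<psi> (?s x) $$ ((e(n := p, Suc n := p')) x, (f(n := q, Suc n := q')) x)"
  have "has_bochner_integral H (\<lambda>\<psi>. \<Sum>p<d. \<Sum>q<d. A q p * (\<Sum>p'<d. \<Sum>q'<d. B q' p' * ?P \<psi> p q p' q')) (M2 i j A B e f)"
    unfolding M2_def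
    by (intro has_bochner_integral_sum has_bochner_integral_mult_right monomial_integral) (use ef i j in \<open>auto simp: strings_less r_less\<close>)
  moreover have "(\<Sum>p<d. \<Sum>q<d. A q p * (\<Sum>p'<d. \<Sum>q'<d. B q' p' * ?P \<psi> p q p' q'))
    = (\<Prod>x<n. \<psi> (r x) $$ (e x, f x)) * (obs A i \<psi> * obs B j \<psi>)" for \<psi> :: "nat \<Rightarrow> complex mat"
  proof -
    have P: "?P \<psi> p q p' q' = \<psi> j $$ (p', q') * (\<psi> i $$ (p, q) * (\<Prod>x<n. \<psi> (r x) $$ (e x, f x)))" for p q p' q'
    proof -
      have "?P \<psi> p q p' q' = \<psi> j $$ (p', q') * (\<psi> i $$ (p, q) * (\<Prod>x<n. \<psi> (?s x) $$ ((e(n := p, Suc n := p')) x, (f(n := q, Suc n := q')) x)))"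
        by simp
      also have "(\<Prod>x<n. \<psi> (?s x) $$ ((e(n := p, Suc n := p')) x, (f(n := q, Suc n := q')) x)) = (\<Prod>x<n. \<psi> (r x) $$ (e x, f x))"
        by (rule prod.cong) auto
      finally show ?thesis .
    qed
    have "(\<Sum>p'<d. \<Sum>q'<d. B q' p' * ?P \<psi> p q p' q') = obs B j \<psi> * (\<psi> i $$ (p, q) * (\<Prod>x<n. \<psi> (r x) $$ (e x, f x)))" for p q
      unfolding P obs_def sum_distrib_right by (intro sum.cong refl) (simp only: mult.assoc)
    then have "(\<Sum>p<d. \<Sum>q<d. A q p * (\<Sum>p'<d. \<Sum>q'<d. B q' p' * ?P \<psi> p q p' q'))
      = (\<Sum>p<d. \<Sum>q<d. A q p * \<psi> i $$ (p, q) * (obs B j \<psi> * (\<Prod>x<n. \<psi> (r x) $$ (e x, f x))))"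
      by (simp only: mult_ac)
    also have "\<dots> = obs A i \<psi> * (obs B j \<psi> * (\<Prod>x<n. \<psi> (r x) $$ (e x, f x)))"
      by (simp only: obs_def[of A] sum_distrib_right)
    finally show ?thesis by (simp only: mult_ac)
  qed
  ultimately show "has_bochner_integral H (\<lambda>\<psi>. (\<Prod>x<n. \<psi> (r x) $$ (e x, f x)) * (obs A i \<psi> * obs B j \<psi>)) (M2 i j A B e f)" by simp
qed

text \<open>The tensor product \<open>K\<close> of the projectors is Hermitian and idempotent, so
  its expectation in \<open>w\<close> is the squared norm of \<open>K\<close> applied to
  \<open>w\<close>.\<close>

lemma dens_nonneg:
  assumes \<psi>: "\<psi> \<in> space H"
  shows "0 \<le> Re (dens w \<psi>)" "dens w \<psi> = of_real (Re (dens w \<psi>))"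
proof -
  define K where "K e f = (\<Prod>x<n. \<psi> (r x) $$ (e x, f x))" for e f
  have idem: "K e f = (\<Sum>g\<in>strings d n. K e g * K g f)" if "e \<in> strings d n" "f \<in> strings d n" for e f
  proof -
    have "K e f = (\<Prod>x<n. \<Sum>q<d. \<psi> (r x) $$ (e x, q) * \<psi> (r x) $$ (q, f x))"
      unfolding K_def by (rule prod.cong) (use that \<psi> in \<open>auto simp: projector_idem[OF space_H] strings_less r_less\<close>)
    also have "\<dots> = (\<Sum>g\<in>strings d n. \<Prod>x<n. \<psi> (r x) $$ (e x, g x) * \<psi> (r x) $$ (g x, f x))"
      unfolding strings_def by (rule prod_sum_PiE) auto
    finally show ?thesis by (simp only: prod.distrib K_def)
  qed
  have herm: "cnj (K g e) = K e g" if "e \<in> strings d n" "g \<in> strings d n" for e g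
    unfolding K_def cnj_prod by (rule prod.cong) (use that \<psi> in \<open>auto simp: projector_cnj[OF space_H] strings_less r_less\<close>)
  define S where "S = (\<Sum>g\<in>strings d n. (cmod (\<Sum>f\<in>strings d n. K g f * w f))\<^sup>2)"
  have "(\<Sum>e\<in>strings d n. \<Sum>f\<in>strings d n. cnj (w e) * w f * K e f)
    = (\<Sum>e\<in>strings d n. \<Sum>f\<in>strings d n. \<Sum>g\<in>strings d n. cnj (K g e * w e) * (K g f * w f))"
  proof (intro sum.cong refl)
    fix e f assume ef: "e \<in> strings d n" "f \<in> strings d n"
    have "cnj (w e) * w f * K e f = (\<Sum>g\<in>strings d n. cnj (w e) * w f * (K e g * K g f))"
      by (simp only: idem[OF ef] sum_distrib_left)
    also have "\<dots> = (\<Sum>g\<in>strings d n. cnj (K g e * w e) * (K g f * w f))"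
      by (intro sum.cong refl) (simp add: herm[OF ef(1)] mult_ac)
    finally show "cnj (w e) * w f * K e f = (\<Sum>g\<in>strings d n. cnj (K g e * w e) * (K g f * w f))" .
  qed
  also have "\<dots> = (\<Sum>e\<in>strings d n. \<Sum>g\<in>strings d n. \<Sum>f\<in>strings d n. cnj (K g e * w e) * (K g f * w f))"
    by (rule sum.cong[OF refl], rule sum.swap)
  also have "\<dots> = (\<Sum>g\<in>strings d n. \<Sum>e\<in>strings d n. \<Sum>f\<in>strings d n. cnj (K g e * w e) * (K g f * w f))"
    by (rule sum.swap)
  also have "\<dots> = (\<Sum>g\<in>strings d n. cnj (\<Sum>f\<in>strings d n. K g f * w f) * (\<Sum>f\<in>strings d n. K g f * w f))"
    by (simp only: sum_product cnj_sum)
  also have "\<dots> = of_real S"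
    unfolding S_def of_real_sum complex_norm_square by (intro sum.cong refl) (simp only: mult.commute)
  finally have e: "(\<Sum>e\<in>strings d n. \<Sum>f\<in>strings d n. cnj (w e) * w f * K e f) = of_real S" .
  define c where "c = (\<Prod>i<k. real (sym_dim d (lam ! i)))"
  have "\<kappa> = of_real c" by (simp add: \<kappa>_def c_def)
  moreover have "dens w \<psi> = \<kappa> * (\<Sum>e\<in>strings d n. \<Sum>f\<in>strings d n. cnj (w e) * w f * K e f)"
    unfolding dens_eq sum_distrib_left by (simp only: mult.assoc K_def)
  ultimately have d: "dens w \<psi> = of_real (c * S)" by (simp add: e)
  have "0 \<le> c * S" unfolding c_def S_def by (intro mult_nonneg_nonneg prod_nonneg sum_nonneg) auto
  then show "0 \<le> Re (dens w \<psi>)" "dens w \<psi> = of_real (Re (dens w \<psi>))" by (simp_all add: d)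
qed

lemma obs_real:
  assumes "\<psi> \<in> space H" "i < k" and A: "\<And>p q. p < d \<Longrightarrow> q < d \<Longrightarrow> cnj (A p q) = A q p"
  shows "obs A i \<psi> = of_real (Re (obs A i \<psi>))"
proof -
  have "cnj (obs A i \<psi>) = (\<Sum>p<d. \<Sum>q<d. A p q * \<psi> i $$ (q, p))"
    unfolding obs_def cnj_sum by (intro sum.cong refl) (use assms in \<open>simp add: projector_cnj[OF space_H]\<close>)
  also have "\<dots> = obs A i \<psi>" unfolding obs_def by (rule sum.swap)
  finally show ?thesis by (simp add: complex_eq_iff)
qed

text \<open>Scaled and shifted so that \<open>J1_eq\<close> becomes exact: its mean in a row
  symmetric state is that of the sum of \<open>A\<close> over the positions of row
  \<open>i\<close>.\<close>

definition est :: "(nat \<Rightarrow> nat \<Rightarrow> complex) \<Rightarrow> nat \<Rightarrow> (nat \<Rightarrow> complex mat) \<Rightarrow> complex" where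
  "est A i \<psi> = (of_nat (lam ! i) + of_nat d) * obs A i \<psi> - mat_tr d A"

lemma sum_sites_rows: "(\<Sum>i<k. sites_op d n A (R i) v) = sites_op d n A {..<n} v"
proof -
  have "(\<Sum>i<k. \<Sum>x\<in>{x \<in> {..<n}. r x = i}. site_op d n A x v) = (\<Sum>x<n. site_op d n A x v)"
    by (rule sum.group) (auto simp: r_less)
  then show ?thesis by (simp add: sites_op_def)
qed

context
  fixes w assumes w: "color_sym n False r w"
begin

lemma est_mean: "has_bochner_integral H (\<lambda>\<psi>. dens w \<psi> * (\<Sum>i<k. est A i \<psi>)) (tinner d n w (sites_op d n A {..<n} w))"
proof -
  have "has_bochner_integral H (\<lambda>\<psi>. dens w \<psi> * est A i \<psi>) (tinner d n w (sites_op d n A (R i) w))" if i: "i < k" for i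
  proof -
    have "has_bochner_integral H (\<lambda>\<psi>. (of_nat (lam ! i) + of_nat d) * (dens w \<psi> * obs A i \<psi>) - mat_tr d A * dens w \<psi>)
      ((of_nat (lam ! i) + of_nat d) * J (M1 i A) w - mat_tr d A * J M0 w)"
      by (intro has_bochner_integral_diff has_bochner_integral_mult_right J1_integral J0_integral i)
    then show ?thesis unfolding J1_eq[OF w i] J0_eq[OF w] by (simp add: est_def algebra_simps)
  qed
  then have "has_bochner_integral H (\<lambda>\<psi>. \<Sum>i<k. dens w \<psi> * est A i \<psi>) (\<Sum>i<k. tinner d n w (sites_op d n A (R i) w))"
    by (intro has_bochner_integral_sum) auto
  then show ?thesis by (simp only: tinner_sum_right[symmetric] sum_sites_rows sum_distrib_left[symmetric])
qed

text \<open>Products over different rows have exactly the mean of the product of the two sums of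
  site operators. Within a row the extra 1 in \<open>J2_eq\<close> leaves the correction
  \<open>?X i\<close>, whose subtracted part is the mean of a square times a positive factor.
  Dropping it costs at most one trace of the square of \<open>A\<close> per row and the mean of that
  square over the positions.\<close>

lemma est_second_moment:
  assumes A: "\<And>p q. p < d \<Longrightarrow> q < d \<Longrightarrow> cnj (A p q) = A q p"
  obtains V where "has_bochner_integral H (\<lambda>\<psi>. dens w \<psi> * ((\<Sum>i<k. est A i \<psi>) * (\<Sum>i<k. est A i \<psi>))) V"
    "Re V \<le> Re (tinner d n w (sites_op d n A {..<n} (sites_op d n A {..<n} w)) + of_nat k * (mat_tr d (mat_mul d A A) * tinner d n w w)
       + tinner d n w (sites_op d n (mat_mul d A A) {..<n} w))"
proof -
  let ?N = "sites_op d n"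
  let ?a = "\<lambda>i. of_nat (lam ! i) + of_nat d :: complex" and ?t = "mat_tr d A" and ?ww = "tinner d n w w"
  let ?X = "\<lambda>i. mat_tr d (mat_mul d A A) * ?ww + tinner d n w (?N (mat_mul d A A) (R i) w) - ?a i * J (M2 i i A A) w"
  define V where "V i j = tinner d n w (?N A (R i) (?N A (R j) w)) + (if i = j then ?X i else 0)" for i j
  have ij: "has_bochner_integral H (\<lambda>\<psi>. dens w \<psi> * (est A i \<psi> * est A j \<psi>)) (V i j)" if i: "i < k" and j: "j < k" for i j
  proof -
    have hb: "has_bochner_integral H (\<lambda>\<psi>. ?a i * (?a j * (dens w \<psi> * (obs A i \<psi> * obs A j \<psi>))) - ?t * (?a i * (dens w \<psi> * obs A i \<psi>))
        - ?t * (?a j * (dens w \<psi> * obs A j \<psi>)) + ?t * (?t * dens w \<psi>))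
      (?a i * (?a j * J (M2 i j A A) w) - ?t * (?a i * J (M1 i A) w) - ?t * (?a j * J (M1 j A) w) + ?t * (?t * J M0 w))"
      by (intro has_bochner_integral_diff has_bochner_integral_add has_bochner_integral_mult_right J2_integral J1_integral J0_integral i j)
    have fe: "?a i * (?a j * (dens w \<psi> * (obs A i \<psi> * obs A j \<psi>))) - ?t * (?a i * (dens w \<psi> * obs A i \<psi>))
        - ?t * (?a j * (dens w \<psi> * obs A j \<psi>)) + ?t * (?t * dens w \<psi>) = dens w \<psi> * (est A i \<psi> * est A j \<psi>)" for \<psi>
      by (simp add: est_def algebra_simps)
    \<comment> \<open>The estimator carries the weight \<open>?a j\<close>, while
      \<open>J2_eq\<close> has 1 more for \<open>i = j\<close>; the difference is split off as the
      term to be dropped.\<close>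
    have "?a i * (?a j * J (M2 i j A A) w) = ?a i * ((of_nat (lam ! j) + (if i = j then 1 else 0) + of_nat d) * J (M2 i j A A) w)
       - (if i = j then ?a i * J (M2 i i A A) w else 0)"
      by (simp add: algebra_simps)
    also have "\<dots> = ?t * (?t * ?ww + tinner d n w (?N A (R i) w)) + ?t * tinner d n w (?N A (R j) w) + V i j"
      unfolding J2_eq[OF w i j] by (simp add: V_def)
    finally have "?a i * (?a j * J (M2 i j A A) w) - ?t * (?a i * J (M1 i A) w) - ?t * (?a j * J (M1 j A) w) + ?t * (?t * J M0 w) = V i j"
      unfolding J1_eq[OF w i] J1_eq[OF w j] J0_eq[OF w] by (simp add: algebra_simps)
    then show ?thesis using hb unfolding fe by simp
  qed
  have "has_bochner_integral H (\<lambda>\<psi>. \<Sum>i<k. \<Sum>j<k. dens w \<psi> * (est A i \<psi> * est A j \<psi>)) (\<Sum>i<k. \<Sum>j<k. V i j)"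
    by (intro has_bochner_integral_sum ij) auto
  moreover have "(\<Sum>i<k. \<Sum>j<k. dens w \<psi> * (est A i \<psi> * est A j \<psi>)) = dens w \<psi> * ((\<Sum>i<k. est A i \<psi>) * (\<Sum>i<k. est A i \<psi>))" for \<psi>
    by (subst sum_product) (simp only: sum_distrib_left)
  ultimately have hb: "has_bochner_integral H (\<lambda>\<psi>. dens w \<psi> * ((\<Sum>i<k. est A i \<psi>) * (\<Sum>i<k. est A i \<psi>))) (\<Sum>i<k. \<Sum>j<k. V i j)" by simp
  have "(\<Sum>i<k. \<Sum>j<k. V i j) = (\<Sum>i<k. \<Sum>j<k. tinner d n w (?N A (R i) (?N A (R j) w))) + (\<Sum>i<k. ?X i)"
    by (simp add: V_def sum.distrib)
  also have "(\<Sum>i<k. \<Sum>j<k. tinner d n w (?N A (R i) (?N A (R j) w))) = tinner d n w (?N A {..<n} (?N A {..<n} w))"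
    by (simp only: tinner_sum_right[symmetric] tlinear_sum[OF tlinear_sites_op, symmetric] sum_sites_rows)
  also have "(\<Sum>i<k. ?X i) = of_nat k * (mat_tr d (mat_mul d A A) * ?ww) + tinner d n w (?N (mat_mul d A A) {..<n} w) - (\<Sum>i<k. ?a i * J (M2 i i A A) w)"
    by (simp add: sum_subtractf sum.distrib tinner_sum_right[symmetric] sum_sites_rows)
  finally have Ve: "(\<Sum>i<k. \<Sum>j<k. V i j) = tinner d n w (?N A {..<n} (?N A {..<n} w)) + (of_nat k * (mat_tr d (mat_mul d A A) * ?ww)
    + tinner d n w (?N (mat_mul d A A) {..<n} w) - (\<Sum>i<k. ?a i * J (M2 i i A A) w))" .
  \<comment> \<open>For Hermitian \<open>A\<close> the integrand is the nonnegative density times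
    the square of a real number.\<close>
  have J: "0 \<le> Re (?a i * J (M2 i i A A) w)" if i: "i < k" for i
  proof -
    have hb: "has_bochner_integral H (\<lambda>\<psi>. Re (dens w \<psi> * (obs A i \<psi> * obs A i \<psi>))) (Re (J (M2 i i A A) w))"
      by (rule has_bochner_integral_bounded_linear[OF bounded_linear_Re J2_integral[OF i i]])
    have "0 \<le> Re (J (M2 i i A A) w)"
      unfolding has_bochner_integral_integral_eq[OF hb, symmetric]
    proof (rule Bochner_Integration.integral_nonneg_AE, rule AE_I2)
      fix \<psi> assume \<psi>: "\<psi> \<in> space H"
      have "Re (dens w \<psi> * (obs A i \<psi> * obs A i \<psi>)) = Re (of_real (Re (dens w \<psi>)) * (of_real (Re (obs A i \<psi>)) * of_real (Re (obs A i \<psi>))))"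
        using obs_real[OF \<psi> i A] dens_nonneg(2)[OF \<psi>, of w] by simp
      then show "0 \<le> Re (dens w \<psi> * (obs A i \<psi> * obs A i \<psi>))"
        using dens_nonneg(1)[OF \<psi>, of w] by simp
    qed
    moreover have "Re (?a i * J (M2 i i A A) w) = real (lam ! i + d) * Re (J (M2 i i A A) w)"
      by (simp flip: of_nat_add)
    ultimately show ?thesis by simp
  qed
  have "0 \<le> Re (\<Sum>i<k. ?a i * J (M2 i i A A) w)" unfolding Re_sum by (rule sum_nonneg) (use J in auto)
  then have "Re (\<Sum>i<k. \<Sum>j<k. V i j) \<le> Re (tinner d n w (?N A {..<n} (?N A {..<n} w)) + of_nat k * (mat_tr d (mat_mul d A A) * ?ww)
       + tinner d n w (?N (mat_mul d A A) {..<n} w))"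
    unfolding Ve by simp
  then show ?thesis using that hb by blast
qed

end

end

section \<open>The outcome space and the law of the measurement\<close>

definition outcome_opt :: "complex mat measure \<Rightarrow> nat list \<Rightarrow> (nat \<Rightarrow> complex mat) option measure" where
  "outcome_opt \<mu> lam = sigma (insert None (Some ` space (haar_tuples \<mu> lam)))
     {S. S \<subseteq> insert None (Some ` space (haar_tuples \<mu> lam)) \<and> Some -` S \<in> sets (haar_tuples \<mu> lam)}"

lemma space_outcome_opt: "space (outcome_opt \<mu> lam) = insert None (Some ` space (haar_tuples \<mu> lam))"
  unfolding outcome_opt_def by (rule space_measure_of) auto

lemma Some_measurable: "Some \<in> measurable (haar_tuples \<mu> lam) (outcome_opt \<mu> lam)"
  unfolding outcome_opt_def
proof (rule measurable_measure_of)
  fix S assume S: "S \<in> {S. S \<subseteq> insert None (Some ` space (haar_tuples \<mu> lam)) \<and> Some -` S \<in> sets (haar_tuples \<mu> lam)}"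
  then have "Some -` S \<inter> space (haar_tuples \<mu> lam) = Some -` S" by auto
  then show "Some -` S \<inter> space (haar_tuples \<mu> lam) \<in> sets (haar_tuples \<mu> lam)" using S by simp
qed auto

lemma outcome_space_eq:
  "space (outcome_space d n \<mu>) = (SIGMA lam:{lam. partition_of d n lam}. insert None (Some ` space (haar_tuples \<mu> lam)))"
  unfolding outcome_space_def Let_def by (rule space_measure_of) auto

lemma sets_outcome_spaceI:
  assumes "S \<subseteq> space (outcome_space d n \<mu>)"
    "\<And>lam. partition_of d n lam \<Longrightarrow> {\<psi>. (lam, Some \<psi>) \<in> S} \<in> sets (haar_tuples \<mu> lam)"
  shows "S \<in> sets (outcome_space d n \<mu>)"
  using assms unfolding outcome_space_eq unfolding outcome_space_def Let_def
  by (subst sets_measure_of) (auto intro!: sigma_sets.Basic)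

lemma Pair_Some_measurable:
  assumes lam: "partition_of d n lam"
  shows "(\<lambda>\<psi>. (lam, Some \<psi>)) \<in> measurable (haar_tuples \<mu> lam) (outcome_space d n \<mu>)"
  unfolding outcome_space_def Let_def
proof (rule measurable_measure_of)
  let ?\<Omega> = "SIGMA lam:{lam. partition_of d n lam}. insert None (Some ` space (haar_tuples \<mu> lam))"
  fix S assume S: "S \<in> {S. S \<subseteq> ?\<Omega> \<and> (\<forall>lam. partition_of d n lam \<longrightarrow> {\<psi>. (lam, Some \<psi>) \<in> S} \<in> sets (haar_tuples \<mu> lam))}"
  then have "(\<lambda>\<psi>. (lam, Some \<psi>)) -` S \<inter> space (haar_tuples \<mu> lam) = {\<psi>. (lam, Some \<psi>) \<in> S}" by auto
  then show "(\<lambda>\<psi>. (lam, Some \<psi>)) -` S \<inter> space (haar_tuples \<mu> lam) \<in> sets (haar_tuples \<mu> lam)" using S lam by simp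
qed (use lam in auto)

lemma Pair_measurable:
  assumes lam: "partition_of d n lam"
  shows "Pair lam \<in> measurable (outcome_opt \<mu> lam) (outcome_space d n \<mu>)"
  unfolding outcome_space_def Let_def
proof (rule measurable_measure_of)
  let ?\<Omega> = "SIGMA lam:{lam. partition_of d n lam}. insert None (Some ` space (haar_tuples \<mu> lam))"
  fix S assume S: "S \<in> {S. S \<subseteq> ?\<Omega> \<and> (\<forall>lam. partition_of d n lam \<longrightarrow> {\<psi>. (lam, Some \<psi>) \<in> S} \<in> sets (haar_tuples \<mu> lam))}"
  have "Some -` (Pair lam -` S \<inter> space (outcome_opt \<mu> lam)) = {\<psi>. (lam, Some \<psi>) \<in> S}"
    using S by (auto simp: space_outcome_opt)
  then show "Pair lam -` S \<inter> space (outcome_opt \<mu> lam) \<in> sets (outcome_opt \<mu> lam)"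
    using S lam unfolding space_outcome_opt unfolding outcome_opt_def
    by (subst sets_measure_of) (auto intro!: sigma_sets.Basic)
qed (use lam in \<open>auto simp: space_outcome_opt\<close>)

text \<open>A set of outcomes is measurable as soon as its slices over \<open>Some\<close> are, and
  there is one slice for each partition.\<close>

lemma outcome_borel_measurable:
  fixes g :: "outcome \<Rightarrow> 'a :: topological_space"
  assumes "\<And>lam. partition_of d n lam \<Longrightarrow> (\<lambda>\<psi>. g (lam, Some \<psi>)) \<in> borel_measurable (haar_tuples \<mu> lam)"
  shows "g \<in> borel_measurable (outcome_space d n \<mu>)"
proof (rule measurableI)
  fix B :: "'a set" assume B: "B \<in> sets borel"
  show "g -` B \<inter> space (outcome_space d n \<mu>) \<in> sets (outcome_space d n \<mu>)"
  proof (rule sets_outcome_spaceI)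
    fix lam assume lam: "partition_of d n lam"
    have "{\<psi>. (lam, Some \<psi>) \<in> g -` B \<inter> space (outcome_space d n \<mu>)} = (\<lambda>\<psi>. g (lam, Some \<psi>)) -` B \<inter> space (haar_tuples \<mu> lam)"
      using lam by (auto simp: outcome_space_eq)
    then show "{\<psi>. (lam, Some \<psi>) \<in> g -` B \<inter> space (outcome_space d n \<mu>)} \<in> sets (haar_tuples \<mu> lam)"
      using measurable_sets[OF assms[OF lam] B] by simp
  qed auto
qed auto

context row_measurement
begin

lemma dens_measurable: "dens w \<in> borel_measurable H"
proof -
  have "integrable H (dens w)" using J0_integral[of w] by (simp add: has_bochner_integral_iff)
  then show ?thesis by (rule borel_measurable_integrable)
qed

text \<open>On row symmetric vectors the average over the row group is the identity. Since the
  pre-processing returns only such states, the fail outcome has probability 0.\<close>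

lemma row_fail_sym:
  assumes w: "color_sym n False r w" shows "row_fail lam w = 0"
proof -
  have "(\<Sum>\<pi>\<in>row_group lam. perm_op \<pi> w) = color_sum n False r w"
    by (simp add: color_sum_def row_group_eq sum_lam chi_def)
  then have "tscale (1 / of_nat (card (row_group lam))) (\<Sum>\<pi>\<in>row_group lam. perm_op \<pi> w) = w"
    using color_sum_sym[OF w] card_color_group_nonzero[of n r] by (simp add: row_group_eq sum_lam)
  then show ?thesis by (simp add: row_fail_def)
qed

text \<open>\<open>row_law\<close> is built by \<open>measure_of\<close> from a set function, which
  counts only if it is countably additive on the generated sigma-algebra. Identifying it there with
  the push-forward of a density settles this and makes integration available.\<close>

lemma row_law_eq:
  assumes w: "color_sym n False r w"
  shows "row_law d n \<mu> lam w = distr (density H (\<lambda>\<psi>. ennreal (Re (dens w \<psi>)))) (outcome_opt \<mu> lam) Some"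
proof -
  let ?\<Omega> = "insert None (Some ` space H)" and ?D = "distr (density H (\<lambda>\<psi>. ennreal (Re (dens w \<psi>)))) (outcome_opt \<mu> lam) Some"
  let ?F = "{S. S \<subseteq> ?\<Omega> \<and> Some -` S \<in> sets H}"
  have F: "?F \<subseteq> Pow ?\<Omega>" by auto
  have sD: "sets ?D = sigma_sets ?\<Omega> ?F" by (simp add: outcome_opt_def sets_measure_of[OF F])
  have SM: "Some \<in> measurable (density H (\<lambda>\<psi>. ennreal (Re (dens w \<psi>)))) (outcome_opt \<mu> lam)"
    using Some_measurable by simp
  have dm: "(\<lambda>\<psi>. ennreal (Re (dens w \<psi>))) \<in> borel_measurable H"
    using dens_measurable[of w] by simp
  have e: "(\<integral>\<^sup>+\<psi>. ennreal (Re (tinner d n w (row_povm d n lam \<psi> w))) * indicator (Some -` S) \<psi> \<partial>H)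
      + ennreal (Re (tinner d n w (row_fail lam w))) * indicator S None = emeasure ?D S"
    if S: "S \<in> sigma_sets ?\<Omega> ?F" for S
  proof -
    have S': "S \<in> sets (outcome_opt \<mu> lam)" using S sD by simp
    have "emeasure ?D S = emeasure (density H (\<lambda>\<psi>. ennreal (Re (dens w \<psi>)))) (Some -` S \<inter> space H)"
      by (subst emeasure_distr[OF SM S']) simp
    also have "\<dots> = (\<integral>\<^sup>+\<psi>. ennreal (Re (dens w \<psi>)) * indicator (Some -` S \<inter> space H) \<psi> \<partial>H)"
      using measurable_sets[OF Some_measurable S'] by (intro emeasure_density dm) auto
    also have "\<dots> = (\<integral>\<^sup>+\<psi>. ennreal (Re (tinner d n w (row_povm d n lam \<psi> w))) * indicator (Some -` S) \<psi> \<partial>H)"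
      by (intro nn_integral_cong) (auto simp: dens_def indicator_def)
    finally show ?thesis by (simp add: row_fail_sym[OF w])
  qed
  have rl: "row_law d n \<mu> lam w = measure_of ?\<Omega> ?F (emeasure ?D)"
    unfolding row_law_def by (rule measure_of_eq[OF F e])
  show ?thesis
  proof (rule measure_eqI)
    show s: "sets (row_law d n \<mu> lam w) = sets ?D" unfolding rl sD by (rule sets_measure_of[OF F])
    fix X assume "X \<in> sets (row_law d n \<mu> lam w)"
    then show "emeasure (row_law d n \<mu> lam w) X = emeasure ?D X"
      using emeasure_measure_of[OF rl F] s emeasure_positive[of ?D] emeasure_countably_additive[of ?D] by metis
  qed
qed

definition kernel :: "tens \<Rightarrow> outcome measure" where
  "kernel w = distr (density H (\<lambda>\<psi>. ennreal (Re (dens w \<psi>)))) (outcome_space d n \<mu>) (\<lambda>\<psi>. (lam, Some \<psi>))"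

lemma row_law_kernel:
  assumes "color_sym n False r w"
  shows "distr (row_law d n \<mu> lam w) (outcome_space d n \<mu>) (Pair lam) = kernel w"
  unfolding row_law_eq[OF assms] kernel_def
  by (subst distr_distr) (use Some_measurable Pair_measurable[OF lam] in \<open>auto simp: comp_def\<close>)

lemma Pair_Some_measurable_density:
  "(\<lambda>\<psi>. (lam, Some \<psi>)) \<in> measurable (density H g) (outcome_space d n \<mu>)"
  using Pair_Some_measurable[OF lam] by simp

lemma kernel_mass:
  assumes w: "color_sym n False r w"
  shows "emeasure (kernel w) (space (kernel w)) = ennreal (Re (tinner d n w w))"
proof -
  have "emeasure (kernel w) (space (kernel w)) = emeasure (density H (\<lambda>\<psi>. ennreal (Re (dens w \<psi>)))) (space H)"
    unfolding kernel_def using measurable_space[OF Pair_Some_measurable[OF lam]]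
    by (subst emeasure_distr[OF Pair_Some_measurable_density]) (auto intro!: arg_cong2[where f = emeasure])
  also have "\<dots> = (\<integral>\<^sup>+\<psi>. ennreal (Re (dens w \<psi>)) \<partial>H)"
    using dens_measurable[of w] by (subst emeasure_density) (auto intro!: nn_integral_cong)
  also have "\<dots> = ennreal (Re (tinner d n w w))"
  proof -
    have hb: "has_bochner_integral H (\<lambda>\<psi>. Re (dens w \<psi>)) (Re (J M0 w))"
      by (rule has_bochner_integral_bounded_linear[OF bounded_linear_Re J0_integral])
    have "(\<integral>\<^sup>+\<psi>. ennreal (Re (dens w \<psi>)) \<partial>H) = ennreal (\<integral>\<psi>. Re (dens w \<psi>) \<partial>H)"
      using hb dens_nonneg(1) by (intro nn_integral_eq_integral) (auto simp: has_bochner_integral_iff)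
    then show ?thesis using has_bochner_integral_integral_eq[OF hb] J0_eq[OF w] by simp
  qed
  finally show ?thesis .
qed

lemma kernel_integral:
  fixes g :: "outcome \<Rightarrow> real"
  assumes g: "g \<in> borel_measurable (outcome_space d n \<mu>)"
  shows "(\<integral>\<omega>. g \<omega> \<partial>kernel w) = (\<integral>\<psi>. Re (dens w \<psi>) * g (lam, Some \<psi>) \<partial>H)"
proof -
  have m: "(\<lambda>\<psi>. g (lam, Some \<psi>)) \<in> borel_measurable H"
    by (rule measurable_compose[OF Pair_Some_measurable[OF lam] g])
  have "(\<integral>\<omega>. g \<omega> \<partial>kernel w) = (\<integral>\<psi>. g (lam, Some \<psi>) \<partial>density H (\<lambda>\<psi>. ennreal (Re (dens w \<psi>))))"
    unfolding kernel_def by (rule integral_distr[OF Pair_Some_measurable_density g])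
  also have "\<dots> = (\<integral>\<psi>. Re (dens w \<psi>) *\<^sub>R g (lam, Some \<psi>) \<partial>H)"
    using dens_measurable[of w] dens_nonneg(1)[of _ w] by (intro integral_density m) auto
  finally show ?thesis by simp
qed

lemma dens_scale: "dens (tscale c w) \<psi> = cnj c * c * dens w \<psi>"
  unfolding dens_eq sum_distrib_left by (intro sum.cong refl) (simp add: tscale_def mult_ac)

end

section \<open>The law of the whole output\<close>

locale measurement = schur_basis d n b + haar d \<mu> for d n b \<mu> +
  assumes d_pos: "1 \<le> d"
begin

lemma row_measurement: "partition_of d n lam \<Longrightarrow> row_measurement d \<mu> n lam"
  by (intro row_measurement.intro row_measurement_axioms.intro haar_axioms d_pos)

abbreviation weight_dens :: "nat list \<Rightarrow> tens \<Rightarrow> (nat \<Rightarrow> complex mat) \<Rightarrow> complex" where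
  "weight_dens lam w \<psi> \<equiv> tinner d n w (row_povm d n lam \<psi> w)"

context
  fixes v assumes v: "v \<in> tensor_space d n" and unit: "tinner d n v v = 1"
begin

lemma post_state_eq:
  assumes "br \<in> branches d n b"
  shows "post_state d n b v br = tscale (of_real (1 / tnorm d n (branch_vec v br))) (branch_vec v br)"
  by (simp add: post_state_def Let_def branch_swap_proj[OF assms])

lemma branch_sym:
  assumes "(lam, j) \<in> branches d n b"
  shows "color_sym n False (row_of lam) (branch_vec v (lam, j))"
    "color_sym n False (row_of lam) (post_state d n b v (lam, j))"
proof -
  have lam: "partition_of d n lam" using assms by (simp add: branches_def)
  note Q = branch_vec_Q[OF assms, of v]
  show "color_sym n False (row_of lam) (branch_vec v (lam, j))" by (rule Q_space_row_sym[OF lam Q])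
  show "color_sym n False (row_of lam) (post_state d n b v (lam, j))"
    unfolding post_state_eq[OF assms]
    by (rule Q_space_row_sym[OF lam]) (intro tens.subspace_scale subspace_Q_space Q)
qed

lemma sum_branch_norms: "(\<Sum>br\<in>branches d n b. (tnorm d n (branch_vec v br))\<^sup>2) = 1"
proof -
  have "tinner d n v v = (\<Sum>br\<in>branches d n b. tinner d n (branch_vec v br) (branch_vec v br))"
    by (rule inner_commuting[of v "\<lambda>v. v"]) (auto intro: v tlinearI)
  then have "complex_of_real (\<Sum>br\<in>branches d n b. (tnorm d n (branch_vec v br))\<^sup>2) = of_real 1"
    unfolding unit by (simp only: tinner_self of_real_sum of_real_1)
  then show ?thesis unfolding of_real_eq_iff .
qed

lemma branches_nonempty: "branches d n b \<noteq> {}"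
  using sum_branch_norms by auto

definition step :: "nat list \<times> nat \<Rightarrow> outcome measure" where
  "step = (\<lambda>(lam, j). distr (row_law d n \<mu> lam (post_state d n b v (lam, j))) (outcome_space d n \<mu>) (Pair lam))"

lemma output_law_eq: "output_law d n b \<mu> v = Giry_Monad.bind (branch_law d n b v) step"
  by (simp add: output_law_def step_def)

text \<open>A branch of norm 0 returns the zero vector, because \<open>1 / 0 = 0\<close>. Hence only
  an inequality holds, and the steps are treated as subprobability kernels.\<close>

lemma post_state_norm:
  assumes "br \<in> branches d n b"
  shows "Re (tinner d n (post_state d n b v br) (post_state d n b v br)) \<le> 1"
proof (cases "tnorm d n (branch_vec v br) = 0")
  case True then show ?thesis by (simp add: post_state_eq[OF assms])
next
  case False
  let ?t = "tnorm d n (branch_vec v br)"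
  have "tinner d n (post_state d n b v br) (post_state d n b v br) = of_real (1 / ?t * (1 / ?t * ?t\<^sup>2))"
    by (simp only: post_state_eq[OF assms] tinner_scale_left tinner_scale_right)
      (simp only: tinner_self complex_cnj_complex_of_real of_real_mult)
  then show ?thesis using False by (simp add: power2_eq_square)
qed

lemma step_mem:
  assumes br: "br \<in> branches d n b"
  shows "step br \<in> space (subprob_algebra (outcome_space d n \<mu>))" "emeasure (step br) (space (step br)) \<le> ennreal 1"
proof -
  obtain lam j where e: "br = (lam, j)" by (cases br)
  have lam: "partition_of d n lam" using br e by (simp add: branches_def)
  interpret row_measurement d \<mu> n lam by (rule row_measurement[OF lam])
  note w = branch_sym(2)[OF br[unfolded e]]
  have s: "step br = kernel (post_state d n b v br)" by (simp add: e step_def row_law_kernel[OF w])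
  show le: "emeasure (step br) (space (step br)) \<le> ennreal 1"
    unfolding s using kernel_mass[OF w] post_state_norm[OF br] by (simp add: e ennreal_le_1)
  have sp: "space (step br) = space (outcome_space d n \<mu>)" by (simp add: s kernel_def)
  have "(lam, None) \<in> space (outcome_space d n \<mu>)" using lam by (simp add: outcome_space_eq)
  then have "subprob_space (step br)" using le sp by (intro subprob_spaceI) auto
  then show "step br \<in> space (subprob_algebra (outcome_space d n \<mu>))"
    by (simp add: space_subprob_algebra s kernel_def)
qed

lemma sets_branch_law: "sets (branch_law d n b v) = sets (count_space (branches d n b))"
  by (simp add: branch_law_def)

lemma step_measurable: "step \<in> measurable (branch_law d n b v) (subprob_algebra (outcome_space d n \<mu>))"
  unfolding measurable_cong_sets[OF sets_branch_law refl] measurable_count_space_eq1 using step_mem(1) by auto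

lemma branch_weight:
  "br \<in> branches d n b \<Longrightarrow> (tnorm d n (branch_proj d n b br v))\<^sup>2 = (tnorm d n (branch_vec v br))\<^sup>2"
  by (simp add: branch_norm_eq)

lemma prob_space_branch_law: "prob_space (branch_law d n b v)"
proof
  have "emeasure (branch_law d n b v) (space (branch_law d n b v))
    = (\<integral>\<^sup>+br. ennreal ((tnorm d n (branch_proj d n b br v))\<^sup>2) \<partial>count_space (branches d n b))"
    unfolding branch_law_def by (subst emeasure_density) (auto intro!: nn_integral_cong)
  also have "\<dots> = (\<Sum>br\<in>branches d n b. ennreal ((tnorm d n (branch_proj d n b br v))\<^sup>2))"
    by (rule nn_integral_count_space_finite[OF finite_branches])
  also have "\<dots> = (\<Sum>br\<in>branches d n b. ennreal ((tnorm d n (branch_vec v br))\<^sup>2))"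
    by (rule sum.cong) (simp_all add: branch_weight)
  also have "\<dots> = 1" by (simp add: sum_ennreal sum_branch_norms)
  finally show "emeasure (branch_law d n b v) (space (branch_law d n b v)) = 1" .
qed

lemma sets_output_law: "sets (output_law d n b \<mu> v) = sets (outcome_space d n \<mu>)"
  unfolding output_law_eq by (rule sets_bind_measurable[OF step_measurable]) (simp add: branch_law_def branches_nonempty)

lemma finite_measure_output_law: "finite_measure (output_law d n b \<mu> v)"
  unfolding output_law_eq
  by (intro subprob_space.axioms(1) subprob_space_bind[OF prob_space_imp_subprob_space[OF prob_space_branch_law] step_measurable])

text \<open>The probability of a branch is the squared norm of its vector and cancels the
  normalization of the returned state; for a branch of norm 0 both sides vanish. So the density of
  the unnormalized branch vector remains.\<close>

lemma output_integral_real: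
  fixes g :: "outcome \<Rightarrow> real"
  assumes g: "g \<in> borel_measurable (outcome_space d n \<mu>)" and bd: "\<And>\<omega>. \<omega> \<in> space (outcome_space d n \<mu>) \<Longrightarrow> \<bar>g \<omega>\<bar> \<le> K"
  shows "(\<integral>\<omega>. g \<omega> \<partial>output_law d n b \<mu> v)
    = (\<Sum>(lam, j)\<in>branches d n b. \<integral>\<psi>. Re (weight_dens lam (branch_vec v (lam, j)) \<psi>) * g (lam, Some \<psi>) \<partial>haar_tuples \<mu> lam)"
proof -
  interpret B: prob_space "branch_law d n b v" by (rule prob_space_branch_law)
  have "(\<integral>\<omega>. g \<omega> \<partial>output_law d n b \<mu> v) = (\<integral>br. (\<integral>\<omega>. g \<omega> \<partial>step br) \<partial>branch_law d n b v)"
    unfolding output_law_eq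
    by (rule integral_bind[OF g bd step_measurable B.finite_measure_axioms, of 1])
      (auto simp: branch_law_def intro!: AE_I2 step_mem(2)[unfolded ennreal_1])
  also have "\<dots> = (\<integral>br. (tnorm d n (branch_proj d n b br v))\<^sup>2 *\<^sub>R (\<integral>\<omega>. g \<omega> \<partial>step br) \<partial>count_space (branches d n b))"
    unfolding branch_law_def by (rule integral_density) auto
  also have "\<dots> = (\<Sum>br\<in>branches d n b. (tnorm d n (branch_proj d n b br v))\<^sup>2 *\<^sub>R (\<integral>\<omega>. g \<omega> \<partial>step br))"
    by (rule lebesgue_integral_count_space_finite[OF finite_branches])
  also have "\<dots> = (\<Sum>br\<in>branches d n b. case br of (lam, j) \<Rightarrow> \<integral>\<psi>. Re (weight_dens lam (branch_vec v (lam, j)) \<psi>) * g (lam, Some \<psi>) \<partial>haar_tuples \<mu> lam)"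
  proof (rule sum.cong[OF refl])
    fix br assume br: "br \<in> branches d n b"
    obtain lam j where e: "br = (lam, j)" by (cases br)
    have lam: "partition_of d n lam" using br e by (simp add: branches_def)
    interpret row_measurement d \<mu> n lam by (rule row_measurement[OF lam])
    let ?u = "branch_vec v br" and ?c = "1 / tnorm d n (branch_vec v br)"
    have s: "step br = kernel (post_state d n b v br)"
      by (simp add: e step_def row_law_kernel[OF branch_sym(2)[OF br[unfolded e]]])
    have u0: "?u = 0" if "tnorm d n ?u = 0"
      using that by (intro tinner_self_eq_0[OF Q_space_tensor_space[OF lam]]) (use branch_vec_Q br e in \<open>auto simp: tinner_self\<close>)
    have d: "(tnorm d n ?u)\<^sup>2 * Re (dens (post_state d n b v br) \<psi>) = Re (dens ?u \<psi>)" for \<psi>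
    proof (cases "tnorm d n ?u = 0")
      case True
      then show ?thesis using u0 by (simp add: dens_def)
    next
      case False
      have "dens (post_state d n b v br) \<psi> = of_real (?c * ?c) * dens ?u \<psi>"
        by (simp add: post_state_eq[OF br] dens_scale)
      then have "Re (dens (post_state d n b v br) \<psi>) = ?c * ?c * Re (dens ?u \<psi>)" by simp
      then show ?thesis using False by (simp add: power2_eq_square)
    qed
    have "(tnorm d n (branch_proj d n b br v))\<^sup>2 *\<^sub>R (\<integral>\<omega>. g \<omega> \<partial>step br)
      = (\<integral>\<psi>. (tnorm d n ?u)\<^sup>2 * (Re (dens (post_state d n b v br) \<psi>) * g (lam, Some \<psi>)) \<partial>haar_tuples \<mu> lam)"
      by (simp add: branch_weight[OF br] s kernel_integral[OF g])
    also have "\<dots> = (\<integral>\<psi>. Re (dens ?u \<psi>) * g (lam, Some \<psi>) \<partial>haar_tuples \<mu> lam)"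
      by (simp only: mult.assoc[symmetric] d)
    finally show "(tnorm d n (branch_proj d n b br v))\<^sup>2 *\<^sub>R (\<integral>\<omega>. g \<omega> \<partial>step br)
      = (case br of (lam, j) \<Rightarrow> \<integral>\<psi>. Re (weight_dens lam (branch_vec v (lam, j)) \<psi>) * g (lam, Some \<psi>) \<partial>haar_tuples \<mu> lam)"
      by (simp add: e dens_def)
  qed
  finally show ?thesis .
qed

lemma output_integrable:
  fixes g :: "outcome \<Rightarrow> 'a :: {banach, second_countable_topology}"
  assumes g: "g \<in> borel_measurable (outcome_space d n \<mu>)" and bd: "\<And>\<omega>. \<omega> \<in> space (outcome_space d n \<mu>) \<Longrightarrow> norm (g \<omega>) \<le> K"
  shows "integrable (output_law d n b \<mu> v) g"
proof -
  interpret finite_measure "output_law d n b \<mu> v" by (rule finite_measure_output_law)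
  show ?thesis
    by (rule integrable_const_bound[of _ K])
      (use g bd in \<open>auto simp: measurable_cong_sets[OF sets_output_law refl] sets_eq_imp_space_eq[OF sets_output_law]\<close>)
qed

lemma output_integral:
  fixes g :: "outcome \<Rightarrow> complex"
  assumes g: "g \<in> borel_measurable (outcome_space d n \<mu>)" and bd: "\<And>\<omega>. \<omega> \<in> space (outcome_space d n \<mu>) \<Longrightarrow> cmod (g \<omega>) \<le> K"
    and hb: "\<And>lam j. (lam, j) \<in> branches d n b \<Longrightarrow>
      has_bochner_integral (haar_tuples \<mu> lam) (\<lambda>\<psi>. weight_dens lam (branch_vec v (lam, j)) \<psi> * g (lam, Some \<psi>)) (I (lam, j))"
  shows "(\<integral>\<omega>. g \<omega> \<partial>output_law d n b \<mu> v) = (\<Sum>br\<in>branches d n b. I br)"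
proof -
  note int = output_integrable[OF g bd]
  \<comment> \<open>Real and imaginary part are handled at once: \<open>T\<close> stands for either,
    and the density, being real, can be pulled through it.\<close>
  have part: "(\<integral>\<omega>. T (g \<omega>) \<partial>output_law d n b \<mu> v) = T (\<Sum>br\<in>branches d n b. I br)"
    if T: "bounded_linear T" "\<And>x y. T (of_real x * y) = x * T y" "\<And>x. \<bar>T x\<bar> \<le> cmod x" for T :: "complex \<Rightarrow> real"
  proof -
    have "(\<lambda>\<omega>. T (g \<omega>)) \<in> borel_measurable (outcome_space d n \<mu>)"
      by (rule measurable_compose[OF g]) (use T(1) in \<open>auto intro: borel_measurable_continuous_onI linear_continuous_on\<close>)
    then have "(\<integral>\<omega>. T (g \<omega>) \<partial>output_law d n b \<mu> v)
      = (\<Sum>(lam, j)\<in>branches d n b. \<integral>\<psi>. Re (weight_dens lam (branch_vec v (lam, j)) \<psi>) * T (g (lam, Some \<psi>)) \<partial>haar_tuples \<mu> lam)"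
      using bd T(3) by (intro output_integral_real[where K = K]) (auto intro: order_trans)
    also have "\<dots> = (\<Sum>br\<in>branches d n b. T (I br))"
    proof (rule sum.cong[OF refl])
      fix br assume br: "br \<in> branches d n b"
      obtain lam j where e: "br = (lam, j)" by (cases br)
      have lam: "partition_of d n lam" using br e by (simp add: branches_def)
      interpret row_measurement d \<mu> n lam by (rule row_measurement[OF lam])
      have "(\<integral>\<psi>. Re (weight_dens lam (branch_vec v (lam, j)) \<psi>) * T (g (lam, Some \<psi>)) \<partial>haar_tuples \<mu> lam)
        = (\<integral>\<psi>. T (weight_dens lam (branch_vec v (lam, j)) \<psi> * g (lam, Some \<psi>)) \<partial>haar_tuples \<mu> lam)"
      proof (rule Bochner_Integration.integral_cong[OF refl])
        fix \<psi> assume "\<psi> \<in> space (haar_tuples \<mu> lam)"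
        from dens_nonneg(2)[OF this, of "branch_vec v (lam, j)", unfolded dens_def]
        show "Re (weight_dens lam (branch_vec v (lam, j)) \<psi>) * T (g (lam, Some \<psi>)) = T (weight_dens lam (branch_vec v (lam, j)) \<psi> * g (lam, Some \<psi>))"
          using T(2) by metis
      qed
      also have "\<dots> = T (I (lam, j))"
        by (rule has_bochner_integral_integral_eq[OF has_bochner_integral_bounded_linear[OF T(1) hb]]) (use br e in simp)
      finally show "(case br of (lam, j) \<Rightarrow> \<integral>\<psi>. Re (weight_dens lam (branch_vec v (lam, j)) \<psi>) * T (g (lam, Some \<psi>)) \<partial>haar_tuples \<mu> lam) = T (I br)"
        by (simp add: e)
    qed
    also have "\<dots> = T (\<Sum>br\<in>branches d n b. I br)"
      using linear_sum[OF bounded_linear.linear[OF T(1)]] by metis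
    finally show ?thesis .
  qed
  have "Re (\<integral>\<omega>. g \<omega> \<partial>output_law d n b \<mu> v) = Re (\<Sum>br\<in>branches d n b. I br)"
    using part[of Re] integral_Re[OF int] bounded_linear_Re abs_Re_le_cmod by simp
  moreover have "Im (\<integral>\<omega>. g \<omega> \<partial>output_law d n b \<mu> v) = Im (\<Sum>br\<in>branches d n b. I br)"
    using part[of Im] integral_Im[OF int] bounded_linear_Im abs_Im_le_cmod by simp
  ultimately show ?thesis by (simp add: complex_eq_iff)
qed

end

end

subsection \<open>Product vectors\<close>

definition product_vec :: "nat \<Rightarrow> nat \<Rightarrow> (nat \<Rightarrow> nat \<Rightarrow> complex) \<Rightarrow> tens" where
  "product_vec d n \<phi> = (\<lambda>e. if e \<in> strings d n then \<Prod>x<n. \<phi> x (e x) else 0)"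

definition vdot :: "nat \<Rightarrow> (nat \<Rightarrow> complex) \<Rightarrow> (nat \<Rightarrow> complex) \<Rightarrow> complex" where
  "vdot d u v = (\<Sum>q<d. cnj (u q) * v q)"

definition mvec :: "nat \<Rightarrow> (nat \<Rightarrow> nat \<Rightarrow> complex) \<Rightarrow> (nat \<Rightarrow> complex) \<Rightarrow> nat \<Rightarrow> complex" where
  "mvec d A u = (\<lambda>p. \<Sum>q<d. A p q * u q)"

lemma product_vec_tensor_space: "product_vec d n \<phi> \<in> tensor_space d n"
  by (simp add: tensor_space_iff product_vec_def)

lemma tinner_product_vec: "tinner d n (product_vec d n \<phi>) (product_vec d n \<xi>) = (\<Prod>x<n. vdot d (\<phi> x) (\<xi> x))"
proof -
  have "tinner d n (product_vec d n \<phi>) (product_vec d n \<xi>) = (\<Sum>e\<in>strings d n. \<Prod>x<n. cnj (\<phi> x (e x)) * \<xi> x (e x))"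
    unfolding tinner_def by (rule sum.cong) (simp_all add: product_vec_def prod.distrib)
  also have "\<dots> = (\<Prod>x<n. vdot d (\<phi> x) (\<xi> x))"
    unfolding strings_def vdot_def by (rule prod_sum_PiE[symmetric]) auto
  finally show ?thesis .
qed

lemma site_op_product_vec:
  assumes x: "x < n"
  shows "site_op d n A x (product_vec d n \<phi>) = product_vec d n (\<phi>(x := mvec d A (\<phi> x)))"
proof
  fix e :: "nat \<Rightarrow> nat"
  show "site_op d n A x (product_vec d n \<phi>) e = product_vec d n (\<phi>(x := mvec d A (\<phi> x))) e"
  proof (cases "e \<in> strings d n")
    case e: True
    define P where "P = (\<Prod>y\<in>{..<n} - {x}. \<phi> y (e y))"
    have 1: "product_vec d n \<phi> (e(x := q)) = \<phi> x q * P" if "q < d" for q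
    proof -
      have "(\<Prod>y<n. \<phi> y ((e(x := q)) y)) = \<phi> x ((e(x := q)) x) * (\<Prod>y\<in>{..<n} - {x}. \<phi> y ((e(x := q)) y))"
        by (rule prod.remove) (use x in auto)
      also have "(\<Prod>y\<in>{..<n} - {x}. \<phi> y ((e(x := q)) y)) = P" unfolding P_def by (rule prod.cong) auto
      finally show ?thesis using strings_upd[OF e x that] by (simp add: product_vec_def)
    qed
    have "(\<Prod>y<n. (\<phi>(x := mvec d A (\<phi> x))) y (e y)) = (\<phi>(x := mvec d A (\<phi> x))) x (e x) * (\<Prod>y\<in>{..<n} - {x}. (\<phi>(x := mvec d A (\<phi> x))) y (e y))"
      by (rule prod.remove) (use x in auto)
    also have "(\<Prod>y\<in>{..<n} - {x}. (\<phi>(x := mvec d A (\<phi> x))) y (e y)) = P" unfolding P_def by (rule prod.cong) auto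
    finally have "product_vec d n (\<phi>(x := mvec d A (\<phi> x))) e = (\<Sum>q<d. A (e x) q * \<phi> x q) * P"
      using e by (simp add: product_vec_def mvec_def)
    moreover have "site_op d n A x (product_vec d n \<phi>) e = (\<Sum>q<d. A (e x) q * (\<phi> x q * P))"
      using e 1 by (simp add: site_op_def)
    ultimately show ?thesis by (simp add: sum_distrib_right mult.assoc)
  qed (simp add: site_op_def product_vec_def)
qed

context
  fixes d n :: nat and \<phi> :: "nat \<Rightarrow> nat \<Rightarrow> complex" and A :: "nat \<Rightarrow> nat \<Rightarrow> complex"
  assumes unit: "\<And>x. x < n \<Longrightarrow> vdot d (\<phi> x) (\<phi> x) = 1"
begin

abbreviation "pv \<equiv> product_vec d n \<phi>"

lemma pv_unit: "tinner d n pv pv = 1"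
  by (simp add: tinner_product_vec unit)

lemma pv_site: "x < n \<Longrightarrow> tinner d n pv (site_op d n A x pv) = vdot d (\<phi> x) (mvec d A (\<phi> x))"
proof -
  assume x: "x < n"
  have "tinner d n pv (site_op d n A x pv) = (\<Prod>y<n. vdot d (\<phi> y) ((\<phi>(x := mvec d A (\<phi> x))) y))"
    by (simp only: site_op_product_vec[OF x] tinner_product_vec)
  also have "\<dots> = (\<Prod>y<n. if y = x then vdot d (\<phi> x) (mvec d A (\<phi> x)) else 1)"
    by (rule prod.cong) (auto simp: unit)
  finally show ?thesis using x by simp
qed

lemma pv_sites: "tinner d n pv (sites_op d n A {..<n} pv) = (\<Sum>x<n. vdot d (\<phi> x) (mvec d A (\<phi> x)))"
  unfolding sites_op_def tinner_sum_right by (rule sum.cong) (simp_all add: pv_site)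

lemma pv_site_site:
  assumes x: "x < n" and y: "y < n"
  shows "tinner d n pv (site_op d n A x (site_op d n A y pv)) =
    (if x = y then vdot d (\<phi> x) (mvec d A (mvec d A (\<phi> x))) else vdot d (\<phi> x) (mvec d A (\<phi> x)) * vdot d (\<phi> y) (mvec d A (\<phi> y)))"
proof -
  let ?\<xi> = "\<phi>(y := mvec d A (\<phi> y))"
  have e: "tinner d n pv (site_op d n A x (site_op d n A y pv)) = (\<Prod>z<n. vdot d (\<phi> z) ((?\<xi>(x := mvec d A (?\<xi> x))) z))"
    by (simp only: site_op_product_vec[OF x] site_op_product_vec[OF y] tinner_product_vec)
  show ?thesis
  proof (cases "x = y")
    case True
    have "(\<Prod>z<n. vdot d (\<phi> z) ((?\<xi>(x := mvec d A (?\<xi> x))) z)) = (\<Prod>z<n. if z = x then vdot d (\<phi> x) (mvec d A (mvec d A (\<phi> x))) else 1)"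
      by (rule prod.cong) (auto simp: unit True)
    then show ?thesis using e x True by simp
  next
    case False
    have "(\<Prod>z<n. vdot d (\<phi> z) ((?\<xi>(x := mvec d A (?\<xi> x))) z))
      = (\<Prod>z<n. (if z = x then vdot d (\<phi> x) (mvec d A (\<phi> x)) else 1) * (if z = y then vdot d (\<phi> y) (mvec d A (\<phi> y)) else 1))"
      by (rule prod.cong) (use False in \<open>auto simp: unit\<close>)
    then show ?thesis using e x y False by (simp add: prod.distrib)
  qed
qed

text \<open>In a product vector different sites are uncorrelated, so the second moment exceeds the
  squared mean by the sum of the one-site variances. Each variance is at most the squared norm of
  \<open>A\<close> applied to a unit vector, hence at most 1.\<close>

lemma pv_second_moment:
  assumes A: "\<And>p q. p < d \<Longrightarrow> q < d \<Longrightarrow> cnj (A p q) = A q p"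
    and bound: "\<And>x. x < n \<Longrightarrow> Re (vdot d (mvec d A (\<phi> x)) (mvec d A (\<phi> x))) \<le> 1"
  shows "Re (tinner d n pv (sites_op d n A {..<n} (sites_op d n A {..<n} pv))) \<le> (cmod (tinner d n pv (sites_op d n A {..<n} pv)))\<^sup>2 + n"
    and "Re (tinner d n pv (sites_op d n (mat_mul d A A) {..<n} pv)) \<le> n"
proof -
  let ?a = "\<lambda>x. vdot d (\<phi> x) (mvec d A (\<phi> x))" and ?s = "\<lambda>x. vdot d (\<phi> x) (mvec d A (mvec d A (\<phi> x)))"
  have herm: "vdot d u (mvec d A v) = vdot d (mvec d A u) v" for u v
  proof -
    have "vdot d u (mvec d A v) = (\<Sum>p<d. \<Sum>q<d. cnj (u p) * (A p q * v q))" by (simp add: vdot_def mvec_def sum_distrib_left)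
    also have "\<dots> = (\<Sum>q<d. \<Sum>p<d. cnj (u p) * (A p q * v q))" by (rule sum.swap)
    also have "\<dots> = (\<Sum>q<d. \<Sum>p<d. cnj (A q p * u p) * v q)"
      by (intro sum.cong refl) (simp add: A mult_ac)
    also have "\<dots> = vdot d (mvec d A u) v" by (simp add: vdot_def mvec_def sum_distrib_right)
    finally show ?thesis .
  qed
  have s: "Re (?s x) \<le> 1" if "x < n" for x using bound[OF that] herm by simp
  have cj: "cnj (vdot d u v) = vdot d v u" for u v by (simp add: vdot_def mult.commute)
  have real: "?a x = of_real (Re (?a x))" for x
    using cj[of "\<phi> x" "mvec d A (\<phi> x)"] herm[of "\<phi> x" "\<phi> x"] by (simp add: complex_eq_iff)
  have mean: "tinner d n pv (sites_op d n A {..<n} pv) = of_real (\<Sum>x<n. Re (?a x))"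
    unfolding pv_sites of_real_sum by (rule sum.cong[OF refl real])
  have "tinner d n pv (sites_op d n A {..<n} (sites_op d n A {..<n} pv)) = (\<Sum>x<n. \<Sum>y<n. tinner d n pv (site_op d n A x (site_op d n A y pv)))"
    by (simp add: sites_op_def tlinear_sum[OF tlinear_site_op] tinner_sum_right)
  also have "\<dots> = (\<Sum>x<n. \<Sum>y<n. ?a x * ?a y + (if x = y then ?s x - ?a x * ?a x else 0))"
    by (intro sum.cong refl) (auto simp: pv_site_site)
  also have "\<dots> = (\<Sum>x<n. ?a x) * (\<Sum>x<n. ?a x) + (\<Sum>x<n. ?s x - ?a x * ?a x)"
    by (simp add: sum.distrib sum_product)
  finally have e: "tinner d n pv (sites_op d n A {..<n} (sites_op d n A {..<n} pv)) = (\<Sum>x<n. ?a x) * (\<Sum>x<n. ?a x) + (\<Sum>x<n. ?s x - ?a x * ?a x)" .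
  have aa: "(\<Sum>x<n. ?a x) = of_real (\<Sum>x<n. Re (?a x))" using mean by (simp only: pv_sites)
  have "Re (\<Sum>x<n. ?s x - ?a x * ?a x) \<le> (\<Sum>x<n. 1)"
    unfolding Re_sum
  proof (rule sum_mono)
    fix x assume "x \<in> {..<n}"
    have "?a x * ?a x = of_real (Re (?a x) * Re (?a x))" using real[of x] by (metis of_real_mult)
    then have "0 \<le> Re (?a x * ?a x)" by (metis Re_complex_of_real zero_le_square)
    then show "Re (?s x - ?a x * ?a x) \<le> 1" using s[of x] \<open>x \<in> {..<n}\<close> by simp
  qed
  then show "Re (tinner d n pv (sites_op d n A {..<n} (sites_op d n A {..<n} pv))) \<le> (cmod (tinner d n pv (sites_op d n A {..<n} pv)))\<^sup>2 + n"
  proof -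
    define S where "S = (\<Sum>x<n. Re (?a x))"
    assume "Re (\<Sum>x<n. ?s x - ?a x * ?a x) \<le> (\<Sum>x<n. 1)"
    then show ?thesis unfolding e mean aa S_def[symmetric] by (simp add: power2_eq_square del: Re_sum)
  qed
  have "mvec d (mat_mul d A A) u p = mvec d A (mvec d A u) p" for u p
  proof -
    have "mvec d (mat_mul d A A) u p = (\<Sum>q<d. \<Sum>k<d. A p k * A k q * u q)" by (simp add: mvec_def mat_mul_def sum_distrib_right)
    also have "\<dots> = (\<Sum>k<d. \<Sum>q<d. A p k * A k q * u q)" by (rule sum.swap)
    finally show ?thesis by (simp add: mvec_def sum_distrib_left mult.assoc)
  qed
  then have mm: "mvec d (mat_mul d A A) u = mvec d A (mvec d A u)" for u by blast
  have "tinner d n pv (sites_op d n (mat_mul d A A) {..<n} pv) = (\<Sum>x<n. ?s x)"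
  proof -
    have "tinner d n pv (site_op d n (mat_mul d A A) x pv) = ?s x" if "x < n" for x
    proof -
      have "tinner d n pv (site_op d n (mat_mul d A A) x pv) = (\<Prod>y<n. vdot d (\<phi> y) ((\<phi>(x := mvec d (mat_mul d A A) (\<phi> x))) y))"
        by (simp only: site_op_product_vec[OF that] tinner_product_vec)
      also have "\<dots> = (\<Prod>y<n. if y = x then ?s x else 1)" by (rule prod.cong) (auto simp: unit mm)
      finally show ?thesis using that by simp
    qed
    then show ?thesis by (simp add: sites_op_def tinner_sum_right)
  qed
  then have "Re (tinner d n pv (sites_op d n (mat_mul d A A) {..<n} pv)) = (\<Sum>x<n. Re (?s x))" by simp
  also have "\<dots> \<le> (\<Sum>x<n. 1)" by (rule sum_mono) (use s in auto)
  finally show "Re (tinner d n pv (sites_op d n (mat_mul d A A) {..<n} pv)) \<le> n" by simp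
qed

end

section \<open>Input states and the operator norm\<close>

lemma input_state_eq:
  assumes "e \<in> strings d n"
  shows "input_state d n U e = product_vec d n (\<lambda>x a. U $$ (a, e x))"
proof
  fix f
  have "(\<Sum>g\<in>strings d n. (\<Prod>x<n. U $$ (f x, g x)) * ket e g) = (\<Sum>g\<in>strings d n. if g = e then \<Prod>x<n. U $$ (f x, e x) else 0)"
    by (rule sum.cong) (auto simp: ket_def)
  then show "input_state d n U e f = product_vec d n (\<lambda>x a. U $$ (a, e x)) f"
    using assms by (simp add: input_state_def tensor_op_def product_vec_def)
qed

lemma unitary_column:
  assumes U: "unitary_mat d U" and a: "a < d"
  shows "vdot d (\<lambda>q. U $$ (q, a)) (\<lambda>q. U $$ (q, a)) = 1"
proof -
  have c: "U \<in> carrier_mat d d" and u: "mat_adjoint U * U = 1\<^sub>m d" using U by (auto simp: unitary_mat_def)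
  have "(mat_adjoint U * U) $$ (a, a) = (\<Sum>q<d. cnj (U $$ (q, a)) * U $$ (q, a))"
    unfolding mult_mat_index[OF mat_adjoint_carrier[OF c] c a a]
    by (rule sum.cong) (use a in \<open>auto simp: mat_adjoint_index[OF c]\<close>)
  then show ?thesis using u a by (simp add: vdot_def)
qed

text \<open>The supremum dominates its members only if the set is bounded above; the sum of the
  moduli of all entries is a bound on unit vectors.\<close>

lemma op_norm_bound:
  assumes A: "A \<in> carrier_mat d d" and v: "v \<in> carrier_vec d" "euclid_norm v = 1"
  shows "euclid_norm (A *\<^sub>v v) \<le> op_norm d A"
  unfolding op_norm_def
proof (rule cSUP_upper)
  show "v \<in> {v \<in> carrier_vec d. euclid_norm v = 1}" using v by simp
  show "bdd_above ((\<lambda>v. euclid_norm (A *\<^sub>v v)) ` {v \<in> carrier_vec d. euclid_norm v = 1})"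
  proof (rule bdd_aboveI2)
    fix v :: "complex Matrix.vec" assume "v \<in> {v \<in> carrier_vec d. euclid_norm v = 1}"
    then have v: "v \<in> carrier_vec d" "L2_set (\<lambda>i. cmod (v $ i)) {..<d} = 1" by (auto simp: euclid_norm_def)
    have v1: "cmod (v $ i) \<le> 1" if "i < d" for i
      using member_le_L2_set[of "{..<d}" i "\<lambda>i. cmod (v $ i)"] that v(2) by simp
    have "euclid_norm (A *\<^sub>v v) \<le> (\<Sum>i<d. cmod ((A *\<^sub>v v) $ i))"
    proof -
      have "dim_vec (A *\<^sub>v v) = d" using A by simp
      then show ?thesis unfolding euclid_norm_def by (simp only:) (rule L2_set_le_sum, simp)
    qed
    also have "\<dots> \<le> (\<Sum>i<d. \<Sum>j<d. cmod (A $$ (i, j)))"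
    proof (rule sum_mono)
      fix i assume i: "i \<in> {..<d}"
      have "(A *\<^sub>v v) $ i = (\<Sum>j<d. A $$ (i, j) * v $ j)"
        using A v i by (simp add: scalar_prod_def atLeast0LessThan)
      also have "cmod \<dots> \<le> (\<Sum>j<d. cmod (A $$ (i, j)))"
        by (intro order_trans[OF norm_sum] sum_mono) (simp add: norm_mult mult_left_le v1)
      finally show "cmod ((A *\<^sub>v v) $ i) \<le> (\<Sum>j<d. cmod (A $$ (i, j)))" by simp
    qed
    finally show "euclid_norm (A *\<^sub>v v) \<le> (\<Sum>i<d. \<Sum>j<d. cmod (A $$ (i, j)))" .
  qed
qed

lemma mvec_norm_le:
  assumes A: "A \<in> carrier_mat d d" and op: "op_norm d A = 1" and u: "vdot d u u = 1"
  shows "Re (vdot d (mvec d (\<lambda>p q. A $$ (p, q)) u) (mvec d (\<lambda>p q. A $$ (p, q)) u)) \<le> 1"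
proof -
  have L2: "vdot d f f = of_real ((L2_set (\<lambda>i. cmod (f i)) {..<d})\<^sup>2)" for f
    by (simp add: vdot_def L2_set_def sum_nonneg complex_norm_square[symmetric] mult.commute flip: of_real_power)
  define v where "v = Matrix.vec d u"
  have v: "v \<in> carrier_vec d" by (simp add: v_def)
  have "(L2_set (\<lambda>i. cmod (u i)) {..<d})\<^sup>2 = 1" using u unfolding L2 by (metis of_real_eq_1_iff)
  then have "L2_set (\<lambda>i. cmod (u i)) {..<d} = 1 \<or> L2_set (\<lambda>i. cmod (u i)) {..<d} = -1" by (simp only: power2_eq_1_iff)
  then have L1: "L2_set (\<lambda>i. cmod (u i)) {..<d} = 1" using L2_set_nonneg[of "\<lambda>i. cmod (u i)" "{..<d}"] by linarith
  have "L2_set (\<lambda>i. cmod (v $ i)) {..<d} = L2_set (\<lambda>i. cmod (u i)) {..<d}"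
    by (rule L2_set_cong) (auto simp: v_def)
  then have nv: "euclid_norm v = 1" using L1 v by (simp add: euclid_norm_def)
  have e: "(A *\<^sub>v v) $ i = mvec d (\<lambda>p q. A $$ (p, q)) u i" if "i < d" for i
    using A that by (simp add: v_def mvec_def scalar_prod_def atLeast0LessThan)
  have "euclid_norm (A *\<^sub>v v) \<le> 1" using op_norm_bound[OF A v nv] op by simp
  moreover have "euclid_norm (A *\<^sub>v v) = L2_set (\<lambda>i. cmod (mvec d (\<lambda>p q. A $$ (p, q)) u i)) {..<d}"
    unfolding euclid_norm_def by (rule L2_set_cong) (use A e in auto)
  ultimately have "L2_set (\<lambda>i. cmod (mvec d (\<lambda>p q. A $$ (p, q)) u i)) {..<d} \<le> 1" by simp
  then show ?thesis unfolding L2 using L2_set_nonneg by (simp add: power_le_one)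
qed

text \<open>The tensor power of \<open>U\<close> commutes with the permutations, so it can be pulled
  out of the antisymmetrizer, leaving a basis vector with the symbols of \<open>e\<close>;
  \<open>color_sum_column_ket\<close> kills it when there are more rows than symbols.\<close>

lemma color_sum_input_state:
  assumes lam: "partition_of d n lam" and e: "e \<in> strings d n" and g: "g permutes {..<n}"
    and nz: "color_sum n True (col_of lam) (perm_op g (input_state d n U e)) \<noteq> 0"
  shows "length lam \<le> card (e ` {..<n})"
proof (rule ccontr)
  assume less: "\<not> length lam \<le> card (e ` {..<n})"
  let ?T = "tensor_op d n (\<lambda>_. U)"
  have T: "tlinear ?T"
    by (intro tlinearI) (auto simp: tensor_op_def tscale_def plus_fun_apply fun_eq_iff algebra_simps sum.distrib sum_distrib_left)
  have comm: "perm_op \<pi> (?T v) = ?T (perm_op \<pi> v)" if p: "\<pi> permutes {..<n}" for \<pi> v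
  proof
    fix f :: "nat \<Rightarrow> nat"
    have "(\<Sum>g\<in>strings d n. (\<Prod>x<n. U $$ ((f \<circ> \<pi>) x, g x)) * v g) = (\<Sum>g\<in>strings d n. (\<Prod>x<n. U $$ (f x, g x)) * v (g \<circ> \<pi>))"
    proof (rule sum.reindex_bij_witness[where i = "\<lambda>g. g \<circ> \<pi>" and j = "\<lambda>g. g \<circ> pinv \<pi>"])
      fix h assume h: "h \<in> strings d n"
      have "(\<Prod>x<n. U $$ (f x, (h \<circ> pinv \<pi>) x)) = (\<Prod>x<n. U $$ ((f \<circ> \<pi>) x, h x))"
        using prod.permute[OF p, of "\<lambda>x. U $$ (f x, (h \<circ> pinv \<pi>) x)"] by (simp add: comp_def permutes_inverses[OF p])
      then show "(\<Prod>x<n. U $$ (f x, (h \<circ> pinv \<pi>) x)) * v (h \<circ> pinv \<pi> \<circ> \<pi>) = (\<Prod>x<n. U $$ ((f \<circ> \<pi>) x, h x)) * v h"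
        by (simp add: comp_assoc permutes_inv_o[OF p])
    qed (auto simp: comp_assoc permutes_inv_o[OF p] strings_comp_permutes[OF p] strings_comp_permutes[OF permutes_inv[OF p]])
    then show "perm_op \<pi> (?T v) f = ?T (perm_op \<pi> v) f"
      by (simp add: perm_op_def tensor_op_def strings_comp_permutes[OF p])
  qed
  have "color_sum n True (col_of lam) (perm_op g (?T (ket e))) = ?T (color_sum n True (col_of lam) (ket (e \<circ> pinv g)))"
    unfolding comm[OF g] perm_op_ket[OF g] color_sum_def tlinear_sum[OF T] tlinear_scale[OF T]
    by (rule sum.cong) (simp_all add: comm color_group_permutes)
  also have "color_sum n True (col_of lam) (ket (e \<circ> pinv g)) = 0"
  proof (rule color_sum_column_ket[OF lam])
    have "pinv g ` {..<n} = {..<n}" by (rule permutes_image[OF permutes_inv[OF g]])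
    then show "card ((e \<circ> pinv g) ` {..<n}) < length lam" using less unfolding image_comp[symmetric] by simp
  qed
  finally show False using nz by (simp add: input_state_def tlinear_zero[OF T])
qed

subsection \<open>The estimator\<close>

text \<open>The value 0 is assigned to the fail outcome, which has probability 0.\<close>

definition estimator :: "nat \<Rightarrow> nat \<Rightarrow> outcome \<Rightarrow> complex mat" where
  "estimator d n \<omega> = (case \<omega> of (lam, None) \<Rightarrow> 0\<^sub>m d d
     | (lam, Some \<psi>) \<Rightarrow> mat d d (\<lambda>(a, c). 1 / of_nat n *
         (\<Sum>i<length lam. (of_nat (lam ! i) + of_nat d) * \<psi> i $$ (a, c) - (if a = c then 1 else 0))))"

text \<open>The trace of the estimator against \<open>A\<close>. Matrix units for \<open>A\<close>
  give its entries and an observable gives the quantity whose variance is bounded, so one set of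
  moments serves both.\<close>

definition score :: "nat \<Rightarrow> nat \<Rightarrow> (nat \<Rightarrow> nat \<Rightarrow> complex) \<Rightarrow> outcome \<Rightarrow> complex" where
  "score d n A \<omega> = (case \<omega> of (lam, None) \<Rightarrow> 0
     | (lam, Some \<psi>) \<Rightarrow> 1 / of_nat n *
         (\<Sum>i<length lam. (of_nat (lam ! i) + of_nat d) * (\<Sum>p<d. \<Sum>q<d. A q p * \<psi> i $$ (p, q)) - mat_tr d A))"

lemma estimator_carrier: "estimator d n \<omega> \<in> carrier_mat d d"
  by (auto simp: estimator_def split: prod.split option.split)

lemma sum_unit_matrix:
  fixes a c d :: nat
  assumes "a < d" "c < d"
  shows "(\<Sum>p<d. \<Sum>q<d. (if q = c \<and> p = a then 1 else 0) * f p q) = (f a c :: complex)"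
proof -
  have "(\<Sum>p<d. \<Sum>q<d. (if q = c \<and> p = a then 1 else 0) * f p q) = (\<Sum>p<d. \<Sum>q<d. if q = c then (if p = a then f p q else 0) else 0)"
    by (intro sum.cong refl) auto
  also have "\<dots> = (\<Sum>p<d. if p = a then f p c else 0)" by (intro sum.cong refl sum_delta_less(1)[OF assms(2)])
  also have "\<dots> = f a c" by (rule sum_delta_less(1)[OF assms(1)])
  finally show ?thesis .
qed

lemma estimator_entry:
  assumes "a < d" "c < d"
  shows "estimator d n \<omega> $$ (a, c) = score d n (\<lambda>q p. if q = c \<and> p = a then 1 else 0) \<omega>"
proof -
  have "mat_tr d (\<lambda>q p. if q = c \<and> p = a then 1 else 0) = (if a = c then 1 else 0)"
  proof -
    have "mat_tr d (\<lambda>q p. if q = c \<and> p = a then 1 else 0) = (\<Sum>k<d. if k = c then (if k = a then 1 else 0) else 0)"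
      unfolding mat_tr_def by (intro sum.cong refl) auto
    then show ?thesis using assms by auto
  qed
  then show ?thesis
    using assms by (auto simp: estimator_def score_def sum_unit_matrix split: prod.split option.split)
qed

lemma mat_trace_mult:
  assumes A: "A \<in> carrier_mat d d" and M: "M \<in> carrier_mat d d"
  shows "mat_trace (A * M) = (\<Sum>p<d. \<Sum>q<d. A $$ (q, p) * M $$ (p, q))"
proof -
  have "mat_trace (A * M) = (\<Sum>q<d. \<Sum>p<d. A $$ (q, p) * M $$ (p, q))"
    unfolding mat_trace_def using A by (auto simp: mult_mat_index[OF A M] simp del: index_mult_mat(1) intro!: sum.cong)
  then show ?thesis by (subst sum.swap)
qed

lemma estimator_trace:
  assumes A: "A \<in> carrier_mat d d"
  shows "mat_trace (A * estimator d n \<omega>) = score d n (\<lambda>p q. A $$ (p, q)) \<omega>"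
proof -
  obtain lam \<psi> where \<omega>: "\<omega> = (lam, \<psi>)" by (cases \<omega>)
  show ?thesis
  proof (cases \<psi>)
    case None
    then show ?thesis unfolding mat_trace_mult[OF A estimator_carrier] by (simp add: \<omega> estimator_def score_def)
  next
    case (Some \<xi>)
    let ?f = "\<lambda>i p q. (of_nat (lam ! i) + of_nat d) * \<xi> i $$ (p, q) - (if p = q then 1 else 0)"
    have tr: "(\<Sum>p<d. \<Sum>q<d. A $$ (q, p) * ?f i p q) = (of_nat (lam ! i) + of_nat d) * (\<Sum>p<d. \<Sum>q<d. A $$ (q, p) * \<xi> i $$ (p, q)) - mat_tr d (\<lambda>p q. A $$ (p, q))" for i
    proof -
      have "(\<Sum>p<d. \<Sum>q<d. A $$ (q, p) * ?f i p q) = (\<Sum>p<d. \<Sum>q<d. (of_nat (lam ! i) + of_nat d) * (A $$ (q, p) * \<xi> i $$ (p, q)) - (if p = q then A $$ (q, p) else 0))"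
        by (intro sum.cong refl) (auto simp: algebra_simps)
      then show ?thesis by (simp add: sum_subtractf sum_distrib_left mat_tr_def)
    qed
    have "mat_trace (A * estimator d n \<omega>) = (\<Sum>p<d. \<Sum>q<d. A $$ (q, p) * (1 / of_nat n * (\<Sum>i<length lam. ?f i p q)))"
      unfolding mat_trace_mult[OF A estimator_carrier] by (intro sum.cong refl) (simp add: \<omega> Some estimator_def)
    also have "\<dots> = (\<Sum>p<d. \<Sum>q<d. \<Sum>i<length lam. 1 / of_nat n * (A $$ (q, p) * ?f i p q))"
      unfolding sum_distrib_left by (intro sum.cong refl) (simp only: mult.left_commute)
    also have "\<dots> = (\<Sum>p<d. \<Sum>i<length lam. \<Sum>q<d. 1 / of_nat n * (A $$ (q, p) * ?f i p q))"
      by (intro sum.cong refl sum.swap)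
    also have "\<dots> = (\<Sum>i<length lam. \<Sum>p<d. \<Sum>q<d. 1 / of_nat n * (A $$ (q, p) * ?f i p q))"
      by (rule sum.swap)
    also have "\<dots> = 1 / of_nat n * (\<Sum>i<length lam. \<Sum>p<d. \<Sum>q<d. A $$ (q, p) * ?f i p q)"
      by (simp only: sum_distrib_left)
    finally show ?thesis unfolding tr by (simp add: \<omega> Some score_def)
  qed
qed

lemma mat_tr_square_nonneg:
  assumes A: "\<And>p q. p < d \<Longrightarrow> q < d \<Longrightarrow> cnj (A p q) = A q p"
  shows "mat_tr d (mat_mul d A A) = of_real (\<Sum>p<d. \<Sum>q<d. (cmod (A p q))\<^sup>2)"
proof -
  have "A p q * A q p = of_real ((cmod (A p q))\<^sup>2)" if "p < d" "q < d" for p q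
    unfolding A[OF that, symmetric] by (rule complex_norm_square[symmetric])
  then show ?thesis unfolding mat_tr_def mat_mul_def of_real_sum by (intro sum.cong refl) simp
qed

section \<open>Mean and second moment of the estimator\<close>

context measurement
begin

lemma score_measurable: "score d n A \<in> borel_measurable (outcome_space d n \<mu>)"
proof (rule outcome_borel_measurable)
  fix lam assume lam: "partition_of d n lam"
  interpret row_measurement d \<mu> n lam by (rule row_measurement[OF lam])
  show "(\<lambda>\<psi>. score d n A (lam, Some \<psi>)) \<in> borel_measurable (haar_tuples \<mu> lam)"
    unfolding score_def prod.case option.case
    by (intro borel_measurable_times borel_measurable_sum borel_measurable_diff borel_measurable_const entry_H_measurable) auto
qed

text \<open>There are at most \<open>d\<close> rows of length at most \<open>n\<close>, and entries
  of projectors have modulus at most 1. Boundedness allows integrals to be taken through the bind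
  over the branches.\<close>

lemma score_bounded: "\<exists>K. \<forall>\<omega>\<in>space (outcome_space d n \<mu>). cmod (score d n A \<omega>) \<le> K"
proof -
  define c where "c = real (n + d) * (\<Sum>p<d. \<Sum>q<d. cmod (A q p)) + cmod (mat_tr d A)"
  have c0: "0 \<le> c" unfolding c_def by (intro add_nonneg_nonneg mult_nonneg_nonneg sum_nonneg) auto
  show ?thesis
  proof (intro exI ballI)
    fix \<omega> assume w: "\<omega> \<in> space (outcome_space d n \<mu>)"
    obtain lam \<psi> where \<omega>: "\<omega> = (lam, \<psi>)" by (cases \<omega>)
    have lam: "partition_of d n lam" using w \<omega> by (simp add: outcome_space_eq)
    interpret row_measurement d \<mu> n lam by (rule row_measurement[OF lam])
    show "cmod (score d n A \<omega>) \<le> cmod (1 / of_nat n) * (real d * c)"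
    proof (cases \<psi>)
      case None then show ?thesis using c0 by (simp add: \<omega> score_def)
    next
      case (Some \<xi>)
      then have \<xi>: "\<xi> \<in> space (haar_tuples \<mu> lam)" using w \<omega> by (auto simp: outcome_space_eq)
      have t: "cmod ((of_nat (lam ! i) + of_nat d) * (\<Sum>p<d. \<Sum>q<d. A q p * \<xi> i $$ (p, q)) - mat_tr d A) \<le> c" if i: "i < length lam" for i
      proof -
        have "lam ! i \<le> n" using member_le_sum_list[of "lam ! i" lam] i sum_lam by simp
        then have "cmod (of_nat (lam ! i) + of_nat d) \<le> real (n + d)" by (metis add_le_mono1 norm_of_nat of_nat_add of_nat_mono)
        moreover have "cmod (\<Sum>p<d. \<Sum>q<d. A q p * \<xi> i $$ (p, q)) \<le> (\<Sum>p<d. \<Sum>q<d. cmod (A q p))"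
          by (intro order_trans[OF norm_sum] sum_mono)
            (simp add: norm_mult mult_left_le projector_norm_le_1[OF space_H[OF \<xi> i]])
        ultimately have "cmod ((of_nat (lam ! i) + of_nat d) * (\<Sum>p<d. \<Sum>q<d. A q p * \<xi> i $$ (p, q))) \<le> real (n + d) * (\<Sum>p<d. \<Sum>q<d. cmod (A q p))"
          unfolding norm_mult by (intro mult_mono) auto
        then show ?thesis unfolding c_def by (intro order_trans[OF norm_triangle_ineq4] add_mono) auto
      qed
      have "cmod (score d n A \<omega>) = cmod (1 / of_nat n) * cmod (\<Sum>i<length lam. (of_nat (lam ! i) + of_nat d) * (\<Sum>p<d. \<Sum>q<d. A q p * \<xi> i $$ (p, q)) - mat_tr d A)"
        by (simp only: \<omega> Some score_def prod.case option.case norm_mult)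
      also have "\<dots> \<le> cmod (1 / of_nat n) * (\<Sum>i<length lam. c)"
        by (intro mult_left_mono order_trans[OF norm_sum] sum_mono) (auto intro: t)
      also have "\<dots> \<le> cmod (1 / of_nat n) * (real d * c)"
        using lam c0 by (intro mult_left_mono) (auto simp: partition_of_def intro!: mult_right_mono)
      finally show ?thesis .
    qed
  qed
qed

lemma sites_op_commutes: "g permutes {..<n} \<Longrightarrow> sites_op d n A {..<n} (perm_op g x) = perm_op g (sites_op d n A {..<n} x)"
  by (simp add: sites_op_perm permutes_image)

context
  fixes v assumes v: "v \<in> tensor_space d n" and unit: "tinner d n v v = 1"
begin

text \<open>The steps are only known to be subprobabilities, so the total mass is computed as the
  integral of 1: it is the sum of the squared norms of the branch vectors, hence that of
  \<open>v\<close>.\<close>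

lemma prob_space_output: "prob_space (output_law d n b \<mu> v)"
proof -
  interpret finite_measure "output_law d n b \<mu> v" by (rule finite_measure_output_law[OF v unit])
  have "(\<integral>\<omega>. (1 :: complex) \<partial>output_law d n b \<mu> v) = (\<Sum>br\<in>branches d n b. tinner d n (branch_vec v br) (branch_vec v br))"
  proof (rule output_integral[OF v unit, of "\<lambda>_. 1" 1])
    fix lam j assume br: "(lam, j) \<in> branches d n b"
    then have lam: "partition_of d n lam" by (simp add: branches_def)
    interpret row_measurement d \<mu> n lam by (rule row_measurement[OF lam])
    show "has_bochner_integral (haar_tuples \<mu> lam) (\<lambda>\<psi>. weight_dens lam (branch_vec v (lam, j)) \<psi> * 1) (tinner d n (branch_vec v (lam, j)) (branch_vec v (lam, j)))"
      using J0_integral[of "branch_vec v (lam, j)"] J0_eq[OF branch_sym(1)[OF v unit br]] by (simp add: dens_def)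
  qed auto
  also have "\<dots> = tinner d n v v"
    by (rule inner_commuting[of v "\<lambda>v. v", symmetric]) (auto intro: v tlinearI)
  finally have "measure (output_law d n b \<mu> v) (space (output_law d n b \<mu> v)) = 1" using unit by (simp add: scaleR_conv_of_real of_real_eq_1_iff)
  then show ?thesis by (intro prob_spaceI) (simp add: emeasure_eq_measure)
qed

lemma score_integrable: "integrable (output_law d n b \<mu> v) (score d n A)"
  using score_bounded[of A] output_integrable[OF v unit score_measurable] by blast

lemma score_square_integrable: "integrable (output_law d n b \<mu> v) (\<lambda>\<omega>. (cmod (score d n A \<omega>))\<^sup>2)"
proof -
  obtain K where K: "\<And>\<omega>. \<omega> \<in> space (outcome_space d n \<mu>) \<Longrightarrow> cmod (score d n A \<omega>) \<le> K" using score_bounded by blast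
  have "(\<lambda>\<omega>. (cmod (score d n A \<omega>))\<^sup>2) \<in> borel_measurable (outcome_space d n \<mu>)" using score_measurable by measurable
  moreover have "norm ((cmod (score d n A \<omega>))\<^sup>2) \<le> K\<^sup>2" if "\<omega> \<in> space (outcome_space d n \<mu>)" for \<omega>
    using K[OF that] by (simp add: power_mono)
  ultimately show ?thesis by (rule output_integrable[OF v unit])
qed

lemma score_mean: "(\<integral>\<omega>. score d n A \<omega> \<partial>output_law d n b \<mu> v) = 1 / of_nat n * tinner d n v (sites_op d n A {..<n} v)"
proof -
  obtain K where K: "\<And>\<omega>. \<omega> \<in> space (outcome_space d n \<mu>) \<Longrightarrow> cmod (score d n A \<omega>) \<le> K" using score_bounded by blast
  have "(\<integral>\<omega>. score d n A \<omega> \<partial>output_law d n b \<mu> v)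
    = (\<Sum>br\<in>branches d n b. 1 / of_nat n * tinner d n (branch_vec v br) (sites_op d n A {..<n} (branch_vec v br)))"
  proof (rule output_integral[OF v unit score_measurable K])
    fix lam j assume br: "(lam, j) \<in> branches d n b"
    then have lam: "partition_of d n lam" by (simp add: branches_def)
    interpret row_measurement d \<mu> n lam by (rule row_measurement[OF lam])
    let ?u = "branch_vec v (lam, j)"
    have "has_bochner_integral (haar_tuples \<mu> lam) (\<lambda>\<psi>. 1 / of_nat n * (dens ?u \<psi> * (\<Sum>i<length lam. est A i \<psi>))) (1 / of_nat n * tinner d n ?u (sites_op d n A {..<n} ?u))"
      by (intro has_bochner_integral_mult_right est_mean branch_sym(1)[OF v unit br])
    then show "has_bochner_integral (haar_tuples \<mu> lam) (\<lambda>\<psi>. weight_dens lam ?u \<psi> * score d n A (lam, Some \<psi>)) (1 / of_nat n * tinner d n ?u (sites_op d n A {..<n} ?u))"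
      by (simp only: dens_def score_def est_def obs_def prod.case option.case mult.left_commute)
  qed
  also have "\<dots> = 1 / of_nat n * (\<Sum>br\<in>branches d n b. tinner d n (branch_vec v br) (sites_op d n A {..<n} (branch_vec v br)))"
    by (rule sum_distrib_left[symmetric])
  also have "(\<Sum>br\<in>branches d n b. tinner d n (branch_vec v br) (sites_op d n A {..<n} (branch_vec v br))) = tinner d n v (sites_op d n A {..<n} v)"
    by (rule inner_commuting[OF v tlinear_sites_op sites_op_tensor_space sites_op_commutes, symmetric])
  finally show ?thesis .
qed

text \<open>The bounds for the single branches are summed, and \<open>inner_commuting\<close>
  reassembles the sums into expectations in \<open>v\<close>. The number of rows is at most
  \<open>r\<close> in every branch that occurs, and the squared norms of the branches sum to 1, so
  the traces add up to at most \<open>r\<close> times one of them.\<close>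

lemma score_second_moment:
  assumes A: "\<And>p q. p < d \<Longrightarrow> q < d \<Longrightarrow> cnj (A p q) = A q p"
    and rows: "\<And>lam j. (lam, j) \<in> branches d n b \<Longrightarrow> branch_vec v (lam, j) \<noteq> 0 \<Longrightarrow> length lam \<le> r"
  shows "(\<integral>\<omega>. (cmod (score d n A \<omega>))\<^sup>2 \<partial>output_law d n b \<mu> v)
    \<le> 1 / (real n)\<^sup>2 * (Re (tinner d n v (sites_op d n A {..<n} (sites_op d n A {..<n} v))) + real r * Re (mat_tr d (mat_mul d A A))
       + Re (tinner d n v (sites_op d n (mat_mul d A A) {..<n} v)))"
proof -
  let ?N = "sites_op d n A {..<n}" and ?N2 = "sites_op d n (mat_mul d A A) {..<n}" and ?t = "Re (mat_tr d (mat_mul d A A))"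
  let ?g = "\<lambda>\<omega>. complex_of_real ((cmod (score d n A \<omega>))\<^sup>2)" and ?c = "1 / (complex_of_nat n * complex_of_nat n)"
  obtain K where K: "\<And>\<omega>. \<omega> \<in> space (outcome_space d n \<mu>) \<Longrightarrow> cmod (score d n A \<omega>) \<le> K" using score_bounded by blast
  have t: "mat_tr d (mat_mul d A A) = of_real ?t" "0 \<le> ?t"
    using mat_tr_square_nonneg[of d A, OF A] by (simp_all add: sum_nonneg)
  \<comment> \<open>\<open>V\<close> is the second moment in the branch without the factor
    \<open>?c\<close>; its bound already has \<open>r\<close> in place of the number of
    rows.\<close>
  define good where "good br V \<longleftrightarrow> has_bochner_integral (haar_tuples \<mu> (fst br)) (\<lambda>\<psi>. weight_dens (fst br) (branch_vec v br) \<psi> * ?g (fst br, Some \<psi>)) (?c * V) \<and>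
      Re V \<le> Re (tinner d n (branch_vec v br) (?N (?N (branch_vec v br)))) + real r * ?t * Re (tinner d n (branch_vec v br) (branch_vec v br))
         + Re (tinner d n (branch_vec v br) (?N2 (branch_vec v br)))" for br V
  have ex: "\<exists>V. good br V" if br: "br \<in> branches d n b" for br
  proof -
    obtain lam j where e: "br = (lam, j)" by (cases br)
    have lam: "partition_of d n lam" using br e by (simp add: branches_def)
    interpret row_measurement d \<mu> n lam by (rule row_measurement[OF lam])
    let ?u = "branch_vec v br"
    have sym: "color_sym n False (row_of lam) ?u" using branch_sym(1)[OF v unit] br e by blast
    obtain V where V: "has_bochner_integral (haar_tuples \<mu> lam) (\<lambda>\<psi>. dens ?u \<psi> * ((\<Sum>i<length lam. est A i \<psi>) * (\<Sum>i<length lam. est A i \<psi>))) V"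
      "Re V \<le> Re (tinner d n ?u (?N (?N ?u)) + of_nat (length lam) * (mat_tr d (mat_mul d A A) * tinner d n ?u ?u) + tinner d n ?u (?N2 ?u))"
      by (rule est_second_moment[OF sym, of A]) (use A in auto)
    have "has_bochner_integral (haar_tuples \<mu> lam) (\<lambda>\<psi>. ?c * (dens ?u \<psi> * ((\<Sum>i<length lam. est A i \<psi>) * (\<Sum>i<length lam. est A i \<psi>)))) (?c * V)"
      by (rule has_bochner_integral_mult_right[OF V(1)])
    moreover have "?c * (dens ?u \<psi> * ((\<Sum>i<length lam. est A i \<psi>) * (\<Sum>i<length lam. est A i \<psi>))) = dens ?u \<psi> * ?g (lam, Some \<psi>)"
      if \<psi>: "\<psi> \<in> space (haar_tuples \<mu> lam)" for \<psi>
    proof -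
      have "cnj (mat_tr d A) = mat_tr d A" by (simp add: mat_tr_def A)
      moreover have "cnj (obs A i \<psi>) = obs A i \<psi>" if "i < length lam" for i
        by (subst (1 2) obs_real[OF \<psi> that A]) (simp_all only: complex_cnj_complex_of_real)
      ultimately have S: "cnj (\<Sum>i<length lam. est A i \<psi>) = (\<Sum>i<length lam. est A i \<psi>)"
        unfolding cnj_sum by (intro sum.cong refl) (simp add: est_def)
      have sc: "score d n A (lam, Some \<psi>) = 1 / of_nat n * (\<Sum>i<length lam. est A i \<psi>)"
        by (simp only: score_def est_def obs_def prod.case option.case)
      have "?g (lam, Some \<psi>) = score d n A (lam, Some \<psi>) * cnj (score d n A (lam, Some \<psi>))"
        by (rule complex_norm_square)
      also have "\<dots> = ?c * ((\<Sum>i<length lam. est A i \<psi>) * (\<Sum>i<length lam. est A i \<psi>))"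
        unfolding sc complex_cnj_mult S by simp
      finally show ?thesis by (simp only: mult.left_commute)
    qed
    ultimately have hb: "has_bochner_integral (haar_tuples \<mu> lam) (\<lambda>\<psi>. dens ?u \<psi> * ?g (lam, Some \<psi>)) (?c * V)"
      by (subst has_bochner_integral_cong[OF refl _ refl, symmetric]) auto
    have uu: "tinner d n ?u ?u = of_real (Re (tinner d n ?u ?u))" "0 \<le> Re (tinner d n ?u ?u)" by (simp_all add: tinner_self)
    have "Re (of_nat (length lam) * (mat_tr d (mat_mul d A A) * tinner d n ?u ?u)) = real (length lam) * (?t * Re (tinner d n ?u ?u))"
      using t(1) uu(1) by (metis Re_complex_of_real of_real_mult of_real_of_nat_eq)
    also have "\<dots> \<le> real r * (?t * Re (tinner d n ?u ?u))"
    \<comment> \<open>A branch that does not occur may have more than \<open>r\<close> rows, but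
      then both sides are 0.\<close>
    proof (cases "?u = 0")
      case False
      then show ?thesis using rows br e t(2) uu(2) by (intro mult_right_mono mult_nonneg_nonneg) auto
    qed simp
    finally have "Re V \<le> Re (tinner d n ?u (?N (?N ?u))) + real r * ?t * Re (tinner d n ?u ?u) + Re (tinner d n ?u (?N2 ?u))"
      using V(2) by simp
    with hb show ?thesis unfolding good_def e fst_conv dens_def by blast
  qed
  obtain V where V': "\<forall>br\<in>branches d n b. good br (V br)" using bchoice[of "branches d n b" good] ex by blast
  have V: "\<And>br. br \<in> branches d n b \<Longrightarrow>
      has_bochner_integral (haar_tuples \<mu> (fst br)) (\<lambda>\<psi>. weight_dens (fst br) (branch_vec v br) \<psi> * ?g (fst br, Some \<psi>)) (?c * V br)"
    "\<And>br. br \<in> branches d n b \<Longrightarrow> Re (V br) \<le> Re (tinner d n (branch_vec v br) (?N (?N (branch_vec v br))))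
      + real r * ?t * Re (tinner d n (branch_vec v br) (branch_vec v br)) + Re (tinner d n (branch_vec v br) (?N2 (branch_vec v br)))"
    using V' unfolding good_def by blast+
  have "(\<integral>\<omega>. ?g \<omega> \<partial>output_law d n b \<mu> v) = (\<Sum>br\<in>branches d n b. ?c * V br)"
  proof (rule output_integral[OF v unit, where K = "K\<^sup>2"])
    show "?g \<in> borel_measurable (outcome_space d n \<mu>)" using score_measurable by measurable
    show "cmod (?g \<omega>) \<le> K\<^sup>2" if "\<omega> \<in> space (outcome_space d n \<mu>)" for \<omega>
      using K[OF that] by (simp add: power_mono norm_power)
    show "has_bochner_integral (haar_tuples \<mu> lam) (\<lambda>\<psi>. weight_dens lam (branch_vec v (lam, j)) \<psi> * ?g (lam, Some \<psi>)) (?c * V (lam, j))"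
      if "(lam, j) \<in> branches d n b" for lam j
      using V(1)[OF that] by simp
  qed
  then have "complex_of_real (\<integral>\<omega>. (cmod (score d n A \<omega>))\<^sup>2 \<partial>output_law d n b \<mu> v) = ?c * (\<Sum>br\<in>branches d n b. V br)"
    by (simp only: integral_complex_of_real sum_distrib_left)
  then have "(\<integral>\<omega>. (cmod (score d n A \<omega>))\<^sup>2 \<partial>output_law d n b \<mu> v) = Re (?c * (\<Sum>br\<in>branches d n b. V br))"
    by (metis Re_complex_of_real)
  also have "?c = of_real (1 / (real n)\<^sup>2)" by (simp add: power2_eq_square)
  also have "Re (of_real (1 / (real n)\<^sup>2) * (\<Sum>br\<in>branches d n b. V br)) = 1 / (real n)\<^sup>2 * (\<Sum>br\<in>branches d n b. Re (V br))"
    by (simp only: Re_complex_of_real Im_complex_of_real times_complex.sel Re_sum mult_zero_left diff_zero)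
  also have "\<dots> \<le> 1 / (real n)\<^sup>2 * (\<Sum>br\<in>branches d n b. Re (tinner d n (branch_vec v br) (?N (?N (branch_vec v br))))
      + real r * ?t * Re (tinner d n (branch_vec v br) (branch_vec v br)) + Re (tinner d n (branch_vec v br) (?N2 (branch_vec v br))))"
    by (intro mult_left_mono sum_mono V(2)) auto
  also have "(\<Sum>br\<in>branches d n b. Re (tinner d n (branch_vec v br) (?N (?N (branch_vec v br))))
      + real r * ?t * Re (tinner d n (branch_vec v br) (branch_vec v br)) + Re (tinner d n (branch_vec v br) (?N2 (branch_vec v br))))
    = Re (tinner d n v (?N (?N v))) + real r * ?t + Re (tinner d n v (?N2 v))"
  proof -
    have 1: "tinner d n v (?N (?N v)) = (\<Sum>br\<in>branches d n b. tinner d n (branch_vec v br) (?N (?N (branch_vec v br))))"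
      by (rule inner_commuting[OF v]) (simp_all add: tlinear_comp[OF tlinear_sites_op tlinear_sites_op] sites_op_tensor_space sites_op_commutes)
    have 2: "tinner d n v (?N2 v) = (\<Sum>br\<in>branches d n b. tinner d n (branch_vec v br) (?N2 (branch_vec v br)))"
      by (rule inner_commuting[OF v tlinear_sites_op sites_op_tensor_space sites_op_commutes])
    have "tinner d n v v = (\<Sum>br\<in>branches d n b. tinner d n (branch_vec v br) (branch_vec v br))"
      by (rule inner_commuting[of v "\<lambda>v. v"]) (auto intro: v tlinearI)
    then have "(\<Sum>br\<in>branches d n b. Re (tinner d n (branch_vec v br) (branch_vec v br))) = 1" using unit by (metis Re_sum one_complex.sel(1))
    then have 3: "(\<Sum>br\<in>branches d n b. real r * ?t * Re (tinner d n (branch_vec v br) (branch_vec v br))) = real r * ?t"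
      by (simp only: sum_distrib_left[symmetric] mult_1_right)
    show ?thesis unfolding 1 2 by (simp only: sum.distrib 3 Re_sum)
  qed
  finally show ?thesis .
qed

lemma score_variance:
  "complex_variance (output_law d n b \<mu> v) (score d n A)
    = (\<integral>\<omega>. (cmod (score d n A \<omega>))\<^sup>2 \<partial>output_law d n b \<mu> v) - (cmod (\<integral>\<omega>. score d n A \<omega> \<partial>output_law d n b \<mu> v))\<^sup>2"
proof -
  interpret M: prob_space "output_law d n b \<mu> v" by (rule prob_space_output)
  define m where "m = (\<integral>\<omega>. score d n A \<omega> \<partial>output_law d n b \<mu> v)"
  have e: "(cmod (z - m))\<^sup>2 = (cmod z)\<^sup>2 - 2 * Re (cnj m * z) + (cmod m)\<^sup>2" for z
    by (simp only: cmod_power2) (simp add: power2_eq_square algebra_simps)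
  have i1: "integrable (output_law d n b \<mu> v) (\<lambda>\<omega>. cnj m * score d n A \<omega>)"
    by (intro integrable_mult_right score_integrable)
  have i2: "integrable (output_law d n b \<mu> v) (\<lambda>\<omega>. 2 * Re (cnj m * score d n A \<omega>))"
    by (intro integrable_mult_right integrable_Re i1)
  have "(\<integral>\<omega>. Re (cnj m * score d n A \<omega>) \<partial>output_law d n b \<mu> v) = Re (cnj m * m)"
    unfolding integral_Re[OF i1] by (simp add: m_def)
  also have "\<dots> = (cmod m)\<^sup>2" by (simp add: cmod_def power2_eq_square)
  finally have "(\<integral>\<omega>. 2 * Re (cnj m * score d n A \<omega>) \<partial>output_law d n b \<mu> v) = 2 * (cmod m)\<^sup>2"
    by (simp only: Bochner_Integration.integral_mult_right_zero)
  then show ?thesis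
    unfolding complex_variance_def m_def[symmetric] e
    using i2 score_square_integrable
    by (simp add: M.prob_space del: Re_complex_of_real times_complex.sel)
qed

end

end

theorem theorem3:
  shows "\<exists>C>0::real. \<forall>(d::nat) (n::nat) (r::nat) (B::real) (\<mu>::complex mat measure) (b::basis).
    1 \<le> d \<longrightarrow> 1 \<le> n \<longrightarrow> 1 \<le> r \<longrightarrow> r \<le> d \<longrightarrow> 0 < B \<longrightarrow>
    haar_projectors d \<mu> \<longrightarrow> young_basis d n b \<longrightarrow>
    (\<exists>Phat :: outcome \<Rightarrow> complex mat.
      (\<forall>\<omega>\<in>space (outcome_space d n \<mu>). Phat \<omega> \<in> carrier_mat d d) \<and>
      (\<forall>U e. unitary_mat d U \<longrightarrow> e \<in> strings d n \<longrightarrow> card (e ` {..<n}) \<le> r \<longrightarrow>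
        (let M = output_law d n b \<mu> (input_state d n U e) in
          (\<forall>i<d. \<forall>j<d. integrable M (\<lambda>\<omega>. Phat \<omega> $$ (i, j))) \<and>
          mat_expectation d M Phat = mean_state d n U e \<and>
          (\<forall>O1. hermitian_mat d O1 \<longrightarrow> op_norm d O1 = 1 \<longrightarrow> Re (mat_trace (O1 * O1)) \<le> B \<longrightarrow>
            integrable M (\<lambda>\<omega>. (cmod (mat_trace (O1 * Phat \<omega>)))\<^sup>2) \<and>
            complex_variance M (\<lambda>\<omega>. mat_trace (O1 * Phat \<omega>))
              \<le> C * (1 + real r * B / (real n)\<^sup>2)))))"
proof (intro exI[of _ "2::real"] conjI allI impI)
  fix d n r :: nat and B :: real and \<mu> :: "complex mat measure" and b :: basis
  assume d: "1 \<le> d" and n: "1 \<le> n" and B: "0 < B" and \<mu>: "haar_projectors d \<mu>" and b: "young_basis d n b"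
  interpret measurement d n b \<mu> by unfold_locales (use d \<mu> b in auto)
  show "\<exists>Phat :: outcome \<Rightarrow> complex mat.
      (\<forall>\<omega>\<in>space (outcome_space d n \<mu>). Phat \<omega> \<in> carrier_mat d d) \<and>
      (\<forall>U e. unitary_mat d U \<longrightarrow> e \<in> strings d n \<longrightarrow> card (e ` {..<n}) \<le> r \<longrightarrow>
        (let M = output_law d n b \<mu> (input_state d n U e) in
          (\<forall>i<d. \<forall>j<d. integrable M (\<lambda>\<omega>. Phat \<omega> $$ (i, j))) \<and>
          mat_expectation d M Phat = mean_state d n U e \<and>
          (\<forall>O1. hermitian_mat d O1 \<longrightarrow> op_norm d O1 = 1 \<longrightarrow> Re (mat_trace (O1 * O1)) \<le> B \<longrightarrow>
            integrable M (\<lambda>\<omega>. (cmod (mat_trace (O1 * Phat \<omega>)))\<^sup>2) \<and>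
            complex_variance M (\<lambda>\<omega>. mat_trace (O1 * Phat \<omega>))
              \<le> 2 * (1 + real r * B / (real n)\<^sup>2))))"
    unfolding Let_def
  proof (intro exI[of _ "estimator d n"] conjI ballI allI impI)
    show "estimator d n \<omega> \<in> carrier_mat d d" for \<omega> by (rule estimator_carrier)
    fix U e assume U: "unitary_mat d U" and e: "e \<in> strings d n" and r: "card (e ` {..<n}) \<le> r"
    let ?v = "input_state d n U e"
    define \<phi> where "\<phi> = (\<lambda>x a. U $$ (a, e x))"
    have v: "?v = product_vec d n \<phi>" unfolding \<phi>_def by (rule input_state_eq[OF e])
    have unit: "vdot d (\<phi> x) (\<phi> x) = 1" if "x < n" for x
      unfolding \<phi>_def using unitary_column[OF U strings_less[OF e that]] .
    have vT: "?v \<in> tensor_space d n" unfolding v by (rule product_vec_tensor_space)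
    have vv: "tinner d n ?v ?v = 1" unfolding v by (rule pv_unit[OF unit])
    show "integrable (output_law d n b \<mu> ?v) (\<lambda>\<omega>. estimator d n \<omega> $$ (i, j))" if "i < d" "j < d" for i j
      unfolding estimator_entry[OF that] by (rule score_integrable[OF vT vv])
    show "mat_expectation d (output_law d n b \<mu> ?v) (estimator d n) = mean_state d n U e"
    proof (rule eq_matI)
      fix a c assume "a < dim_row (mean_state d n U e)" "c < dim_col (mean_state d n U e)"
      then have ac: "a < d" "c < d" by (simp_all add: mean_state_def)
      \<comment> \<open>With this matrix unit the score is the entry \<open>(a, c)\<close> of the
        estimator, and the one-site mean is the entry \<open>(a, c)\<close> of the projection onto
        the column of \<open>U\<close>.\<close>
      let ?E = "\<lambda>q p. if q = c \<and> p = a then 1 else (0::complex)"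
      have m: "vdot d u (mvec d ?E u) = cnj (u c) * u a" for u
      proof -
        have "vdot d u (mvec d ?E u) = (\<Sum>p<d. \<Sum>q<d. cnj (u p) * (?E p q * u q))" by (simp only: vdot_def mvec_def sum_distrib_left)
        also have "\<dots> = (\<Sum>q<d. \<Sum>p<d. ?E p q * (cnj (u p) * u q))"
          by (subst sum.swap) (simp only: mult.left_commute)
        also have "\<dots> = cnj (u c) * u a" by (rule sum_unit_matrix[OF ac])
        finally show ?thesis .
      qed
      have "mat_expectation d (output_law d n b \<mu> ?v) (estimator d n) $$ (a, c) = (\<integral>\<omega>. score d n ?E \<omega> \<partial>output_law d n b \<mu> ?v)"
        using ac by (simp add: mat_expectation_def estimator_entry[OF ac, symmetric])
      also have "\<dots> = 1 / of_nat n * (\<Sum>x<n. cnj (\<phi> x c) * \<phi> x a)"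
        unfolding score_mean[OF vT vv] using pv_sites[of n d \<phi> ?E, OF unit] by (simp only: v m)
      also have "\<dots> = mean_state d n U e $$ (a, c)"
      proof -
        have "col U (e x) $ i = \<phi> x i" if "x < n" "i < d" for x i
          using U strings_less[OF e that(1)] that(2) by (auto simp: \<phi>_def unitary_mat_def)
        then show ?thesis using ac by (simp add: mean_state_def mult.commute)
      qed
      finally show "mat_expectation d (output_law d n b \<mu> ?v) (estimator d n) $$ (a, c) = mean_state d n U e $$ (a, c)" .
    qed (simp_all add: mat_expectation_def mean_state_def)
    fix O1 assume O1: "hermitian_mat d O1" "op_norm d O1 = 1" "Re (mat_trace (O1 * O1)) \<le> B"
    have c: "O1 \<in> carrier_mat d d" using O1(1) by (simp add: hermitian_mat_def)
    define A where "A = (\<lambda>p q. O1 $$ (p, q))"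
    have s: "mat_trace (O1 * estimator d n \<omega>) = score d n A \<omega>" for \<omega> unfolding A_def by (rule estimator_trace[OF c])
    have A: "cnj (A p q) = A q p" if "p < d" "q < d" for p q
      using mat_adjoint_index[OF c that(2,1)] O1(1) by (simp add: A_def hermitian_mat_def)
    have trA: "mat_tr d (mat_mul d A A) = mat_trace (O1 * O1)"
      unfolding mat_trace_mult[OF c c] by (subst sum.swap) (simp add: mat_tr_def mat_mul_def A_def)
    show "integrable (output_law d n b \<mu> ?v) (\<lambda>\<omega>. (cmod (mat_trace (O1 * estimator d n \<omega>)))\<^sup>2)"
      unfolding s by (rule score_square_integrable[OF vT vv])
    \<comment> \<open>If the branch vector is nonzero, some permuted input state survives the column
      antisymmetrizer, which forces at most as many rows as symbols in \<open>e\<close>.\<close>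
    have rows: "length lam \<le> r" if br: "(lam, j) \<in> branches d n b" and nz: "branch_vec ?v (lam, j) \<noteq> 0" for lam j
    proof -
      have "partition_of d n lam" using br by (simp add: branches_def)
      with branch_vec_nonzero[OF br nz] color_sum_input_state[OF _ e] show ?thesis using r by (metis order_trans)
    qed
    have bound: "Re (vdot d (mvec d A (\<phi> x)) (mvec d A (\<phi> x))) \<le> 1" if "x < n" for x
      unfolding A_def using mvec_norm_le[OF c O1(2) unit[OF that]] .
    note mom = pv_second_moment[of n d \<phi> A, OF unit A bound, folded v]
    let ?m = "tinner d n ?v (sites_op d n A {..<n} ?v)"
    have "complex_variance (output_law d n b \<mu> ?v) (score d n A)
      \<le> 1 / (real n)\<^sup>2 * (Re (tinner d n ?v (sites_op d n A {..<n} (sites_op d n A {..<n} ?v))) + real r * Re (mat_tr d (mat_mul d A A))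
        + Re (tinner d n ?v (sites_op d n (mat_mul d A A) {..<n} ?v))) - (cmod (1 / of_nat n * ?m))\<^sup>2"
      unfolding score_variance[OF vT vv] score_mean[OF vT vv]
      using score_second_moment[OF vT vv A rows] by (intro diff_right_mono)
    also have "(cmod (1 / of_nat n * ?m))\<^sup>2 = 1 / (real n)\<^sup>2 * (cmod ?m)\<^sup>2"
      by (simp add: norm_mult norm_divide power_mult_distrib power_divide)
    \<comment> \<open>One \<open>n\<close> is the excess of the second moment of the summed
      observable over its squared mean, the other bounds the mean of the summed squares of the
      observable; \<open>r * B\<close> bounds the traces for at most \<open>r\<close> rows.\<close>
    also have "1 / (real n)\<^sup>2 * (Re (tinner d n ?v (sites_op d n A {..<n} (sites_op d n A {..<n} ?v))) + real r * Re (mat_tr d (mat_mul d A A))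
        + Re (tinner d n ?v (sites_op d n (mat_mul d A A) {..<n} ?v))) - 1 / (real n)\<^sup>2 * (cmod ?m)\<^sup>2
      \<le> 1 / (real n)\<^sup>2 * (2 * real n + real r * B)"
    proof -
      have "real r * Re (mat_tr d (mat_mul d A A)) \<le> real r * B" unfolding trA by (intro mult_left_mono O1(3)) simp
      then have "Re (tinner d n ?v (sites_op d n A {..<n} (sites_op d n A {..<n} ?v))) + real r * Re (mat_tr d (mat_mul d A A))
        + Re (tinner d n ?v (sites_op d n (mat_mul d A A) {..<n} ?v)) - (cmod ?m)\<^sup>2 \<le> 2 * real n + real r * B"
        using mom by linarith
      then have "1 / (real n)\<^sup>2 * (Re (tinner d n ?v (sites_op d n A {..<n} (sites_op d n A {..<n} ?v))) + real r * Re (mat_tr d (mat_mul d A A))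
        + Re (tinner d n ?v (sites_op d n (mat_mul d A A) {..<n} ?v)) - (cmod ?m)\<^sup>2) \<le> 1 / (real n)\<^sup>2 * (2 * real n + real r * B)"
        by (rule mult_left_mono) simp
      then show ?thesis by (simp only: right_diff_distrib)
    qed
    also have "\<dots> = 2 / real n + real r * B / (real n)\<^sup>2"
      using n by (simp add: field_simps power2_eq_square)
    \<comment> \<open>The constant 2 comes from the first summand, since \<open>2 / real n\<close>
      is at most 2.\<close>
    also have "\<dots> \<le> 2 * (1 + real r * B / (real n)\<^sup>2)"
    proof -
      have "2 / real n \<le> 2 * 1" using n by (simp add: divide_le_eq)
      moreover have double: "x \<le> 2 * x" if "0 \<le> x" for x :: real using that by simp
      have "real r * B / (real n)\<^sup>2 \<le> 2 * (real r * B / (real n)\<^sup>2)" by (rule double) (use B in simp)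
      ultimately show ?thesis unfolding distrib_left by (intro add_mono)
    qed
    finally show "complex_variance (output_law d n b \<mu> ?v) (\<lambda>\<omega>. mat_trace (O1 * estimator d n \<omega>)) \<le> 2 * (1 + real r * B / (real n)\<^sup>2)"
      unfolding s by simp
  qed
qed simp

end
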